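(* Let $W$ be a finite Coxeter group, $M=M(W)$ its biHecke monoid and $\mathbb{K}$ a field. The monoid $M$ admits exactly $|W|$ simple right modules over $\mathbb{K}$ up to isomorphism, forming a family $(S_w)_{w\in W}$ of pairwise non-isomorphic modules, and correspondingly $|W|$ pairwise non-isomorphic indecomposable projective modules $(P_w)_{w\in W}$. For each $w\in W$, the simple module $S_w$ is isomorphic to the top simple module $S^{(w)}_{\emptyset}$ of the translation module $T_w$. In general, for every $w\in W$ and every reduced left block $J$ of $w$, the simple subquotient $S^{(w)}_J$ of $T_w$ is isomorphic to the simple module $S_{{}^{J}w}$ of $M$.
   Context: $W$ is a finite Coxeter group with simple reflections $(s_i)_{i\in I}$, identity $1$, length $\ell$. $D_R(w)=\{i:\ell(ws_i)<\ell(w)\}$ is the right descent set. Right (weak) order: $u\le_R v$ if some reduced word of $u$ is a left factor (prefix) of a reduced word of $v$; $[1,w]_R=\{u: u\le_R w\}$. Left (weak) order $\le_L$: the same with right factors (suffixes). The biHecke monoid $M(W)$ is the monoid of functions $W\to W$ (acting on the right, $w.(fg)=(w.f).g$) generated by $\pi_i,\overline\pi_i$ ($i\in I$), where $w.\pi_i=w$ if $i\in D_R(w)$ and $ws_i$ otherwise; $w.\overline\pi_i=ws_i$ if $i\in D_R(w)$ and $w$ otherwise. Modules are right modules. Translation module: $T_w$ is the $\mathbb{K}$-vector space with basis $[1,w]_R$ and right $M$-action: $u.\pi_i=u$ if $i\in D_R(u)$; $u.\pi_i=us_i$ if $i\notin D_R(u)$ and $us_i\in[1,w]_R$; $u.\pi_i=0$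 otherwise; $u.\overline\pi_i=us_i$ if $i\in D_R(u)$ and $us_i\in[1,w]_R$; $u.\overline\pi_i=u$ if $i\notin D_R(u)$ and $us_i\in[1,w]_R$; $u.\overline\pi_i=0$ otherwise. Blocks: for $J\subseteq I$, $W_J$ is the parabolic subgroup generated by $(s_j)_{j\in J}$; each $w$ factors uniquely as $w=w_J\,{}^{J}w$ with $w_J\in W_J$ and ${}^{J}w$ the minimal length element of $W_Jw$. $J$ is a left block of $w$ if there is $K\subseteq I$ with $wW_K=W_Jw$; $J$ is (left) reduced with respect to $w$ if $J'\subsetneq J$ implies ${}^{J'}w>_L{}^{J}w$. For $i\in I$, let $\overleftarrow{s}_i$ be the linear operator on $T_w$ with $\overleftarrow{s}_i.u=s_iu$ if $s_iu\in[1,w]_R$ and $\overleftarrow{s}_i.u=-u$ otherwise. For $J\subseteq I$, $P^{(w)}_J=\{v\in T_w:\overleftarrow{s}_i.v=-v\ \forall i\in J\}$. For $J$ a reduced left block of $w$, $P_J^{(w)}$ is an $M$-submodule of $T_w$, and $S^{(w)}_J=P^{(w)}_J/\sum_{J'}P^{(w)}_{J'}$, the sum being over reduced left blocks $J'\supsetneq J$ of $w$. ($P^{(w)}_\emptyset=T_w$.) $P_w$ denotes the projective cover of $S_w$.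
   Formalization: P_J^{(w)} is defined by antisymmetry under all reflections of W_J, not only the s_i with i in J; with simple reflections only, P_J^{(w)} need not be a submodule (S_3, w = s_1 s_2, J = {1,2}). *)

theory Defs
  imports "HOL-Library.Sublist" "HOL-Algebra.Generated_Groups" "HOL-Algebra.AbelCoset" "HOL-Algebra.Module"
begin

section \<open>Finite Coxeter groups\<close>

text \<open>Words are lists of indices in \<open>I\<close>.\<close>

definition word_val :: "('a, 'b) monoid_scheme \<Rightarrow> ('i \<Rightarrow> 'a) \<Rightarrow> 'i list \<Rightarrow> 'a" where
  "word_val G s is = foldr (\<lambda>i x. s i \<otimes>\<^bsub>G\<^esub> x) is \<one>\<^bsub>G\<^esub>"

text \<open>
  The congruence on words generated by the relations \<open>(s\<^sub>i s\<^sub>j)\<^bsup>m i j\<^esup> = 1\<close>. Since \<open>m i i = 1\<close> makes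
  every generator an involution, the monoid presented by these relations is the group presented
  by them. The entry \<open>0\<close> stands for \<open>\<infinity>\<close> (no relation).
\<close>

inductive cox_cong :: "'i set \<Rightarrow> ('i \<Rightarrow> 'i \<Rightarrow> nat) \<Rightarrow> 'i list \<Rightarrow> 'i list \<Rightarrow> bool"
  for I m where
  rel: "i \<in> I \<Longrightarrow> j \<in> I \<Longrightarrow> m i j \<noteq> 0 \<Longrightarrow> xs \<in> lists I \<Longrightarrow> ys \<in> lists I \<Longrightarrow>
    cox_cong I m (xs @ concat (replicate (m i j) [i, j]) @ ys) (xs @ ys)"
| refl: "xs \<in> lists I \<Longrightarrow> cox_cong I m xs xs"
| sym: "cox_cong I m xs ys \<Longrightarrow> cox_cong I m ys xs"
| trans: "cox_cong I m xs ys \<Longrightarrow> cox_cong I m ys zs \<Longrightarrow> cox_cong I m xs zs"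

definition coxeter_matrix :: "'i set \<Rightarrow> ('i \<Rightarrow> 'i \<Rightarrow> nat) \<Rightarrow> bool" where
  "coxeter_matrix I m \<longleftrightarrow>
     (\<forall>i\<in>I. m i i = 1) \<and> (\<forall>i\<in>I. \<forall>j\<in>I. m i j = m j i) \<and> (\<forall>i\<in>I. \<forall>j\<in>I. i \<noteq> j \<longrightarrow> m i j \<noteq> 1)"

locale finite_coxeter_group = group G
  for G :: "('a, 'b) monoid_scheme" (structure) +
  fixes I :: "'i set" and s :: "'i \<Rightarrow> 'a" and m :: "'i \<Rightarrow> 'i \<Rightarrow> nat"
  assumes finite_carrier: "finite (carrier G)"
    and finite_index: "finite I"
    and matrix: "coxeter_matrix I m"
    and simple_closed: "s \<in> I \<rightarrow> carrier G"
    and generated: "generate G (s ` I) = carrier G"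
    and presented: "\<And>xs ys. xs \<in> lists I \<Longrightarrow> ys \<in> lists I \<Longrightarrow>
      word_val G s xs = word_val G s ys \<longleftrightarrow> cox_cong I m xs ys"

definition cox_length :: "('a, 'b) monoid_scheme \<Rightarrow> 'i set \<Rightarrow> ('i \<Rightarrow> 'a) \<Rightarrow> 'a \<Rightarrow> nat" where
  "cox_length G I s w = (LEAST n. \<exists>is\<in>lists I. length is = n \<and> word_val G s is = w)"

definition reduced_word ::
    "('a, 'b) monoid_scheme \<Rightarrow> 'i set \<Rightarrow> ('i \<Rightarrow> 'a) \<Rightarrow> 'a \<Rightarrow> 'i list \<Rightarrow> bool" where
  "reduced_word G I s w is \<longleftrightarrow>
     is \<in> lists I \<and> word_val G s is = w \<and> length is = cox_length G I s w"

definition right_descents :: "('a, 'b) monoid_scheme \<Rightarrow> 'i set \<Rightarrow> ('i \<Rightarrow> 'a) \<Rightarrow> 'a \<Rightarrow> 'i set" where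
  "right_descents G I s w = {i \<in> I. cox_length G I s (w \<otimes>\<^bsub>G\<^esub> s i) < cox_length G I s w}"

definition right_le ::
    "('a, 'b) monoid_scheme \<Rightarrow> 'i set \<Rightarrow> ('i \<Rightarrow> 'a) \<Rightarrow> 'a \<Rightarrow> 'a \<Rightarrow> bool" where
  "right_le G I s u v \<longleftrightarrow>
     (\<exists>xs ys. reduced_word G I s u xs \<and> reduced_word G I s v ys \<and> prefix xs ys)"

definition left_le ::
    "('a, 'b) monoid_scheme \<Rightarrow> 'i set \<Rightarrow> ('i \<Rightarrow> 'a) \<Rightarrow> 'a \<Rightarrow> 'a \<Rightarrow> bool" where
  "left_le G I s u v \<longleftrightarrow>
     (\<exists>xs ys. reduced_word G I s u xs \<and> reduced_word G I s v ys \<and> suffix xs ys)"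

definition right_interval :: "('a, 'b) monoid_scheme \<Rightarrow> 'i set \<Rightarrow> ('i \<Rightarrow> 'a) \<Rightarrow> 'a \<Rightarrow> 'a set" where
  "right_interval G I s w = {u \<in> carrier G. right_le G I s u w}"

definition parabolic :: "('a, 'b) monoid_scheme \<Rightarrow> ('i \<Rightarrow> 'a) \<Rightarrow> 'i set \<Rightarrow> 'a set" where
  "parabolic G s J = generate G (s ` J)"

text \<open>\<open>min_rep G I s J w\<close> is \<open>\<^sup>Jw\<close>, the (unique) shortest element of the coset \<open>W\<^sub>J w\<close>.\<close>

definition min_rep ::
    "('a, 'b) monoid_scheme \<Rightarrow> 'i set \<Rightarrow> ('i \<Rightarrow> 'a) \<Rightarrow> 'i set \<Rightarrow> 'a \<Rightarrow> 'a" where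
  "min_rep G I s J w = arg_min_on (cox_length G I s) (parabolic G s J #>\<^bsub>G\<^esub> w)"

definition left_block ::
    "('a, 'b) monoid_scheme \<Rightarrow> 'i set \<Rightarrow> ('i \<Rightarrow> 'a) \<Rightarrow> 'a \<Rightarrow> 'i set \<Rightarrow> bool" where
  "left_block G I s w J \<longleftrightarrow>
     J \<subseteq> I \<and> (\<exists>K\<subseteq>I. w <#\<^bsub>G\<^esub> parabolic G s K = parabolic G s J #>\<^bsub>G\<^esub> w)"

definition left_reduced ::
    "('a, 'b) monoid_scheme \<Rightarrow> 'i set \<Rightarrow> ('i \<Rightarrow> 'a) \<Rightarrow> 'a \<Rightarrow> 'i set \<Rightarrow> bool" where
  "left_reduced G I s w J \<longleftrightarrow>
     (\<forall>J'. J' \<subset> J \<longrightarrow>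
        left_le G I s (min_rep G I s J w) (min_rep G I s J' w) \<and>
        min_rep G I s J w \<noteq> min_rep G I s J' w)"

definition reduced_left_block ::
    "('a, 'b) monoid_scheme \<Rightarrow> 'i set \<Rightarrow> ('i \<Rightarrow> 'a) \<Rightarrow> 'a \<Rightarrow> 'i set \<Rightarrow> bool" where
  "reduced_left_block G I s w J \<longleftrightarrow> left_block G I s w J \<and> left_reduced G I s w J"


section \<open>The biHecke monoid\<close>

text \<open>\<open>Ascend i\<close> and \<open>Descend i\<close> stand for \<open>\<pi>\<^sub>i\<close> and \<open>\<pi>\<close>-bar\<open>\<^sub>i\<close>.\<close>

datatype 'i hecke_gen = Ascend 'i | Descend 'i

definition hecke_gens :: "'i set \<Rightarrow> 'i hecke_gen set" where
  "hecke_gens I = Ascend ` I \<union> Descend ` I"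

fun gen_fun ::
    "('a, 'b) monoid_scheme \<Rightarrow> 'i set \<Rightarrow> ('i \<Rightarrow> 'a) \<Rightarrow> 'i hecke_gen \<Rightarrow> 'a \<Rightarrow> 'a" where
  "gen_fun G I s (Ascend i) w = (if i \<in> right_descents G I s w then w else w \<otimes>\<^bsub>G\<^esub> s i)"
| "gen_fun G I s (Descend i) w = (if i \<in> right_descents G I s w then w \<otimes>\<^bsub>G\<^esub> s i else w)"

text \<open>
  Functions \<open>W \<rightarrow> W\<close> are represented extensionally on \<open>carrier G\<close>. They act on the right, so the
  leftmost letter of a word is applied first.
\<close>

definition hecke_word_fun ::
    "('a, 'b) monoid_scheme \<Rightarrow> 'i set \<Rightarrow> ('i \<Rightarrow> 'a) \<Rightarrow> 'i hecke_gen list \<Rightarrow> 'a \<Rightarrow> 'a" where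
  "hecke_word_fun G I s gs = (\<lambda>w\<in>carrier G. foldl (\<lambda>u g. gen_fun G I s g u) w gs)"

definition biHecke :: "('a, 'b) monoid_scheme \<Rightarrow> 'i set \<Rightarrow> ('i \<Rightarrow> 'a) \<Rightarrow> ('a \<Rightarrow> 'a) monoid" where
  "biHecke G I s =
     \<lparr>carrier = hecke_word_fun G I s ` lists (hecke_gens I),
      mult = (\<lambda>f g. compose (carrier G) g f),
      one = (\<lambda>w\<in>carrier G. w)\<rparr>"


section \<open>Right modules over a monoid\<close>

text \<open>
  The fields \<open>mult\<close> and \<open>one\<close> which \<open>rmodule\<close> inherits from rings through the library's
  record of modules play no role.
\<close>

record ('k, 'v, 'm) rmodule = "('k, 'v) module" +
  ract :: "'v \<Rightarrow> 'm \<Rightarrow> 'v" (infixl \<open>\<cdot>\<index>\<close> 70)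

locale right_module = module K V + M: monoid M
  for K :: "('k, 'c) ring_scheme"
    and M :: "('m, 'd) monoid_scheme"
    and V :: "('k, 'v, 'm, 'e) rmodule_scheme" +
  assumes ract_closed: "x \<in> carrier V \<Longrightarrow> f \<in> carrier M \<Longrightarrow> x \<cdot>\<^bsub>V\<^esub> f \<in> carrier V"
    and ract_add: "x \<in> carrier V \<Longrightarrow> y \<in> carrier V \<Longrightarrow> f \<in> carrier M \<Longrightarrow>
      (x \<oplus>\<^bsub>V\<^esub> y) \<cdot>\<^bsub>V\<^esub> f = x \<cdot>\<^bsub>V\<^esub> f \<oplus>\<^bsub>V\<^esub> y \<cdot>\<^bsub>V\<^esub> f"
    and ract_smult: "a \<in> carrier K \<Longrightarrow> x \<in> carrier V \<Longrightarrow> f \<in> carrier M \<Longrightarrow>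
      (a \<odot>\<^bsub>V\<^esub> x) \<cdot>\<^bsub>V\<^esub> f = a \<odot>\<^bsub>V\<^esub> (x \<cdot>\<^bsub>V\<^esub> f)"
    and ract_one: "x \<in> carrier V \<Longrightarrow> x \<cdot>\<^bsub>V\<^esub> \<one>\<^bsub>M\<^esub> = x"
    and ract_mult: "x \<in> carrier V \<Longrightarrow> f \<in> carrier M \<Longrightarrow> g \<in> carrier M \<Longrightarrow>
      x \<cdot>\<^bsub>V\<^esub> (f \<otimes>\<^bsub>M\<^esub> g) = x \<cdot>\<^bsub>V\<^esub> f \<cdot>\<^bsub>V\<^esub> g"

definition right_submodule ::
    "('k, 'c) ring_scheme \<Rightarrow> ('m, 'd) monoid_scheme \<Rightarrow> ('k, 'v, 'm) rmodule \<Rightarrow> 'v set \<Rightarrow> bool" where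
  "right_submodule K M V N \<longleftrightarrow>
     submodule N K V \<and> (\<forall>x\<in>N. \<forall>f\<in>carrier M. x \<cdot>\<^bsub>V\<^esub> f \<in> N)"

definition rmodule_hom ::
    "('k, 'c) ring_scheme \<Rightarrow> ('m, 'd) monoid_scheme \<Rightarrow>
     ('k, 'v, 'm) rmodule \<Rightarrow> ('k, 'w, 'm) rmodule \<Rightarrow> ('v \<Rightarrow> 'w) set" where
  "rmodule_hom K M V W =
     {h \<in> hom (add_monoid V) (add_monoid W).
        (\<forall>a\<in>carrier K. \<forall>x\<in>carrier V. h (a \<odot>\<^bsub>V\<^esub> x) = a \<odot>\<^bsub>W\<^esub> h x) \<and>
        (\<forall>x\<in>carrier V. \<forall>f\<in>carrier M. h (x \<cdot>\<^bsub>V\<^esub> f) = h x \<cdot>\<^bsub>W\<^esub> f)}"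

definition rmodule_iso ::
    "('k, 'c) ring_scheme \<Rightarrow> ('m, 'd) monoid_scheme \<Rightarrow>
     ('k, 'v, 'm) rmodule \<Rightarrow> ('k, 'w, 'm) rmodule \<Rightarrow> bool" where
  "rmodule_iso K M V W \<longleftrightarrow> (\<exists>h\<in>rmodule_hom K M V W. bij_betw h (carrier V) (carrier W))"

text \<open>Scalars and monoid elements act on a coset \<open>X\<close> of \<open>N\<close> by acting on its elements.\<close>

definition rmodule_quot :: "('k, 'v, 'm) rmodule \<Rightarrow> 'v set \<Rightarrow> ('k, 'v set, 'm) rmodule" where
  "rmodule_quot V N =
     \<lparr>carrier = a_rcosets\<^bsub>V\<^esub> N, mult = undefined, one = undefined,
      zero = N, add = (\<lambda>X Y. X <+>\<^bsub>V\<^esub> Y),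
      smult = (\<lambda>a X. N <+>\<^bsub>V\<^esub> ((\<lambda>x. a \<odot>\<^bsub>V\<^esub> x) ` X)),
      ract = (\<lambda>X f. N <+>\<^bsub>V\<^esub> ((\<lambda>x. x \<cdot>\<^bsub>V\<^esub> f) ` X))\<rparr>"

definition simple_rmodule ::
    "('k, 'c) ring_scheme \<Rightarrow> ('m, 'd) monoid_scheme \<Rightarrow> ('k, 'v, 'm) rmodule \<Rightarrow> bool" where
  "simple_rmodule K M V \<longleftrightarrow>
     right_module K M V \<and> carrier V \<noteq> {\<zero>\<^bsub>V\<^esub>} \<and>
     (\<forall>N. right_submodule K M V N \<longrightarrow> N = {\<zero>\<^bsub>V\<^esub>} \<or> N = carrier V)"

definition internal_direct_sum ::
    "('k, 'c) ring_scheme \<Rightarrow> ('m, 'd) monoid_scheme \<Rightarrow> ('k, 'v, 'm) rmodule \<Rightarrow>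
     'v set \<Rightarrow> 'v set \<Rightarrow> bool" where
  "internal_direct_sum K M V N N' \<longleftrightarrow>
     right_submodule K M V N \<and> right_submodule K M V N' \<and>
     N \<inter> N' = {\<zero>\<^bsub>V\<^esub>} \<and> N <+>\<^bsub>V\<^esub> N' = carrier V"

definition indecomposable_rmodule ::
    "('k, 'c) ring_scheme \<Rightarrow> ('m, 'd) monoid_scheme \<Rightarrow> ('k, 'v, 'm) rmodule \<Rightarrow> bool" where
  "indecomposable_rmodule K M V \<longleftrightarrow>
     right_module K M V \<and> carrier V \<noteq> {\<zero>\<^bsub>V\<^esub>} \<and>
     (\<forall>N N'. internal_direct_sum K M V N N' \<longrightarrow> N = {\<zero>\<^bsub>V\<^esub>} \<or> N' = {\<zero>\<^bsub>V\<^esub>})"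

text \<open>
  The free right module on \<open>X\<close>, i.e. the direct sum of copies indexed by \<open>X\<close> of the regular right
  module of the monoid algebra of \<open>M\<close>. It has linear basis \<open>X \<times> M\<close>, with \<open>(b, f) \<cdot> g = (b, f g)\<close>.
\<close>

definition free_rmodule ::
    "('k, 'c) ring_scheme \<Rightarrow> ('m, 'd) monoid_scheme \<Rightarrow> 'x set \<Rightarrow> ('k, 'x \<times> 'm \<Rightarrow> 'k, 'm) rmodule" where
  "free_rmodule K M X =
     (let B = X \<times> carrier M in
      \<lparr>carrier = {x \<in> B \<rightarrow>\<^sub>E carrier K. finite {p \<in> B. x p \<noteq> \<zero>\<^bsub>K\<^esub>}},
       mult = undefined, one = undefined,
       zero = (\<lambda>p\<in>B. \<zero>\<^bsub>K\<^esub>),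
       add = (\<lambda>x y. \<lambda>p\<in>B. x p \<oplus>\<^bsub>K\<^esub> y p),
       smult = (\<lambda>a x. \<lambda>p\<in>B. a \<otimes>\<^bsub>K\<^esub> x p),
       ract = (\<lambda>x g. \<lambda>(b, f)\<in>B.
         \<Oplus>\<^bsub>K\<^esub>f' \<in> {f' \<in> carrier M. f' \<otimes>\<^bsub>M\<^esub> g = f \<and> x (b, f') \<noteq> \<zero>\<^bsub>K\<^esub>}. x (b, f'))\<rparr>)"

text \<open>
  Projective modules are the direct summands of free modules. Taking the index set \<open>X\<close> in the
  element type of \<open>V\<close> is no restriction: a projective \<open>V\<close> is a direct summand of the free module
  on \<open>carrier V\<close>.
\<close>

definition projective_rmodule ::
    "('k, 'c) ring_scheme \<Rightarrow> ('m, 'd) monoid_scheme \<Rightarrow> ('k, 'v, 'm) rmodule \<Rightarrow> bool" where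
  "projective_rmodule K M V \<longleftrightarrow>
     right_module K M V \<and>
     (\<exists>(X :: 'v set) N N'.
        internal_direct_sum K M (free_rmodule K M X) N N' \<and>
        rmodule_iso K M (free_rmodule K M X\<lparr>carrier := N\<rparr>) V)"

text \<open>A surjection from a projective module whose kernel is superfluous.\<close>

definition projective_cover ::
    "('k, 'c) ring_scheme \<Rightarrow> ('m, 'd) monoid_scheme \<Rightarrow>
     ('k, 'v, 'm) rmodule \<Rightarrow> ('v \<Rightarrow> 'w) \<Rightarrow> ('k, 'w, 'm) rmodule \<Rightarrow> bool" where
  "projective_cover K M P p V \<longleftrightarrow>
     projective_rmodule K M P \<and> right_module K M V \<and>
     p \<in> rmodule_hom K M P V \<and> p ` carrier P = carrier V \<and>
     (\<forall>N. right_submodule K M P N \<and> N <+>\<^bsub>P\<^esub> a_kernel P V p = carrier P \<longrightarrow> N = carrier P)"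

definition rmodule_radical ::
    "('k, 'c) ring_scheme \<Rightarrow> ('m, 'd) monoid_scheme \<Rightarrow> ('k, 'v, 'm) rmodule \<Rightarrow> 'v set" where
  "rmodule_radical K M V =
     carrier V \<inter> \<Inter> {N. right_submodule K M V N \<and> N \<noteq> carrier V \<and>
       (\<forall>N'. right_submodule K M V N' \<and> N \<subseteq> N' \<longrightarrow> N' = N \<or> N' = carrier V)}"

definition rmodule_top ::
    "('k, 'c) ring_scheme \<Rightarrow> ('m, 'd) monoid_scheme \<Rightarrow> ('k, 'v, 'm) rmodule \<Rightarrow>
     ('k, 'v set, 'm) rmodule" where
  "rmodule_top K M V = rmodule_quot V (rmodule_radical K M V)"


section \<open>Translation modules\<close>

text \<open>
  Vectors of the space with finite basis \<open>B\<close> are coefficient functions \<open>B \<rightarrow> K\<close>;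
  \<open>lin_ext K B \<phi>\<close> is the linear endomorphism sending the basis vector \<open>u\<close> to \<open>\<phi> u\<close>.
\<close>

definition zero_vec :: "('k, 'c) ring_scheme \<Rightarrow> 'a set \<Rightarrow> 'a \<Rightarrow> 'k" where
  "zero_vec K B = (\<lambda>v\<in>B. \<zero>\<^bsub>K\<^esub>)"

definition basis_vec :: "('k, 'c) ring_scheme \<Rightarrow> 'a set \<Rightarrow> 'a \<Rightarrow> 'a \<Rightarrow> 'k" where
  "basis_vec K B u = (\<lambda>v\<in>B. if v = u then \<one>\<^bsub>K\<^esub> else \<zero>\<^bsub>K\<^esub>)"

definition neg_vec :: "('k, 'c) ring_scheme \<Rightarrow> 'a set \<Rightarrow> ('a \<Rightarrow> 'k) \<Rightarrow> 'a \<Rightarrow> 'k" where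
  "neg_vec K B x = (\<lambda>v\<in>B. \<ominus>\<^bsub>K\<^esub> x v)"

definition lin_ext ::
    "('k, 'c) ring_scheme \<Rightarrow> 'a set \<Rightarrow> ('a \<Rightarrow> 'a \<Rightarrow> 'k) \<Rightarrow> ('a \<Rightarrow> 'k) \<Rightarrow> 'a \<Rightarrow> 'k" where
  "lin_ext K B \<phi> x = (\<lambda>v\<in>B. \<Oplus>\<^bsub>K\<^esub>u\<in>B. x u \<otimes>\<^bsub>K\<^esub> \<phi> u v)"

fun trans_gen_basis ::
    "('k, 'c) ring_scheme \<Rightarrow> ('a, 'b) monoid_scheme \<Rightarrow> 'i set \<Rightarrow> ('i \<Rightarrow> 'a) \<Rightarrow> 'a \<Rightarrow>
     'i hecke_gen \<Rightarrow> 'a \<Rightarrow> 'a \<Rightarrow> 'k" where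
  "trans_gen_basis K G I s w (Ascend i) u =
     (let B = right_interval G I s w in
      if i \<in> right_descents G I s u then basis_vec K B u
      else if u \<otimes>\<^bsub>G\<^esub> s i \<in> B then basis_vec K B (u \<otimes>\<^bsub>G\<^esub> s i)
      else zero_vec K B)"
| "trans_gen_basis K G I s w (Descend i) u =
     (let B = right_interval G I s w in
      if i \<in> right_descents G I s u \<and> u \<otimes>\<^bsub>G\<^esub> s i \<in> B then basis_vec K B (u \<otimes>\<^bsub>G\<^esub> s i)
      else if i \<notin> right_descents G I s u \<and> u \<otimes>\<^bsub>G\<^esub> s i \<in> B then basis_vec K B u
      else zero_vec K B)"

definition trans_gen ::
    "('k, 'c) ring_scheme \<Rightarrow> ('a, 'b) monoid_scheme \<Rightarrow> 'i set \<Rightarrow> ('i \<Rightarrow> 'a) \<Rightarrow> 'a \<Rightarrow>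
     'i hecke_gen \<Rightarrow> ('a \<Rightarrow> 'k) \<Rightarrow> 'a \<Rightarrow> 'k" where
  "trans_gen K G I s w g = lin_ext K (right_interval G I s w) (trans_gen_basis K G I s w g)"

text \<open>
  The action of an element \<open>f\<close> of the biHecke monoid is the composite of the actions of the letters
  of a word in the generators whose value is \<open>f\<close>; it does not depend on the choice of the word.
\<close>

definition translation_module ::
    "('k, 'c) ring_scheme \<Rightarrow> ('a, 'b) monoid_scheme \<Rightarrow> 'i set \<Rightarrow> ('i \<Rightarrow> 'a) \<Rightarrow> 'a \<Rightarrow>
     ('k, 'a \<Rightarrow> 'k, 'a \<Rightarrow> 'a) rmodule" where
  "translation_module K G I s w =
     (let B = right_interval G I s w in
      \<lparr>carrier = B \<rightarrow>\<^sub>E carrier K, mult = undefined, one = undefined,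
       zero = zero_vec K B,
       add = (\<lambda>x y. \<lambda>v\<in>B. x v \<oplus>\<^bsub>K\<^esub> y v),
       smult = (\<lambda>a x. \<lambda>v\<in>B. a \<otimes>\<^bsub>K\<^esub> x v),
       ract = (\<lambda>x f. THE y. \<exists>gs\<in>lists (hecke_gens I).
         hecke_word_fun G I s gs = f \<and> y = foldl (\<lambda>z g. trans_gen K G I s w g z) x gs)\<rparr>)"

definition parabolic_reflections ::
    "('a, 'b) monoid_scheme \<Rightarrow> ('i \<Rightarrow> 'a) \<Rightarrow> 'i set \<Rightarrow> 'a set" where
  "parabolic_reflections G s J =
     {x \<otimes>\<^bsub>G\<^esub> s j \<otimes>\<^bsub>G\<^esub> inv\<^bsub>G\<^esub> x | x j. x \<in> parabolic G s J \<and> j \<in> J}"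

definition left_op ::
    "('k, 'c) ring_scheme \<Rightarrow> ('a, 'b) monoid_scheme \<Rightarrow> 'i set \<Rightarrow> ('i \<Rightarrow> 'a) \<Rightarrow> 'a \<Rightarrow>
     'a \<Rightarrow> ('a \<Rightarrow> 'k) \<Rightarrow> 'a \<Rightarrow> 'k" where
  "left_op K G I s w t =
     (let B = right_interval G I s w in
      lin_ext K B (\<lambda>u. if t \<otimes>\<^bsub>G\<^esub> u \<in> B then basis_vec K B (t \<otimes>\<^bsub>G\<^esub> u)
                       else neg_vec K B (basis_vec K B u)))"

text \<open>
  The vectors of the translation module that are antisymmetric under left multiplication by \<open>W\<^sub>J\<close>.
  Antisymmetry is required for all reflections \<open>t\<close> of \<open>W\<^sub>J\<close> and not only for the \<open>s\<^sub>i\<close>, \<open>i \<in> J\<close>: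
  \<open>[1, w]\<^sub>R\<close> is not closed under left multiplication, the operators \<open>left_op\<close> of the simple
  reflections do not satisfy the braid relations, and their common \<open>-1\<close> eigenspace can be too large
  to be a submodule. For \<open>w = s\<^sub>1 s\<^sub>2\<close> in the symmetric group on three letters and \<open>J = {1, 2}\<close>, a
  reduced left block of \<open>w\<close>, that eigenspace is spanned by \<open>1 - s\<^sub>1\<close> and \<open>s\<^sub>1 s\<^sub>2\<close>. It is not stable:
  \<open>\<pi>\<close>-bar\<open>\<^sub>2\<close> maps \<open>s\<^sub>1 s\<^sub>2\<close> to \<open>s\<^sub>1\<close>. The reflection \<open>s\<^sub>1 s\<^sub>2 s\<^sub>1\<close>, which swaps \<open>s\<^sub>1\<close> and \<open>s\<^sub>1 s\<^sub>2\<close>, cuts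
  it down to the span of \<open>1 - s\<^sub>1 + s\<^sub>1 s\<^sub>2\<close>.
\<close>

definition P_space ::
    "('k, 'c) ring_scheme \<Rightarrow> ('a, 'b) monoid_scheme \<Rightarrow> 'i set \<Rightarrow> ('i \<Rightarrow> 'a) \<Rightarrow> 'a \<Rightarrow>
     'i set \<Rightarrow> ('a \<Rightarrow> 'k) set" where
  "P_space K G I s w J =
     {x \<in> carrier (translation_module K G I s w).
        \<forall>t\<in>parabolic_reflections G s J.
          left_op K G I s w t x = neg_vec K (right_interval G I s w) x}"

definition P_space_sum ::
    "('k, 'c) ring_scheme \<Rightarrow> ('a, 'b) monoid_scheme \<Rightarrow> 'i set \<Rightarrow> ('i \<Rightarrow> 'a) \<Rightarrow> 'a \<Rightarrow>
     'i set \<Rightarrow> ('a \<Rightarrow> 'k) set" where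
  "P_space_sum K G I s w J =
     (let \<J> = {J'. reduced_left_block G I s w J' \<and> J \<subset> J'} in
      {\<Oplus>\<^bsub>translation_module K G I s w\<^esub>J'\<in>\<J>. x J' | x. x \<in> (\<Pi> J'\<in>\<J>. P_space K G I s w J')})"

definition S_module ::
    "('k, 'c) ring_scheme \<Rightarrow> ('a, 'b) monoid_scheme \<Rightarrow> 'i set \<Rightarrow> ('i \<Rightarrow> 'a) \<Rightarrow> 'a \<Rightarrow>
     'i set \<Rightarrow> ('k, ('a \<Rightarrow> 'k) set, 'a \<Rightarrow> 'a) rmodule" where
  "S_module K G I s w J =
     rmodule_quot (translation_module K G I s w\<lparr>carrier := P_space K G I s w J\<rparr>)
       (P_space_sum K G I s w J)"

end

theory Submission imports Defs begin

text \<open>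
  Write \<open>\<pi>\<^sub>v\<close> for the product of the \<open>\<pi>\<^sub>i\<close> along a reduced word of \<open>v\<close>. An element \<open>f\<close> of the monoid
  either translates \<open>x = w\<^sub>0 w\<inverse>\<close> through \<open>u\<close>, i.e. \<open>(x u).f = x (u.f)\<close>, or the ratio of \<open>(x u).f\<close> and
  \<open>u.f\<close> is shorter than \<open>x\<close>; the module \<open>T\<^sub>w\<close> records the first case. If \<open>w\<close> is of maximal length with
  \<open>V \<cdot> \<pi>\<^sub>w \<noteq> 0\<close>, this yields a nonzero homomorphism \<open>T\<^sub>w \<rightarrow> V\<close>, so every simple \<open>V\<close> is the quotient of some
  \<open>T\<^sub>w\<close> by its largest proper submodule \<open>R\<^sub>w = {c. c M \<pi>\<^sub>w = 0}\<close>, and \<open>w\<close> is recovered from that quotient.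

  For a reduced left block \<open>J\<close> of \<open>w\<close>, antisymmetrization over \<open>W\<^sub>J\<close> identifies \<open>T\<^sub>v\<close>, \<open>v = \<^sup>Jw\<close>, with
  \<open>P\<^sub>J\<close>. It remains to see that \<open>R\<^sub>w\<close> is the sum \<open>\<Sigma>\<close> of the \<open>P\<^sub>J\<close> with \<open>J \<noteq> {}\<close>. The vectors supported on the
  set of all \<open>u\<close> having a left descent in every such \<open>J\<close> form a complement of \<open>\<Sigma>\<close>. If \<open>R\<^sub>w\<close> were
  larger than \<open>\<Sigma>\<close>, take \<open>v\<close> of maximal length with \<open>R\<^sub>w \<cdot> \<pi>\<^sub>v\<close> not inside \<open>\<Sigma>\<close>. Then \<open>w = v k\<close> with \<open>k\<close> in
  the parabolic subgroup of the right non-descents of \<open>v\<close>, and, by the duality between \<open>T\<^sub>w\<close> and the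
  translation module of \<open>w\<inverse>\<close>, also \<open>w = h v\<close> with \<open>h\<close> in that of the left non-descents. Unless \<open>v = w\<close>,
  which \<open>R\<^sub>w \<cdot> \<pi>\<^sub>w = 0\<close> excludes, the letters of \<open>h\<close> contain a reduced left block of \<open>w\<close> none of whose
  elements is a left descent of \<open>v\<close>, a contradiction.
\<close>

section \<open>Length and inversions\<close>

text \<open>The group is known only through its presentation, so length, descents and both weak
  orders are read off from inversion sets, and these from a parity of words that the defining
  relations preserve. The main obstacle is the inclusion of \<open>rad w\<close> in
  \<open>PSum w {}\<close>: the dimension of the simple quotient is not known in advance, so
  equality cannot be obtained by counting. Instead, every class modulo \<open>PSum w {}\<close> has
  a unique representative supported in \<open>interior w\<close>. This set is closed upwards in the
  right order inside \<open>B w\<close>, and therefore relations under a single ascent that hold for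
  the representative modulo \<open>PSum w {}\<close> hold exactly. Two factorizations w = v k = h v
  then force v to carry every letter of h to a simple reflection, and this is what turns the letters
  of h into a block. The projective modules are treated over an arbitrary finite monoid: every
  simple module is covered by a summand of the free module on one generator, which also fixes the
  type in which the cover lives.\<close>

context finite_coxeter_group
begin

abbreviation "W \<equiv> carrier G"
abbreviation "reduced \<equiv> reduced_word G I s"
abbreviation "val \<equiv> word_val G s"
abbreviation "len \<equiv> cox_length G I s"

lemma cancel_left [simp]:
  "x \<in> W \<Longrightarrow> y \<in> W \<Longrightarrow> x \<otimes> (inv x \<otimes> y) = y"
  "x \<in> W \<Longrightarrow> y \<in> W \<Longrightarrow> inv x \<otimes> (x \<otimes> y) = y"
  by (simp_all flip: m_assoc)

lemma s_closed [simp]: "i \<in> I \<Longrightarrow> s i \<in> W"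
  using simple_closed by auto

lemma val_Nil [simp]: "val [] = \<one>"
  by (simp add: word_val_def)

lemma val_Cons [simp]: "val (i # xs) = s i \<otimes> val xs"
  by (simp add: word_val_def)

lemma val_closed [simp]: "xs \<in> lists I \<Longrightarrow> val xs \<in> W"
  by (induction xs) auto

lemma val_append: "xs \<in> lists I \<Longrightarrow> ys \<in> lists I \<Longrightarrow> val (xs @ ys) = val xs \<otimes> val ys"
  by (induction xs) (auto simp: m_assoc)

lemma s_square [simp]: "i \<in> I \<Longrightarrow> s i \<otimes> s i = \<one>"
proof -
  assume i: "i \<in> I"
  hence "cox_cong I m ([] @ concat (replicate (m i i) [i, i]) @ []) ([] @ [])"
    using matrix by (intro cox_cong.rel) (auto simp: coxeter_matrix_def)
  hence "cox_cong I m [i, i] []"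
    using i matrix by (simp add: coxeter_matrix_def)
  hence "val [i, i] = val []" using presented[of "[i,i]" "[]"] i by simp
  thus ?thesis using i by simp
qed

lemma s_cancel [simp]: "i \<in> I \<Longrightarrow> x \<in> W \<Longrightarrow> s i \<otimes> (s i \<otimes> x) = x"
  by (simp flip: m_assoc)

lemma s_inv [simp]: "i \<in> I \<Longrightarrow> inv (s i) = s i"
  by (rule inv_equality) auto

lemma val_surj: "w \<in> W \<Longrightarrow> \<exists>xs\<in>lists I. val xs = w"
proof -
  assume "w \<in> W"
  hence "w \<in> generate G (s ` I)" using generated by simp
  thus ?thesis
  proof (induction rule: generate.induct)
    case one show ?case by (rule bexI[of _ "[]"]) auto
  next
    case (incl h)
    then obtain i where "i \<in> I" "h = s i" by auto
    thus ?case by (intro bexI[of _ "[i]"]) auto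
  next
    case (inv h)
    then obtain i where "i \<in> I" "h = s i" by auto
    thus ?case by (intro bexI[of _ "[i]"]) auto
  next
    case (eng h1 h2)
    then obtain xs ys where "xs \<in> lists I" "ys \<in> lists I" "val xs = h1" "val ys = h2" by auto
    thus ?case by (intro bexI[of _ "xs @ ys"]) (auto simp: val_append)
  qed
qed

text \<open>Each letter of a word contributes the reflection obtained by conjugating it with the
  product of the letters before it; \<open>inv_parity xs t\<close> says that t arises in this way an
  odd number of times. Words need not be reduced, so repetitions occur, and only their parity is an
  invariant of the group element.\<close>

primrec inv_parity :: "'i list \<Rightarrow> 'a \<Rightarrow> bool" where
  "inv_parity [] t = False"
| "inv_parity (i # xs) t = ((t = s i) \<noteq> inv_parity xs (s i \<otimes> t \<otimes> s i))"

lemma inv_parity_append: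
  "xs \<in> lists I \<Longrightarrow> ys \<in> lists I \<Longrightarrow> t \<in> W \<Longrightarrow>
   inv_parity (xs @ ys) t = (inv_parity xs t \<noteq> inv_parity ys (inv (val xs) \<otimes> t \<otimes> val xs))"
  by (induction xs arbitrary: t) (auto simp: inv_mult_group m_assoc)

lemma val_alternating:
  "i \<in> I \<Longrightarrow> j \<in> I \<Longrightarrow> val (concat (replicate n [i, j])) = (s i \<otimes> s j) [^] n"
proof (induction n)
  case (Suc n)
  thus ?case using nat_pow_Suc2[of "s i \<otimes> s j" n] by (simp add: m_assoc)
qed simp

text \<open>With r = s_i s_j, the reflections contributed by the 2n letters are r^k s_i for k < 2n:
  conjugation by r raises k by two, and the second letter of the word accounts for k = 1.\<close>

lemma inv_parity_alternating:
  assumes "i \<in> I" "j \<in> I" "t \<in> W"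
  shows "inv_parity (concat (replicate n [i, j])) t \<longleftrightarrow>
    odd (\<Sum>k<2 * n. of_bool ((s i \<otimes> s j) [^] k \<otimes> s i = t) :: nat)"
  using assms(3)
proof (induction n arbitrary: t)
  case (Suc n)
  let ?r = "s i \<otimes> s j"
  have r: "?r \<in> W" using assms by simp
  have shift: "?r [^] k \<otimes> s i = s j \<otimes> (s i \<otimes> t \<otimes> s i) \<otimes> s j \<longleftrightarrow> ?r [^] Suc (Suc k) \<otimes> s i = t"
    (is "?A = ?B \<longleftrightarrow> _") for k
  proof -
    have 1: "?r \<otimes> ?A \<otimes> inv ?r = ?r [^] Suc (Suc k) \<otimes> s i"
    proof -
      have "s i \<otimes> inv ?r = ?r \<otimes> s i" using assms by (simp add: inv_mult_group m_assoc)
      hence "?r \<otimes> ?A \<otimes> inv ?r = ?r \<otimes> ?r [^] k \<otimes> (?r \<otimes> s i)"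
        using assms r by (simp add: m_assoc del: nat_pow_Suc)
      also have "\<dots> = ?r [^] Suc (Suc k) \<otimes> s i"
        using assms r nat_pow_Suc2[OF r, of k] by (simp flip: m_assoc)
      finally show ?thesis .
    qed
    have 2: "?r \<otimes> ?B \<otimes> inv ?r = t"
      using assms Suc.prems by (simp add: inv_mult_group m_assoc)
    have "?A = ?B \<longleftrightarrow> ?r \<otimes> ?A \<otimes> inv ?r = ?r \<otimes> ?B \<otimes> inv ?r"
      using assms r Suc.prems by (simp del: nat_pow_Suc)
    thus ?thesis unfolding 1 2 .
  qed
  have one: "s i \<otimes> t \<otimes> s i = s j \<longleftrightarrow> ?r [^] (1::nat) \<otimes> s i = t"
  proof -
    have "s i \<otimes> t \<otimes> s i = s j \<longleftrightarrow> s i \<otimes> (s i \<otimes> t \<otimes> s i) \<otimes> s i = s i \<otimes> s j \<otimes> s i"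
      using assms Suc.prems by simp
    also have "s i \<otimes> (s i \<otimes> t \<otimes> s i) \<otimes> s i = t" using assms Suc.prems by (simp add: m_assoc)
    finally show ?thesis using r by auto
  qed
  have "inv_parity (concat (replicate (Suc n) [i, j])) t \<longleftrightarrow>
     ((t = s i) \<noteq> ((s i \<otimes> t \<otimes> s i = s j) \<noteq>
       odd (\<Sum>k<2 * n. of_bool (?r [^] k \<otimes> s i = s j \<otimes> (s i \<otimes> t \<otimes> s i) \<otimes> s j) :: nat)))"
    using Suc.IH[of "s j \<otimes> (s i \<otimes> t \<otimes> s i) \<otimes> s j"] assms Suc.prems by simp
  also have "\<dots> \<longleftrightarrow> odd (\<Sum>k<Suc (Suc (2 * n)). of_bool (?r [^] k \<otimes> s i = t) :: nat)"
    unfolding sum.lessThan_Suc_shift shift one using assms by auto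
  finally show ?case by simp
qed simp

text \<open>If r^n = 1, the list r^k s_i for k < 2n runs through the same n terms twice, so every t
  is counted an even number of times.\<close>

lemma relation_parity:
  assumes "i \<in> I" "j \<in> I" "(s i \<otimes> s j) [^] n = \<one>" "t \<in> W"
  shows "\<not> inv_parity (concat (replicate n [i, j])) t"
proof -
  let ?f = "\<lambda>k. of_bool ((s i \<otimes> s j) [^] k \<otimes> s i = t) :: nat"
  have shift: "?f (n + k) = ?f k" for k
    using assms nat_pow_mult[of "s i \<otimes> s j" n k] by simp
  have "(\<Sum>k<a + b. ?f k) = (\<Sum>k<a. ?f k) + (\<Sum>k<b. ?f (a + k))" for a b :: nat
    by (induction b) auto
  from this[of n n] have "(\<Sum>k<n + n. ?f k) = (\<Sum>k<n. ?f k) + (\<Sum>k<n. ?f k)"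
    unfolding shift .
  thus ?thesis using inv_parity_alternating[OF assms(1,2,4), of n] by (simp add: mult_2)
qed

text \<open>A relator has value 1 and even parity everywhere. Inserting it therefore changes neither
  the parity of the word nor the conjugation under which its tail is evaluated.\<close>

lemma cox_cong_parity: "cox_cong I m xs ys \<Longrightarrow> t \<in> W \<Longrightarrow> inv_parity xs t = inv_parity ys t"
proof (induction arbitrary: t rule: cox_cong.induct)
  case (rel i j xs ys)
  let ?c = "concat (replicate (m i j) [i, j])"
  have c: "?c \<in> lists I" using rel by (auto split: if_splits)
  have "cox_cong I m ([] @ ?c @ []) ([] @ [])"
    using rel by (intro cox_cong.rel) auto
  hence "val ?c = \<one>" using presented[of ?c "[]"] c by simp
  moreover have "\<not> inv_parity ?c u" if "u \<in> W" for u
    using relation_parity[OF rel(1,2) _ that] calculation val_alternating[OF rel(1,2)] by simp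
  ultimately show ?case
    using rel c by (simp add: inv_parity_append m_assoc val_append)
qed auto

text \<open>Every word for w gives the same set, by \<open>inversions_word\<close>. Its elements are
  the reflections t with len (t w) < len w, see \<open>reflection_inversion_iff\<close>; so these
  are left inversions.\<close>

definition inversions :: "'a \<Rightarrow> 'a set" where
  "inversions w = {t \<in> W. inv_parity (SOME xs. xs \<in> lists I \<and> val xs = w) t}"

lemma inversions_word:
  assumes "xs \<in> lists I"
  shows "inversions (val xs) = {t \<in> W. inv_parity xs t}"
proof -
  let ?ys = "SOME ys. ys \<in> lists I \<and> val ys = val xs"
  have "?ys \<in> lists I \<and> val ?ys = val xs" by (rule someI) (use assms in simp)
  hence "cox_cong I m ?ys xs" using presented assms by blast
  thus ?thesis unfolding inversions_def using cox_cong_parity by auto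
qed

lemma inversions_closed: "inversions w \<subseteq> W"
  by (auto simp: inversions_def)

lemma finite_inversions [simp]: "finite (inversions w)"
  using finite_subset[OF inversions_closed finite_carrier] .

lemma inversions_one [simp]: "inversions \<one> = {}"
  using inversions_word[of "[]"] by simp

lemma inversions_simple [simp]:
  assumes "i \<in> I"
  shows "inversions (s i) = {s i}"
proof -
  have "inversions (val [i]) = {t \<in> W. t = s i}"
    using assms by (subst inversions_word) (simp, simp)
  also have "\<dots> = {s i}" using s_closed[OF assms] by blast
  finally show ?thesis using assms by simp
qed

text \<open>Concatenating words for x and y adds their parities, the second one conjugated by x.
  This is the cocycle rule from which all statements on lengths of products follow.\<close>

lemma mem_inversions_mult:
  assumes "x \<in> W" "y \<in> W" "t \<in> W"
  shows "t \<in> inversions (x \<otimes> y) \<longleftrightarrow> ((t \<in> inversions x) \<noteq> (inv x \<otimes> t \<otimes> x \<in> inversions y))"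
proof -
  obtain xs ys where "xs \<in> lists I" "val xs = x" "ys \<in> lists I" "val ys = y"
    using val_surj assms by metis
  thus ?thesis using assms inversions_word[of xs] inversions_word[of ys] inversions_word[of "xs @ ys"]
    by (auto simp: val_append inv_parity_append)
qed

lemma mem_inversions_inv:
  assumes "x \<in> W" "t \<in> W"
  shows "t \<in> inversions (inv x) \<longleftrightarrow> x \<otimes> t \<otimes> inv x \<in> inversions x"
  using mem_inversions_mult[of x "inv x" "x \<otimes> t \<otimes> inv x"] assms by (simp add: m_assoc)

text \<open>Strong exchange: odd parity means in particular that t is contributed by some letter,
  and deleting that letter multiplies the value by t on the left. The inclusion of letters is
  recorded because it later confines reduced words to parabolic subgroups.\<close>

lemma exchange_word:
  "xs \<in> lists I \<Longrightarrow> t \<in> W \<Longrightarrow> inv_parity xs t \<Longrightarrow>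
   \<exists>ys. set ys \<subseteq> set xs \<and> Suc (length ys) = length xs \<and> val ys = t \<otimes> val xs"
proof (induction xs arbitrary: t)
  case (Cons i xs)
  hence i: "i \<in> I" and xs: "xs \<in> lists I" by auto
  show ?case
  proof (cases "t = s i")
    case True
    thus ?thesis using i xs by (intro exI[of _ xs]) auto
  next
    case False
    then obtain ys where ys: "set ys \<subseteq> set xs" "Suc (length ys) = length xs"
      "val ys = s i \<otimes> t \<otimes> s i \<otimes> val xs"
      using Cons.IH[of "s i \<otimes> t \<otimes> s i"] Cons.prems i by auto
    have "val (i # ys) = t \<otimes> val (i # xs)"
      using ys i xs Cons.prems by (simp add: m_assoc)
    thus ?thesis using ys by (intro exI[of _ "i # ys"]) auto
  qed
qed simp

lemma inversions_s_mult:
  assumes "i \<in> I" "w \<in> W" "s i \<notin> inversions w"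
  shows "inversions (s i \<otimes> w) = insert (s i) ((\<lambda>t. s i \<otimes> t \<otimes> s i) ` inversions w)"
    and "card (inversions (s i \<otimes> w)) = Suc (card (inversions w))"
proof -
  have conj: "s i \<otimes> (s i \<otimes> t \<otimes> s i) \<otimes> s i = t" if "t \<in> W" for t
    using assms that by (simp add: m_assoc)
  have ss: "s i \<otimes> s i \<otimes> s i = s i" using assms by simp
  have inj: "inj_on (\<lambda>t. s i \<otimes> t \<otimes> s i) (inversions w)"
    by (rule inj_on_inverseI[of _ "\<lambda>t. s i \<otimes> t \<otimes> s i"]) (use conj inversions_closed in auto)
  have notin: "s i \<notin> (\<lambda>t. s i \<otimes> t \<otimes> s i) ` inversions w"
  proof
    assume "s i \<in> (\<lambda>t. s i \<otimes> t \<otimes> s i) ` inversions w"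
    then obtain t where t: "t \<in> inversions w" "s i = s i \<otimes> t \<otimes> s i" by auto
    hence "t = s i \<otimes> s i \<otimes> s i" using conj inversions_closed by (metis subsetD)
    thus False using ss t assms by simp
  qed
  have img: "(\<lambda>t. s i \<otimes> t \<otimes> s i) ` inversions w = {t \<in> W. s i \<otimes> t \<otimes> s i \<in> inversions w}"
  proof -
    have "t \<in> (\<lambda>t. s i \<otimes> t \<otimes> s i) ` inversions w" if "t \<in> W" "s i \<otimes> t \<otimes> s i \<in> inversions w" for t
      using conj[OF that(1)] that(2) by (metis image_eqI)
    thus ?thesis using conj inversions_closed assms by (auto simp: subset_iff)
  qed
  have ne: "s i \<otimes> s i \<otimes> s i \<notin> inversions w" using assms ss by simp
  show eq: "inversions (s i \<otimes> w) = insert (s i) ((\<lambda>t. s i \<otimes> t \<otimes> s i) ` inversions w)"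
    unfolding img using mem_inversions_mult[of "s i" w] assms ne inversions_closed[of "s i \<otimes> w"]
    by auto
  show "card (inversions (s i \<otimes> w)) = Suc (card (inversions w))"
    unfolding eq using notin card_image[OF inj] by simp
qed

lemma mem_inversions_s_mult_self:
  assumes "i \<in> I" "w \<in> W"
  shows "s i \<in> inversions (s i \<otimes> w) \<longleftrightarrow> s i \<notin> inversions w"
  using mem_inversions_mult[of "s i" w "s i"] assms by simp

lemma card_inversions_s_mult:
  assumes "i \<in> I" "w \<in> W" "s i \<in> inversions w"
  shows "Suc (card (inversions (s i \<otimes> w))) = card (inversions w)"
  using inversions_s_mult(2)[of i "s i \<otimes> w"] mem_inversions_s_mult_self[of i w] assms by simp

text \<open>A reduced word is built from the right: a letter that creates an inversion is prepended,
  and one that cancels an inversion is absorbed by an exchange. All letters come from the given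
  word.\<close>

lemma reduced_subword:
  "xs \<in> lists I \<Longrightarrow>
   \<exists>ys. set ys \<subseteq> set xs \<and> val ys = val xs \<and> length ys = card (inversions (val xs))"
proof (induction xs)
  case (Cons i xs)
  hence i: "i \<in> I" and xs: "xs \<in> lists I" by auto
  then obtain ys where ys: "set ys \<subseteq> set xs" "val ys = val xs" "length ys = card (inversions (val xs))"
    using Cons by auto
  have ysI: "ys \<in> lists I" using ys xs by auto
  show ?case
  proof (cases "s i \<in> inversions (val xs)")
    case False
    thus ?thesis using ys i xs inversions_s_mult(2)[of i "val xs"]
      by (intro exI[of _ "i # ys"]) auto
  next
    case True
    hence "inv_parity ys (s i)" using inversions_word[OF ysI] ys by auto
    then obtain zs where "set zs \<subseteq> set ys" "Suc (length zs) = length ys" "val zs = s i \<otimes> val ys"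
      using exchange_word[OF ysI, of "s i"] i by auto
    thus ?thesis using ys card_inversions_s_mult[of i "val xs"] True i xs
      by (intro exI[of _ zs]) auto
  qed
qed auto

lemma card_inversions_le: "xs \<in> lists I \<Longrightarrow> card (inversions (val xs)) \<le> length xs"
proof (induction xs)
  case (Cons i xs)
  thus ?case using inversions_s_mult(2)[of i "val xs"] card_inversions_s_mult[of i "val xs"]
    by (cases "s i \<in> inversions (val xs)") auto
qed simp

lemma len_eq_card: "w \<in> W \<Longrightarrow> len w = card (inversions w)"
proof -
  assume w: "w \<in> W"
  then obtain xs where "xs \<in> lists I" "val xs = w" using val_surj by auto
  then obtain ys where "ys \<in> lists I" "val ys = w" "length ys = card (inversions w)"
    using reduced_subword[of xs] by (metis in_lists_conv_set subsetD)
  thus ?thesis unfolding cox_length_def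
  proof (intro Least_equality)
    show "\<exists>is\<in>lists I. length is = card (inversions w) \<and> val is = w"
      using \<open>ys \<in> lists I\<close> \<open>val ys = w\<close> \<open>length ys = _\<close> by blast
    fix n assume "\<exists>is\<in>lists I. length is = n \<and> val is = w"
    then obtain zs where "zs \<in> lists I" "length zs = n" "val zs = w" by blast
    thus "card (inversions w) \<le> n" using card_inversions_le[of zs] by simp
  qed
qed

lemma inversions_mult:
  assumes "x \<in> W" "y \<in> W"
  shows "inversions (x \<otimes> y) = sym_diff (inversions x) ((\<lambda>t. x \<otimes> t \<otimes> inv x) ` inversions y)"
proof -
  have "(\<lambda>t. x \<otimes> t \<otimes> inv x) ` inversions y = {t \<in> W. inv x \<otimes> t \<otimes> x \<in> inversions y}" (is "?L = ?R")
  proof (intro equalityI subsetI)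
    fix t assume "t \<in> ?L"
    then obtain u where "u \<in> inversions y" "t = x \<otimes> u \<otimes> inv x" by auto
    thus "t \<in> ?R" using assms inversions_closed[of y] by (auto simp: m_assoc subset_iff)
  next
    fix t assume "t \<in> ?R"
    thus "t \<in> ?L" using assms by (intro image_eqI[of _ _ "inv x \<otimes> t \<otimes> x"]) (auto simp: m_assoc)
  qed
  thus ?thesis
    using mem_inversions_mult[OF assms] inversions_closed[of "x \<otimes> y"] inversions_closed[of x] by auto
qed

lemma inj_on_conj: "x \<in> W \<Longrightarrow> inj_on (\<lambda>t. x \<otimes> t \<otimes> inv x) (W)"
  by (rule inj_on_inverseI[of _ "\<lambda>t. inv x \<otimes> t \<otimes> x"]) (simp add: m_assoc)

text \<open>In the symmetric difference of the cocycle rule every common element is lost twice. The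
  correction term is kept explicit, so that subadditivity, the parity of lengths and the criterion
  for additive lengths come from one equation.\<close>

lemma len_mult_inter:
  assumes "x \<in> W" "y \<in> W"
  shows "len (x \<otimes> y) + 2 * card (inversions x \<inter> (\<lambda>t. x \<otimes> t \<otimes> inv x) ` inversions y) = len x + len y"
proof -
  let ?C = "(\<lambda>t. x \<otimes> t \<otimes> inv x) ` inversions y"
  have C: "card ?C = len y"
    using card_image[OF inj_on_subset[OF inj_on_conj inversions_closed]] assms by (simp add: len_eq_card)
  have "card (sym_diff (inversions x) ?C) = card (inversions x - ?C) + card (?C - inversions x)"
    by (intro card_Un_disjoint) auto
  moreover have "card (inversions x) = card (inversions x \<inter> ?C) + card (inversions x - ?C)"
    by (rule card_Int_Diff) simp
  moreover have "card ?C = card (?C \<inter> inversions x) + card (?C - inversions x)"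
    by (rule card_Int_Diff) simp
  ultimately show ?thesis using assms C by (simp add: len_eq_card inversions_mult Int_commute)
qed

lemma len_mult_le: "x \<in> W \<Longrightarrow> y \<in> W \<Longrightarrow> len (x \<otimes> y) \<le> len x + len y"
  using len_mult_inter[of x y] by simp

lemma even_len_mult:
  "x \<in> W \<Longrightarrow> y \<in> W \<Longrightarrow> even (len (x \<otimes> y)) = (even (len x) = even (len y))"
  using len_mult_inter[of x y] by presburger

lemma len_one [simp]: "len \<one> = 0"
  by (simp add: len_eq_card)

lemma len_simple [simp]: "i \<in> I \<Longrightarrow> len (s i) = 1"
  by (simp add: len_eq_card)

lemma len_zero_iff: "x \<in> W \<Longrightarrow> len x = 0 \<longleftrightarrow> x = \<one>"
proof
  assume x: "x \<in> W" "len x = 0"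
  obtain xs where "xs \<in> lists I" "val xs = x" using val_surj x by blast
  then obtain ys where "val ys = x" "length ys = 0" using reduced_subword[of xs] x by (auto simp: len_eq_card)
  thus "x = \<one>" by simp
qed simp

lemma len_inv [simp]: "x \<in> W \<Longrightarrow> len (inv x) = len x"
proof -
  have *: "len x \<le> len (inv x)" if "x \<in> W" for x
  proof -
    have "(\<lambda>t. inv x \<otimes> t \<otimes> x) ` inversions x \<subseteq> inversions (inv x)"
      using that inversions_closed[of x] mem_inversions_inv[of x] by (auto simp: m_assoc subset_iff)
    moreover have "inj_on (\<lambda>t. inv x \<otimes> t \<otimes> x) (inversions x)"
      using inj_on_subset[OF inj_on_conj[of "inv x"] inversions_closed] that by simp
    ultimately show ?thesis
      using card_mono[OF finite_inversions] that by (metis card_image inv_closed len_eq_card)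
  qed
  assume "x \<in> W"
  thus ?thesis using *[of x] *[of "inv x"] by simp
qed

lemma len_mult_eq_iff:
  assumes "x \<in> W" "y \<in> W"
  shows "len (x \<otimes> y) = len x + len y \<longleftrightarrow> inversions (inv x) \<inter> inversions y = {}"
proof -
  have "len (x \<otimes> y) = len x + len y \<longleftrightarrow> card (inversions x \<inter> (\<lambda>t. x \<otimes> t \<otimes> inv x) ` inversions y) = 0"
    using len_mult_inter[OF assms] by linarith
  also have "\<dots> \<longleftrightarrow> inversions x \<inter> (\<lambda>t. x \<otimes> t \<otimes> inv x) ` inversions y = {}" by simp
  also have "\<dots> \<longleftrightarrow> inversions (inv x) \<inter> inversions y = {}"
    using assms mem_inversions_inv[of x] inversions_closed[of y] by blast
  finally show ?thesis .
qed

text \<open>The weak orders are handled as containment of inversion sets, where transitivity is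
  evident; \<open>right_le_iff\<close> and \<open>left_le_iff\<close> connect them with prefixes and
  suffixes of reduced words.\<close>

definition rle :: "'a \<Rightarrow> 'a \<Rightarrow> bool" where
  "rle u w \<longleftrightarrow> inversions u \<subseteq> inversions w"

definition lle :: "'a \<Rightarrow> 'a \<Rightarrow> bool" where
  "lle u w \<longleftrightarrow> inversions (inv u) \<subseteq> inversions (inv w)"

lemma rle_refl [simp]: "rle u u" and rle_one [simp]: "rle \<one> u"
  and rle_trans: "rle u v \<Longrightarrow> rle v w \<Longrightarrow> rle u w"
  by (auto simp: rle_def)

lemma lle_refl [simp]: "lle u u" and lle_trans: "lle u v \<Longrightarrow> lle v w \<Longrightarrow> lle u w"
  and lle_one [simp]: "lle \<one> w"
  by (auto simp: lle_def)

lemma rle_inv: "u \<in> W \<Longrightarrow> w \<in> W \<Longrightarrow> rle (inv u) (inv w) \<longleftrightarrow> lle u w"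
  by (auto simp: rle_def lle_def)

lemma rle_iff_len:
  assumes "u \<in> W" "w \<in> W"
  shows "rle u w \<longleftrightarrow> len w = len u + len (inv u \<otimes> w)"
proof -
  let ?C = "(\<lambda>t. u \<otimes> t \<otimes> inv u) ` inversions (inv u \<otimes> w)"
  have w: "inversions w = sym_diff (inversions u) ?C"
    using inversions_mult[of u "inv u \<otimes> w"] assms by simp
  have "len w + 2 * card (inversions u \<inter> ?C) = len u + len (inv u \<otimes> w)"
    using len_mult_inter[of u "inv u \<otimes> w"] assms by simp
  hence "len w = len u + len (inv u \<otimes> w) \<longleftrightarrow> card (inversions u \<inter> ?C) = 0" by linarith
  also have "\<dots> \<longleftrightarrow> inversions u \<inter> ?C = {}" by simp
  also have "\<dots> \<longleftrightarrow> inversions u \<subseteq> inversions w" unfolding w by blast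
  finally show ?thesis by (simp add: rle_def)
qed

lemma lle_iff_len:
  assumes "u \<in> W" "w \<in> W"
  shows "lle u w \<longleftrightarrow> len w = len (w \<otimes> inv u) + len u"
proof -
  have "len (w \<otimes> inv u) = len (u \<otimes> inv w)"
    using len_inv[of "w \<otimes> inv u"] assms by (simp add: inv_mult_group)
  thus ?thesis using rle_iff_len[of "inv u" "inv w"] assms by (auto simp: rle_inv)
qed

lemma rle_mult: "x \<in> W \<Longrightarrow> y \<in> W \<Longrightarrow> rle x (x \<otimes> y) \<longleftrightarrow> len (x \<otimes> y) = len x + len y"
  by (simp add: rle_iff_len)

lemma lle_mult: "x \<in> W \<Longrightarrow> y \<in> W \<Longrightarrow> lle y (x \<otimes> y) \<longleftrightarrow> len (x \<otimes> y) = len x + len y"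
  by (simp add: lle_iff_len m_assoc)

lemma rle_len: "u \<in> W \<Longrightarrow> w \<in> W \<Longrightarrow> rle u w \<Longrightarrow> len u \<le> len w"
  by (simp add: rle_iff_len)

lemma lle_len: "u \<in> W \<Longrightarrow> w \<in> W \<Longrightarrow> lle u w \<Longrightarrow> len u \<le> len w"
  by (simp add: lle_iff_len)

lemma rle_len_eq:
  assumes "u \<in> W" "w \<in> W" "rle u w" "len w \<le> len u"
  shows "u = w"
proof -
  have "inv u \<otimes> w = \<one>" using assms len_zero_iff[of "inv u \<otimes> w"] by (simp add: rle_iff_len)
  thus ?thesis using assms by (metis inv_equality inv_inv inv_closed)
qed

lemma lle_len_eq:
  assumes "u \<in> W" "w \<in> W" "lle u w" "len w \<le> len u"
  shows "u = w"
  using rle_len_eq[of "inv u" "inv w"] assms by (metis inv_closed inv_inv len_inv rle_inv)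

lemma reduced_word_iff:
  "w \<in> W \<Longrightarrow> reduced w xs \<longleftrightarrow> xs \<in> lists I \<and> val xs = w \<and> length xs = len w"
  by (simp add: reduced_word_def)

lemma reduced_word_exists: "w \<in> W \<Longrightarrow> \<exists>xs. reduced w xs"
proof -
  assume w: "w \<in> W"
  then obtain xs where "xs \<in> lists I" "val xs = w" using val_surj by blast
  with reduced_subword[of xs] w show ?thesis
    unfolding reduced_word_def by (auto simp: len_eq_card subset_iff)
qed

lemma len_val_le: "xs \<in> lists I \<Longrightarrow> len (val xs) \<le> length xs"
  using card_inversions_le by (simp add: len_eq_card)

lemma reduced_append:
  assumes "xs \<in> lists I" "ys \<in> lists I" "reduced w (xs @ ys)"
  shows "reduced (val xs) xs" "reduced (val ys) ys"
    "len w = len (val xs) + len (val ys)"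
  using assms len_val_le[of xs] len_val_le[of ys] len_mult_le[of "val xs" "val ys"]
  by (auto simp: reduced_word_def val_append)

lemma reduced_append_intro:
  assumes "reduced u xs" "reduced v ys" "len (u \<otimes> v) = len u + len v"
  shows "reduced (u \<otimes> v) (xs @ ys)"
  using assms by (auto simp: reduced_word_def val_append)

lemma reduced_word_closed: "reduced u xs \<Longrightarrow> u \<in> W"
  unfolding reduced_word_def using val_closed by blast

lemma right_le_iff:
  "right_le G I s u w \<longleftrightarrow> u \<in> W \<and> w \<in> W \<and> rle u w"
proof
  assume "right_le G I s u w"
  then obtain xs zs where red: "reduced u xs" "reduced w (xs @ zs)"
    unfolding right_le_def prefix_def by blast
  hence l: "xs \<in> lists I" "zs \<in> lists I" by (auto simp: reduced_word_def)
  from red have "u \<in> W" "w \<in> W" by (simp_all add: reduced_word_closed)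
  moreover have "w = u \<otimes> val zs" "len w = len u + len (val zs)"
    using red reduced_append(3)[OF l red(2)] l by (auto simp: reduced_word_def val_append)
  ultimately show "u \<in> W \<and> w \<in> W \<and> rle u w" using l by (simp add: rle_mult)
next
  assume *: "u \<in> W \<and> w \<in> W \<and> rle u w"
  then obtain xs zs where "reduced u xs" "reduced (inv u \<otimes> w) zs"
    using reduced_word_exists by (meson inv_closed m_closed)
  moreover from this have "reduced w (xs @ zs)"
    using reduced_append_intro[of u xs "inv u \<otimes> w" zs] * rle_iff_len[of u w] by simp
  ultimately show "right_le G I s u w" unfolding right_le_def prefix_def by blast
qed

lemma left_le_iff:
  "left_le G I s u w \<longleftrightarrow> u \<in> W \<and> w \<in> W \<and> lle u w"
proof
  assume "left_le G I s u w"
  then obtain xs zs where red: "reduced u xs" "reduced w (zs @ xs)"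
    unfolding left_le_def suffix_def by blast
  hence l: "xs \<in> lists I" "zs \<in> lists I" by (auto simp: reduced_word_def)
  from red have "u \<in> W" "w \<in> W" by (simp_all add: reduced_word_closed)
  moreover have "w = val zs \<otimes> u" "len w = len (val zs) + len u"
    using red reduced_append(3)[OF l(2,1) red(2)] l by (auto simp: reduced_word_def val_append)
  ultimately show "u \<in> W \<and> w \<in> W \<and> lle u w" using l by (simp add: lle_mult)
next
  assume *: "u \<in> W \<and> w \<in> W \<and> lle u w"
  then obtain xs zs where "reduced u xs" "reduced (w \<otimes> inv u) zs"
    using reduced_word_exists by (meson inv_closed m_closed)
  moreover from this have "reduced w (zs @ xs)"
    using reduced_append_intro[of "w \<otimes> inv u" zs u xs] * lle_iff_len[of u w] by (simp add: m_assoc)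
  ultimately show "left_le G I s u w" unfolding left_le_def suffix_def by blast
qed

section \<open>Descents\<close>

abbreviation "D \<equiv> right_descents G I s"

lemma descent_index: "i \<in> D w \<Longrightarrow> i \<in> I"
  by (simp add: right_descents_def)

text \<open>The inversions of w and of w s_i differ exactly by the reflection w s_i w^-1, so its
  membership decides between the two possible lengths.\<close>

lemma descent_iff_inversion:
  assumes "i \<in> I" "w \<in> W"
  shows "i \<in> D w \<longleftrightarrow> w \<otimes> s i \<otimes> inv w \<in> inversions w"
    and "i \<in> D w \<longleftrightarrow> s i \<in> inversions (inv w)"
    and "len (w \<otimes> s i) = (if i \<in> D w then len w - 1 else Suc (len w))"
    and "i \<in> D w \<Longrightarrow> 0 < len w"
proof -
  have "len (w \<otimes> s i) + 2 * card (inversions w \<inter> {w \<otimes> s i \<otimes> inv w}) = len w + 1"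
    using len_mult_inter[of w "s i"] assms by simp
  hence len: "len (w \<otimes> s i) + (if w \<otimes> s i \<otimes> inv w \<in> inversions w then 2 else 0) = len w + 1"
    by (auto split: if_splits)
  show *: "i \<in> D w \<longleftrightarrow> w \<otimes> s i \<otimes> inv w \<in> inversions w"
    using len assms by (auto simp: right_descents_def split: if_splits)
  show "i \<in> D w \<longleftrightarrow> s i \<in> inversions (inv w)" using * assms by (simp add: mem_inversions_inv)
  show "len (w \<otimes> s i) = (if i \<in> D w then len w - 1 else Suc (len w))" "i \<in> D w \<Longrightarrow> 0 < len w"
    using len * by (auto split: if_splits)
qed

lemma len_mult_s:
  assumes "i \<in> I" "w \<in> W"
  shows "i \<in> D w \<Longrightarrow> Suc (len (w \<otimes> s i)) = len w" "i \<notin> D w \<Longrightarrow> len (w \<otimes> s i) = Suc (len w)"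
  using descent_iff_inversion(3,4)[OF assms] by auto

lemma descent_iff_len: "i \<in> D w \<longleftrightarrow> i \<in> I \<and> len (w \<otimes> s i) < len w"
  by (simp add: right_descents_def)

lemma descent_mult_s: "i \<in> I \<Longrightarrow> w \<in> W \<Longrightarrow> i \<in> D (w \<otimes> s i) \<longleftrightarrow> i \<notin> D w"
  using len_mult_s[of i w] by (cases "i \<in> D w") (auto simp: m_assoc descent_iff_len[of i "w \<otimes> s i"])

lemma inversion_iff_len:
  assumes "i \<in> I" "w \<in> W"
  shows "s i \<in> inversions w \<longleftrightarrow> len (s i \<otimes> w) < len w"
    and "len (s i \<otimes> w) = (if s i \<in> inversions w then len w - 1 else Suc (len w))"
  using card_inversions_s_mult[OF assms] inversions_s_mult(2)[OF assms] assms
  by (cases "s i \<in> inversions w"; simp add: len_eq_card; fail)+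

text \<open>The reflection \<open>w s\<^sub>j w\<inverse>\<close> decides whether \<open>j\<close> is a descent of \<open>w\<close>, and left multiplication by
  \<open>s\<^sub>i\<close> permutes all inversions except \<open>s\<^sub>i\<close> itself.\<close>

lemma descent_change:
  assumes "i \<in> I" "j \<in> I" "w \<in> W" "j \<in> D (s i \<otimes> w) \<longleftrightarrow> j \<notin> D w"
  shows "s i \<otimes> w = w \<otimes> s j"
proof -
  let ?r = "w \<otimes> s j \<otimes> inv w"
  have "s i \<otimes> w \<otimes> s j \<otimes> inv (s i \<otimes> w) = s i \<otimes> ?r \<otimes> s i"
    using assms by (simp add: inv_mult_group m_assoc)
  hence "j \<in> D (s i \<otimes> w) \<longleftrightarrow> s i \<otimes> ?r \<otimes> s i \<in> inversions (s i \<otimes> w)"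
    using descent_iff_inversion(1)[of j "s i \<otimes> w"] assms by simp
  also have "\<dots> \<longleftrightarrow> (s i \<otimes> ?r \<otimes> s i = s i) \<noteq> (?r \<in> inversions w)"
    using mem_inversions_mult[of "s i" w "s i \<otimes> ?r \<otimes> s i"] assms by (simp add: m_assoc)
  finally have *: "s i \<otimes> ?r \<otimes> s i = s i"
    using assms descent_iff_inversion(1)[of j w] by blast
  have "?r \<otimes> w = w \<otimes> s j" using assms by (simp add: m_assoc)
  moreover have "?r = s i"
  proof -
    have "?r = s i \<otimes> (s i \<otimes> ?r \<otimes> s i) \<otimes> s i" using assms by (simp add: m_assoc)
    thus ?thesis using * assms by simp
  qed
  ultimately show ?thesis by metis
qed

section \<open>Reflections and the longest element\<close>

definition reflections :: "'a set" where
  "reflections = {x \<otimes> s i \<otimes> inv x | x i. x \<in> W \<and> i \<in> I}"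

lemma reflections_conj: "t \<in> reflections \<Longrightarrow> x \<in> W \<Longrightarrow> x \<otimes> t \<otimes> inv x \<in> reflections"
proof -
  assume "t \<in> reflections" and x: "x \<in> W"
  then obtain y i where "y \<in> W" "i \<in> I" "t = y \<otimes> s i \<otimes> inv y" unfolding reflections_def by blast
  thus ?thesis using x unfolding reflections_def
    by (intro CollectI exI[of _ "x \<otimes> y"] exI[of _ i]) (simp add: inv_mult_group m_assoc)
qed

lemma inversions_reflections: 
  assumes "w \<in> W" shows "inversions w \<subseteq> reflections"
proof -
  have *: "inv_parity xs t \<Longrightarrow> xs \<in> lists I \<Longrightarrow> t \<in> W \<Longrightarrow> t \<in> reflections" for xs t
  proof (induction xs arbitrary: t)
    case (Cons i xs)
    have i: "i \<in> I" using Cons.prems by auto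
    show ?case
    proof (cases "t = s i")
      case True
      thus ?thesis using i unfolding reflections_def
        by (intro CollectI exI[of _ \<one>] exI[of _ i]) simp
    next
      case False
      hence "s i \<otimes> t \<otimes> s i \<in> reflections" using Cons i by auto
      from reflections_conj[OF this, of "s i"] show ?thesis using i Cons.prems by (simp add: m_assoc)
    qed
  qed simp
  obtain xs where "xs \<in> lists I" "val xs = w" using val_surj assms by blast
  thus ?thesis using * inversions_word[of xs] by auto
qed

lemma reflections_closed: "t \<in> reflections \<Longrightarrow> t \<in> W"
  by (auto simp: reflections_def)

lemma reflection_square: "t \<in> reflections \<Longrightarrow> t \<otimes> t = \<one>"
  by (auto simp: reflections_def m_assoc)

text \<open>Writing t = x s_i x^-1, the middle letter contributes t once, while the outer factors
  contribute it either twice or not at all.\<close>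

lemma reflection_inversion_self: "t \<in> reflections \<Longrightarrow> t \<in> inversions t"
proof -
  assume "t \<in> reflections"
  then obtain x i where x: "x \<in> W" "i \<in> I" and t: "t = x \<otimes> s i \<otimes> inv x"
    unfolding reflections_def by blast
  have tc: "t \<in> W" using x t by simp
  have 1: "inv x \<otimes> t \<otimes> x = s i" using x t by (simp add: m_assoc)
  have "t \<in> inversions (x \<otimes> (s i \<otimes> inv x)) \<longleftrightarrow> (t \<in> inversions x) \<noteq> (s i \<in> inversions (s i \<otimes> inv x))"
    using mem_inversions_mult[of x "s i \<otimes> inv x" t] x tc 1 by simp
  also have "s i \<in> inversions (s i \<otimes> inv x) \<longleftrightarrow> \<not> t \<in> inversions x"
    using mem_inversions_s_mult_self[of i "inv x"] mem_inversions_inv[of x "s i"] x t by simp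
  finally show ?thesis using x t by (simp add: m_assoc)
qed

lemma reflection_len_less:
  assumes "w \<in> W" "t \<in> inversions w"
  shows "len (t \<otimes> w) < len w"
proof -
  obtain xs where xs: "reduced w xs" using reduced_word_exists assms by blast
  have t: "t \<in> W" using assms inversions_closed by blast
  have l: "xs \<in> lists I" "val xs = w" "length xs = len w" using xs by (auto simp: reduced_word_def)
  have "inv_parity xs t" using inversions_word[OF l(1)] l assms by auto
  then obtain ys where "set ys \<subseteq> set xs" "Suc (length ys) = length xs" "val ys = t \<otimes> val xs"
    using exchange_word[OF l(1) t] by blast
  moreover from this have "ys \<in> lists I" using l by auto
  ultimately show ?thesis using l len_val_le[of ys] by auto
qed

text \<open>Exactly one of w and t w has t as an inversion, and by
  \<open>reflection_len_less\<close> the one that has it is the longer of the two.\<close>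

lemma reflection_inversion_iff:
  assumes "w \<in> W" "t \<in> reflections"
  shows "t \<in> inversions w \<longleftrightarrow> len (t \<otimes> w) < len w"
proof
  assume *: "len (t \<otimes> w) < len w"
  have tc: "t \<in> W" using assms reflections_closed by blast
  have "inv t = t" using reflection_square[OF assms(2)] tc inv_equality by blast
  hence "t \<in> inversions (t \<otimes> w) \<longleftrightarrow> t \<notin> inversions w"
    using mem_inversions_mult[of t w t] assms tc reflection_inversion_self[of t] reflection_square[of t] by simp
  moreover have "t \<otimes> (t \<otimes> w) = w" using reflection_square[OF assms(2)] tc assms by (simp flip: m_assoc)
  ultimately show "t \<in> inversions w"
    using reflection_len_less[of "t \<otimes> w" t] * assms tc by auto
qed (use reflection_len_less assms in blast)

lemma odd_len_reflection: "t \<in> reflections \<Longrightarrow> odd (len t)"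
  by (auto simp: reflections_def even_len_mult)

text \<open>An element of maximal length has all reflections as inversions, since multiplication by
  a reflection changes the parity of the length and so must shorten it. The set of all reflections
  is stable under conjugation, hence it absorbs the inversions of any x completely.\<close>

lemma longest_exists: "\<exists>w\<in>W. \<forall>x\<in>W. len (w \<otimes> x) + len x = len w"
proof -
  have fin: "finite (len ` W)" and ne: "len ` W \<noteq> {}" using finite_carrier by auto
  obtain w where w: "w \<in> W" "Max (len ` W) = len w"
    using Max_in[OF fin ne] by blast
  hence w: "w \<in> W" "\<And>x. x \<in> W \<Longrightarrow> len x \<le> len w"
    using Max_ge[OF fin] by (simp_all flip: w(2))
  have all: "inversions w = reflections"
  proof (intro equalityI subsetI)
    fix t assume t: "t \<in> reflections"
    hence tc: "t \<in> W" by (rule reflections_closed)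
    have "len (t \<otimes> w) \<noteq> len w"
      using even_len_mult[of t w] odd_len_reflection[OF t] tc w by fastforce
    thus "t \<in> inversions w" using reflection_inversion_iff[OF w(1) t] w(2)[of "t \<otimes> w"] tc w(1) by simp
  qed (use inversions_reflections w in blast)
  have "len (w \<otimes> x) + len x = len w" if x: "x \<in> W" for x
  proof -
    have "(\<lambda>t. w \<otimes> t \<otimes> inv w) ` inversions x \<subseteq> inversions w"
      unfolding all using inversions_reflections[OF x] reflections_conj w by blast
    hence "inversions w \<inter> (\<lambda>t. w \<otimes> t \<otimes> inv w) ` inversions x = (\<lambda>t. w \<otimes> t \<otimes> inv w) ` inversions x"
      by blast
    moreover have "card ((\<lambda>t. w \<otimes> t \<otimes> inv w) ` inversions x) = len x"
      using card_image[OF inj_on_subset[OF inj_on_conj inversions_closed]] w x by (simp add: len_eq_card)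
    ultimately show ?thesis using len_mult_inter[OF w(1) x] by simp
  qed
  thus ?thesis using w by blast
qed

definition longest :: 'a where
  "longest = (SOME w. w \<in> W \<and> (\<forall>x\<in>W. len (w \<otimes> x) + len x = len w))"

lemma longest_closed [simp]: "longest \<in> W"
  and len_longest_mult: "x \<in> W \<Longrightarrow> len (longest \<otimes> x) + len x = len longest"
proof -
  have "longest \<in> W \<and> (\<forall>x\<in>W. len (longest \<otimes> x) + len x = len longest)"
    unfolding longest_def by (rule someI_ex) (use longest_exists in blast)
  thus "longest \<in> W" "x \<in> W \<Longrightarrow> len (longest \<otimes> x) + len x = len longest" by auto
qed

lemma lle_longest: "x \<in> W \<Longrightarrow> lle x longest"
  using len_longest_mult[of "inv x"] by (simp add: lle_iff_len)

section \<open>Parabolic subgroups and minimal coset representatives\<close>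

abbreviation "Par J \<equiv> parabolic G s J"

lemma parabolic_subgroup: "J \<subseteq> I \<Longrightarrow> subgroup (Par J) G"
  unfolding parabolic_def by (rule generate_is_subgroup) auto

lemma parabolic_closed: "J \<subseteq> I \<Longrightarrow> x \<in> Par J \<Longrightarrow> x \<in> W"
  by (rule subgroup.mem_carrier[OF parabolic_subgroup])

lemma parabolic_one [simp]: "\<one> \<in> Par J"
  unfolding parabolic_def by (rule generate.one)

lemma parabolic_mult: "x \<in> Par J \<Longrightarrow> y \<in> Par J \<Longrightarrow> x \<otimes> y \<in> Par J"
  unfolding parabolic_def by (rule generate.eng)

lemma parabolic_inv: "J \<subseteq> I \<Longrightarrow> x \<in> Par J \<Longrightarrow> inv x \<in> Par J"
  by (rule subgroup.m_inv_closed[OF parabolic_subgroup])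

lemma parabolic_simple: "j \<in> J \<Longrightarrow> s j \<in> Par J"
  unfolding parabolic_def by (rule generate.incl) simp

lemma parabolic_mono: "s ` J \<subseteq> s ` K \<Longrightarrow> x \<in> Par J \<Longrightarrow> x \<in> Par K"
  unfolding parabolic_def using mono_generate by blast

lemma parabolic_least:
  assumes "J \<subseteq> I" "subgroup H G" "\<And>j. j \<in> J \<Longrightarrow> s j \<in> H"
  shows "Par J \<subseteq> H"
  unfolding parabolic_def using assms by (intro generate_subgroup_incl) auto

text \<open>Passing to a reduced word keeps to the letters of the given word, so an element of W_J
  has the same length in W_J as in W.\<close>

lemma parabolic_word:
  assumes "J \<subseteq> I" "x \<in> Par J"
  shows "\<exists>xs\<in>lists J. reduced x xs"
proof -
  have "\<exists>xs\<in>lists J. val xs = x"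
    using assms(2) unfolding parabolic_def
  proof (induction rule: generate.induct)
    case one show ?case by (rule bexI[of _ "[]"]) auto
  next
    case (incl h)
    then obtain i where "i \<in> J" "h = s i" by auto
    thus ?case using assms(1) by (intro bexI[of _ "[i]"]) auto
  next
    case (inv h)
    then obtain i where "i \<in> J" "h = s i" by auto
    thus ?case using assms(1) by (intro bexI[of _ "[i]"]) auto
  next
    case (eng h1 h2)
    then obtain xs ys where "xs \<in> lists J" "ys \<in> lists J" "val xs = h1" "val ys = h2" by auto
    thus ?case using assms(1) by (intro bexI[of _ "xs @ ys"]) (auto simp: val_append subset_iff in_lists_conv_set)
  qed
  then obtain xs where xs: "xs \<in> lists J" "val xs = x" by blast
  hence xsI: "xs \<in> lists I" using assms by auto
  from reduced_subword[OF this] obtain ys where "set ys \<subseteq> set xs" "val ys = x" "length ys = card (inversions x)"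
    using xs by blast
  thus ?thesis using xs xsI parabolic_closed[OF assms]
    by (intro bexI[of _ ys]) (auto simp: reduced_word_def len_eq_card)
qed

lemma val_parabolic: "xs \<in> lists J \<Longrightarrow> val xs \<in> Par J"
  by (induction xs) (auto intro: parabolic_mult parabolic_simple)

lemma inversions_parabolic:
  assumes "J \<subseteq> I" "x \<in> Par J"
  shows "inversions x \<subseteq> Par J"
proof -
  have *: "inv_parity xs t \<Longrightarrow> xs \<in> lists J \<Longrightarrow> t \<in> W \<Longrightarrow> t \<in> Par J" for xs t
  proof (induction xs arbitrary: t)
    case (Cons i xs)
    have i: "i \<in> J" "i \<in> I" using Cons.prems assms by auto
    show ?case
    proof (cases "t = s i")
      case False
      hence "s i \<otimes> t \<otimes> s i \<in> Par J" using Cons i by auto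
      hence "s i \<otimes> (s i \<otimes> t \<otimes> s i) \<otimes> s i \<in> Par J"
        by (rule parabolic_mult[OF parabolic_mult[OF parabolic_simple[OF i(1)]] parabolic_simple[OF i(1)]])
      moreover have "s i \<otimes> (s i \<otimes> t \<otimes> s i) \<otimes> s i = t"
        using i Cons.prems by (simp add: m_assoc)
      ultimately show ?thesis by simp
    qed (use i in \<open>simp add: parabolic_simple\<close>)
  qed simp
  obtain xs where xs: "xs \<in> lists J" "val xs = x" using parabolic_word[OF assms] by (auto simp: reduced_word_def)
  hence "xs \<in> lists I" using assms by auto
  thus ?thesis using * xs inversions_word[of xs] by auto
qed

lemma parabolic_left_descent:
  assumes "J \<subseteq> I" "x \<in> Par J" "x \<noteq> \<one>"
  shows "\<exists>j\<in>J. s j \<in> inversions x"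
proof -
  obtain xs where xs: "xs \<in> lists J" "reduced x xs" using parabolic_word[OF assms(1,2)] by blast
  then obtain j ys where xs': "xs = j # ys" using assms by (cases xs) (auto simp: reduced_word_def)
  have j: "j \<in> J" "j \<in> I" "ys \<in> lists I" using xs xs' assms by auto
  have "x = s j \<otimes> val ys" "len x = Suc (length ys)" using xs xs' by (auto simp: reduced_word_def)
  hence "s j \<otimes> x = val ys" "len (val ys) < len x" using j len_val_le[of ys] by auto
  thus ?thesis using inversion_iff_len(1)[of j x] j parabolic_closed[OF assms(1,2)] by auto
qed

lemma parabolic_right_descent:
  assumes "J \<subseteq> I" "x \<in> Par J" "x \<noteq> \<one>"
  shows "\<exists>j\<in>J. j \<in> D x"
proof -
  have x: "x \<in> W" using parabolic_closed assms by blast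
  have "inv x \<noteq> \<one>" using assms x by (metis inv_inv inv_one)
  then obtain j where "j \<in> J" "s j \<in> inversions (inv x)"
    using parabolic_left_descent[OF assms(1), of "inv x"] parabolic_inv[OF assms(1,2)] by blast
  thus ?thesis using descent_iff_inversion(2)[of j x] x assms(1) by blast
qed

definition left_minimal :: "'i set \<Rightarrow> 'a \<Rightarrow> bool" where
  "left_minimal J v \<longleftrightarrow> (\<forall>j\<in>J. s j \<notin> inversions v)"

abbreviation "mrep J w \<equiv> min_rep G I s J w"

text \<open>An inversion t of the shortest element v, lying in \<open>Par J\<close>, would give the
  shorter element t v of the same coset.\<close>

lemma min_rep_mem:
  assumes "J \<subseteq> I" "w \<in> W"
  shows "mrep J w \<in> W" "w \<otimes> inv (mrep J w) \<in> Par J" "inversions (mrep J w) \<inter> Par J = {}"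
proof -
  let ?C = "Par J #> w"
  have C: "?C \<subseteq> W" 
    using assms parabolic_closed[OF assms(1)] by (auto simp: r_coset_def)
  have w: "w \<in> ?C" using assms parabolic_one by (auto simp: r_coset_def intro!: bexI[of _ \<one>])
  have fin: "finite ?C" using C finite_carrier finite_subset by blast
  define v where "v = mrep J w"
  have v: "v \<in> ?C" "\<And>u. u \<in> ?C \<Longrightarrow> len v \<le> len u"
    using arg_min_if_finite[OF fin, of len] w unfolding v_def min_rep_def by (auto simp: not_less[symmetric])
  then obtain h where h: "h \<in> Par J" "v = h \<otimes> w" by (auto simp: r_coset_def)
  have hc: "h \<in> W" using h parabolic_closed assms by blast
  show vc: "mrep J w \<in> W" using v C v_def by blast
  show "w \<otimes> inv (mrep J w) \<in> Par J"
    using h hc assms parabolic_inv[OF assms(1) h(1)] unfolding v_def[symmetric] by (simp add: inv_mult_group)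
  have False if "t \<in> inversions v" "t \<in> Par J" for t
  proof -
    have "t \<otimes> v \<in> ?C"
      using that h hc assms parabolic_mult[OF that(2) h(1)] parabolic_closed[OF assms(1) that(2)]
      by (auto simp: r_coset_def m_assoc intro!: bexI[of _ "t \<otimes> h"])
    thus False using v(2) reflection_len_less[of v t] that vc v_def by fastforce
  qed
  thus "inversions (mrep J w) \<inter> Par J = {}" unfolding v_def by blast
qed

text \<open>The inversions of h lie in \<open>Par J\<close>, whereas the conjugates by h of those of
  v avoid it, so the symmetric difference in the cocycle rule is a disjoint union.\<close>

lemma inversions_mult_minimal:
  assumes "J \<subseteq> I" "h \<in> Par J" "v \<in> W" "inversions v \<inter> Par J = {}"
  shows "len (h \<otimes> v) = len h + len v"
    and "inversions (h \<otimes> v) \<inter> Par J = inversions h"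
    and "t \<in> W \<Longrightarrow> t \<in> inversions (h \<otimes> v) \<longleftrightarrow> t \<in> inversions h \<or> inv h \<otimes> t \<otimes> h \<in> inversions v"
proof -
  have h: "h \<in> W" using parabolic_closed assms by blast
  have "inversions (inv h) \<subseteq> Par J" using inversions_parabolic parabolic_inv assms by blast
  thus "len (h \<otimes> v) = len h + len v" using len_mult_eq_iff[of h v] h assms by blast
  have *: "t \<in> Par J \<Longrightarrow> inv h \<otimes> t \<otimes> h \<notin> inversions v" for t
    using assms parabolic_mult parabolic_inv[OF assms(1,2)] by blast
  have hP: "inversions h \<subseteq> Par J" using inversions_parabolic assms by blast
  show "t \<in> W \<Longrightarrow> t \<in> inversions (h \<otimes> v) \<longleftrightarrow> t \<in> inversions h \<or> inv h \<otimes> t \<otimes> h \<in> inversions v" for t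
    using mem_inversions_mult[of h v t] h assms hP * by blast
  from this show "inversions (h \<otimes> v) \<inter> Par J = inversions h"
    using hP * inversions_closed by blast
qed

text \<open>Factor v as h u through its coset. If h were not 1, a left descent of h in J would be
  one of v as well.\<close>

lemma left_minimal_iff:
  assumes "J \<subseteq> I" "v \<in> W"
  shows "left_minimal J v \<longleftrightarrow> inversions v \<inter> Par J = {}"
proof
  assume l: "left_minimal J v"
  define u h where "u = mrep J v" and "h = v \<otimes> inv u"
  have u: "u \<in> W" "h \<in> Par J" "inversions u \<inter> Par J = {}"
    using min_rep_mem[OF assms] by (auto simp: u_def h_def)
  have v: "v = h \<otimes> u" using u assms by (simp add: h_def m_assoc)
  have "h = \<one>"
  proof (rule ccontr)
    assume "h \<noteq> \<one>"
    then obtain j where j: "j \<in> J" "s j \<in> inversions h"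
      using parabolic_left_descent[OF assms(1) u(2)] by blast
    hence "s j \<in> inversions v" using inversions_mult_minimal(2)[OF assms(1) u(2,1,3)] v by auto
    thus False using l j by (simp add: left_minimal_def)
  qed
  thus "inversions v \<inter> Par J = {}" using u v by simp
next
  assume "inversions v \<inter> Par J = {}"
  thus "left_minimal J v" using parabolic_simple by (auto simp: left_minimal_def)
qed

lemma left_minimal_min_rep: "J \<subseteq> I \<Longrightarrow> w \<in> W \<Longrightarrow> left_minimal J (mrep J w)"
  using left_minimal_iff[OF _ min_rep_mem(1)] min_rep_mem(3) by simp

lemma min_rep_unique:
  assumes "J \<subseteq> I" "h \<in> Par J" "v \<in> W" "left_minimal J v"
  shows "mrep J (h \<otimes> v) = v"
proof -
  have h: "h \<in> W" using parabolic_closed assms by blast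
  define u where "u = mrep J (h \<otimes> v)"
  have u: "u \<in> W" "h \<otimes> v \<otimes> inv u \<in> Par J" "inversions u \<inter> Par J = {}"
    using min_rep_mem[OF assms(1), of "h \<otimes> v"] h assms by (auto simp: u_def)
  define k where "k = inv h \<otimes> (h \<otimes> v \<otimes> inv u)"
  have k: "k \<in> Par J" using u parabolic_inv[OF assms(1,2)] parabolic_mult by (simp add: k_def)
  have v: "v = k \<otimes> u" using h assms u by (simp add: k_def m_assoc)
  have "inversions k = {}"
    using inversions_mult_minimal(2)[OF assms(1) k u(1,3)] assms left_minimal_iff[OF assms(1,3)] v by simp
  hence "k = \<one>" using len_zero_iff[of k] parabolic_closed[OF assms(1) k] by (simp add: len_eq_card)
  thus ?thesis using v u by (simp add: u_def)
qed

lemma right_minimal_mult: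
  assumes "K \<subseteq> I" "k \<in> Par K" "v \<in> W" "K \<inter> D v = {}"
  shows "len (v \<otimes> k) = len v + len k"
proof -
  have k: "k \<in> W" using parabolic_closed assms by blast
  have "left_minimal K (inv v)" unfolding left_minimal_def
  proof
    fix j assume "j \<in> K"
    thus "s j \<notin> inversions (inv v)" using assms descent_iff_inversion(2)[of j v] by blast
  qed
  hence "len (inv k \<otimes> inv v) = len (inv k) + len (inv v)"
    using inversions_mult_minimal(1)[of K "inv k" "inv v"] assms parabolic_inv left_minimal_iff by simp
  moreover have "inv k \<otimes> inv v = inv (v \<otimes> k)" using k assms by (simp add: inv_mult_group)
  ultimately show ?thesis using k assms by simp
qed

section \<open>Blocks\<close>

text \<open>The coset equation w W_K = W_J w is turned into a statement about conjugation by w, the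
  form in which blocks can be united and moved to another element of the coset.\<close>

lemma left_blockD:
  assumes "left_block G I s w J" "w \<in> W"
  shows "J \<subseteq> I"
    and "\<exists>K\<subseteq>I. \<forall>x\<in>W. x \<in> Par K \<longleftrightarrow> w \<otimes> x \<otimes> inv w \<in> Par J"
proof -
  show J: "J \<subseteq> I" using assms by (simp add: left_block_def)
  from assms obtain K where K: "K \<subseteq> I" "w <# Par K = Par J #> w" by (auto simp: left_block_def)
  have "x \<in> Par K \<longleftrightarrow> w \<otimes> x \<otimes> inv w \<in> Par J" if x: "x \<in> W" for x
  proof
    assume "x \<in> Par K"
    hence "w \<otimes> x \<in> Par J #> w" using K(2) by (auto simp: l_coset_def)
    then obtain h where h: "h \<in> Par J" "w \<otimes> x = h \<otimes> w" by (auto simp: r_coset_def)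
    hence "w \<otimes> x \<otimes> inv w = h" using parabolic_closed[OF J] assms by (simp add: m_assoc)
    thus "w \<otimes> x \<otimes> inv w \<in> Par J" using h by simp
  next
    assume h: "w \<otimes> x \<otimes> inv w \<in> Par J"
    hence "w \<otimes> x \<otimes> inv w \<otimes> w \<in> Par J #> w" by (auto simp: r_coset_def)
    hence "w \<otimes> x \<in> w <# Par K" using K(2) x assms by (simp add: m_assoc)
    then obtain k where "k \<in> Par K" "w \<otimes> x = w \<otimes> k" by (auto simp: l_coset_def)
    thus "x \<in> Par K" using x assms parabolic_closed[OF K(1)] by auto
  qed
  thus "\<exists>K\<subseteq>I. \<forall>x\<in>W. x \<in> Par K \<longleftrightarrow> w \<otimes> x \<otimes> inv w \<in> Par J" using K(1) by blast
qed

lemma left_blockI: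
  assumes "J \<subseteq> I" "K \<subseteq> I" "w \<in> W"
    "\<And>x. x \<in> W \<Longrightarrow> x \<in> Par K \<longleftrightarrow> w \<otimes> x \<otimes> inv w \<in> Par J"
  shows "left_block G I s w J"
proof -
  have "w <# Par K = Par J #> w"
  proof (intro equalityI subsetI)
    fix y assume "y \<in> w <# Par K"
    then obtain k where k: "k \<in> Par K" "y = w \<otimes> k" by (auto simp: l_coset_def)
    have kc: "k \<in> W" using k(1) by (rule parabolic_closed[OF assms(2)])
    have "w \<otimes> k \<otimes> inv w \<in> Par J" using assms(4)[OF kc] k(1) by simp
    moreover have "y = w \<otimes> k \<otimes> inv w \<otimes> w" using k(2) kc assms(3) by (simp add: m_assoc)
    ultimately show "y \<in> Par J #> w" unfolding r_coset_def by blast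
  next
    fix y assume "y \<in> Par J #> w"
    then obtain h where h: "h \<in> Par J" "y = h \<otimes> w" by (auto simp: r_coset_def)
    have hc: "h \<in> W" using h parabolic_closed[OF assms(1)] by blast
    have "w \<otimes> (inv w \<otimes> h \<otimes> w) \<otimes> inv w = h" using assms(3) hc by (simp add: m_assoc)
    hence "inv w \<otimes> h \<otimes> w \<in> Par K" using assms(3) assms(4)[of "inv w \<otimes> h \<otimes> w"] h hc by simp
    moreover have "y = w \<otimes> (inv w \<otimes> h \<otimes> w)" using h hc assms by (simp add: m_assoc)
    ultimately show "y \<in> w <# Par K" by (auto simp: l_coset_def)
  qed
  thus ?thesis using assms by (auto simp: left_block_def)
qed

lemma left_block_cong: "left_block G I s w J \<Longrightarrow> J' \<subseteq> I \<Longrightarrow> s ` J' = s ` J \<Longrightarrow> left_block G I s w J'"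
  by (simp add: left_block_def parabolic_def)

lemma conj_subgroup:
  assumes "subgroup H G" "w \<in> W"
  shows "subgroup {x \<in> W. w \<otimes> x \<otimes> inv w \<in> H} G"
proof (rule subgroupI)
  show "{x \<in> W. w \<otimes> x \<otimes> inv w \<in> H} \<noteq> {}"
    using assms subgroup.one_closed[OF assms(1)] by (auto intro!: exI[of _ \<one>])
next
  fix a assume a: "a \<in> {x \<in> W. w \<otimes> x \<otimes> inv w \<in> H}"
  have "w \<otimes> inv a \<otimes> inv w = inv (w \<otimes> a \<otimes> inv w)" using a assms by (simp add: inv_mult_group m_assoc)
  thus "inv a \<in> {x \<in> W. w \<otimes> x \<otimes> inv w \<in> H}"
    using a subgroup.m_inv_closed[OF assms(1)] by simp
next
  fix a b assume ab: "a \<in> {x \<in> W. w \<otimes> x \<otimes> inv w \<in> H}" "b \<in> {x \<in> W. w \<otimes> x \<otimes> inv w \<in> H}"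
  have "w \<otimes> (a \<otimes> b) \<otimes> inv w = (w \<otimes> a \<otimes> inv w) \<otimes> (w \<otimes> b \<otimes> inv w)"
    using ab assms by (simp add: m_assoc)
  thus "a \<otimes> b \<in> {x \<in> W. w \<otimes> x \<otimes> inv w \<in> H}"
    using ab subgroup.m_closed[OF assms(1)] by simp
qed auto

lemma conj_parabolic_incl:
  assumes "K \<subseteq> I" "J \<subseteq> I" "w \<in> W" "\<And>k. k \<in> K \<Longrightarrow> w \<otimes> s k \<otimes> inv w \<in> Par J" "x \<in> Par K"
  shows "w \<otimes> x \<otimes> inv w \<in> Par J"
proof -
  have "Par K \<subseteq> {x \<in> W. w \<otimes> x \<otimes> inv w \<in> Par J}"
    using assms by (intro parabolic_least conj_subgroup parabolic_subgroup) auto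
  thus ?thesis using assms by blast
qed

lemma conj_parabolic_iff:
  assumes "K \<subseteq> I" "J \<subseteq> I" "w \<in> W" "\<And>k. k \<in> K \<Longrightarrow> w \<otimes> s k \<otimes> inv w \<in> Par J"
    "\<And>j. j \<in> J \<Longrightarrow> inv w \<otimes> s j \<otimes> w \<in> Par K" "x \<in> W"
  shows "x \<in> Par K \<longleftrightarrow> w \<otimes> x \<otimes> inv w \<in> Par J"
proof
  assume "w \<otimes> x \<otimes> inv w \<in> Par J"
  moreover have "inv w \<otimes> s j \<otimes> inv (inv w) \<in> Par K" if "j \<in> J" for j
    using assms(3) assms(5)[OF that] by simp
  ultimately have "inv w \<otimes> (w \<otimes> x \<otimes> inv w) \<otimes> inv (inv w) \<in> Par K"
    using conj_parabolic_incl[of J K "inv w" "w \<otimes> x \<otimes> inv w"] assms(1-3) by blast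
  moreover have "inv w \<otimes> (w \<otimes> x \<otimes> inv w) \<otimes> inv (inv w) = x"
    using assms(3,6) by (simp add: m_assoc)
  ultimately show "x \<in> Par K" by simp
next
  assume "x \<in> Par K"
  thus "w \<otimes> x \<otimes> inv w \<in> Par J" using conj_parabolic_incl[of K J w x] assms(1-4) by blast
qed

lemma left_block_Un:
  assumes "left_block G I s w J" "left_block G I s w J'" "w \<in> W"
  shows "left_block G I s w (J \<union> J')"
proof -
  obtain K where K: "K \<subseteq> I" "\<And>x. x \<in> W \<Longrightarrow> x \<in> Par K \<longleftrightarrow> w \<otimes> x \<otimes> inv w \<in> Par J"
    using left_blockD(2)[OF assms(1,3)] by blast
  obtain K' where K': "K' \<subseteq> I" "\<And>x. x \<in> W \<Longrightarrow> x \<in> Par K' \<longleftrightarrow> w \<otimes> x \<otimes> inv w \<in> Par J'"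
    using left_blockD(2)[OF assms(2,3)] by blast
  have J: "J \<subseteq> I" "J' \<subseteq> I" using assms by (auto simp: left_block_def)
  have mono: "x \<in> Par A \<Longrightarrow> x \<in> Par (A \<union> B)" "x \<in> Par B \<Longrightarrow> x \<in> Par (A \<union> B)" for x A B
    by (auto intro: parabolic_mono[of A] parabolic_mono[of B])
  show ?thesis
  proof (rule left_blockI[of "J \<union> J'" "K \<union> K'"])
    fix x assume x: "x \<in> W"
    show "x \<in> Par (K \<union> K') \<longleftrightarrow> w \<otimes> x \<otimes> inv w \<in> Par (J \<union> J')"
    proof (rule conj_parabolic_iff)
      fix k assume k: "k \<in> K \<union> K'"
      hence kc: "s k \<in> W" using K K' by auto
      show "w \<otimes> s k \<otimes> inv w \<in> Par (J \<union> J')"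
        using k mono K(2)[OF kc] K'(2)[OF kc] parabolic_simple by blast
    next
      fix j assume j: "j \<in> J \<union> J'"
      hence jc: "s j \<in> W" using J by auto
      hence c: "inv w \<otimes> s j \<otimes> w \<in> W" "w \<otimes> (inv w \<otimes> s j \<otimes> w) \<otimes> inv w = s j"
        using assms by (simp_all add: m_assoc)
      show "inv w \<otimes> s j \<otimes> w \<in> Par (K \<union> K')"
        using j mono K(2)[OF c(1)] K'(2)[OF c(1)] parabolic_simple unfolding c(2) by blast
    qed (use J K K' x assms in auto)
  qed (use J K K' assms in auto)
qed

lemma length_one_simple: "x \<in> W \<Longrightarrow> len x = 1 \<Longrightarrow> \<exists>i\<in>I. x = s i"
proof -
  assume x: "x \<in> W" "len x = 1"
  then obtain xs where xs: "reduced x xs" using reduced_word_exists by blast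
  then obtain i where "xs = [i]" using x by (cases xs) (auto simp: reduced_word_def)
  thus ?thesis using xs by (auto simp: reduced_word_def)
qed

text \<open>A left block seen from the minimal representative v: each simple reflection of J is
  carried by v to a simple reflection. As w is no longer mentioned, one such v serves all elements h
  v with h in \<open>Par J\<close> at once.\<close>

definition block_rep :: "'i set \<Rightarrow> 'a \<Rightarrow> bool" where
  "block_rep J v \<longleftrightarrow> J \<subseteq> I \<and> v \<in> W \<and> left_minimal J v \<and> (\<forall>j\<in>J. \<exists>k\<in>I. s j \<otimes> v = v \<otimes> s k)"

text \<open>Conjugation by w and by v differ by an element of \<open>Par J\<close>, so v conjugates
  W_K onto W_J too, and K contains no right descent of v. For j in J the element k = v^-1 s_j v of
  W_K satisfies len (v k) = len v + len k, while len (s_j v) = len v + 1; hence k has length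
  one.\<close>

lemma left_block_block_rep:
  assumes "left_block G I s w J" "w \<in> W"
  shows "block_rep J (mrep J w)"
proof -
  define v where "v = mrep J w"
  obtain K where K: "K \<subseteq> I" "\<And>x. x \<in> W \<Longrightarrow> x \<in> Par K \<longleftrightarrow> w \<otimes> x \<otimes> inv w \<in> Par J"
    using left_blockD(2)[OF assms] by blast
  have J: "J \<subseteq> I" using assms by (simp add: left_block_def)
  have v: "v \<in> W" "w \<otimes> inv v \<in> Par J" "inversions v \<inter> Par J = {}"
    using min_rep_mem[OF J assms(2)] by (auto simp: v_def)
  have min: "left_minimal J v" using left_minimal_min_rep[OF J assms(2)] by (simp add: v_def)
  have conj: "x \<in> Par K \<longleftrightarrow> v \<otimes> x \<otimes> inv v \<in> Par J" if x: "x \<in> W" for x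
  proof -
    have "v \<otimes> x \<otimes> inv v = inv (w \<otimes> inv v) \<otimes> (w \<otimes> x \<otimes> inv w) \<otimes> (w \<otimes> inv v)"
      using x v assms by (simp add: inv_mult_group m_assoc)
    moreover have "w \<otimes> x \<otimes> inv w = (w \<otimes> inv v) \<otimes> (v \<otimes> x \<otimes> inv v) \<otimes> inv (w \<otimes> inv v)"
      using x v assms by (simp add: inv_mult_group m_assoc)
    ultimately show ?thesis
      using K(2)[OF x] parabolic_mult parabolic_inv[OF J v(2)] v(2) by metis
  qed
  have KD: "K \<inter> D v = {}"
  proof -
    have "k \<notin> D v" if k: "k \<in> K" for k
    proof -
      have kc: "k \<in> I" "s k \<in> W" using k K by auto
      have "v \<otimes> s k \<otimes> inv v \<in> Par J" using conj[OF kc(2)] parabolic_simple[OF k] by blast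
      thus ?thesis using v kc descent_iff_inversion(1)[of k v] by blast
    qed
    thus ?thesis by blast
  qed
  have "\<exists>k\<in>I. s j \<otimes> v = v \<otimes> s k" if j: "j \<in> J" for j
  proof -
    have jc: "j \<in> I" "s j \<in> W" using j J by auto
    define k where "k = inv v \<otimes> s j \<otimes> v"
    have k: "k \<in> W" "v \<otimes> k = s j \<otimes> v" "v \<otimes> k \<otimes> inv v = s j"
      using jc v by (simp_all add: k_def m_assoc)
    hence "k \<in> Par K" using conj[of k] parabolic_simple[OF j] by simp
    hence "len (s j \<otimes> v) = len v + len k" using right_minimal_mult[OF K(1) _ v(1) KD, of k] k by simp
    moreover have "len (s j \<otimes> v) = Suc (len v)"
      using inversion_iff_len(2)[of j v] min j jc v by (simp add: left_minimal_def)
    ultimately obtain i where "i \<in> I" "k = s i" using length_one_simple[OF k(1)] by auto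
    thus ?thesis using k by metis
  qed
  thus ?thesis using J v min unfolding block_rep_def v_def by blast
qed

lemma block_rep_left_block:
  assumes "block_rep J v" "h \<in> Par J"
  shows "left_block G I s (h \<otimes> v) J" "mrep J (h \<otimes> v) = v" "h \<in> W"
proof -
  have J: "J \<subseteq> I" and v: "v \<in> W" "left_minimal J v" and ex: "\<forall>j\<in>J. \<exists>k\<in>I. s j \<otimes> v = v \<otimes> s k"
    using assms by (auto simp: block_rep_def)
  show h: "h \<in> W" using parabolic_closed J assms by blast
  show "mrep J (h \<otimes> v) = v" using min_rep_unique J assms v by blast
  obtain \<kappa> where \<kappa>: "\<And>j. j \<in> J \<Longrightarrow> \<kappa> j \<in> I" "\<And>j. j \<in> J \<Longrightarrow> s j \<otimes> v = v \<otimes> s (\<kappa> j)"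
    using bchoice[OF ex[unfolded Bex_def]] by blast
  have conj: "x \<in> Par (\<kappa> ` J) \<longleftrightarrow> v \<otimes> x \<otimes> inv v \<in> Par J" if x: "x \<in> W" for x
  proof (rule conj_parabolic_iff)
    fix k assume "k \<in> \<kappa> ` J"
    then obtain j where j: "j \<in> J" "k = \<kappa> j" by blast
    hence "v \<otimes> s k \<otimes> inv v = s j" using \<kappa>(2)[of j] J v by (simp flip: \<kappa>(2)[of j]) (simp add: m_assoc subset_iff)
    thus "v \<otimes> s k \<otimes> inv v \<in> Par J" using parabolic_simple j by simp
  next
    fix j assume j: "j \<in> J"
    have "inv v \<otimes> s j \<otimes> v = s (\<kappa> j)"
    proof -
      have "inv v \<otimes> s j \<otimes> v = inv v \<otimes> (v \<otimes> s (\<kappa> j))" using \<kappa>(2)[OF j] j J v by (simp add: m_assoc subset_iff)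
      thus ?thesis using \<kappa>(1)[OF j] v by simp
    qed
    thus "inv v \<otimes> s j \<otimes> v \<in> Par (\<kappa> ` J)" using parabolic_simple j by simp
  qed (use J v x \<kappa> in auto)
  show "left_block G I s (h \<otimes> v) J"
  proof (rule left_blockI[of J "\<kappa> ` J"])
    fix x assume x: "x \<in> W"
    have 1: "(h \<otimes> v) \<otimes> x \<otimes> inv (h \<otimes> v) = h \<otimes> (v \<otimes> x \<otimes> inv v) \<otimes> inv h"
      using h v x by (simp add: inv_mult_group m_assoc)
    have 2: "v \<otimes> x \<otimes> inv v = inv h \<otimes> ((h \<otimes> v) \<otimes> x \<otimes> inv (h \<otimes> v)) \<otimes> h"
      using h v x by (simp add: inv_mult_group m_assoc)
    show "x \<in> Par (\<kappa> ` J) \<longleftrightarrow> (h \<otimes> v) \<otimes> x \<otimes> inv (h \<otimes> v) \<in> Par J"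
      unfolding conj[OF x] using 1 2 parabolic_mult parabolic_inv[OF J assms(2)] assms(2) by metis
  qed (use J v h \<kappa> in auto)
qed

text \<open>Both s_j v and v s_k arise from v by one new inversion, namely s_j. Comparing the two
  descriptions shows that conjugation by s_j preserves the inversions of v, and words in J give all
  of \<open>Par J\<close>.\<close>

lemma block_rep_inversions_conj:
  assumes "block_rep J v" "y \<in> Par J" "t \<in> W"
  shows "inv y \<otimes> t \<otimes> y \<in> inversions v \<longleftrightarrow> t \<in> inversions v"
proof -
  have J: "J \<subseteq> I" and v: "v \<in> W" "left_minimal J v" and ex: "\<forall>j\<in>J. \<exists>k\<in>I. s j \<otimes> v = v \<otimes> s k"
    using assms by (auto simp: block_rep_def)
  have step: "s j \<otimes> t \<otimes> s j \<in> inversions v \<longleftrightarrow> t \<in> inversions v" if j: "j \<in> J" and t: "t \<in> W" for j t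
  proof -
    have jI: "j \<in> I" using j J by blast
    obtain k where k: "k \<in> I" "s j \<otimes> v = v \<otimes> s k" using ex j by blast
    have r: "v \<otimes> s k \<otimes> inv v = s j" using jI k v by (simp flip: k(2)) (simp add: m_assoc)
    have nj: "s j \<notin> inversions v" using v j by (simp add: left_minimal_def)
    have "t \<in> inversions (s j \<otimes> v) \<longleftrightarrow> (t = s j) \<noteq> (s j \<otimes> t \<otimes> s j \<in> inversions v)"
      using mem_inversions_mult[of "s j" v t] jI v t by simp
    moreover have "t \<in> inversions (v \<otimes> s k) \<longleftrightarrow> (t \<in> inversions v) \<noteq> (t = s j)"
    proof -
      have "inv v \<otimes> t \<otimes> v = s k \<longleftrightarrow> t = v \<otimes> s k \<otimes> inv v"
      proof
        assume "inv v \<otimes> t \<otimes> v = s k"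
        hence "v \<otimes> s k \<otimes> inv v = v \<otimes> (inv v \<otimes> t \<otimes> v) \<otimes> inv v" by simp
        also have "\<dots> = t" using t v(1) by (simp add: m_assoc)
        finally show "t = v \<otimes> s k \<otimes> inv v" by simp
      qed (use k v in \<open>simp add: m_assoc\<close>)
      thus ?thesis using mem_inversions_mult[of v "s k" t] k v t r by simp
    qed
    moreover have "s j \<otimes> s j \<otimes> s j = s j" using jI by simp
    ultimately show ?thesis using k(2) nj by (cases "t = s j") auto
  qed
  obtain ys where ys: "ys \<in> lists J" "val ys = y" using parabolic_word[OF J assms(2)] by (auto simp: reduced_word_def)
  have "ys \<in> lists J \<Longrightarrow> t \<in> W \<Longrightarrow>
    inv (val ys) \<otimes> t \<otimes> val ys \<in> inversions v \<longleftrightarrow> t \<in> inversions v" for ys t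
  proof (induction ys arbitrary: t)
    case (Cons j ys)
    have j: "j \<in> J" "j \<in> I" "ys \<in> lists I" "ys \<in> lists J" using Cons.prems J by auto
    have "inv (val (j # ys)) \<otimes> t \<otimes> val (j # ys) = inv (val ys) \<otimes> (s j \<otimes> t \<otimes> s j) \<otimes> val ys"
      using j Cons.prems by (simp add: inv_mult_group m_assoc)
    thus ?case using Cons.IH[of "s j \<otimes> t \<otimes> s j"] j Cons.prems step[OF j(1)] by simp
  qed simp
  thus ?thesis using ys assms by blast
qed

text \<open>By the stability just shown, the inversions of h v are those of h, inside
  \<open>Par J\<close>, together with those of v, outside it. Thus the interval below h v is a
  product of the interval below h and the interval below v.\<close>

lemma block_rep_rle_iff:
  assumes "block_rep J v" "h \<in> Par J" "y \<in> Par J" "u \<in> W" "left_minimal J u"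
  shows "rle (y \<otimes> u) (h \<otimes> v) \<longleftrightarrow> rle y h \<and> rle u v"
proof -
  have J: "J \<subseteq> I" and v: "v \<in> W" "left_minimal J v"
    using assms by (auto simp: block_rep_def)
  have c: "h \<in> W" "y \<in> W" using assms parabolic_closed[OF J] by auto
  have vi: "inversions v \<inter> Par J = {}" and ui: "inversions u \<inter> Par J = {}"
    using left_minimal_iff[OF J] v assms by auto
  have hv: "t \<in> inversions (h \<otimes> v) \<longleftrightarrow> t \<in> inversions h \<or> t \<in> inversions v" if "t \<in> W" for t
    using inversions_mult_minimal(3)[OF J assms(2) v(1) vi that] block_rep_inversions_conj[OF assms(1,2) that] by simp
  have yu: "t \<in> inversions (y \<otimes> u) \<longleftrightarrow> t \<in> inversions y \<or> inv y \<otimes> t \<otimes> y \<in> inversions u" if "t \<in> W" for t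
    by (rule inversions_mult_minimal(3)[OF J assms(3,4) ui that])
  have hP: "inversions h \<subseteq> Par J" "inversions y \<subseteq> Par J" using inversions_parabolic[OF J] assms by auto
  show ?thesis
  proof
    assume r: "rle (y \<otimes> u) (h \<otimes> v)"
    have "t \<in> inversions h" if "t \<in> inversions y" for t
    proof -
      have t: "t \<in> W" using that inversions_closed by blast
      have "t \<in> inversions (h \<otimes> v)" using yu[OF t] that r by (auto simp: rle_def)
      thus ?thesis using hv[OF t] that hP vi by blast
    qed
    moreover have "t \<in> inversions v" if tu: "t \<in> inversions u" for t
    proof -
      have t: "t \<in> W" using tu inversions_closed by blast
      define t' where "t' = y \<otimes> t \<otimes> inv y"
      have t': "t' \<in> W" "inv y \<otimes> t' \<otimes> y = t" using t c by (simp_all add: t'_def m_assoc)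
      have "t' \<in> inversions (h \<otimes> v)" using yu[OF t'(1)] t'(2) tu r by (auto simp: rle_def)
      moreover have "t' \<notin> Par J"
      proof
        assume "t' \<in> Par J"
        hence "inv y \<otimes> t' \<otimes> y \<in> Par J"
          using parabolic_mult[OF parabolic_mult[OF parabolic_inv[OF J assms(3)]] assms(3)] by blast
        thus False using t' tu ui by auto
      qed
      ultimately have "t' \<in> inversions v" using hv[OF t'(1)] hP by blast
      thus ?thesis using block_rep_inversions_conj[OF assms(1,3) t'(1)] t'(2) by simp
    qed
    ultimately show "rle y h \<and> rle u v" by (auto simp: rle_def)
  next
    assume r: "rle y h \<and> rle u v"
    show "rle (y \<otimes> u) (h \<otimes> v)" unfolding rle_def
    proof
      fix t assume t: "t \<in> inversions (y \<otimes> u)"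
      hence tc: "t \<in> W" using inversions_closed by blast
      have "t \<in> inversions y \<or> inv y \<otimes> t \<otimes> y \<in> inversions v"
        using yu[OF tc] t r by (auto simp: rle_def)
      thus "t \<in> inversions (h \<otimes> v)"
        using hv[OF tc] block_rep_inversions_conj[OF assms(1,3) tc] r by (auto simp: rle_def)
    qed
  qed
qed

lemma block_rep_interval:
  assumes "block_rep J v" "h \<in> Par J" "u \<in> W"
  shows "rle u (h \<otimes> v) \<and> left_minimal J u \<longleftrightarrow> rle u v"
proof
  assume "rle u (h \<otimes> v) \<and> left_minimal J u"
  thus "rle u v" using block_rep_rle_iff[OF assms(1,2) parabolic_one, of u] assms by simp
next
  assume r: "rle u v"
  hence "left_minimal J u" using assms by (auto simp: block_rep_def left_minimal_def rle_def)
  thus "rle u (h \<otimes> v) \<and> left_minimal J u"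
    using block_rep_rle_iff[OF assms(1,2) parabolic_one, of u] assms r by simp
qed

text \<open>The simple reflections occurring in a reduced word. They are recorded as group elements since
  the injectivity of \<open>s\<close> is not available.\<close>

definition support :: "'a \<Rightarrow> 'a set" where
  "support w = s ` set (SOME xs. reduced w xs)"

text \<open>The first letter of w is an inversion of w and therefore lies in \<open>Par J\<close>.
  Its only inversion is itself, so the left descent that it must have in J is this letter. Removing
  it stays in \<open>Par J\<close>.\<close>

lemma reduced_word_parabolic:
  assumes "J \<subseteq> I" "reduced w xs" "w \<in> Par J"
  shows "s ` set xs \<subseteq> s ` J"
  using assms(2,3)
proof (induction xs arbitrary: w)
  case (Cons i xs)
  have i: "i \<in> I" "xs \<in> lists I" and w: "w = s i \<otimes> val xs" "w \<in> W"
    using Cons.prems(1) reduced_word_closed[OF Cons.prems(1)] by (auto simp: reduced_word_def)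
  have red: "reduced (val xs) xs" "len w = Suc (len (val xs))"
    using reduced_append[of "[i]" xs w] Cons.prems i by auto
  have siw: "s i \<otimes> w = val xs" using i w by simp
  have "s i \<in> inversions w" using inversion_iff_len(1)[OF i(1) w(2)] red siw by simp
  hence siJ: "s i \<in> Par J" using inversions_parabolic[OF assms(1) Cons.prems(2)] by blast
  have "s i \<noteq> \<one>" using i len_simple[of i] by fastforce
  then obtain j where "j \<in> J" "s j \<in> inversions (s i)" using parabolic_left_descent[OF assms(1) siJ] by blast
  hence "s i \<in> s ` J" using i by (simp add: image_iff) metis
  moreover have "val xs \<in> Par J" using siw siJ Cons.prems parabolic_mult[OF siJ] by metis
  ultimately show ?case using Cons.IH[OF red(1)] by auto
qed simp

lemma support_word:
  assumes "w \<in> W"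
  obtains xs where "reduced w xs" "support w = s ` set xs"
  using someI_ex[OF reduced_word_exists[OF assms]] that by (simp add: support_def)

lemma support_subset: 
  assumes "J \<subseteq> I" "w \<in> Par J" shows "support w \<subseteq> s ` J"
proof -
  have "w \<in> W" using parabolic_closed assms by blast
  then obtain xs where "reduced w xs" "support w = s ` set xs" using support_word by blast
  thus ?thesis using reduced_word_parabolic[OF assms(1) _ assms(2)] by simp
qed

lemma support_parabolic:
  assumes "w \<in> W" "support w \<subseteq> s ` J"
  shows "w \<in> Par J"
proof -
  obtain xs where xs: "reduced w xs" "support w = s ` set xs" using support_word assms by blast
  hence "w \<in> Par (set xs)" using val_parabolic[of xs "set xs"] by (auto simp: reduced_word_def)
  thus ?thesis using parabolic_mono xs assms by blast
qed

lemma support_eq_word: 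
  assumes "reduced w xs" shows "support w = s ` set xs"
proof
  have w: "w \<in> W" using assms reduced_word_closed by blast
  have I: "set xs \<subseteq> I" using assms by (auto simp: reduced_word_def)
  have "w \<in> Par (set xs)" using assms val_parabolic[of xs "set xs"] by (auto simp: reduced_word_def)
  thus "support w \<subseteq> s ` set xs" using support_subset[OF I] by blast
  obtain ys where ys: "reduced w ys" "support w = s ` set ys" using support_word w by blast
  hence "w \<in> Par (set ys)" "set ys \<subseteq> I" using val_parabolic[of ys "set ys"] by (auto simp: reduced_word_def)
  thus "s ` set xs \<subseteq> support w" using reduced_word_parabolic[OF _ assms] ys by simp
qed

lemma support_mult:
  assumes "x \<in> W" "y \<in> W" "len (x \<otimes> y) = len x + len y"
  shows "support (x \<otimes> y) = support x \<union> support y"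
proof -
  obtain xs ys where xs: "reduced x xs" "reduced y ys" using reduced_word_exists assms by meson
  from reduced_append_intro[OF this assms(3)] show ?thesis
    using support_eq_word xs by (auto simp: image_Un)
qed

text \<open>Let h be the factor of w in \<open>Par J\<close>. A smaller J' leaves the minimal
  representative unchanged precisely when h already lies in \<open>Par J'\<close>, so reducedness
  says that h uses every reflection of J. Two indices of J with the same reflection would allow one
  of them to be dropped, which is why injectivity appears.\<close>

lemma left_reduced_iff:
  assumes "J \<subseteq> I" "w \<in> W"
  shows "left_reduced G I s w J \<longleftrightarrow> inj_on s J \<and> s ` J \<subseteq> support (w \<otimes> inv (mrep J w))"
proof -
  define v h where "v = mrep J w" and "h = w \<otimes> inv v"
  have v: "v \<in> W" "h \<in> Par J" "inversions v \<inter> Par J = {}"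
    using min_rep_mem[OF assms] by (auto simp: v_def h_def)
  have hc: "h \<in> W" using v assms by (simp add: h_def)
  have w: "w = h \<otimes> v" using v assms by (simp add: h_def m_assoc)
  have *: "left_le G I s v (mrep J' w) \<and> v \<noteq> mrep J' w \<longleftrightarrow> h \<notin> Par J'" if "J' \<subset> J" for J'
  proof -
    have J': "J' \<subseteq> I" using that assms by auto
    define v' h' where "v' = mrep J' w" and "h' = w \<otimes> inv v'"
    have v': "v' \<in> W" "h' \<in> Par J'" "inversions v' \<inter> Par J' = {}"
      using min_rep_mem[OF J' assms(2)] by (auto simp: v'_def h'_def)
    have h'c: "h' \<in> W" using v' assms by (simp add: h'_def)
    have w': "w = h' \<otimes> v'" using v' assms by (simp add: h'_def m_assoc)
    have PJ: "h' \<in> Par J" using v' that parabolic_mono[of J' J] by blast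
    define r where "r = inv h' \<otimes> h"
    have r: "r \<in> Par J" "r \<in> W" "v' = r \<otimes> v"
      using parabolic_mult[OF parabolic_inv[OF assms(1) PJ] v(2)] h'c hc v v' w w'
      by (auto simp: r_def m_assoc) (metis cancel_left(2) m_assoc)
    have "lle v v'" using r lle_mult[OF r(2) v(1)] inversions_mult_minimal(1)[OF assms(1) r(1) v(1,3)] by simp
    moreover have "h \<in> Par J' \<Longrightarrow> v = v'"
    proof -
      assume hJ: "h \<in> Par J'"
      have "Par J' \<subseteq> Par J" using that parabolic_mono[of J' J] by blast
      hence "left_minimal J' v" using left_minimal_iff[OF J' v(1)] v by blast
      thus "v = v'" using min_rep_unique[OF J' hJ v(1)] w by (simp add: v'_def)
    qed
    moreover have "v = v' \<Longrightarrow> h \<in> Par J'" using v' by (simp add: h_def h'_def)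
    ultimately show ?thesis using v v' left_le_iff by (auto simp: v'_def)
  qed
  have "left_reduced G I s w J \<longleftrightarrow> (\<forall>J'. J' \<subset> J \<longrightarrow> h \<notin> Par J')"
    unfolding left_reduced_def v_def[symmetric] using * by blast
  also have "\<dots> \<longleftrightarrow> inj_on s J \<and> s ` J \<subseteq> support h"
  proof (intro iffI conjI)
    assume min: "\<forall>J'. J' \<subset> J \<longrightarrow> h \<notin> Par J'"
    show "inj_on s J"
    proof (rule inj_onI, rule ccontr)
      fix i j assume ij: "i \<in> J" "j \<in> J" "s i = s j" "i \<noteq> j"
      have "s l \<in> s ` (J - {i})" if "l \<in> J" for l
        using that ij by (cases "l = i") (simp_all add: ij(3))
      hence "s ` J \<subseteq> s ` (J - {i})" by blast
      hence "h \<in> Par (J - {i})" using parabolic_mono v by blast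
      moreover have "J - {i} \<subset> J" using ij by blast
      ultimately show False using min by blast
    qed
    show "s ` J \<subseteq> support h"
    proof (rule ccontr)
      assume n: "\<not> s ` J \<subseteq> support h"
      have "support h \<subseteq> s ` {j \<in> J. s j \<in> support h}" using support_subset[OF assms(1) v(2)] by blast
      hence "h \<in> Par {j \<in> J. s j \<in> support h}" by (rule support_parabolic[OF hc])
      moreover have "{j \<in> J. s j \<in> support h} \<subset> J" using n by blast
      ultimately show False using min by blast
    qed
  next
    assume inj: "inj_on s J \<and> s ` J \<subseteq> support h"
    show "\<forall>J'. J' \<subset> J \<longrightarrow> h \<notin> Par J'"
    proof (intro allI impI notI)
      fix J' assume J': "J' \<subset> J" "h \<in> Par J'"
      hence "s ` J \<subseteq> s ` J'" using inj support_subset[of J' h] assms by blast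
      moreover obtain j where j: "j \<in> J" "j \<notin> J'" using J' by blast
      ultimately obtain j' where "j' \<in> J'" "s j = s j'" by blast
      moreover from this have "j = j'" using inj_onD[of s J j j'] inj j J' by blast
      ultimately show False using j by simp
    qed
  qed
  finally show ?thesis by (simp add: h_def v_def)
qed

section \<open>Unions, inverses and extensions of reduced left blocks\<close>

abbreviation "RB \<equiv> reduced_left_block G I s"

text \<open>The factor \<open>w_J\<close> in the decomposition of w along the coset of W_J.\<close>

definition top_part :: "'i set \<Rightarrow> 'a \<Rightarrow> 'a" where
  "top_part J w = w \<otimes> inv (mrep J w)"

lemma top_part:
  assumes "J \<subseteq> I" "w \<in> W"
  shows "top_part J w \<in> Par J" "top_part J w \<in> W" "w = top_part J w \<otimes> mrep J w"
    "len w = len (top_part J w) + len (mrep J w)" "inversions (top_part J w) = inversions w \<inter> Par J"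
proof -
  note m = min_rep_mem[OF assms]
  show 1: "top_part J w \<in> Par J" using m by (simp add: top_part_def)
  show "top_part J w \<in> W" using m assms by (simp add: top_part_def)
  show w: "w = top_part J w \<otimes> mrep J w" using m assms by (simp add: top_part_def m_assoc)
  show "len w = len (top_part J w) + len (mrep J w)" "inversions (top_part J w) = inversions w \<inter> Par J"
    using inversions_mult_minimal(1,2)[OF assms(1) 1 m(1,3)] w by simp_all
qed

lemma top_part_unique:
  assumes "J \<subseteq> I" "h \<in> Par J" "v \<in> W" "left_minimal J v"
  shows "top_part J (h \<otimes> v) = h"
proof -
  have "h \<in> W" using assms parabolic_closed by blast
  thus ?thesis using min_rep_unique[OF assms] assms by (simp add: top_part_def m_assoc)
qed

lemma RB_iff:
  assumes "w \<in> W"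
  shows "RB w J \<longleftrightarrow> left_block G I s w J \<and> inj_on s J \<and> s ` J \<subseteq> support (top_part J w)"
  using left_reduced_iff[OF _ assms, of J] by (auto simp: reduced_left_block_def left_block_def top_part_def)

lemma RB_subset: "RB w J \<Longrightarrow> J \<subseteq> I"
  by (simp add: reduced_left_block_def left_block_def)

lemma RB_block_rep: "RB w J \<Longrightarrow> w \<in> W \<Longrightarrow> block_rep J (mrep J w)"
  by (simp add: reduced_left_block_def left_block_block_rep)

lemma left_minimal_cong: "s ` J = s ` J' \<Longrightarrow> left_minimal J u = left_minimal J' u"
proof -
  have "left_minimal J u \<longleftrightarrow> s ` J \<inter> inversions u = {}" for J by (auto simp: left_minimal_def)
  thus "s ` J = s ` J' \<Longrightarrow> ?thesis" by simp
qed

lemma support_mono: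
  assumes "u \<in> W" "w \<in> W" "rle u w"
  shows "support u \<subseteq> support w"
  using support_mult[of u "inv u \<otimes> w"] assms rle_iff_len[of u w] by auto

lemma support_one [simp]: "support \<one> = {}"
  using support_subset[of "{}" \<one>] by simp

lemma support_inv: "w \<in> W \<Longrightarrow> support (inv w) = support w"
proof -
  have *: "support (inv w) \<subseteq> support w" if w: "w \<in> W" for w
  proof -
    obtain xs where xs: "reduced w xs" "support w = s ` set xs" using support_word w by blast
    hence "w \<in> Par (set xs)" "set xs \<subseteq> I" using val_parabolic[of xs "set xs"] by (auto simp: reduced_word_def)
    thus ?thesis using support_subset[of "set xs" "inv w"] parabolic_inv[of "set xs" w] xs by simp
  qed
  assume "w \<in> W"
  thus ?thesis using *[of w] *[of "inv w"] by auto
qed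

text \<open>Two index sets may name the same reflection by different indices. Adding only those
  indices of K whose reflection is new keeps \<open>s\<close> injective without changing the
  parabolic subgroup of the union.\<close>

lemma image_Un_extend: "s ` (J \<union> {k \<in> K. s k \<notin> s ` J}) = s ` (J \<union> K)"
  by blast

lemma inj_on_extend: "inj_on s J \<Longrightarrow> inj_on s K \<Longrightarrow> inj_on s (J \<union> {k \<in> K. s k \<notin> s ` J})"
proof -
  let ?K = "{k \<in> K. s k \<notin> s ` J}"
  assume "inj_on s J" "inj_on s K"
  moreover from this(2) have "inj_on s ?K" by (rule inj_on_subset) blast
  moreover have "s ` (J - ?K) \<inter> s ` (?K - J) = {}"
  proof -
    have "s ` (J - ?K) \<subseteq> s ` J" "s ` (?K - J) \<inter> s ` J = {}" by blast+
    thus ?thesis by blast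
  qed
  ultimately show ?thesis by (simp add: inj_on_Un)
qed

text \<open>The inversions of \<open>top_part J w\<close> are the inversions of w in
  \<open>Par J\<close>. Enlarging the block therefore enlarges this factor in the right order, and
  its support covers both J and J'.\<close>

lemma RB_Un:
  assumes "RB w J" "RB w J'" "w \<in> W"
  shows "\<exists>L. RB w L \<and> s ` L = s ` (J \<union> J')"
proof (intro exI conjI)
  let ?L = "J \<union> {k \<in> J'. s k \<notin> s ` J}"
  show img: "s ` ?L = s ` (J \<union> J')" by (rule image_Un_extend)
  have J: "J \<subseteq> I" "J' \<subseteq> I" using RB_subset assms by auto
  hence L: "?L \<subseteq> I" by blast
  have "left_block G I s w (J \<union> J')"
    using assms left_block_Un by (simp add: reduced_left_block_def)
  hence "left_block G I s w ?L" using left_block_cong L img by metis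
  moreover have "inj_on s ?L" using inj_on_extend assms RB_iff by blast
  moreover have "s ` A \<subseteq> support (top_part ?L w)" if A: "RB w A" "A = J \<or> A = J'" for A
  proof -
    have AI: "A \<subseteq> I" using A J by blast
    have "s ` A \<subseteq> s ` ?L" using img A(2) by blast
    hence "Par A \<subseteq> Par ?L" using parabolic_mono by blast
    hence "rle (top_part A w) (top_part ?L w)"
      unfolding rle_def top_part(5)[OF AI assms(3)] top_part(5)[OF L assms(3)] by blast
    hence "support (top_part A w) \<subseteq> support (top_part ?L w)"
      using support_mono[OF top_part(2)[OF AI assms(3)] top_part(2)[OF L assms(3)]] by blast
    thus ?thesis using A(1) RB_iff[OF assms(3)] by blast
  qed
  ultimately show "RB w ?L" using RB_iff[OF assms(3), of ?L] img assms(1,2) by blast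
qed

text \<open>By \<open>RB_Un\<close> the reduced left blocks for which u is minimal form a directed
  family, so one with the largest number of reflections contains the reflections of all the
  others.\<close>

lemma maximal_RB:
  assumes "RB w J" "left_minimal J u" "w \<in> W"
  shows "\<exists>L. RB w L \<and> left_minimal L u \<and> (\<forall>J'. RB w J' \<longrightarrow> left_minimal J' u \<longrightarrow> s ` J' \<subseteq> s ` L)"
proof -
  let ?X = "{J. RB w J \<and> left_minimal J u}"
  have fin: "finite (s ` A)" if "A \<subseteq> I" for A using that finite_index finite_subset by blast
  have "\<forall>J'. J' \<in> ?X \<longrightarrow> card (s ` J') < Suc (card (s ` I))"
    using fin[of I] RB_subset by (auto simp: less_Suc_eq_le intro!: card_mono)
  moreover have "J \<in> ?X" using assms by simp
  ultimately obtain L where L: "L \<in> ?X" "\<And>J'. J' \<in> ?X \<Longrightarrow> card (s ` J') \<le> card (s ` L)"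
    using ex_has_greatest_nat[of "\<lambda>J. J \<in> ?X" J "\<lambda>J. card (s ` J)" "Suc (card (s ` I))"] by blast
  have "s ` J' \<subseteq> s ` L" if J': "RB w J'" "left_minimal J' u" for J'
  proof -
    obtain L' where L': "RB w L'" "s ` L' = s ` (L \<union> J')" using RB_Un L J' assms by blast
    have "left_minimal (L \<union> J') u" using L J' by (auto simp: left_minimal_def)
    hence "L' \<in> ?X" using L' left_minimal_cong by blast
    hence "card (s ` (L \<union> J')) \<le> card (s ` L)" using L L' by metis
    moreover have "finite (s ` (L \<union> J'))"
      using fin[of "L \<union> J'"] RB_subset[of w L] RB_subset[OF J'(1)] L by blast
    ultimately have "s ` L = s ` (L \<union> J')" by (intro card_seteq) auto
    thus ?thesis by blast
  qed
  thus ?thesis using L by blast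
qed

lemma block_rep_conj_word:
  assumes "block_rep J v"
  shows "\<exists>\<kappa>. (\<forall>j\<in>J. \<kappa> j \<in> I \<and> s j \<otimes> v = v \<otimes> s (\<kappa> j)) \<and>
    (\<forall>xs\<in>lists J. val xs \<otimes> v = v \<otimes> val (map \<kappa> xs))"
proof -
  have J: "J \<subseteq> I" and v: "v \<in> W" and ex: "\<forall>j\<in>J. \<exists>k. k \<in> I \<and> s j \<otimes> v = v \<otimes> s k"
    using assms by (auto simp: block_rep_def)
  obtain \<kappa> where \<kappa>: "\<And>j. j \<in> J \<Longrightarrow> \<kappa> j \<in> I" "\<And>j. j \<in> J \<Longrightarrow> s j \<otimes> v = v \<otimes> s (\<kappa> j)"
    using bchoice[OF ex] by blast
  have "xs \<in> lists J \<Longrightarrow> val xs \<otimes> v = v \<otimes> val (map \<kappa> xs)" for xs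
  proof (induction xs)
    case (Cons j xs)
    have j: "j \<in> J" "j \<in> I" "\<kappa> j \<in> I" "xs \<in> lists J" "xs \<in> lists I" "map \<kappa> xs \<in> lists I"
      using Cons.prems J \<kappa>(1) by auto
    have "val (j # xs) \<otimes> v = s j \<otimes> (v \<otimes> val (map \<kappa> xs))"
      using Cons.IH[OF j(4)] j v by (simp add: m_assoc)
    also have "\<dots> = (s j \<otimes> v) \<otimes> val (map \<kappa> xs)" using j v by (simp add: m_assoc)
    also have "\<dots> = v \<otimes> val (map \<kappa> (j # xs))" unfolding \<kappa>(2)[OF j(1)] using j v by (simp add: m_assoc)
    finally show ?case .
  qed (use v in simp)
  thus ?thesis using \<kappa> by blast
qed

text \<open>Let K collect the indices i with s_j v = v s_i for j in J. Then w = h v = v k with k in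
  W_K of the same length as h, so \<open>inv w\<close> has the minimal representative
  \<open>inv v\<close> and the factor \<open>inv k\<close>. The clause on reflections is what
  transports antisymmetry to the dual module.\<close>

lemma RB_inverse:
  assumes "RB w J" "w \<in> W"
  shows "\<exists>K. RB (inv w) K \<and> (J \<noteq> {} \<longrightarrow> K \<noteq> {}) \<and>
    (\<forall>t\<in>parabolic_reflections G s K. w \<otimes> t \<otimes> inv w \<in> parabolic_reflections G s J)"
proof -
  define v h where "v = mrep J w" and "h = top_part J w"
  have rep: "block_rep J v" using RB_block_rep[OF assms] by (simp add: v_def)
  have J: "J \<subseteq> I" "v \<in> W" "left_minimal J v" using rep by (auto simp: block_rep_def)
  have h: "h \<in> Par J" "h \<in> W" "w = h \<otimes> v" "len w = len h + len v"
    using top_part[OF J(1) assms(2)] by (simp_all add: h_def v_def)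
  obtain \<kappa> where \<kappa>: "\<And>j. j \<in> J \<Longrightarrow> \<kappa> j \<in> I" "\<And>j. j \<in> J \<Longrightarrow> s j \<otimes> v = v \<otimes> s (\<kappa> j)"
    and \<kappa>w: "\<And>xs. xs \<in> lists J \<Longrightarrow> val xs \<otimes> v = v \<otimes> val (map \<kappa> xs)"
    using block_rep_conj_word[OF rep] by blast
  let ?K = "\<kappa> ` J"
  have K: "?K \<subseteq> I" using \<kappa> by blast
  have desc: "\<kappa> j \<notin> D v" if j: "j \<in> J" for j
  proof -
    have "len (v \<otimes> s (\<kappa> j)) = Suc (len v)"
      using inversion_iff_len(2)[of j v] j J by (auto simp: left_minimal_def simp flip: \<kappa>(2))
    thus ?thesis using descent_iff_len by simp
  qed
  hence KD: "?K \<inter> D v = {}" by blast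
  obtain xs where xs: "xs \<in> lists J" "reduced h xs" using parabolic_word[OF J(1) h(1)] by blast
  define k where "k = val (map \<kappa> xs)"
  have mapK: "map \<kappa> xs \<in> lists ?K" using xs by auto
  hence mapI: "map \<kappa> xs \<in> lists I" using K lists_mono[of ?K I] by blast
  have k: "k \<in> Par ?K" "k \<in> W" "h \<otimes> v = v \<otimes> k"
    using val_parabolic[OF mapK] val_closed[OF mapI] \<kappa>w[OF xs(1)] xs(2) by (auto simp: k_def reduced_word_def)
  have "len k = len h" using right_minimal_mult[OF K k(1) J(2) KD] k(3) h by simp
  hence red_k: "reduced k (map \<kappa> xs)" using mapI xs by (auto simp: reduced_word_def k_def)
  have repK: "block_rep ?K (inv v)"
    unfolding block_rep_def
  proof (intro conjI ballI)
    show "left_minimal ?K (inv v)" unfolding left_minimal_def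
      using desc descent_iff_inversion(2)[of _ v] \<kappa>(1) J(2) by auto
    fix i assume "i \<in> ?K"
    then obtain j where j: "j \<in> J" "i = \<kappa> j" by blast
    have jI: "j \<in> I" using j J by blast
    have "s i \<otimes> inv v = inv v \<otimes> (v \<otimes> s i) \<otimes> inv v" using \<kappa>(1)[OF j(1)] j J by (simp add: m_assoc)
    also have "v \<otimes> s i = s j \<otimes> v" using \<kappa>(2)[OF j(1)] j by simp
    finally have "s i \<otimes> inv v = inv v \<otimes> s j" using jI J by (simp add: m_assoc)
    thus "\<exists>j\<in>I. s i \<otimes> inv v = inv v \<otimes> s j" using jI by blast
  qed (use K J in auto)
  have ik: "inv k \<in> Par ?K" "inv k \<in> W" using parabolic_inv[OF K k(1)] k by auto
  have iw: "inv w = inv k \<otimes> inv v" using h k J by (metis inv_mult_group)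
  have blk: "left_block G I s (inv w) ?K" and mr: "mrep ?K (inv w) = inv v"
    using block_rep_left_block[OF repK ik(1)] iw by simp_all
  have tp: "top_part ?K (inv w) = inv k" using mr iw ik J by (simp add: top_part_def m_assoc)
  have inj: "inj_on s J" "s ` J \<subseteq> support h" using assms RB_iff h_def by auto
  have "inj_on s ?K"
  proof (rule inj_onI)
    fix a b assume "a \<in> ?K" "b \<in> ?K" "s a = s b"
    then obtain i j where ij: "i \<in> J" "j \<in> J" "a = \<kappa> i" "b = \<kappa> j" "s (\<kappa> i) = s (\<kappa> j)" by blast
    have "s i \<otimes> v = s j \<otimes> v" using \<kappa>(2) ij by metis
    hence "s i = s j" using right_cancel[of v "s i" "s j"] ij J s_closed by blast
    thus "a = b" using inj ij by (metis inj_onD)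
  qed
  moreover have "s ` ?K \<subseteq> support (inv k)"
  proof -
    have "J \<subseteq> set xs"
    proof
      fix j assume j: "j \<in> J"
      hence "s j \<in> s ` set xs" using inj(2) support_eq_word[OF xs(2)] by blast
      then obtain i where i: "i \<in> set xs" "s j = s i" by blast
      hence "i \<in> J" using xs(1) by auto
      thus "j \<in> set xs" using i j inj_onD[OF inj(1), of j i] by simp
    qed
    thus ?thesis unfolding support_inv[OF k(2)] support_eq_word[OF red_k] by auto
  qed
  ultimately have "RB (inv w) ?K" using RB_iff[of "inv w" ?K] blk tp assms by simp
  moreover have "w \<otimes> t \<otimes> inv w \<in> parabolic_reflections G s J" if t: "t \<in> parabolic_reflections G s ?K" for t
  proof -
    from t obtain x j where xj: "x \<in> Par ?K" "j \<in> J" "t = x \<otimes> s (\<kappa> j) \<otimes> inv x"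
      unfolding parabolic_reflections_def by blast
    have c: "x \<in> W" "s (\<kappa> j) \<in> W" "j \<in> I" using xj parabolic_closed[OF K] \<kappa> J by auto
    have conj: "v \<otimes> s (\<kappa> i) \<otimes> inv v = s i" if "i \<in> J" for i
      using that J by (simp flip: \<kappa>(2)[OF that]) (simp add: m_assoc subset_iff)
    have "v \<otimes> s i \<otimes> inv v \<in> Par J" if "i \<in> ?K" for i
      using that conj parabolic_simple by auto
    hence y: "h \<otimes> (v \<otimes> x \<otimes> inv v) \<in> Par J"
      using conj_parabolic_incl[OF K J(1,2) _ xj(1)] parabolic_mult[OF h(1)] by blast
    have "w \<otimes> t \<otimes> inv w = (h \<otimes> (v \<otimes> x \<otimes> inv v)) \<otimes> (v \<otimes> s (\<kappa> j) \<otimes> inv v) \<otimes> inv (h \<otimes> (v \<otimes> x \<otimes> inv v))"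
      using c h J xj by (simp add: m_assoc inv_mult_group)
    thus ?thesis unfolding conj[OF xj(2)] parabolic_reflections_def using y xj(2) by blast
  qed
  ultimately show ?thesis by blast
qed

text \<open>The first letter s_j of h is an inversion of h v = v k but not of v, so v^-1 s_j v is an
  inversion of k and lies in W_K. Lengths add in v W_K, hence it is a simple reflection, and
  deleting s_j leaves a factorization of the same kind. All letters of h are thus carried by v to
  simple reflections.\<close>

lemma block_from_factorizations:
  assumes "H \<subseteq> I" "K \<subseteq> I" "v \<in> W" "h \<in> Par H" "k \<in> Par K" "h \<otimes> v = v \<otimes> k"
    "left_minimal H v" "K \<inter> D v = {}" "h \<noteq> \<one>"
  shows "\<exists>J. J \<noteq> {} \<and> RB (h \<otimes> v) J \<and> left_minimal J v"
proof -
  have simple: "\<forall>j\<in>set xs. \<exists>i\<in>I. s j \<otimes> v = v \<otimes> s i"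
    if "xs \<in> lists H" "reduced h xs" "k \<in> Par K" "h \<otimes> v = v \<otimes> k" for xs h k
    using that
  proof (induction xs arbitrary: h k rule: list.induct)
    case (Cons j xs)
    have j: "j \<in> H" "j \<in> I" "xs \<in> lists H" "xs \<in> lists I" using Cons.prems assms(1) by auto
    have hc: "h \<in> W" using Cons.prems reduced_word_closed by blast
    have kc: "k \<in> W" using Cons.prems parabolic_closed[OF assms(2)] by blast
    have h: "h = s j \<otimes> val xs" using Cons.prems by (simp add: reduced_word_def)
    have red: "reduced (val xs) xs" "len h = Suc (len (val xs))"
      using reduced_append[of "[j]" xs h] Cons.prems j by auto
    have hP: "h \<in> Par H" using Cons.prems val_parabolic[of "j # xs" H] by (simp add: reduced_word_def)
    have nj: "s j \<notin> inversions v" using assms(7) j by (simp add: left_minimal_def)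
    have "s j \<in> inversions h" using inversion_iff_len(1)[OF j(2) hc] red h j by simp
    hence "s j \<in> inversions (v \<otimes> k)"
      using inversions_mult_minimal(3)[OF assms(1) hP assms(3), of "s j"] left_minimal_iff[OF assms(1,3)]
        assms(7) j Cons.prems(4) by auto
    hence "inv v \<otimes> s j \<otimes> v \<in> inversions k" using mem_inversions_mult[of v k "s j"] nj j kc assms(3) by simp
    hence rP: "inv v \<otimes> s j \<otimes> v \<in> Par K" using inversions_parabolic[OF assms(2) Cons.prems(3)] by blast
    define r where "r = inv v \<otimes> s j \<otimes> v"
    have r: "r \<in> W" "s j \<otimes> v = v \<otimes> r" using j assms(3) by (simp_all add: r_def m_assoc)
    have "len (s j \<otimes> v) = Suc (len v)" using inversion_iff_len(2)[OF j(2) assms(3)] nj by simp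
    hence "len r = 1" using right_minimal_mult[OF assms(2) rP assms(3,8)] r by (simp flip: r_def)
    hence ex: "\<exists>i\<in>I. s j \<otimes> v = v \<otimes> s i" using length_one_simple[OF r(1)] r(2) by auto
    have "val xs \<otimes> v = s j \<otimes> (h \<otimes> v)" using h j assms(3) by (simp add: m_assoc)
    also have "\<dots> = s j \<otimes> v \<otimes> k" unfolding Cons.prems(4) using j assms(3) kc by (simp add: m_assoc)
    also have "\<dots> = v \<otimes> (r \<otimes> k)" unfolding r(2) using assms(3) r(1) kc by (simp add: m_assoc)
    finally have "\<forall>j\<in>set xs. \<exists>i\<in>I. s j \<otimes> v = v \<otimes> s i"
      using Cons.IH[OF j(3) red(1), of "r \<otimes> k"] parabolic_mult[OF rP Cons.prems(3)] by (simp flip: r_def)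
    thus ?case using ex by simp
  qed simp
  obtain xs where xs: "xs \<in> lists H" "reduced h xs" using parabolic_word[OF assms(1,4)] by blast
  \<comment> \<open>One index is kept for every reflection occurring in h.\<close>
  obtain J where J: "J \<subseteq> set xs" "inj_on s J" "s ` set xs = s ` J"
    using subset_image_inj[of "s ` set xs" s "set xs"] by blast
  have JH: "J \<subseteq> H" using J xs by auto
  have lm: "left_minimal J v" using assms(7) JH by (auto simp: left_minimal_def)
  have rep: "block_rep J v" unfolding block_rep_def
    using simple[OF xs assms(5,6)] J(1) JH assms(1,3) lm by blast
  have sup: "support h = s ` J" using support_eq_word[OF xs(2)] J by simp
  have hc: "h \<in> W" using xs reduced_word_closed by blast
  have hJ: "h \<in> Par J" using support_parabolic[OF hc] sup by simp
  have "top_part J (h \<otimes> v) = h" using top_part_unique[OF _ hJ assms(3) lm] JH assms(1) by blast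
  hence "RB (h \<otimes> v) J"
    using RB_iff[of "h \<otimes> v" J] block_rep_left_block(1)[OF rep hJ] J(2) sup hc assms(3) by simp
  moreover have "J \<noteq> {}"
  proof
    assume "J = {}"
    hence "xs = []" using J(3) by simp
    thus False using xs(2) assms(9) by (simp add: reduced_word_def)
  qed
  ultimately show ?thesis using lm by blast
qed

text \<open>A reduced block K of v = \<open>mrep J w\<close> is lifted to w by joining it with J,
  which is a block of v as well. Every nonempty reduced block of v thus accounts for a strictly
  larger one of w.\<close>

lemma RB_extend:
  assumes "w \<in> W" "RB w J" "RB (mrep J w) K" "K \<noteq> {}"
  shows "\<exists>L. RB w L \<and> J \<subset> L \<and> s ` L = s ` (J \<union> K) \<and> mrep L w = mrep K (mrep J w)"
proof -
  define v h where "v = mrep J w" and "h = top_part J w"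
  have rep: "block_rep J v" using RB_block_rep assms by (simp add: v_def)
  have J: "J \<subseteq> I" "v \<in> W" "left_minimal J v" using rep by (auto simp: block_rep_def)
  have h: "h \<in> Par J" "h \<in> W" "w = h \<otimes> v" "len w = len h + len v"
    using top_part[OF J(1) assms(1)] by (simp_all add: h_def v_def)
  have RK: "RB v K" using assms by (simp add: v_def)
  have K: "K \<subseteq> I" using RB_subset RK by blast
  define q k where "q = mrep K v" and "k = top_part K v"
  have repK: "block_rep K q" using RB_block_rep RK J by (simp add: q_def)
  have k: "k \<in> Par K" "k \<in> W" "v = k \<otimes> q" "len v = len k + len q"
    using top_part[OF K J(2)] by (simp_all add: k_def q_def)
  have blkJ: "left_block G I s v J" using block_rep_left_block(1)[OF rep parabolic_one] J by simp
  have blkK: "left_block G I s v K" using RK by (simp add: reduced_left_block_def)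
  have blk0: "left_block G I s v (J \<union> K)" by (rule left_block_Un[OF blkJ blkK J(2)])
  define L where "L = J \<union> {k \<in> K. s k \<notin> s ` J}"
  have img: "s ` L = s ` (J \<union> K)" unfolding L_def by (rule image_Un_extend)
  have LI: "L \<subseteq> I" using J K by (auto simp: L_def)
  have blkL: "left_block G I s v L" by (rule left_block_cong[OF blk0 LI img])
  define q' where "q' = mrep L v"
  have repL: "block_rep L q'" using left_block_block_rep[OF blkL J(2)] by (simp add: q'_def)
  have lmL: "left_minimal L u \<longleftrightarrow> left_minimal J u \<and> left_minimal K u" for u
    unfolding left_minimal_cong[OF img] by (auto simp: left_minimal_def)
  note tpL = top_part[OF LI J(2), folded q'_def]
  have qc: "q \<in> W" "q' \<in> W" using repK repL by (auto simp: block_rep_def)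
  \<comment> \<open>The minimal representatives for K and for L are compared through the intervals
    below them: everything below v is minimal for J, so there minimality for K and for L
    agree.\<close>
  have "rle u q \<longleftrightarrow> rle u q'" if u: "u \<in> W" for u
  proof -
    have "rle u q \<longleftrightarrow> rle u v \<and> left_minimal K u" using block_rep_interval[OF repK k(1) u] k(3) by simp
    also have "\<dots> \<longleftrightarrow> rle u v \<and> left_minimal L u"
      using lmL[of u] J(3) by (auto simp: left_minimal_def rle_def)
    also have "\<dots> \<longleftrightarrow> rle u q'" using block_rep_interval[OF repL tpL(1) u] tpL(3) by simp
    finally show ?thesis .
  qed
  hence "rle q q'" "rle q' q" using qc rle_refl by blast+
  hence qq: "q' = q" using rle_len_eq qc rle_len by metis
  have hkL: "h \<otimes> k \<in> Par L"
    using parabolic_mono[OF _ h(1), of L] parabolic_mono[OF _ k(1), of L] parabolic_mult img by blast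
  have w: "w = (h \<otimes> k) \<otimes> q" using h k qc by (simp add: m_assoc)
  have blkwL: "left_block G I s w L" and mrL: "mrep L w = q"
    using block_rep_left_block[OF repL hkL] qq w by simp_all
  have tpw: "top_part L w = h \<otimes> k" using mrL w qc h k by (simp add: top_part_def m_assoc)
  have len_hk: "len (h \<otimes> k) = len h + len k"
    using top_part(4)[OF LI assms(1)] tpw mrL h k by simp
  have "s ` J \<subseteq> support h" "inj_on s J" "s ` K \<subseteq> support k" "inj_on s K"
    using assms(2) RK RB_iff[OF assms(1)] RB_iff[OF J(2)] by (auto simp: h_def k_def)
  hence "RB w L" unfolding RB_iff[OF assms(1)] tpw support_mult[OF h(2) k(2) len_hk]
    using blkwL img inj_on_extend[of J K] unfolding L_def by blast
  \<comment> \<open>If nothing were added, k would be a nontrivial element of \<open>Par J\<close>,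
    and its left descent in J would be an inversion of v.\<close>
  moreover have "J \<noteq> L"
  proof
    assume "J = L"
    hence "s ` K \<subseteq> s ` J" using img by blast
    hence kJ: "k \<in> Par J" using parabolic_mono k(1) by blast
    have "k \<noteq> \<one>" using \<open>s ` K \<subseteq> support k\<close> assms(4) by auto
    then obtain j where j: "j \<in> J" "s j \<in> inversions k" using parabolic_left_descent[OF J(1) kJ] by blast
    have "inversions k \<subseteq> inversions v" using top_part(5)[OF K J(2)] by (simp add: k_def)
    thus False using j J(3) by (auto simp: left_minimal_def)
  qed
  ultimately show ?thesis using img mrL unfolding q_def v_def L_def by blast
qed

section \<open>The action on the group\<close>

abbreviation "HW \<equiv> lists (hecke_gens I)"

definition run :: "'i hecke_gen list \<Rightarrow> 'a \<Rightarrow> 'a" where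
  "run gs w = foldl (\<lambda>u g. gen_fun G I s g u) w gs"

lemma run_Nil [simp]: "run [] w = w" by (simp add: run_def)
lemma run_Cons [simp]: "run (g # gs) w = run gs (gen_fun G I s g w)" by (simp add: run_def)
lemma run_append [simp]: "run (gs @ hs) w = run hs (run gs w)" by (simp add: run_def)

lemma hecke_gens_cases:
  assumes "g \<in> hecke_gens I"
  obtains i where "i \<in> I" "g = Ascend i" | i where "i \<in> I" "g = Descend i"
  using assms by (auto simp: hecke_gens_def)

lemma gen_closed [simp]: "g \<in> hecke_gens I \<Longrightarrow> w \<in> W \<Longrightarrow> gen_fun G I s g w \<in> W"
  by (erule hecke_gens_cases) auto

lemma run_closed [simp]: "gs \<in> HW \<Longrightarrow> w \<in> W \<Longrightarrow> run gs w \<in> W"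
  by (induction gs arbitrary: w) auto

text \<open>If p and s_i p agree on whether j is a descent, a generator with index j treats them
  alike; otherwise s_i p = p s_j by \<open>descent_change\<close>, and the generator sends both to
  the same element.\<close>

lemma gen_left:
  assumes "i \<in> I" "p \<in> W" "g \<in> hecke_gens I"
  shows "gen_fun G I s g (s i \<otimes> p) = gen_fun G I s g p \<or>
    gen_fun G I s g (s i \<otimes> p) = s i \<otimes> gen_fun G I s g p"
proof -
  have "gen_fun G I s g (s i \<otimes> p) = gen_fun G I s g p \<or>
    gen_fun G I s g (s i \<otimes> p) = s i \<otimes> gen_fun G I s g p"
    if j: "j \<in> I" "g = Ascend j \<or> g = Descend j" for j
  proof (cases "j \<in> D (s i \<otimes> p) \<longleftrightarrow> j \<in> D p")
    case True
    thus ?thesis using j assms by (auto simp: m_assoc)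
  next
    case False
    hence "s i \<otimes> p = p \<otimes> s j" using descent_change[of i j p] j assms by blast
    moreover from this have "s i \<otimes> p \<otimes> s j = p" using j assms by (simp add: m_assoc)
    ultimately show ?thesis using False j by auto
  qed
  thus ?thesis using assms(3) by (elim hecke_gens_cases) auto
qed

lemma run_left:
  "gs \<in> HW \<Longrightarrow> i \<in> I \<Longrightarrow> p \<in> W \<Longrightarrow>
    run gs (s i \<otimes> p) = run gs p \<or> run gs (s i \<otimes> p) = s i \<otimes> run gs p"
proof (induction gs arbitrary: p rule: list.induct)
  case (Cons g gs)
  hence g: "g \<in> hecke_gens I" "gs \<in> HW" by auto
  from gen_left[OF Cons.prems(2,3) g(1)] show ?case
    using Cons.IH[OF g(2) Cons.prems(2), of "gen_fun G I s g p"] g Cons.prems by auto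
qed simp

text \<open>Passing from \<open>p\<close> to \<open>yp\<close> along a reduced word of \<open>y\<close>, some of the letters may collapse.\<close>

lemma run_ratio:
  assumes "gs \<in> HW" "y \<in> W" "p \<in> W"
  defines "r \<equiv> run gs (y \<otimes> p) \<otimes> inv (run gs p)"
  shows "r = y \<or> len r < len y"
proof -
  have "run gs (val xs \<otimes> p) \<otimes> inv (run gs p) = val xs \<or> len (run gs (val xs \<otimes> p) \<otimes> inv (run gs p)) < length xs"
    if "xs \<in> lists I" for xs
    using that
  proof (induction xs rule: list.induct)
    case Nil
    thus ?case using assms by simp
  next
    case (Cons i xs)
    hence i: "i \<in> I" "xs \<in> lists I" by auto
    let ?r = "run gs (val xs \<otimes> p) \<otimes> inv (run gs p)"
    have c: "run gs (val xs \<otimes> p) \<in> W" "run gs p \<in> W" "?r \<in> W" using i assms by simp_all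
    have IH: "?r = val xs \<or> len ?r < length xs" using Cons.IH i by blast
    hence le: "len ?r \<le> length xs" using len_val_le[OF i(2)] by auto
    have e: "val (i # xs) \<otimes> p = s i \<otimes> (val xs \<otimes> p)" using i assms by (simp add: m_assoc)
    show ?case
    proof (cases "run gs (s i \<otimes> (val xs \<otimes> p)) = run gs (val xs \<otimes> p)")
      case True
      thus ?thesis unfolding e using le by simp
    next
      case False
      hence "run gs (s i \<otimes> (val xs \<otimes> p)) = s i \<otimes> run gs (val xs \<otimes> p)"
        using run_left[OF assms(1) i(1), of "val xs \<otimes> p"] i assms by simp
      hence eq: "run gs (val (i # xs) \<otimes> p) \<otimes> inv (run gs p) = s i \<otimes> ?r"
        unfolding e using c i by (simp add: m_assoc)
      show ?thesis unfolding eq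
        using IH len_mult_le[of "s i" ?r] c i by auto
    qed
  qed
  moreover obtain xs where "reduced y xs" using reduced_word_exists assms by blast
  ultimately show ?thesis unfolding r_def reduced_word_def by metis
qed

lemma gen_lle:
  assumes "i \<in> I" "p \<in> W" "g \<in> hecke_gens I" "s i \<notin> inversions p"
  shows "lle (gen_fun G I s g p) (gen_fun G I s g (s i \<otimes> p))"
proof (cases "gen_fun G I s g (s i \<otimes> p) = gen_fun G I s g p")
  case False
  hence e: "gen_fun G I s g (s i \<otimes> p) = s i \<otimes> gen_fun G I s g p" using gen_left assms by blast
  have l: "len (s i \<otimes> p) = Suc (len p)" using inversion_iff_len(2) assms by simp
  have "len (s i \<otimes> gen_fun G I s g p) = Suc (len (gen_fun G I s g p))"
    if j: "j \<in> I" "g = Ascend j \<or> g = Descend j" for j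
  proof (cases "j \<in> D (s i \<otimes> p) \<longleftrightarrow> j \<in> D p")
    case True
    hence "len (s i \<otimes> p \<otimes> s j) = Suc (len (p \<otimes> s j))"
      using l len_mult_s[OF j(1), of p] len_mult_s[OF j(1), of "s i \<otimes> p"] assms j
      by (cases "j \<in> D p") auto
    thus ?thesis using l j assms by (auto simp: m_assoc)
  next
    case ne: False
    hence "s i \<otimes> p = p \<otimes> s j" using descent_change[of i j p] j assms by blast
    moreover from this have "s i \<otimes> p \<otimes> s j = p" using j assms by (simp add: m_assoc)
    ultimately show ?thesis using False ne j by auto
  qed
  hence "len (s i \<otimes> gen_fun G I s g p) = Suc (len (gen_fun G I s g p))"
    using assms(3) by (elim hecke_gens_cases) auto
  thus ?thesis unfolding e using lle_mult[of "s i" "gen_fun G I s g p"] assms by simp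
qed simp

text \<open>Along a chain of covers from p to q, each generator either keeps a cover or collapses it
  (\<open>gen_lle\<close>). So the monoid acts by maps preserving the left order.\<close>

lemma run_lle:
  assumes "gs \<in> HW" "p \<in> W" "q \<in> W" "lle p q"
  shows "lle (run gs p) (run gs q)"
proof -
  have gen: "lle (gen_fun G I s g p) (gen_fun G I s g q)"
    if pq: "p \<in> W" "q \<in> W" "lle p q" and g: "g \<in> hecke_gens I" for p q g
  proof -
    have "lle (gen_fun G I s g p) (gen_fun G I s g (val xs \<otimes> p))"
      if "xs \<in> lists I" "len (val xs \<otimes> p) = length xs + len p" for xs
      using that
    proof (induction xs rule: list.induct)
      case Nil
      thus ?case using pq by simp
    next
      case (Cons i xs)
      hence i: "i \<in> I" "xs \<in> lists I" by auto
      have e: "val (i # xs) \<otimes> p = s i \<otimes> (val xs \<otimes> p)" using i pq by (simp add: m_assoc)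
      have "len (val xs \<otimes> p) \<le> length xs + len p"
        using len_mult_le[of "val xs" p] len_val_le[OF i(2)] i pq by simp
      moreover have "len (s i \<otimes> (val xs \<otimes> p)) \<le> Suc (len (val xs \<otimes> p))"
        using len_mult_le[of "s i" "val xs \<otimes> p"] i pq by simp
      ultimately have l: "len (val xs \<otimes> p) = length xs + len p"
        "\<not> len (s i \<otimes> (val xs \<otimes> p)) < len (val xs \<otimes> p)"
        using Cons.prems(2) unfolding e by auto
      have "s i \<notin> inversions (val xs \<otimes> p)" using inversion_iff_len(1)[OF i(1), of "val xs \<otimes> p"] l i pq by simp
      from gen_lle[OF i(1) _ g this] show ?case unfolding e
        using lle_trans[OF Cons.IH[OF i(2) l(1)]] i pq by simp
    qed
    moreover obtain xs where "reduced (q \<otimes> inv p) xs" using reduced_word_exists pq by (meson inv_closed m_closed)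
    moreover have "q \<otimes> inv p \<otimes> p = q" using pq by (simp add: m_assoc)
    ultimately show ?thesis using pq(3) lle_iff_len[OF pq(1,2)] unfolding reduced_word_def by metis
  qed
  show ?thesis using assms
  proof (induction gs arbitrary: p q rule: list.induct)
    case (Cons g gs)
    thus ?case using gen[of p q g] by auto
  qed simp
qed

section \<open>Ascending and descending along a reduced word\<close>

definition up :: "'i list \<Rightarrow> 'i hecke_gen list" where "up xs = map Ascend xs"
text \<open>The letters are reversed so that \<open>down xs\<close> retraces the steps of
  \<open>up xs\<close> wherever each of them was a genuine ascent.\<close>

definition down :: "'i list \<Rightarrow> 'i hecke_gen list" where "down xs = map Descend (rev xs)"

lemma up_down_words [simp]: "xs \<in> lists I \<Longrightarrow> up xs \<in> HW" "xs \<in> lists I \<Longrightarrow> down xs \<in> HW"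
  by (auto simp: up_def down_def hecke_gens_def)

lemma up_simps [simp]: "up [] = []" "up (xs @ ys) = up xs @ up ys" "up (i # xs) = Ascend i # up xs"
  and down_simps [simp]: "down [] = []" "down (xs @ ys) = down ys @ down xs" "down (i # xs) = down xs @ [Descend i]"
  by (auto simp: up_def down_def)

lemma up_down_val:
  "xs \<in> lists I \<Longrightarrow> a \<in> W \<Longrightarrow> len (a \<otimes> val xs) = len a + length xs \<Longrightarrow>
    run (up xs) a = a \<otimes> val xs \<and> run (down xs) (a \<otimes> val xs) = a"
proof (induction xs arbitrary: a rule: list.induct)
  case (Cons i xs)
  have i: "i \<in> I" "xs \<in> lists I" using Cons.prems by auto
  have e: "a \<otimes> val (i # xs) = a \<otimes> s i \<otimes> val xs" using i Cons.prems by (simp add: m_assoc)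
  have "len (a \<otimes> s i \<otimes> val xs) \<le> len (a \<otimes> s i) + length xs"
    using len_mult_le[of "a \<otimes> s i" "val xs"] len_val_le[OF i(2)] i Cons.prems by simp
  moreover have "len (a \<otimes> s i) \<le> Suc (len a)" using len_mult_le[of a "s i"] i Cons.prems by simp
  ultimately have l: "len (a \<otimes> s i) = Suc (len a)" "len (a \<otimes> s i \<otimes> val xs) = len (a \<otimes> s i) + length xs"
    using Cons.prems(3) unfolding e by auto
  hence "i \<notin> D a" by (simp add: descent_iff_len)
  moreover from this have "i \<in> D (a \<otimes> s i)" using descent_mult_s i Cons.prems by simp
  ultimately show ?case using Cons.IH[OF i(2) _ l(2)] i Cons.prems unfolding e by (auto simp: m_assoc)
qed simp

context
  fixes z :: 'a and zs :: "'i list"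
  assumes red: "reduced z zs"
begin

lemma red_word: "zs \<in> lists I" "z \<in> W" "val zs = z" "length zs = len z"
  using red reduced_word_closed[OF red] by (auto simp: reduced_word_def)

lemma run_up: "a \<in> W \<Longrightarrow> len (a \<otimes> z) = len a + len z \<Longrightarrow> run (up zs) a = a \<otimes> z"
  and run_down: "a \<in> W \<Longrightarrow> len (a \<otimes> z) = len a + len z \<Longrightarrow> run (down zs) (a \<otimes> z) = a"
  using up_down_val[OF red_word(1)] red_word by auto

lemma run_up_one: "run (up zs) \<one> = z"
  using run_up[of \<one>] red_word by simp

lemma run_up_lle: "y \<in> W \<Longrightarrow> lle z (run (up zs) y)"
  using run_lle[of "up zs" \<one> y] red_word run_up_one by simp

lemma run_down_longest: "run (down zs) longest = longest \<otimes> inv z"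
proof -
  have "longest \<otimes> inv z \<otimes> z = longest" using red_word by (simp add: m_assoc)
  thus ?thesis using run_down[of "longest \<otimes> inv z"] len_longest_mult[of "inv z"] red_word by simp
qed

text \<open>The longest element is sent to its product with \<open>inv z\<close>. As the left order
  is preserved, the whole image of \<open>down zs\<close> lies below this product, and below it are
  only elements p with len (p z) = len p + len z.\<close>

lemma run_down_image: 
  assumes "y \<in> W"
  shows "len (run (down zs) y \<otimes> z) = len (run (down zs) y) + len z"
proof -
  let ?p = "run (down zs) y"
  have p: "?p \<in> W" using red_word assms by simp
  have "lle ?p (longest \<otimes> inv z)"
    using run_lle[of "down zs" y longest] lle_longest[OF assms] red_word assms run_down_longest by simp
  hence "len (longest \<otimes> inv z) = len (longest \<otimes> inv z \<otimes> inv ?p) + len ?p"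
    using lle_iff_len[OF p, of "longest \<otimes> inv z"] red_word by simp
  moreover have "longest \<otimes> inv z \<otimes> inv ?p = longest \<otimes> inv (?p \<otimes> z)"
    using p red_word by (simp add: inv_mult_group m_assoc)
  ultimately show ?thesis
    using len_longest_mult[of "inv z"] len_longest_mult[of "inv (?p \<otimes> z)"] p red_word by simp
qed

text \<open>On the image of \<open>down zs\<close> all ascents along zs are genuine, so
  \<open>up zs\<close> followed by \<open>down zs\<close> is the identity there. With
  \<open>run_up_down_up\<close> the two words become generalized inverses of each other, and their
  composites are idempotents.\<close>

lemma run_down_up_down: "y \<in> W \<Longrightarrow> run (down zs @ up zs @ down zs) y = run (down zs) y"
  using run_down_image[of y] run_up[of "run (down zs) y"] run_down[of "run (down zs) y"] red_word by simp

lemma run_down_lle: "q \<in> W \<Longrightarrow> lle z q \<Longrightarrow> run (down zs) q = q \<otimes> inv z"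
  using run_down[of "q \<otimes> inv z"] lle_iff_len[of z q] red_word by (simp add: m_assoc)

lemma run_up_lle_id: "q \<in> W \<Longrightarrow> lle z q \<Longrightarrow> run (down zs @ up zs) q = q"
  using run_down_lle[of q] run_up[of "q \<otimes> inv z"] lle_iff_len[of z q] red_word by (simp add: m_assoc)

lemma run_up_down_up: "y \<in> W \<Longrightarrow> run (up zs @ down zs @ up zs) y = run (up zs) y"
  using run_up_lle[of y] run_up_lle_id[of "run (up zs) y"] red_word by simp

lemma run_up_descent: 
  assumes "y \<in> W" "i \<in> D z"
  shows "i \<in> D (run (up zs) y)"
  using descent_iff_inversion(2)[OF descent_index[OF assms(2)]] assms run_up_lle[OF assms(1)] red_word
  by (auto simp: lle_def)

end

section \<open>Translation by \<open>co w\<close>\<close>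

lemma len_mult_longest: "x \<in> W \<Longrightarrow> len (x \<otimes> longest) + len x = len longest"
proof -
  assume x: "x \<in> W"
  have "len (longest \<otimes> longest) = 0" using len_longest_mult[of longest] by simp
  hence "longest \<otimes> longest = \<one>" using len_zero_iff by simp
  hence "inv longest = longest" using inv_equality by simp
  hence "inv (x \<otimes> longest) = longest \<otimes> inv x" using x by (simp add: inv_mult_group)
  thus ?thesis using len_longest_mult[of "inv x"] len_inv[of "x \<otimes> longest"] x by simp
qed

text \<open>The factor x of the translation. By \<open>interval_iff_co\<close>, an element u lies in
  \<open>B w\<close> precisely when the lengths of \<open>co w\<close> and u add in their
  product.\<close>

definition co :: "'a \<Rightarrow> 'a" where "co w = longest \<otimes> inv w"

lemma co_closed [simp]: "w \<in> W \<Longrightarrow> co w \<in> W"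
  by (simp add: co_def)

lemma len_co: "w \<in> W \<Longrightarrow> len (co w) + len w = len longest"
  using len_longest_mult[of "inv w"] by (simp add: co_def)

abbreviation "B \<equiv> right_interval G I s"

lemma interval_iff: "w \<in> W \<Longrightarrow> u \<in> B w \<longleftrightarrow> u \<in> W \<and> rle u w"
  by (auto simp: right_interval_def right_le_iff)

lemma interval_closed: "u \<in> B w \<Longrightarrow> u \<in> W"
  by (simp add: right_interval_def)

lemma finite_interval [simp]: "finite (B w)"
  using finite_subset[OF _ finite_carrier, of "B w"] interval_closed by blast

lemma interval_iff_co:
  assumes "w \<in> W" "u \<in> W"
  shows "u \<in> B w \<longleftrightarrow> len (co w \<otimes> u) = len (co w) + len u"
proof -
  have 1: "len (inv u \<otimes> w) = len (inv w \<otimes> u)"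
    using len_inv[of "inv u \<otimes> w"] assms by (simp add: inv_mult_group)
  have 2: "co w \<otimes> u = longest \<otimes> (inv w \<otimes> u)" using assms by (simp add: co_def m_assoc)
  show ?thesis
    using interval_iff[OF assms(1), of u] rle_iff_len[OF assms(2,1)] len_longest_mult[of "inv w \<otimes> u"]
      len_co[OF assms(1)] assms 1 unfolding 2 by auto
qed

text \<open>Elements \<open>gs\<close> of the monoid with \<open>1.gs = u\<close> and \<open>w\<^sub>0.gs = x u\<close> factor through
  the idempotent \<open>up ws @ down ws\<close> attached to \<open>w = x\<inverse> w\<^sub>0\<close>.\<close>

lemma run_factor:
  assumes "gs \<in> HW" "u = run gs \<one>" "x = run gs longest \<otimes> inv u" "w = inv x \<otimes> longest"
    "reduced u us" "reduced w ws" "y \<in> W"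
  shows "run (gs @ down us @ (up ws @ down ws) @ up us) y = run gs y"
proof -
  have u: "u \<in> W" and x: "x \<in> W" and w: "w \<in> W" using assms by auto
  define p where "p = run gs y"
  have p: "p \<in> W" using assms by (simp add: p_def)
  have top: "run gs longest = x \<otimes> u" using assms u x by (simp add: m_assoc)
  have up: "lle u p" using run_lle[of gs \<one> y] assms by (simp add: p_def)
  have pt: "lle p (x \<otimes> u)" 
    using run_lle[OF assms(1,7) longest_closed lle_longest[OF assms(7)]] unfolding top p_def .
  \<comment> \<open>The value p lies between u and x u in the left order, so a lies below x. As w is
    the product of \<open>inv x\<close> and \<open>longest\<close>, the lengths of a and w add in a
    w, and the idempotent attached to w fixes a.\<close>
  define a where "a = p \<otimes> inv u"
  have a: "a \<in> W" "p = a \<otimes> u" "len p = len a + len u"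
    using up lle_iff_len[OF u p] u p by (simp_all add: a_def m_assoc)
  have xu: "len (x \<otimes> u) = len x + len u" using lle_trans[OF up pt] lle_mult[OF x u] by simp
  have "len (x \<otimes> u) = len (x \<otimes> u \<otimes> inv p) + len p" using pt lle_iff_len[OF p] x u by simp
  moreover have "x \<otimes> u \<otimes> inv p = x \<otimes> inv a" using a x u by (simp add: inv_mult_group m_assoc)
  ultimately have xa: "len x = len (x \<otimes> inv a) + len a" using xu a by simp
  have aw: "a \<otimes> w = inv (x \<otimes> inv a) \<otimes> longest" using a x assms(4) by (simp add: inv_mult_group m_assoc)
  have "len (a \<otimes> w) = len a + len w"
    using len_mult_longest[of "inv (x \<otimes> inv a)"] len_mult_longest[of "inv x"] a x xa assms(4) unfolding aw by simp
  hence "run (up ws @ down ws) a = a" using run_up[OF assms(6) a(1)] run_down[OF assms(6) a(1)] by simp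
  moreover have "run (down us) p = a" using run_down[OF assms(5) a(1)] a by simp
  moreover have "run (up us) a = p" using run_up[OF assms(5) a(1)] a by simp
  ultimately show ?thesis by (simp flip: p_def)
qed

text \<open>The condition that gs translates \<open>co w\<close> past u. It involves only the
  function induced by gs, which will make the truncated action on vectors independent of the
  word.\<close>

definition ok :: "'a \<Rightarrow> 'i hecke_gen list \<Rightarrow> 'a \<Rightarrow> bool" where
  "ok w gs u \<longleftrightarrow> run gs (co w \<otimes> u) = co w \<otimes> run gs u"

lemma ok_Nil [simp]: "ok w [] u" by (simp add: ok_def)

text \<open>For u in \<open>B w\<close>, u lies below its translate in the left order. This relation
  is preserved by gs, and for the image it says again that lengths add.\<close>

lemma ok_interval:
  assumes "w \<in> W" "u \<in> B w" "gs \<in> HW" "ok w gs u"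
  shows "run gs u \<in> B w"
proof -
  have u: "u \<in> W" using assms interval_closed by blast
  have "lle u (co w \<otimes> u)" using interval_iff_co[OF assms(1) u] assms lle_mult[of "co w" u] u by simp
  hence "lle (run gs u) (run gs (co w \<otimes> u))" using run_lle assms u by simp
  hence "lle (run gs u) (co w \<otimes> run gs u)" using assms(4) by (simp add: ok_def)
  thus ?thesis using interval_iff_co[OF assms(1)] lle_mult[of "co w" "run gs u"] assms u by simp
qed

lemma not_ok_len:
  assumes "w \<in> W" "u \<in> W" "gs \<in> HW" "\<not> ok w gs u"
  shows "len (run gs (co w \<otimes> u) \<otimes> inv (run gs u)) < len (co w)"
proof -
  have "run gs (co w \<otimes> u) \<otimes> inv (run gs u) \<noteq> co w"
  proof
    assume "run gs (co w \<otimes> u) \<otimes> inv (run gs u) = co w"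
    hence "run gs (co w \<otimes> u) \<otimes> inv (run gs u) \<otimes> run gs u = co w \<otimes> run gs u" by simp
    thus False using assms by (simp add: ok_def m_assoc)
  qed
  thus ?thesis using run_ratio[OF assms(3) co_closed[OF assms(1)] assms(2)] by blast
qed

text \<open>Once translation fails, the ratio of the two values is shorter than \<open>co w\<close>,
  and by \<open>run_ratio\<close> it never grows again; later letters cannot repair a
  failure.\<close>

lemma ok_append:
  assumes "w \<in> W" "u \<in> W" "gs \<in> HW" "hs \<in> HW"
  shows "ok w (gs @ hs) u \<longleftrightarrow> ok w gs u \<and> ok w hs (run gs u)"
proof (cases "ok w gs u")
  case False
  let ?r = "run gs (co w \<otimes> u) \<otimes> inv (run gs u)"
  have r: "len ?r < len (co w)" "?r \<in> W" using not_ok_len[OF assms(1-3) False] assms by simp_all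
  have e: "run gs (co w \<otimes> u) = ?r \<otimes> run gs u" using assms by (simp add: m_assoc)
  have "len (run hs (?r \<otimes> run gs u) \<otimes> inv (run hs (run gs u))) \<le> len ?r"
    using run_ratio[OF assms(4) r(2), of "run gs u"] assms by auto
  hence "run hs (?r \<otimes> run gs u) \<otimes> inv (run hs (run gs u)) \<noteq> co w" using r by auto
  moreover have "co w \<otimes> run hs (run gs u) \<otimes> inv (run hs (run gs u)) = co w"
    using assms by (simp add: m_assoc)
  ultimately have "run hs (?r \<otimes> run gs u) \<noteq> co w \<otimes> run hs (run gs u)" by metis
  thus ?thesis using False e by (simp add: ok_def)
qed (simp add: ok_def)

lemma interval_descent:
  assumes "w \<in> W" "u \<in> B w" "i \<in> D u"
  shows "u \<otimes> s i \<in> B w" "i \<in> D (co w \<otimes> u)"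
proof -
  have i: "i \<in> I" and u: "u \<in> W" using assms interval_closed descent_index by blast+
  have l: "Suc (len (u \<otimes> s i)) = len u" using len_mult_s assms i u by blast
  have e: "len (co w \<otimes> u) = len (co w) + len u" using interval_iff_co assms u by blast
  have m: "co w \<otimes> u \<otimes> s i = co w \<otimes> (u \<otimes> s i)" using assms u i by (simp add: m_assoc)
  have "len (co w \<otimes> (u \<otimes> s i)) \<le> len (co w) + len (u \<otimes> s i)" using len_mult_le assms u i by simp
  thus d: "i \<in> D (co w \<otimes> u)" using l e m i by (simp add: descent_iff_len)
  have "Suc (len (co w \<otimes> u \<otimes> s i)) = len (co w \<otimes> u)" using len_mult_s(1)[OF i _ d] assms u by simp
  thus "u \<otimes> s i \<in> B w" using interval_iff_co[OF assms(1), of "u \<otimes> s i"] l e m u i by simp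
qed

lemma interval_ascent:
  assumes "w \<in> W" "u \<in> B w" "i \<in> I" "i \<notin> D u"
  shows "u \<otimes> s i \<in> B w \<longleftrightarrow> i \<notin> D (co w \<otimes> u)"
proof -
  have u: "u \<in> W" using assms interval_closed by blast
  have l: "len (u \<otimes> s i) = Suc (len u)" using len_mult_s assms u by blast
  have e: "len (co w \<otimes> u) = len (co w) + len u" using interval_iff_co assms u by blast
  have m: "co w \<otimes> u \<otimes> s i = co w \<otimes> (u \<otimes> s i)" using assms u by (simp add: m_assoc)
  show ?thesis
    using interval_iff_co[OF assms(1), of "u \<otimes> s i"] l e m u assms(1,3) len_mult_s[OF assms(3), of "co w \<otimes> u"]
    by (cases "i \<in> D (co w \<otimes> u)") auto
qed

text \<open>Matches failure of translation with the cases in which a generator acts by zero on the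
  translation module: an ascent leaves the interval exactly when i is already a descent of the
  translate of u.\<close>

lemma ok_gen:
  assumes "w \<in> W" "u \<in> B w" "i \<in> I"
  shows "ok w [Ascend i] u \<longleftrightarrow> i \<in> D u \<or> u \<otimes> s i \<in> B w"
    and "ok w [Descend i] u \<longleftrightarrow> i \<in> D u \<or> u \<otimes> s i \<in> B w"
proof -
  have u: "u \<in> W" using assms interval_closed by blast
  have ne: "co w \<otimes> u \<noteq> co w \<otimes> (u \<otimes> s i)"
  proof
    assume "co w \<otimes> u = co w \<otimes> (u \<otimes> s i)"
    hence "u = u \<otimes> s i" using u assms by simp
    thus False using len_mult_s[OF assms(3) u] by (cases "i \<in> D u") auto
  qed
  show "ok w [Ascend i] u \<longleftrightarrow> i \<in> D u \<or> u \<otimes> s i \<in> B w" "ok w [Descend i] u \<longleftrightarrow> i \<in> D u \<or> u \<otimes> s i \<in> B w"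
    using interval_descent[OF assms(1,2), of i] interval_ascent[OF assms] ne assms(1,3) u
    by (cases "i \<in> D u"; cases "i \<in> D (co w \<otimes> u)"; auto simp: ok_def m_assoc)+
qed

lemma reduced_word_rev:
  assumes "reduced z zs"
  shows "reduced (inv z) (rev zs)"
proof -
  have "val (rev xs) = inv (val xs)" if "xs \<in> lists I" for xs
    using that
  proof (induction xs rule: list.induct)
    case (Cons i xs)
    hence "i \<in> I" "xs \<in> lists I" "rev xs \<in> lists I" by auto
    thus ?case using Cons.IH by (simp add: val_append inv_mult_group)
  qed simp
  thus ?thesis using red_word[OF assms] reduced_word_iff[of "inv z" "rev zs"] by auto
qed

lemma interval_climb:
  assumes "w \<in> W" "a \<in> B w" "a \<noteq> w"
  shows "\<exists>i\<in>I. i \<notin> D a \<and> a \<otimes> s i \<in> B w"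
proof -
  have a: "a \<in> W" "len w = len a + len (inv a \<otimes> w)"
    using assms interval_iff[OF assms(1)] rle_iff_len by blast+
  let ?z = "inv a \<otimes> w"
  have z: "?z \<in> W" using a assms by simp
  obtain zs where zs: "reduced ?z zs" using reduced_word_exists[OF z] by blast
  note r = red_word[OF zs]
  have "?z \<noteq> \<one>"
  proof
    assume "?z = \<one>"
    hence "a \<otimes> ?z = a" using a by simp
    thus False using a assms by (simp add: m_assoc[symmetric])
  qed
  then obtain i xs where ix: "zs = i # xs" using r by (cases zs) auto
  have i: "i \<in> I" "xs \<in> lists I" using r(1) ix by auto
  have c: "a \<otimes> s i \<in> W" "val xs \<in> W" using a i by auto
  have "?z = s i \<otimes> val xs" using r(3) ix by simp
  hence "a \<otimes> (inv a \<otimes> w) = a \<otimes> (s i \<otimes> val xs)" by simp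
  hence w: "w = a \<otimes> s i \<otimes> val xs" using a assms i by (simp add: m_assoc)
  have "len w \<le> len (a \<otimes> s i) + len (val xs)" using len_mult_le[OF c] w by simp
  moreover have "len (val xs) \<le> length xs" "len ?z = Suc (length xs)" using len_val_le i r(4) ix by auto
  moreover have "len (a \<otimes> s i) \<le> Suc (len a)" using len_mult_le[OF a(1) s_closed[OF i(1)]] i by simp
  ultimately have l: "len (a \<otimes> s i) = Suc (len a)" "len w = len (a \<otimes> s i) + len (val xs)" using a(2) by linarith+
  have "rle (a \<otimes> s i) w" using rle_mult[OF c] l(2) w by simp
  thus ?thesis using i l(1) c interval_iff[OF assms(1)] by (intro bexI[of _ i]) (auto simp: descent_iff_len)
qed

lemma len_run_down:
  "xs \<in> lists I \<Longrightarrow> u \<in> W \<Longrightarrow> len u \<le> len (run (down xs) u) + length xs"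
proof (induction xs rule: list.induct)
  case (Cons i xs)
  hence i: "i \<in> I" "xs \<in> lists I" by auto
  let ?p = "run (down xs) u"
  have p: "?p \<in> W" using i Cons.prems by simp
  have "len ?p \<le> Suc (len (gen_fun G I s (Descend i) ?p))" using len_mult_s[OF i(1) p] by auto
  thus ?case using Cons i by simp
qed simp

text \<open>Descending along zs loses at most len z in length, and ascending from a value of
  \<open>down zs\<close> regains exactly len z.\<close>

lemma len_run_down_up:
  assumes "reduced z zs" "u \<in> W"
  shows "len u \<le> len (run (down zs @ up zs) u)"
proof -
  note r = red_word[OF assms(1)]
  let ?p = "run (down zs) u"
  have "run (up zs) ?p = ?p \<otimes> z" "len (?p \<otimes> z) = len ?p + len z"
    using run_up[OF assms(1), of ?p] run_down_image[OF assms] r assms by simp_all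
  thus ?thesis using len_run_down[OF r(1) assms(2)] r(4) by simp
qed

end

section \<open>Right modules\<close>

lemma (in abelian_group) minus_eq_zero_iff:
  "x \<in> carrier G \<Longrightarrow> y \<in> carrier G \<Longrightarrow> x \<ominus> y = \<zero> \<longleftrightarrow> x = y"
  by (metis a_inv_closed minus_eq minus_equality minus_minus r_neg)

text \<open>Every axiom of Q is checked on images of elements of V. This serves quotients as well as
  the transport of a module to another type.\<close>

lemma right_module_image:
  assumes V: "right_module K M V" and surj: "q ` carrier V = carrier Q"
    and add: "\<And>x y. x \<in> carrier V \<Longrightarrow> y \<in> carrier V \<Longrightarrow> q (x \<oplus>\<^bsub>V\<^esub> y) = q x \<oplus>\<^bsub>Q\<^esub> q y"
    and zero: "q \<zero>\<^bsub>V\<^esub> = \<zero>\<^bsub>Q\<^esub>"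
    and smult: "\<And>a x. a \<in> carrier K \<Longrightarrow> x \<in> carrier V \<Longrightarrow> q (a \<odot>\<^bsub>V\<^esub> x) = a \<odot>\<^bsub>Q\<^esub> q x"
    and ract: "\<And>x f. x \<in> carrier V \<Longrightarrow> f \<in> carrier M \<Longrightarrow> q (x \<cdot>\<^bsub>V\<^esub> f) = q x \<cdot>\<^bsub>Q\<^esub> f"
  shows "right_module K M Q"
proof -
  interpret V: right_module K M V by fact
  let ?Q = "q ` carrier V"
  have cr: "cring K" by unfold_locales
  have ab: "abelian_group Q"
  proof (rule abelian_groupI; unfold surj[symmetric])
    show "\<zero>\<^bsub>Q\<^esub> \<in> ?Q" by (simp flip: zero)
    fix x assume x: "x \<in> ?Q"
    thus "\<zero>\<^bsub>Q\<^esub> \<oplus>\<^bsub>Q\<^esub> x = x" by (elim imageE) (simp flip: add zero)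
    from x obtain x' where x': "x' \<in> carrier V" "x = q x'" by blast
    show "\<exists>y\<in>?Q. y \<oplus>\<^bsub>Q\<^esub> x = \<zero>\<^bsub>Q\<^esub>"
      using x' add[of "\<ominus>\<^bsub>V\<^esub> x'" x'] zero V.l_neg[of x'] by (intro bexI[of _ "q (\<ominus>\<^bsub>V\<^esub> x')"]) simp_all
    fix y assume y: "y \<in> ?Q"
    from x y show "x \<oplus>\<^bsub>Q\<^esub> y \<in> ?Q" by (elim imageE) (simp flip: add)
    from x y show "x \<oplus>\<^bsub>Q\<^esub> y = y \<oplus>\<^bsub>Q\<^esub> x" by (elim imageE) (simp add: V.a_comm flip: add)
    fix z assume "z \<in> ?Q"
    with x y show "x \<oplus>\<^bsub>Q\<^esub> y \<oplus>\<^bsub>Q\<^esub> z = x \<oplus>\<^bsub>Q\<^esub> (y \<oplus>\<^bsub>Q\<^esub> z)" by (elim imageE) (simp add: V.a_assoc flip: add)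
  qed
  have md: "module K Q"
  proof (rule moduleI[OF cr ab]; unfold surj[symmetric])
    fix a x assume x: "a \<in> carrier K" "x \<in> ?Q"
    thus "a \<odot>\<^bsub>Q\<^esub> x \<in> ?Q" by (elim imageE) (simp flip: smult)
    { fix b assume "b \<in> carrier K"
      with x show "(a \<oplus>\<^bsub>K\<^esub> b) \<odot>\<^bsub>Q\<^esub> x = a \<odot>\<^bsub>Q\<^esub> x \<oplus>\<^bsub>Q\<^esub> b \<odot>\<^bsub>Q\<^esub> x" "a \<otimes>\<^bsub>K\<^esub> b \<odot>\<^bsub>Q\<^esub> x = a \<odot>\<^bsub>Q\<^esub> (b \<odot>\<^bsub>Q\<^esub> x)"
        by (elim imageE; simp add: V.smult_l_distr V.smult_assoc1 flip: add smult)+ }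
    fix y assume "y \<in> ?Q"
    with x show "a \<odot>\<^bsub>Q\<^esub> (x \<oplus>\<^bsub>Q\<^esub> y) = a \<odot>\<^bsub>Q\<^esub> x \<oplus>\<^bsub>Q\<^esub> a \<odot>\<^bsub>Q\<^esub> y"
      by (elim imageE) (simp add: V.smult_r_distr flip: add smult)
  next
    fix x assume "x \<in> ?Q"
    thus "\<one>\<^bsub>K\<^esub> \<odot>\<^bsub>Q\<^esub> x = x" by (elim imageE) (simp flip: smult)
  qed
  show ?thesis
  proof (intro right_module.intro right_module_axioms.intro md V.M.monoid_axioms; unfold surj[symmetric])
    fix x assume x: "x \<in> ?Q"
    thus "x \<cdot>\<^bsub>Q\<^esub> \<one>\<^bsub>M\<^esub> = x" by (elim imageE) (simp add: V.ract_one flip: ract)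
    fix f assume f: "f \<in> carrier M"
    with x show "x \<cdot>\<^bsub>Q\<^esub> f \<in> ?Q" by (elim imageE) (simp add: V.ract_closed flip: ract)
    { fix g assume "g \<in> carrier M"
      with x f show "x \<cdot>\<^bsub>Q\<^esub> (f \<otimes>\<^bsub>M\<^esub> g) = x \<cdot>\<^bsub>Q\<^esub> f \<cdot>\<^bsub>Q\<^esub> g"
        by (elim imageE) (simp add: V.ract_mult V.ract_closed flip: ract) }
    { fix y assume "y \<in> ?Q"
      with x f show "(x \<oplus>\<^bsub>Q\<^esub> y) \<cdot>\<^bsub>Q\<^esub> f = x \<cdot>\<^bsub>Q\<^esub> f \<oplus>\<^bsub>Q\<^esub> y \<cdot>\<^bsub>Q\<^esub> f"
        by (elim imageE) (simp add: V.ract_add V.ract_closed flip: add ract) }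
    fix a assume "a \<in> carrier K"
    with x f show "a \<odot>\<^bsub>Q\<^esub> x \<cdot>\<^bsub>Q\<^esub> f = a \<odot>\<^bsub>Q\<^esub> (x \<cdot>\<^bsub>Q\<^esub> f)"
      by (elim imageE) (simp add: V.ract_smult V.ract_closed flip: smult ract)
  qed
qed

text \<open>Common ground of free modules and translation modules: coefficientwise operations on a
  set of functions closed under them.\<close>

lemma (in field) function_module:
  assumes sub: "carrier V \<subseteq> X \<rightarrow>\<^sub>E carrier R"
    and zero: "\<zero>\<^bsub>V\<^esub> = (\<lambda>p\<in>X. \<zero>)" "\<zero>\<^bsub>V\<^esub> \<in> carrier V"
    and add: "\<And>x y. x \<oplus>\<^bsub>V\<^esub> y = (\<lambda>p\<in>X. x p \<oplus> y p)"
      "\<And>x y. x \<in> carrier V \<Longrightarrow> y \<in> carrier V \<Longrightarrow> x \<oplus>\<^bsub>V\<^esub> y \<in> carrier V"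
    and smult: "\<And>a x. a \<odot>\<^bsub>V\<^esub> x = (\<lambda>p\<in>X. a \<otimes> x p)"
      "\<And>a x. a \<in> carrier R \<Longrightarrow> x \<in> carrier V \<Longrightarrow> a \<odot>\<^bsub>V\<^esub> x \<in> carrier V"
  shows "module R V"
proof -
  have v: "x p \<in> carrier R" if "x \<in> carrier V" "p \<in> X" for x p using that sub PiE_mem by blast
  have e: "x = restrict x X" if "x \<in> carrier V" for x using that sub PiE_restrict by fastforce
  note r = fun_eq_iff restrict_def
  have ab: "abelian_group V"
  proof (rule abelian_groupI)
    fix x assume x: "x \<in> carrier V"
    show "\<zero>\<^bsub>V\<^esub> \<oplus>\<^bsub>V\<^esub> x = x" using v[OF x] by (subst (2) e[OF x]) (auto simp: add zero(1) r)
    have "\<ominus> \<one> \<odot>\<^bsub>V\<^esub> x \<oplus>\<^bsub>V\<^esub> x = \<zero>\<^bsub>V\<^esub>" using v[OF x] by (auto simp: add(1) smult(1) zero(1) r l_minus l_neg)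
    thus "\<exists>y\<in>carrier V. y \<oplus>\<^bsub>V\<^esub> x = \<zero>\<^bsub>V\<^esub>" using smult(2)[OF _ x, of "\<ominus> \<one>"] by blast
    show "x \<oplus>\<^bsub>V\<^esub> y \<in> carrier V" if "y \<in> carrier V" for y by (rule add(2)[OF x that])
  qed (rule zero(2), auto simp: add(1) v r a_ac)
  show ?thesis
  proof (rule moduleI[OF is_cring ab])
    fix x assume x: "x \<in> carrier V"
    show "\<one> \<odot>\<^bsub>V\<^esub> x = x" using v[OF x] by (subst (2) e[OF x]) (auto simp: smult(1) r)
    show "a \<odot>\<^bsub>V\<^esub> x \<in> carrier V" if "a \<in> carrier R" for a by (rule smult(2)[OF that x])
  qed (auto simp: add(1) smult(1) v r l_distr r_distr m_assoc)
qed

context right_module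
begin

lemma zero_ract: "f \<in> carrier M \<Longrightarrow> \<zero>\<^bsub>V\<^esub> \<cdot>\<^bsub>V\<^esub> f = \<zero>\<^bsub>V\<^esub>"
  using ract_smult[of "\<zero>\<^bsub>K\<^esub>" "\<zero>\<^bsub>V\<^esub>" f] ract_closed[of "\<zero>\<^bsub>V\<^esub>" f] by simp

lemma neg_as_smult: "x \<in> carrier V \<Longrightarrow> \<ominus>\<^bsub>V\<^esub> x = (\<ominus>\<^bsub>K\<^esub> \<one>\<^bsub>K\<^esub>) \<odot>\<^bsub>V\<^esub> x"
  by (simp add: smult_l_minus)

end

lemma right_submoduleI:
  assumes "right_module K M V" "N \<subseteq> carrier V" "\<zero>\<^bsub>V\<^esub> \<in> N"
    "\<And>x y. x \<in> N \<Longrightarrow> y \<in> N \<Longrightarrow> x \<oplus>\<^bsub>V\<^esub> y \<in> N"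
    "\<And>a x. a \<in> carrier K \<Longrightarrow> x \<in> N \<Longrightarrow> a \<odot>\<^bsub>V\<^esub> x \<in> N"
    "\<And>x f. x \<in> N \<Longrightarrow> f \<in> carrier M \<Longrightarrow> x \<cdot>\<^bsub>V\<^esub> f \<in> N"
  shows "right_submodule K M V N"
proof -
  interpret V: right_module K M V by fact
  have "\<ominus>\<^bsub>V\<^esub> x \<in> N" if "x \<in> N" for x
    using assms(2,5) that by (metis V.neg_as_smult V.R.a_inv_closed V.R.one_closed subsetD)
  thus ?thesis unfolding right_submodule_def using assms by (auto intro!: V.submoduleI)
qed

lemma right_submoduleD:
  assumes "right_submodule K M V N" "right_module K M V"
  shows "N \<subseteq> carrier V" "\<zero>\<^bsub>V\<^esub> \<in> N"
    "\<And>x y. x \<in> N \<Longrightarrow> y \<in> N \<Longrightarrow> x \<oplus>\<^bsub>V\<^esub> y \<in> N"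
    "\<And>a x. a \<in> carrier K \<Longrightarrow> x \<in> N \<Longrightarrow> a \<odot>\<^bsub>V\<^esub> x \<in> N"
    "\<And>x f. x \<in> N \<Longrightarrow> f \<in> carrier M \<Longrightarrow> x \<cdot>\<^bsub>V\<^esub> f \<in> N"
    "\<And>x. x \<in> N \<Longrightarrow> \<ominus>\<^bsub>V\<^esub> x \<in> N" "\<And>x y. x \<in> N \<Longrightarrow> y \<in> N \<Longrightarrow> x \<ominus>\<^bsub>V\<^esub> y \<in> N"
proof -
  interpret V: right_module K M V by fact
  have sm: "submodule N K V" using assms by (simp add: right_submodule_def)
  note E = V.submoduleE[OF sm]
  show "N \<subseteq> carrier V" by (rule E(1))
  from E(2) obtain x where x: "x \<in> N" by blast
  show 5: "\<And>x y. x \<in> N \<Longrightarrow> y \<in> N \<Longrightarrow> x \<oplus>\<^bsub>V\<^esub> y \<in> N" and 6: "\<And>x. x \<in> N \<Longrightarrow> \<ominus>\<^bsub>V\<^esub> x \<in> N"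
    and "\<And>a x. a \<in> carrier K \<Longrightarrow> x \<in> N \<Longrightarrow> a \<odot>\<^bsub>V\<^esub> x \<in> N"
    by (rule E(5), assumption, assumption, rule E(3), assumption, rule E(4), assumption, assumption)
  show "\<And>x f. x \<in> N \<Longrightarrow> f \<in> carrier M \<Longrightarrow> x \<cdot>\<^bsub>V\<^esub> f \<in> N" using assms by (simp add: right_submodule_def)
  show "\<zero>\<^bsub>V\<^esub> \<in> N" using 5[OF 6[OF x] x] x E(1) V.l_neg by (metis subsetD)
  show "\<And>x y. x \<in> N \<Longrightarrow> y \<in> N \<Longrightarrow> x \<ominus>\<^bsub>V\<^esub> y \<in> N" using 5 6 by (simp add: a_minus_def)
qed

lemma right_submodule_carrier: "right_module K M V \<Longrightarrow> right_submodule K M V (carrier V)"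
proof -
  assume V: "right_module K M V"
  interpret V: right_module K M V by fact
  show ?thesis by (rule right_submoduleI[OF V]) (auto simp: V.ract_closed)
qed

lemma right_submodule_zero: "right_module K M V \<Longrightarrow> right_submodule K M V {\<zero>\<^bsub>V\<^esub>}"
proof -
  assume V: "right_module K M V"
  interpret V: right_module K M V by fact
  show ?thesis by (rule right_submoduleI[OF V]) (auto simp: V.zero_ract)
qed

lemma right_module_sub:
  assumes "right_module K M V" "right_submodule K M V N"
  shows "right_module K M (V\<lparr>carrier := N\<rparr>)"
proof -
  interpret V: right_module K M V by fact
  have "module K (V\<lparr>carrier := N\<rparr>)"
    using assms(2) submodule.submodule_is_module[OF _ V.module_axioms] by (simp add: right_submodule_def)
  moreover have "N \<subseteq> carrier V" by (rule right_submoduleD(1)[OF assms(2,1)])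
  ultimately show ?thesis
    using assms(2) by (intro right_module.intro right_module_axioms.intro V.M.monoid_axioms)
      (auto simp: right_submodule_def V.ract_add V.ract_smult V.ract_one V.ract_mult subset_iff)
qed

lemma rmodule_homI:
  assumes "\<And>x. x \<in> carrier V \<Longrightarrow> h x \<in> carrier W"
    "\<And>x y. x \<in> carrier V \<Longrightarrow> y \<in> carrier V \<Longrightarrow> h (x \<oplus>\<^bsub>V\<^esub> y) = h x \<oplus>\<^bsub>W\<^esub> h y"
    "\<And>a x. a \<in> carrier K \<Longrightarrow> x \<in> carrier V \<Longrightarrow> h (a \<odot>\<^bsub>V\<^esub> x) = a \<odot>\<^bsub>W\<^esub> h x"
    "\<And>x f. x \<in> carrier V \<Longrightarrow> f \<in> carrier M \<Longrightarrow> h (x \<cdot>\<^bsub>V\<^esub> f) = h x \<cdot>\<^bsub>W\<^esub> f"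
  shows "h \<in> rmodule_hom K M V W"
  using assms by (auto simp: rmodule_hom_def hom_def)

lemma rmodule_homD:
  assumes "h \<in> rmodule_hom K M V W"
  shows "\<And>x. x \<in> carrier V \<Longrightarrow> h x \<in> carrier W"
    "\<And>x y. x \<in> carrier V \<Longrightarrow> y \<in> carrier V \<Longrightarrow> h (x \<oplus>\<^bsub>V\<^esub> y) = h x \<oplus>\<^bsub>W\<^esub> h y"
    "\<And>a x. a \<in> carrier K \<Longrightarrow> x \<in> carrier V \<Longrightarrow> h (a \<odot>\<^bsub>V\<^esub> x) = a \<odot>\<^bsub>W\<^esub> h x"
    "\<And>x f. x \<in> carrier V \<Longrightarrow> f \<in> carrier M \<Longrightarrow> h (x \<cdot>\<^bsub>V\<^esub> f) = h x \<cdot>\<^bsub>W\<^esub> f"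
  using assms by (auto simp: rmodule_hom_def hom_def)

lemma rmodule_hom_zero:
  assumes "h \<in> rmodule_hom K M V W" "right_module K M V" "right_module K M W"
  shows "h \<zero>\<^bsub>V\<^esub> = \<zero>\<^bsub>W\<^esub>"
proof -
  interpret V: right_module K M V by fact
  interpret W: right_module K M W by fact
  note h = rmodule_homD[OF assms(1)]
  have "h (\<zero>\<^bsub>K\<^esub> \<odot>\<^bsub>V\<^esub> \<zero>\<^bsub>V\<^esub>) = \<zero>\<^bsub>K\<^esub> \<odot>\<^bsub>W\<^esub> h \<zero>\<^bsub>V\<^esub>" by (rule h(3)) auto
  thus ?thesis using h(1)[of "\<zero>\<^bsub>V\<^esub>"] by simp
qed

lemma rmodule_hom_neg:
  assumes "h \<in> rmodule_hom K M V W" "right_module K M V" "right_module K M W" "x \<in> carrier V"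
  shows "h (\<ominus>\<^bsub>V\<^esub> x) = \<ominus>\<^bsub>W\<^esub> h x"
proof -
  interpret V: right_module K M V by fact
  interpret W: right_module K M W by fact
  note h = rmodule_homD[OF assms(1)]
  show ?thesis using assms h by (simp add: V.neg_as_smult W.neg_as_smult)
qed

lemma rmodule_hom_minus:
  assumes "h \<in> rmodule_hom K M V W" "right_module K M V" "right_module K M W" "x \<in> carrier V" "y \<in> carrier V"
  shows "h (x \<ominus>\<^bsub>V\<^esub> y) = h x \<ominus>\<^bsub>W\<^esub> h y"
proof -
  interpret V: right_module K M V by fact
  show ?thesis using assms rmodule_hom_neg[OF assms(1-3)] rmodule_homD(2)[OF assms(1)] by (simp add: a_minus_def)
qed

lemma rmodule_hom_comp:
  "h \<in> rmodule_hom K M V W \<Longrightarrow> g \<in> rmodule_hom K M W U \<Longrightarrow> (\<lambda>x. g (h x)) \<in> rmodule_hom K M V U"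
  by (rule rmodule_homI) (auto simp: rmodule_homD)

lemma rmodule_hom_id: "(\<lambda>x. x) \<in> rmodule_hom K M V V"
  by (rule rmodule_homI) auto

lemma rmodule_hom_sub:
  "h \<in> rmodule_hom K M V W \<Longrightarrow> N \<subseteq> carrier V \<Longrightarrow> h \<in> rmodule_hom K M (V\<lparr>carrier := N\<rparr>) W"
  by (rule rmodule_homI) (simp_all add: rmodule_homD subset_iff)

lemma rmodule_hom_into_sub:
  "h \<in> rmodule_hom K M V W \<Longrightarrow> h ` carrier V \<subseteq> N \<Longrightarrow> h \<in> rmodule_hom K M V (W\<lparr>carrier := N\<rparr>)"
  by (rule rmodule_homI) (auto simp: rmodule_homD)

lemma rmodule_hom_from_sub:
  "h \<in> rmodule_hom K M V (W\<lparr>carrier := N\<rparr>) \<Longrightarrow> N \<subseteq> carrier W \<Longrightarrow> h \<in> rmodule_hom K M V W"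
  using rmodule_homD[of h K M V "W\<lparr>carrier := N\<rparr>"] by (intro rmodule_homI) (auto simp: subset_iff)

lemma rmodule_iso_refl: "rmodule_iso K M V V"
  unfolding rmodule_iso_def using rmodule_hom_id by (intro bexI[of _ "\<lambda>x. x"]) (auto simp: bij_betw_def)

lemma rmodule_iso_trans: "rmodule_iso K M U V \<Longrightarrow> rmodule_iso K M V W \<Longrightarrow> rmodule_iso K M U W"
proof -
  assume "rmodule_iso K M U V" "rmodule_iso K M V W"
  then obtain h g where hg: "h \<in> rmodule_hom K M U V" "bij_betw h (carrier U) (carrier V)"
    "g \<in> rmodule_hom K M V W" "bij_betw g (carrier V) (carrier W)" unfolding rmodule_iso_def by blast
  have "bij_betw (\<lambda>x. g (h x)) (carrier U) (carrier W)" using bij_betw_trans[OF hg(2,4)] by (simp add: comp_def)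
  thus ?thesis unfolding rmodule_iso_def using rmodule_hom_comp[OF hg(1,3)] by blast
qed

lemma right_submodule_kernel:
  assumes "h \<in> rmodule_hom K M V W" "right_module K M V" "right_module K M W"
  shows "right_submodule K M V {x \<in> carrier V. h x = \<zero>\<^bsub>W\<^esub>}"
proof -
  interpret V: right_module K M V by fact
  interpret W: right_module K M W by fact
  note h = rmodule_homD[OF assms(1)]
  show ?thesis
    by (rule right_submoduleI[OF assms(2)]) (auto simp: h rmodule_hom_zero[OF assms] V.ract_closed W.zero_ract)
qed

lemma right_submodule_image:
  assumes "h \<in> rmodule_hom K M V W" "right_module K M V" "right_module K M W" "right_submodule K M V N"
  shows "right_submodule K M W (h ` N)"
proof -
  interpret V: right_module K M V by fact
  interpret W: right_module K M W by fact
  note h = rmodule_homD[OF assms(1)] and N = right_submoduleD[OF assms(4,2)]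
  show ?thesis
  proof (rule right_submoduleI[OF assms(3)])
    show "\<zero>\<^bsub>W\<^esub> \<in> h ` N" using rmodule_hom_zero[OF assms(1-3)] N(2) by (metis imageI)
  next
    fix x y assume "x \<in> h ` N" "y \<in> h ` N"
    then obtain x' y' where *: "x' \<in> N" "x = h x'" "y' \<in> N" "y = h y'" by blast
    hence "x \<oplus>\<^bsub>W\<^esub> y = h (x' \<oplus>\<^bsub>V\<^esub> y')" using h(2) N(1) by (simp add: subset_iff)
    thus "x \<oplus>\<^bsub>W\<^esub> y \<in> h ` N" using N(3) * by blast
  next
    fix a x assume "a \<in> carrier K" "x \<in> h ` N"
    then obtain x' where *: "a \<in> carrier K" "x' \<in> N" "x = h x'" by blast
    hence "a \<odot>\<^bsub>W\<^esub> x = h (a \<odot>\<^bsub>V\<^esub> x')" using h(3) N(1) by (simp add: subset_iff)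
    thus "a \<odot>\<^bsub>W\<^esub> x \<in> h ` N" using N(4) * by blast
  next
    fix x f assume "x \<in> h ` N" "f \<in> carrier M"
    then obtain x' where *: "f \<in> carrier M" "x' \<in> N" "x = h x'" by blast
    hence "x \<cdot>\<^bsub>W\<^esub> f = h (x' \<cdot>\<^bsub>V\<^esub> f)" using h(4) N(1) by (simp add: subset_iff)
    thus "x \<cdot>\<^bsub>W\<^esub> f \<in> h ` N" using N(5) * by blast
  qed (use h(1) N(1) in auto)
qed

lemma right_submodule_preimage:
  assumes "h \<in> rmodule_hom K M V W" "right_module K M V" "right_module K M W" "right_submodule K M W N"
  shows "right_submodule K M V {x \<in> carrier V. h x \<in> N}"
proof -
  interpret V: right_module K M V by fact
  note h = rmodule_homD[OF assms(1)] and N = right_submoduleD[OF assms(4,3)]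
  show ?thesis
    by (rule right_submoduleI[OF assms(2)]) (auto simp: h rmodule_hom_zero[OF assms(1-3)] V.ract_closed N)
qed

lemma right_submodule_sub_iff:
  assumes "right_module K M V" "right_submodule K M V D"
  shows "right_submodule K M (V\<lparr>carrier := D\<rparr>) N \<longleftrightarrow> right_submodule K M V N \<and> N \<subseteq> D"
proof -
  have D: "right_module K M (V\<lparr>carrier := D\<rparr>)" by (rule right_module_sub[OF assms])
  have DV: "D \<subseteq> carrier V" using right_submoduleD(1)[OF assms(2,1)] .
  show ?thesis
  proof
    assume N: "right_submodule K M (V\<lparr>carrier := D\<rparr>) N"
    note N' = right_submoduleD[OF N D, simplified]
    show "right_submodule K M V N \<and> N \<subseteq> D"
      using N' DV by (intro conjI right_submoduleI[OF assms(1)]) auto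
  next
    assume N: "right_submodule K M V N \<and> N \<subseteq> D"
    note N' = right_submoduleD[OF conjunct1[OF N] assms(1)]
    show "right_submodule K M (V\<lparr>carrier := D\<rparr>) N"
      using N' N by (intro right_submoduleI[OF D]) auto
  qed
qed

text \<open>Two surjections with the same kernel identify the same pairs of elements, so applying q
  to any preimage under p is well defined and bijective. This takes the place of the isomorphism
  theorems throughout.\<close>

lemma iso_of_surjections:
  assumes V: "right_module K M V" and A: "right_module K M A" and B: "right_module K M B"
    and p: "p \<in> rmodule_hom K M V A" "p ` carrier V = carrier A"
    and q: "q \<in> rmodule_hom K M V B" "q ` carrier V = carrier B"
    and ker: "\<And>x. x \<in> carrier V \<Longrightarrow> p x = \<zero>\<^bsub>A\<^esub> \<longleftrightarrow> q x = \<zero>\<^bsub>B\<^esub>"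
  shows "rmodule_iso K M A B"
proof -
  interpret V: right_module K M V by fact
  interpret A: right_module K M A by fact
  interpret B: right_module K M B by fact
  note p' = rmodule_homD[OF p(1)] and q' = rmodule_homD[OF q(1)]
  have eq: "p x = p y \<longleftrightarrow> q x = q y" if xy: "x \<in> carrier V" "y \<in> carrier V" for x y
  proof -
    have "p x = p y \<longleftrightarrow> p (x \<ominus>\<^bsub>V\<^esub> y) = \<zero>\<^bsub>A\<^esub>"
      using rmodule_hom_minus[OF p(1) V A xy] p'(1)[OF xy(1)] p'(1)[OF xy(2)]
      by (metis A.minus_eq_zero_iff)
    also have "\<dots> \<longleftrightarrow> q (x \<ominus>\<^bsub>V\<^esub> y) = \<zero>\<^bsub>B\<^esub>" using ker xy by simp
    also have "\<dots> \<longleftrightarrow> q x = q y"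
      using rmodule_hom_minus[OF q(1) V B xy] q'(1)[OF xy(1)] q'(1)[OF xy(2)]
      by (metis B.minus_eq_zero_iff)
    finally show ?thesis .
  qed
  define r where "r a = (SOME x. x \<in> carrier V \<and> p x = a)" for a
  have r: "r a \<in> carrier V" "p (r a) = a" if "a \<in> carrier A" for a
  proof -
    have "\<exists>x. x \<in> carrier V \<and> p x = a" using that p(2) by (metis imageE)
    from someI_ex[OF this] show "r a \<in> carrier V" "p (r a) = a" unfolding r_def by auto
  qed
  have qr: "q (r (p x)) = q x" if "x \<in> carrier V" for x
    using eq[of "r (p x)" x] r[of "p x"] that p'(1) by simp
  have ex: "\<exists>x\<in>carrier V. a = p x" if "a \<in> carrier A" for a using that p(2) by blast
  have "(\<lambda>a. q (r a)) \<in> rmodule_hom K M A B"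
  proof (rule rmodule_homI)
    fix x y assume "x \<in> carrier A" "y \<in> carrier A"
    then obtain x' y' where "x' \<in> carrier V" "x = p x'" "y' \<in> carrier V" "y = p y'" using ex by meson
    thus "q (r (x \<oplus>\<^bsub>A\<^esub> y)) = q (r x) \<oplus>\<^bsub>B\<^esub> q (r y)" by (simp add: qr q' flip: p'(2))
  next
    fix a x assume a: "a \<in> carrier K" "x \<in> carrier A"
    then obtain x' where "x' \<in> carrier V" "x = p x'" using ex by meson
    thus "q (r (a \<odot>\<^bsub>A\<^esub> x)) = a \<odot>\<^bsub>B\<^esub> q (r x)" using a by (simp add: qr q' flip: p'(3))
  next
    fix x f assume a: "f \<in> carrier M" "x \<in> carrier A"
    then obtain x' where "x' \<in> carrier V" "x = p x'" using ex by meson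
    thus "q (r (x \<cdot>\<^bsub>A\<^esub> f)) = q (r x) \<cdot>\<^bsub>B\<^esub> f" using a by (simp add: qr q' V.ract_closed flip: p'(4))
  qed (use r q' in auto)
  moreover have "bij_betw (\<lambda>a. q (r a)) (carrier A) (carrier B)"
    unfolding bij_betw_def
  proof
    show "inj_on (\<lambda>a. q (r a)) (carrier A)"
      by (rule inj_onI) (metis eq r)
    show "(\<lambda>a. q (r a)) ` carrier A = carrier B"
    proof (intro equalityI subsetI)
      fix b assume "b \<in> carrier B"
      then obtain x where "x \<in> carrier V" "b = q x" using q(2) by blast
      thus "b \<in> (\<lambda>a. q (r a)) ` carrier A" using qr p'(1) by (intro image_eqI[of _ _ "p x"]) auto
    qed (use r q' in auto)
  qed
  ultimately show ?thesis unfolding rmodule_iso_def by blast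
qed

lemma rmodule_iso_sym:
  assumes "right_module K M V" "right_module K M W" "rmodule_iso K M V W"
  shows "rmodule_iso K M W V"
proof -
  obtain h where h: "h \<in> rmodule_hom K M V W" "bij_betw h (carrier V) (carrier W)"
    using assms by (auto simp: rmodule_iso_def)
  interpret V: right_module K M V by fact
  show ?thesis
  proof (rule iso_of_surjections[OF assms(1,2,1) h(1) _ rmodule_hom_id])
    show "h ` carrier V = carrier W" using h(2) by (simp add: bij_betw_def)
    fix x assume "x \<in> carrier V"
    thus "h x = \<zero>\<^bsub>W\<^esub> \<longleftrightarrow> x = \<zero>\<^bsub>V\<^esub>"
      using h(2) rmodule_hom_zero[OF h(1) assms(1,2)] by (metis V.M.zero_closed bij_betw_def inj_onD V.zero_closed)
  qed simp
qed

section \<open>Quotients and simple modules\<close>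

lemma right_submodule_abelian_subgroup:
  assumes "right_module K M V" "right_submodule K M V N"
  shows "abelian_subgroup N V"
proof -
  interpret V: right_module K M V by fact
  show ?thesis using assms(2) unfolding right_submodule_def
    by (intro abelian_subgroupI3 additive_subgroup.intro submodule.axioms(1) V.abelian_group_axioms) auto
qed

text \<open>In the quotient, scalars and monoid elements act by adding N to the image of a coset.
  For additive \<phi> preserving N this yields the coset of the image of any representative.\<close>

lemma coset_image:
  assumes "right_module K M V" "right_submodule K M V N"
    "\<And>x. x \<in> carrier V \<Longrightarrow> \<phi> x \<in> carrier V"
    "\<And>x y. x \<in> carrier V \<Longrightarrow> y \<in> carrier V \<Longrightarrow> \<phi> (x \<oplus>\<^bsub>V\<^esub> y) = \<phi> x \<oplus>\<^bsub>V\<^esub> \<phi> y"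
    "\<And>x. x \<in> N \<Longrightarrow> \<phi> x \<in> N" "x \<in> carrier V"
  shows "N <+>\<^bsub>V\<^esub> \<phi> ` (N +>\<^bsub>V\<^esub> x) = N +>\<^bsub>V\<^esub> \<phi> x"
proof -
  interpret V: right_module K M V by fact
  note N' = right_submoduleD[OF assms(2,1)]
  have "N <+>\<^bsub>V\<^esub> \<phi> ` (N +>\<^bsub>V\<^esub> x) = {n \<oplus>\<^bsub>V\<^esub> \<phi> (n' \<oplus>\<^bsub>V\<^esub> x) | n n'. n \<in> N \<and> n' \<in> N}"
    unfolding set_add_defs a_r_coset_defs by auto
  also have "\<dots> = {n \<oplus>\<^bsub>V\<^esub> \<phi> x | n. n \<in> N}"
  proof (intro equalityI subsetI)
    fix y assume "y \<in> {n \<oplus>\<^bsub>V\<^esub> \<phi> (n' \<oplus>\<^bsub>V\<^esub> x) | n n'. n \<in> N \<and> n' \<in> N}"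
    then obtain n n' where n: "n \<in> N" "n' \<in> N" "y = n \<oplus>\<^bsub>V\<^esub> \<phi> (n' \<oplus>\<^bsub>V\<^esub> x)" by blast
    moreover have "n \<in> carrier V" "n' \<in> carrier V" using n N'(1) by auto
    ultimately have "y = (n \<oplus>\<^bsub>V\<^esub> \<phi> n') \<oplus>\<^bsub>V\<^esub> \<phi> x" "n \<oplus>\<^bsub>V\<^esub> \<phi> n' \<in> N"
      using assms(3-6) N'(3) by (simp_all add: V.a_assoc)
    thus "y \<in> {n \<oplus>\<^bsub>V\<^esub> \<phi> x | n. n \<in> N}" by blast
  next
    fix y assume "y \<in> {n \<oplus>\<^bsub>V\<^esub> \<phi> x | n. n \<in> N}"
    then obtain n where "n \<in> N" "y = n \<oplus>\<^bsub>V\<^esub> \<phi> (\<zero>\<^bsub>V\<^esub> \<oplus>\<^bsub>V\<^esub> x)" using assms(6) by auto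
    thus "y \<in> {n \<oplus>\<^bsub>V\<^esub> \<phi> (n' \<oplus>\<^bsub>V\<^esub> x) | n n'. n \<in> N \<and> n' \<in> N}" using N'(2) by blast
  qed
  also have "\<dots> = N +>\<^bsub>V\<^esub> \<phi> x" unfolding a_r_coset_defs by auto
  finally show ?thesis .
qed

lemma
  assumes V: "right_module K M V" and N: "right_submodule K M V N"
  shows quot_module: "right_module K M (rmodule_quot V N)"
    and quot_hom: "(\<lambda>x. N +>\<^bsub>V\<^esub> x) \<in> rmodule_hom K M V (rmodule_quot V N)"
    and quot_surj: "(\<lambda>x. N +>\<^bsub>V\<^esub> x) ` carrier V = carrier (rmodule_quot V N)"
    and quot_zero_iff: "x \<in> carrier V \<Longrightarrow> N +>\<^bsub>V\<^esub> x = \<zero>\<^bsub>rmodule_quot V N\<^esub> \<longleftrightarrow> x \<in> N"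
proof -
  interpret V: right_module K M V by fact
  interpret A: abelian_subgroup N V by (rule right_submodule_abelian_subgroup[OF V N])
  note N' = right_submoduleD[OF N V]
  let ?q = "\<lambda>x. N +>\<^bsub>V\<^esub> x" and ?Q = "rmodule_quot V N"
  have surj: "?q ` carrier V = carrier ?Q"
    by (auto simp: rmodule_quot_def A_RCOSETS_def RCOSETS_def a_r_coset_def)
  have add: "?q (x \<oplus>\<^bsub>V\<^esub> y) = ?q x \<oplus>\<^bsub>?Q\<^esub> ?q y" if "x \<in> carrier V" "y \<in> carrier V" for x y
    using A.a_rcos_sum[OF that] by (simp add: rmodule_quot_def)
  have const: "?q x = N" if "x \<in> N" for x using A.a_rcos_const[OF that] .
  have zero: "?q \<zero>\<^bsub>V\<^esub> = \<zero>\<^bsub>?Q\<^esub>" using const[OF N'(2)] by (simp add: rmodule_quot_def)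
  have smult: "?q (a \<odot>\<^bsub>V\<^esub> x) = a \<odot>\<^bsub>?Q\<^esub> ?q x" if "a \<in> carrier K" "x \<in> carrier V" for a x
    using coset_image[OF V N, of "\<lambda>x. a \<odot>\<^bsub>V\<^esub> x" x] N' that by (simp add: rmodule_quot_def V.smult_r_distr)
  have ract: "?q (x \<cdot>\<^bsub>V\<^esub> f) = ?q x \<cdot>\<^bsub>?Q\<^esub> f" if "x \<in> carrier V" "f \<in> carrier M" for x f
    using coset_image[OF V N, of "\<lambda>x. x \<cdot>\<^bsub>V\<^esub> f" x] N' that by (simp add: rmodule_quot_def V.ract_add V.ract_closed)
  show "right_module K M ?Q" by (rule right_module_image[OF V surj add zero smult ract])
  show "?q ` carrier V = carrier ?Q" by (rule surj)
  show "?q \<in> rmodule_hom K M V ?Q" by (rule rmodule_homI) (use surj add smult ract in auto)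
  show "N +>\<^bsub>V\<^esub> x = \<zero>\<^bsub>?Q\<^esub> \<longleftrightarrow> x \<in> N" if "x \<in> carrier V"
  proof
    assume "N +>\<^bsub>V\<^esub> x = \<zero>\<^bsub>?Q\<^esub>"
    thus "x \<in> N" using A.a_rcos_self[OF that] by (simp add: rmodule_quot_def)
  next
    assume "x \<in> N"
    thus "N +>\<^bsub>V\<^esub> x = \<zero>\<^bsub>?Q\<^esub>" using const by (simp add: rmodule_quot_def)
  qed
qed

lemma rmodule_quot_iso:
  assumes "right_module K M V" "right_module K M W" "h \<in> rmodule_hom K M V W" "h ` carrier V = carrier W"
    "N = {x \<in> carrier V. h x = \<zero>\<^bsub>W\<^esub>}"
  shows "rmodule_iso K M (rmodule_quot V N) W"
proof -
  interpret V: right_module K M V by fact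
  have N: "right_submodule K M V N" using right_submodule_kernel[OF assms(3,1,2)] assms(5) by simp
  show ?thesis
    by (rule iso_of_surjections[OF assms(1) quot_module[OF assms(1) N] assms(2) quot_hom[OF assms(1) N] quot_surj[OF assms(1) N] assms(3,4)])
      (simp add: quot_zero_iff[OF assms(1) N], simp add: assms(5))
qed

lemma image_of_preimage:
  assumes "L \<subseteq> q ` C" shows "q ` {x \<in> C. q x \<in> L} = L"
proof (intro equalityI subsetI)
  fix y assume "y \<in> L"
  moreover from this obtain x where "x \<in> C" "y = q x" using assms by blast
  ultimately show "y \<in> q ` {x \<in> C. q x \<in> L}" by blast
qed auto

lemma simple_quot:
  assumes V: "right_module K M V" and N: "right_submodule K M V N" "N \<noteq> carrier V"
    and max: "\<And>N'. right_submodule K M V N' \<Longrightarrow> N \<subseteq> N' \<Longrightarrow> N' = N \<or> N' = carrier V"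
  shows "simple_rmodule K M (rmodule_quot V N)"
proof -
  interpret V: right_module K M V by fact
  let ?Q = "rmodule_quot V N" and ?q = "\<lambda>x. N +>\<^bsub>V\<^esub> x"
  note Q = quot_module[OF V N(1)] and q = quot_hom[OF V N(1)] and s = quot_surj[OF V N(1)] and z = quot_zero_iff[OF V N(1)]
  have NV: "N \<subseteq> carrier V" by (rule right_submoduleD(1)[OF N(1) V])
  have "carrier ?Q \<noteq> {\<zero>\<^bsub>?Q\<^esub>}"
  proof
    assume "carrier ?Q = {\<zero>\<^bsub>?Q\<^esub>}"
    hence "x \<in> N" if "x \<in> carrier V" for x using z[OF that] s that by blast
    thus False using N(2) NV by blast
  qed
  moreover have "L = {\<zero>\<^bsub>?Q\<^esub>} \<or> L = carrier ?Q" if L: "right_submodule K M ?Q L" for L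
  proof -
    let ?P = "{x \<in> carrier V. ?q x \<in> L}"
    have P: "right_submodule K M V ?P" by (rule right_submodule_preimage[OF q V Q L])
    note L' = right_submoduleD[OF L Q]
    have "N \<subseteq> ?P"
    proof
      fix x assume "x \<in> N"
      moreover from this have "x \<in> carrier V" using NV by blast
      ultimately show "x \<in> ?P" using z[of x] L'(2) by simp
    qed
    hence "?P = N \<or> ?P = carrier V" using max[OF P] by blast
    moreover have LP: "?q ` ?P = L" by (rule image_of_preimage) (use L'(1) s in simp)
    moreover have "?q ` N \<subseteq> {\<zero>\<^bsub>?Q\<^esub>}" using z NV by blast
    ultimately have "L \<subseteq> {\<zero>\<^bsub>?Q\<^esub>} \<or> L = carrier ?Q" using s by (elim disjE) simp_all
    thus ?thesis using L'(2) by blast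
  qed
  ultimately show ?thesis unfolding simple_rmodule_def using Q by blast
qed

lemma simple_right_module: "simple_rmodule K M V \<Longrightarrow> right_module K M V"
  by (simp add: simple_rmodule_def)

lemma simple_iso:
  assumes "simple_rmodule K M V" "right_module K M W" "rmodule_iso K M V W"
  shows "simple_rmodule K M W"
proof -
  have V: "right_module K M V" using assms simple_right_module by blast
  obtain h where h: "h \<in> rmodule_hom K M V W" "bij_betw h (carrier V) (carrier W)"
    using assms by (auto simp: rmodule_iso_def)
  have hz: "h \<zero>\<^bsub>V\<^esub> = \<zero>\<^bsub>W\<^esub>" by (rule rmodule_hom_zero[OF h(1) V assms(2)])
  have surj: "h ` carrier V = carrier W" and inj: "inj_on h (carrier V)" using h(2) by (auto simp: bij_betw_def)
  have "\<zero>\<^bsub>V\<^esub> \<in> carrier V" using right_submoduleD(2)[OF right_submodule_carrier[OF V] V] .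
  have "carrier W \<noteq> {\<zero>\<^bsub>W\<^esub>}"
  proof
    assume "carrier W = {\<zero>\<^bsub>W\<^esub>}"
    hence "h x = h \<zero>\<^bsub>V\<^esub>" if "x \<in> carrier V" for x using rmodule_homD(1)[OF h(1) that] hz by simp
    hence "x = \<zero>\<^bsub>V\<^esub>" if "x \<in> carrier V" for x using inj_onD[OF inj] that \<open>\<zero>\<^bsub>V\<^esub> \<in> carrier V\<close> by blast
    thus False using assms(1) \<open>\<zero>\<^bsub>V\<^esub> \<in> carrier V\<close> unfolding simple_rmodule_def by blast
  qed
  moreover have "N = {\<zero>\<^bsub>W\<^esub>} \<or> N = carrier W" if N: "right_submodule K M W N" for N
  proof -
    have "right_submodule K M V {x \<in> carrier V. h x \<in> N}" by (rule right_submodule_preimage[OF h(1) V assms(2) N])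
    hence "{x \<in> carrier V. h x \<in> N} = {\<zero>\<^bsub>V\<^esub>} \<or> {x \<in> carrier V. h x \<in> N} = carrier V"
      using assms(1) unfolding simple_rmodule_def by blast
    moreover have "h ` {x \<in> carrier V. h x \<in> N} = N"
      by (rule image_of_preimage) (use right_submoduleD(1)[OF N assms(2)] surj in simp)
    ultimately show ?thesis using hz surj by (elim disjE) simp_all
  qed
  ultimately show ?thesis unfolding simple_rmodule_def using assms(2) by blast
qed

lemma hom_to_simple_surj:
  assumes "simple_rmodule K M S" "right_module K M V" "h \<in> rmodule_hom K M V S"
    "x \<in> carrier V" "h x \<noteq> \<zero>\<^bsub>S\<^esub>"
  shows "h ` carrier V = carrier S"
proof -
  have S: "right_module K M S" using assms simple_right_module by blast
  have "right_submodule K M S (h ` carrier V)"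
    by (rule right_submodule_image[OF assms(3,2) S right_submodule_carrier[OF assms(2)]])
  hence "h ` carrier V = {\<zero>\<^bsub>S\<^esub>} \<or> h ` carrier V = carrier S" using assms(1) unfolding simple_rmodule_def by blast
  thus ?thesis using assms(4,5) by blast
qed

text \<open>Some element of N has nonzero image, so h maps N onto the simple module S; every element
  of V then differs from an element of N by one of the kernel.\<close>

lemma simple_kernel_maximal:
  assumes "simple_rmodule K M S" "right_module K M V" "h \<in> rmodule_hom K M V S"
    "right_submodule K M V N" "{x \<in> carrier V. h x = \<zero>\<^bsub>S\<^esub>} \<subseteq> N" "y \<in> N" "h y \<noteq> \<zero>\<^bsub>S\<^esub>"
  shows "N = carrier V"
proof -
  have S: "right_module K M S" using assms simple_right_module by blast
  interpret V: right_module K M V by fact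
  interpret S: right_module K M S by fact
  note N = right_submoduleD[OF assms(4,2)] and h = rmodule_homD[OF assms(3)]
  have "right_submodule K M S (h ` N)" by (rule right_submodule_image[OF assms(3,2) S assms(4)])
  hence hN: "h ` N = carrier S" using assms(1,6,7) unfolding simple_rmodule_def by blast
  have "x \<in> N" if x: "x \<in> carrier V" for x
  proof -
    obtain n where n: "n \<in> N" "h x = h n" using hN h(1)[OF x] by (metis imageE)
    have nV: "n \<in> carrier V" using n N(1) by blast
    have "h (x \<ominus>\<^bsub>V\<^esub> n) = \<zero>\<^bsub>S\<^esub>"
      using rmodule_hom_minus[OF assms(3,2) S x nV] n(2) h(1)[OF x] by (simp add: S.minus_eq_zero_iff)
    hence "x \<ominus>\<^bsub>V\<^esub> n \<in> N" using assms(5) x nV by auto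
    hence "(x \<ominus>\<^bsub>V\<^esub> n) \<oplus>\<^bsub>V\<^esub> n \<in> N" using N(3) n by blast
    thus ?thesis using x nV by (simp add: a_minus_def V.M.a_assoc V.M.l_neg)
  qed
  thus ?thesis using N(1) by blast
qed

lemma (in abelian_group) minus_diff_swap:
  assumes "x \<in> carrier G" "y \<in> carrier G" "z \<in> carrier G"
  shows "(z \<ominus> x) \<ominus> (z \<ominus> y) = y \<ominus> x"
proof -
  have "(z \<ominus> x) \<ominus> (z \<ominus> y) = (z \<oplus> \<ominus> x) \<oplus> (\<ominus> z \<oplus> y)" using assms by (simp add: minus_eq minus_add)
  also have "\<dots> = (z \<oplus> \<ominus> z) \<oplus> (y \<oplus> \<ominus> x)" using assms by (simp add: a_ac)
  also have "\<dots> = y \<ominus> x" using assms by (simp add: r_neg minus_eq)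
  finally show ?thesis .
qed

lemma (in abelian_group) plus_minus_cancel: "x \<in> carrier G \<Longrightarrow> y \<in> carrier G \<Longrightarrow> x \<oplus> y \<ominus> x = y"
  by (simp add: a_comm[of x y] a_assoc minus_eq r_neg)

lemma (in abelian_group) minus_plus_cancel: "x \<in> carrier G \<Longrightarrow> y \<in> carrier G \<Longrightarrow> x \<oplus> (y \<ominus> x) = y"
  using a_lcomm[of x y "\<ominus> x"] by (simp add: minus_eq r_neg)

lemma set_addI: "a \<in> A \<Longrightarrow> b \<in> B \<Longrightarrow> a \<oplus>\<^bsub>V\<^esub> b = x \<Longrightarrow> x \<in> A <+>\<^bsub>V\<^esub> B"
  unfolding set_add_defs by auto

lemma set_addE:
  assumes "x \<in> A <+>\<^bsub>V\<^esub> B" obtains a b where "a \<in> A" "b \<in> B" "x = a \<oplus>\<^bsub>V\<^esub> b"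
  using assms unfolding set_add_defs by auto

lemma hom_zero_image:
  assumes "\<And>x. x \<in> C \<Longrightarrow> h x = z" "h ` C = D" "z \<in> D" shows "D = {z}"
proof -
  have "h ` C \<subseteq> {z}" using assms(1) by blast
  thus ?thesis using assms(2,3) by blast
qed

lemma projective_cover_iso:
  assumes "projective_rmodule K M P" "projective_cover K M P' p S" "h \<in> rmodule_hom K M P P'"
    "bij_betw h (carrier P) (carrier P')"
  shows "projective_cover K M P (\<lambda>x. p (h x)) S"
proof -
  have P: "right_module K M P" and P': "right_module K M P'" and S: "right_module K M S"
    and p: "p \<in> rmodule_hom K M P' S" "p ` carrier P' = carrier S"
    and sup: "\<And>N. right_submodule K M P' N \<Longrightarrow> N <+>\<^bsub>P'\<^esub> a_kernel P' S p = carrier P' \<Longrightarrow> N = carrier P'"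
    using assms(1,2) by (auto simp: projective_cover_def projective_rmodule_def)
  have im: "h ` carrier P = carrier P'" and inj: "inj_on h (carrier P)" using assms(4) by (auto simp: bij_betw_def)
  note hd = rmodule_homD[OF assms(3)]
  have "N = carrier P" if N: "right_submodule K M P N" "N <+>\<^bsub>P\<^esub> a_kernel P S (\<lambda>x. p (h x)) = carrier P" for N
  proof -
    note n = right_submoduleD(1)[OF N(1) P]
    have hN: "right_submodule K M P' (h ` N)" by (rule right_submodule_image[OF assms(3) P P' N(1)])
    note hn = right_submoduleD(1)[OF hN P']
    interpret P': right_module K M P' by (rule P')
    have "h ` N <+>\<^bsub>P'\<^esub> a_kernel P' S p = carrier P'"
    proof (intro equalityI subsetI)
      fix y assume "y \<in> h ` N <+>\<^bsub>P'\<^esub> a_kernel P' S p"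
      then obtain a b where "a \<in> h ` N" "b \<in> carrier P'" "y = a \<oplus>\<^bsub>P'\<^esub> b"
        by (auto elim!: set_addE simp: a_kernel_def')
      thus "y \<in> carrier P'" using hn by blast
    next
      fix y assume "y \<in> carrier P'"
      then obtain x where x: "x \<in> carrier P" "y = h x" using im by blast
      hence "x \<in> N <+>\<^bsub>P\<^esub> a_kernel P S (\<lambda>x. p (h x))" using N(2) by simp
      then obtain a b where ab: "a \<in> N" "b \<in> a_kernel P S (\<lambda>x. p (h x))" "x = a \<oplus>\<^bsub>P\<^esub> b" by (blast elim: set_addE)
      have b: "b \<in> carrier P" "h b \<in> a_kernel P' S p" using ab(2) hd(1) by (auto simp: a_kernel_def')
      have "h a \<oplus>\<^bsub>P'\<^esub> h b = y" using hd(2)[of a b] ab b n x by auto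
      thus "y \<in> h ` N <+>\<^bsub>P'\<^esub> a_kernel P' S p" by (rule set_addI[OF imageI[OF ab(1)] b(2)])
    qed
    hence "h ` N = h ` carrier P" using sup[OF hN] im by simp
    thus ?thesis using inj_on_image_eq_iff[OF inj n] by blast
  qed
  moreover have "(\<lambda>x. p (h x)) ` carrier P = carrier S" using im p(2) by (metis image_image)
  ultimately show ?thesis
    unfolding projective_cover_def using assms(1) S rmodule_hom_comp[OF assms(3) p(1)] by blast
qed

lemma (in right_module) finsum_ract:
  assumes "finite F" "x \<in> F \<rightarrow> carrier V" "f \<in> carrier M"
  shows "(\<Oplus>\<^bsub>V\<^esub>j\<in>F. x j) \<cdot>\<^bsub>V\<^esub> f = (\<Oplus>\<^bsub>V\<^esub>j\<in>F. x j \<cdot>\<^bsub>V\<^esub> f)"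
  using assms
proof (induction F rule: finite_induct)
  case empty
  thus ?case using zero_ract by simp
next
  case (insert j F)
  hence "x j \<in> carrier V" "x \<in> F \<rightarrow> carrier V" "(\<lambda>j. x j \<cdot>\<^bsub>V\<^esub> f) \<in> F \<rightarrow> carrier V" using ract_closed by auto
  thus ?case using insert ract_add ract_closed by simp
qed

lemma
  assumes V: "right_module K M V" and F: "finite F" and A: "\<And>j. j \<in> F \<Longrightarrow> right_submodule K M V (A j)"
  defines "S \<equiv> {\<Oplus>\<^bsub>V\<^esub>j\<in>F. x j | x. x \<in> (\<Pi> j\<in>F. A j)}"
  shows submodule_sum: "right_submodule K M V S"
    and submodule_sum_member: "\<And>j. j \<in> F \<Longrightarrow> A j \<subseteq> S"
    and submodule_sum_least: "\<And>N. \<zero>\<^bsub>V\<^esub> \<in> N \<Longrightarrow> (\<And>x y. x \<in> N \<Longrightarrow> y \<in> N \<Longrightarrow> x \<oplus>\<^bsub>V\<^esub> y \<in> N) \<Longrightarrow>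
      (\<And>j. j \<in> F \<Longrightarrow> A j \<subseteq> N) \<Longrightarrow> S \<subseteq> N"
proof -
  interpret V: right_module K M V by fact
  note a = right_submoduleD[OF A V]
  have c: "x \<in> F \<rightarrow> carrier V" if "x \<in> (\<Pi> j\<in>F. A j)" for x using that a(1) by blast
  have SI: "(\<Oplus>\<^bsub>V\<^esub>j\<in>F. x j) \<in> S" if "\<And>j. j \<in> F \<Longrightarrow> x j \<in> A j" for x
    unfolding S_def using that by blast
  have SE: "\<exists>x. (\<forall>j\<in>F. x j \<in> A j) \<and> x \<in> F \<rightarrow> carrier V \<and> y = (\<Oplus>\<^bsub>V\<^esub>j\<in>F. x j)" if "y \<in> S" for y
    using that c unfolding S_def by blast
  show "right_submodule K M V S"
  proof (rule right_submoduleI[OF V])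
    show "S \<subseteq> carrier V" using SE V.M.finsum_closed by blast
    have "\<zero>\<^bsub>V\<^esub> = (\<Oplus>\<^bsub>V\<^esub>j\<in>F. \<zero>\<^bsub>V\<^esub>)" by simp
    thus "\<zero>\<^bsub>V\<^esub> \<in> S" using SI[of "\<lambda>_. \<zero>\<^bsub>V\<^esub>"] a(2) by simp
  next
    fix y z assume "y \<in> S" "z \<in> S"
    then obtain x x' where x: "\<forall>j\<in>F. x j \<in> A j" "x \<in> F \<rightarrow> carrier V" "y = (\<Oplus>\<^bsub>V\<^esub>j\<in>F. x j)"
      "\<forall>j\<in>F. x' j \<in> A j" "x' \<in> F \<rightarrow> carrier V" "z = (\<Oplus>\<^bsub>V\<^esub>j\<in>F. x' j)"
      using SE[of y] SE[of z] by blast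
    have "y \<oplus>\<^bsub>V\<^esub> z = (\<Oplus>\<^bsub>V\<^esub>j\<in>F. x j \<oplus>\<^bsub>V\<^esub> x' j)" using V.M.finsum_addf[OF x(2,5)] x by simp
    thus "y \<oplus>\<^bsub>V\<^esub> z \<in> S" using SI[of "\<lambda>j. x j \<oplus>\<^bsub>V\<^esub> x' j"] x(1,4) a(3) by simp
  next
    fix r y assume r: "r \<in> carrier K" "y \<in> S"
    then obtain x where x: "\<forall>j\<in>F. x j \<in> A j" "x \<in> F \<rightarrow> carrier V" "y = (\<Oplus>\<^bsub>V\<^esub>j\<in>F. x j)" using SE by meson
    have "r \<odot>\<^bsub>V\<^esub> y = (\<Oplus>\<^bsub>V\<^esub>j\<in>F. r \<odot>\<^bsub>V\<^esub> x j)" using V.finsum_smult_ldistr[OF F r(1) x(2)] x by simp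
    thus "r \<odot>\<^bsub>V\<^esub> y \<in> S" using SI[of "\<lambda>j. r \<odot>\<^bsub>V\<^esub> x j"] x(1) r a(4) by simp
  next
    fix y f assume r: "y \<in> S" "f \<in> carrier M"
    then obtain x where x: "\<forall>j\<in>F. x j \<in> A j" "x \<in> F \<rightarrow> carrier V" "y = (\<Oplus>\<^bsub>V\<^esub>j\<in>F. x j)" using SE by meson
    have "y \<cdot>\<^bsub>V\<^esub> f = (\<Oplus>\<^bsub>V\<^esub>j\<in>F. x j \<cdot>\<^bsub>V\<^esub> f)" using V.finsum_ract[OF F x(2) r(2)] x by simp
    thus "y \<cdot>\<^bsub>V\<^esub> f \<in> S" using SI[of "\<lambda>j. x j \<cdot>\<^bsub>V\<^esub> f"] x(1) r a(5) by simp
  qed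
  show "A j \<subseteq> S" if j: "j \<in> F" for j
  proof
    fix y assume y: "y \<in> A j"
    have "(\<Oplus>\<^bsub>V\<^esub>i\<in>F. if j = i then y else \<zero>\<^bsub>V\<^esub>) = y" using y a(1)[OF j] j F by (intro V.M.finsum_singleton) auto
    moreover have "(\<Oplus>\<^bsub>V\<^esub>i\<in>F. if j = i then y else \<zero>\<^bsub>V\<^esub>) \<in> S" using y a(2) by (intro SI) auto
    ultimately show "y \<in> S" by simp
  qed
  show "S \<subseteq> N" if N: "\<zero>\<^bsub>V\<^esub> \<in> N" "\<And>x y. x \<in> N \<Longrightarrow> y \<in> N \<Longrightarrow> x \<oplus>\<^bsub>V\<^esub> y \<in> N" "\<And>j. j \<in> F \<Longrightarrow> A j \<subseteq> N" for N
  proof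
    fix y assume "y \<in> S"
    then obtain x where x: "\<forall>j\<in>F. x j \<in> A j" "x \<in> F \<rightarrow> carrier V" "y = (\<Oplus>\<^bsub>V\<^esub>j\<in>F. x j)" using SE by meson
    have "(\<Oplus>\<^bsub>V\<^esub>j\<in>E. x j) \<in> N" if "finite E" "E \<subseteq> F" for E
      using that
    proof (induction E rule: finite_induct)
      case (insert j E)
      have "x \<in> E \<rightarrow> carrier V" "x j \<in> carrier V" "x j \<in> N" using x insert.prems N(3) by blast+
      thus ?case using insert N(2) by simp
    qed (simp add: N(1))
    thus "y \<in> N" using F x(3) by blast
  qed
qed

section \<open>Projective covers over a finite monoid\<close>

definition single :: "('k, 'c) ring_scheme \<Rightarrow> ('m, 'd) monoid_scheme \<Rightarrow> 'x set \<Rightarrow> 'x \<times> 'm \<Rightarrow> 'k \<Rightarrow> 'x \<times> 'm \<Rightarrow> 'k" where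
  "single K M X p c = (\<lambda>q\<in>X \<times> carrier M. if q = p then c else \<zero>\<^bsub>K\<^esub>)"

locale finite_monoid_algebra = K: field K + M: monoid M
  for K :: "'k ring" and M :: "('m, 'd) monoid_scheme" +
  assumes finite_monoid: "finite (carrier M)"
begin

abbreviation "rmod \<equiv> right_module K M"
abbreviation "submod \<equiv> right_submodule K M"
abbreviation "Hom \<equiv> rmodule_hom K M"
abbreviation "free \<equiv> free_rmodule K M"
abbreviation "sgl \<equiv> single K M"

section \<open>The free module on a set\<close>

lemma free_sel:
  "carrier (free X) = {x \<in> X \<times> carrier M \<rightarrow>\<^sub>E carrier K. finite {p \<in> X \<times> carrier M. x p \<noteq> \<zero>\<^bsub>K\<^esub>}}"
  "\<zero>\<^bsub>free X\<^esub> = (\<lambda>p\<in>X \<times> carrier M. \<zero>\<^bsub>K\<^esub>)"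
  "x \<oplus>\<^bsub>free X\<^esub> y = (\<lambda>p\<in>X \<times> carrier M. x p \<oplus>\<^bsub>K\<^esub> y p)"
  "a \<odot>\<^bsub>free X\<^esub> x = (\<lambda>p\<in>X \<times> carrier M. a \<otimes>\<^bsub>K\<^esub> x p)"
  by (simp_all add: free_rmodule_def Let_def)

lemma free_val:
  assumes "x \<in> carrier (free X)" "p \<in> X \<times> carrier M"
  shows "x p \<in> carrier K"
  using assms by (cases p) (auto simp: free_sel)

lemma free_ract:
  assumes "x \<in> carrier (free X)" "g \<in> carrier M"
  shows "x \<cdot>\<^bsub>free X\<^esub> g = (\<lambda>(b, f)\<in>X \<times> carrier M. \<Oplus>\<^bsub>K\<^esub>f'\<in>{f' \<in> carrier M. f' \<otimes>\<^bsub>M\<^esub> g = f}. x (b, f'))"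
proof -
  have "(\<Oplus>\<^bsub>K\<^esub>f' \<in> {f' \<in> carrier M. f' \<otimes>\<^bsub>M\<^esub> g = f \<and> x (b, f') \<noteq> \<zero>\<^bsub>K\<^esub>}. x (b, f')) =
     (\<Oplus>\<^bsub>K\<^esub>f'\<in>{f' \<in> carrier M. f' \<otimes>\<^bsub>M\<^esub> g = f}. x (b, f'))" if "b \<in> X" for b f
    using finite_monoid free_val[OF assms(1)] that
    by (intro K.add.finprod_mono_neutral_cong_left) auto
  thus ?thesis by (auto simp: free_rmodule_def Let_def fun_eq_iff restrict_def)
qed

lemma free_eqI:
  assumes "x \<in> carrier (free X)" "y \<in> carrier (free X)" "\<And>p. p \<in> X \<times> carrier M \<Longrightarrow> x p = y p"
  shows "x = y"
  using assms by (auto simp: free_sel intro: PiE_ext)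

lemma free_add_closed:
  assumes "x \<in> carrier (free X)" "y \<in> carrier (free X)"
  shows "x \<oplus>\<^bsub>free X\<^esub> y \<in> carrier (free X)"
proof -
  have "{p \<in> X \<times> carrier M. (\<lambda>p\<in>X \<times> carrier M. x p \<oplus>\<^bsub>K\<^esub> y p) p \<noteq> \<zero>\<^bsub>K\<^esub>}
     \<subseteq> {p \<in> X \<times> carrier M. x p \<noteq> \<zero>\<^bsub>K\<^esub>} \<union> {p \<in> X \<times> carrier M. y p \<noteq> \<zero>\<^bsub>K\<^esub>}"
    by auto
  moreover have "finite ({p \<in> X \<times> carrier M. x p \<noteq> \<zero>\<^bsub>K\<^esub>} \<union> {p \<in> X \<times> carrier M. y p \<noteq> \<zero>\<^bsub>K\<^esub>})"
    using assms by (simp add: free_sel)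
  ultimately have "finite {p \<in> X \<times> carrier M. (\<lambda>p\<in>X \<times> carrier M. x p \<oplus>\<^bsub>K\<^esub> y p) p \<noteq> \<zero>\<^bsub>K\<^esub>}"
    by (rule finite_subset)
  thus ?thesis using free_val[OF assms(1)] free_val[OF assms(2)]
    unfolding free_sel by (auto simp del: restrict_apply)
qed

lemma free_smult_closed:
  assumes "x \<in> carrier (free X)" "a \<in> carrier K"
  shows "a \<odot>\<^bsub>free X\<^esub> x \<in> carrier (free X)"
proof -
  have "{p \<in> X \<times> carrier M. (\<lambda>p\<in>X \<times> carrier M. a \<otimes>\<^bsub>K\<^esub> x p) p \<noteq> \<zero>\<^bsub>K\<^esub>}
     \<subseteq> {p \<in> X \<times> carrier M. x p \<noteq> \<zero>\<^bsub>K\<^esub>}"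
    using assms(2) by auto
  hence "finite {p \<in> X \<times> carrier M. (\<lambda>p\<in>X \<times> carrier M. a \<otimes>\<^bsub>K\<^esub> x p) p \<noteq> \<zero>\<^bsub>K\<^esub>}"
    using assms by (simp add: free_sel finite_subset)
  thus ?thesis using free_val[OF assms(1)] assms(2)
    unfolding free_sel by (auto simp del: restrict_apply)
qed

lemma free_zero_closed: "\<zero>\<^bsub>free X\<^esub> \<in> carrier (free X)"
proof -
  have "finite {p \<in> X \<times> carrier M. (\<lambda>p\<in>X \<times> carrier M. \<zero>\<^bsub>K\<^esub>) p \<noteq> \<zero>\<^bsub>K\<^esub>}"
    by (rule finite_subset[of _ "{}"]) auto
  thus ?thesis unfolding free_sel by (auto simp del: restrict_apply)
qed

lemma free_module: "module K (free X)"
proof (rule K.function_module[of _ "X \<times> carrier M"])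
  show "x \<oplus>\<^bsub>free X\<^esub> y \<in> carrier (free X)" if "x \<in> carrier (free X)" "y \<in> carrier (free X)" for x y
    by (rule free_add_closed[OF that])
  show "a \<odot>\<^bsub>free X\<^esub> x \<in> carrier (free X)" if "a \<in> carrier K" "x \<in> carrier (free X)" for a x
    by (rule free_smult_closed[OF that(2,1)])
  show "carrier (free X) \<subseteq> X \<times> carrier M \<rightarrow>\<^sub>E carrier K" unfolding free_sel(1) by blast
qed (rule free_sel(2-4) free_zero_closed)+

lemma sgl_closed: "p \<in> X \<times> carrier M \<Longrightarrow> c \<in> carrier K \<Longrightarrow> sgl X p c \<in> carrier (free X)"
proof -
  assume *: "p \<in> X \<times> carrier M" "c \<in> carrier K"
  have "{q \<in> X \<times> carrier M. sgl X p c q \<noteq> \<zero>\<^bsub>K\<^esub>} \<subseteq> {p}" by (auto simp: single_def)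
  thus ?thesis using * finite_subset[of _ "{p}"] by (auto simp: free_sel single_def)
qed

lemma free_induct [consumes 1, case_names zero single add]:
  assumes "x \<in> carrier (free X)" "P \<zero>\<^bsub>free X\<^esub>"
    "\<And>p c. p \<in> X \<times> carrier M \<Longrightarrow> c \<in> carrier K \<Longrightarrow> P (sgl X p c)"
    "\<And>x y. x \<in> carrier (free X) \<Longrightarrow> y \<in> carrier (free X) \<Longrightarrow> P x \<Longrightarrow> P y \<Longrightarrow> P (x \<oplus>\<^bsub>free X\<^esub> y)"
  shows "P x"
proof -
  let ?r = "\<lambda>S. \<lambda>q\<in>X \<times> carrier M. if q \<in> S then x q else \<zero>\<^bsub>K\<^esub>"
  let ?S = "{p \<in> X \<times> carrier M. x p \<noteq> \<zero>\<^bsub>K\<^esub>}"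
  have "?r S \<in> carrier (free X) \<and> P (?r S)" if "finite S" "S \<subseteq> X \<times> carrier M" for S
    using that
  proof (induction S rule: finite_induct)
    case empty
    have "?r {} = \<zero>\<^bsub>free X\<^esub>" by (auto simp: free_sel)
    thus ?case using assms(2) by (simp add: free_zero_closed)
  next
    case (insert p S)
    hence p: "p \<in> X \<times> carrier M" "x p \<in> carrier K" using free_val[OF assms(1)] by auto
    have val: "x q \<in> carrier K" if "q \<in> X \<times> carrier M" for q using free_val[OF assms(1) that] .
    have e: "?r (insert p S) = ?r S \<oplus>\<^bsub>free X\<^esub> sgl X p (x p)"
      unfolding free_sel(3) using insert p val by (intro ext) (auto simp: single_def restrict_def)
    have "?r S \<in> carrier (free X)" "P (?r S)" using insert.IH insert.prems by blast+
    thus ?case unfolding e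
      using assms(4)[OF _ sgl_closed[OF p] _ assms(3)[OF p]] free_add_closed[OF _ sgl_closed[OF p]] by blast
  qed
  moreover have "finite ?S" using assms(1) by (simp add: free_sel)
  ultimately have "P (?r ?S)" by blast
  moreover have "?r ?S = x"
  proof
    fix q show "?r ?S q = x q"
      using assms(1) PiE_arb[of x "X \<times> carrier M" "\<lambda>_. carrier K" q]
      by (cases "q \<in> X \<times> carrier M") (simp_all add: free_sel)
  qed
  ultimately show ?thesis by simp
qed

lemma free_ract_apply:
  assumes "x \<in> carrier (free X)" "g \<in> carrier M" "b \<in> X" "f \<in> carrier M"
  shows "(x \<cdot>\<^bsub>free X\<^esub> g) (b, f) = (\<Oplus>\<^bsub>K\<^esub>f'\<in>{f' \<in> carrier M. f' \<otimes>\<^bsub>M\<^esub> g = f}. x (b, f'))"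
  using free_ract[OF assms(1,2)] assms by simp

lemma free_ract_closed:
  assumes "x \<in> carrier (free X)" "g \<in> carrier M"
  shows "x \<cdot>\<^bsub>free X\<^esub> g \<in> carrier (free X)"
proof -
  let ?y = "x \<cdot>\<^bsub>free X\<^esub> g" and ?S = "{p \<in> X \<times> carrier M. x p \<noteq> \<zero>\<^bsub>K\<^esub>}"
  have "?y (b, f) = \<zero>\<^bsub>K\<^esub>" if "b \<in> X" "f \<in> carrier M" "b \<notin> fst ` ?S" for b f
  proof -
    have "x (b, f') = \<zero>\<^bsub>K\<^esub>" if "f' \<in> carrier M" for f' using that \<open>b \<notin> fst ` ?S\<close> \<open>b \<in> X\<close> by force
    hence "?y (b, f) = (\<Oplus>\<^bsub>K\<^esub>f'\<in>{f' \<in> carrier M. f' \<otimes>\<^bsub>M\<^esub> g = f}. \<zero>\<^bsub>K\<^esub>)"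
      unfolding free_ract_apply[OF assms that(1,2)] by (intro K.finsum_cong') auto
    thus ?thesis by (simp add: K.add.finprod_one_eqI)
  qed
  hence "{p \<in> X \<times> carrier M. ?y p \<noteq> \<zero>\<^bsub>K\<^esub>} \<subseteq> fst ` ?S \<times> carrier M" by auto
  moreover have "finite (fst ` ?S \<times> carrier M)" using assms(1) finite_monoid by (simp add: free_sel)
  ultimately have fin: "finite {p \<in> X \<times> carrier M. ?y p \<noteq> \<zero>\<^bsub>K\<^esub>}" by (rule finite_subset)
  have "?y p \<in> carrier K" if "p \<in> X \<times> carrier M" for p
    using that free_val[OF assms(1)] by (cases p) (auto simp: free_ract_apply[OF assms] intro!: K.finsum_closed)
  moreover have "?y \<in> extensional (X \<times> carrier M)" unfolding free_ract[OF assms] by simp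
  ultimately show ?thesis using fin by (auto simp: free_sel PiE_def)
qed

lemma free_ract_add:
  assumes "x \<in> carrier (free X)" "y \<in> carrier (free X)" "g \<in> carrier M"
  shows "(x \<oplus>\<^bsub>free X\<^esub> y) \<cdot>\<^bsub>free X\<^esub> g = x \<cdot>\<^bsub>free X\<^esub> g \<oplus>\<^bsub>free X\<^esub> y \<cdot>\<^bsub>free X\<^esub> g"
proof (rule free_eqI[of _ X])
  fix p assume "p \<in> X \<times> carrier M"
  then obtain b f where p: "p = (b, f)" "b \<in> X" "f \<in> carrier M" by blast
  have "((x \<oplus>\<^bsub>free X\<^esub> y) \<cdot>\<^bsub>free X\<^esub> g) p = (\<Oplus>\<^bsub>K\<^esub>f'\<in>{f' \<in> carrier M. f' \<otimes>\<^bsub>M\<^esub> g = f}. x (b, f') \<oplus>\<^bsub>K\<^esub> y (b, f'))"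
    unfolding p(1) free_ract_apply[OF free_add_closed[OF assms(1,2)] assms(3) p(2,3)]
    using p free_val[OF assms(1)] free_val[OF assms(2)] by (intro K.finsum_cong') (auto simp: free_sel(3))
  also have "\<dots> = (x \<cdot>\<^bsub>free X\<^esub> g) p \<oplus>\<^bsub>K\<^esub> (y \<cdot>\<^bsub>free X\<^esub> g) p"
    unfolding p(1) free_ract_apply[OF assms(1,3) p(2,3)] free_ract_apply[OF assms(2,3) p(2,3)]
    using p free_val[OF assms(1)] free_val[OF assms(2)] by (intro K.finsum_addf) auto
  finally show "((x \<oplus>\<^bsub>free X\<^esub> y) \<cdot>\<^bsub>free X\<^esub> g) p = (x \<cdot>\<^bsub>free X\<^esub> g \<oplus>\<^bsub>free X\<^esub> y \<cdot>\<^bsub>free X\<^esub> g) p"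
    using p by (simp add: free_sel(3))
qed (intro free_add_closed free_ract_closed assms)+

lemma free_ract_sgl:
  assumes "b \<in> X" "f \<in> carrier M" "g \<in> carrier M" "c \<in> carrier K"
  shows "sgl X (b, f) c \<cdot>\<^bsub>free X\<^esub> g = sgl X (b, f \<otimes>\<^bsub>M\<^esub> g) c"
proof (rule free_eqI[of _ X])
  have s: "sgl X (b, f) c \<in> carrier (free X)" by (intro sgl_closed) (use assms in auto)
  show "sgl X (b, f) c \<cdot>\<^bsub>free X\<^esub> g \<in> carrier (free X)" by (rule free_ract_closed[OF s assms(3)])
  show "sgl X (b, f \<otimes>\<^bsub>M\<^esub> g) c \<in> carrier (free X)" by (intro sgl_closed) (use assms in auto)
  fix p assume "p \<in> X \<times> carrier M"
  then obtain b' f' where p: "p = (b', f')" "b' \<in> X" "f' \<in> carrier M" by blast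
  have "(sgl X (b, f) c \<cdot>\<^bsub>free X\<^esub> g) p =
    (\<Oplus>\<^bsub>K\<^esub>h\<in>{h \<in> carrier M. h \<otimes>\<^bsub>M\<^esub> g = f'}. if f = h then (if b' = b then c else \<zero>\<^bsub>K\<^esub>) else \<zero>\<^bsub>K\<^esub>)"
    unfolding p(1) free_ract_apply[OF s assms(3) p(2,3)] using p assms
    by (intro K.finsum_cong') (auto simp: single_def)
  also have "\<dots> = sgl X (b, f \<otimes>\<^bsub>M\<^esub> g) c p"
  proof (cases "f \<otimes>\<^bsub>M\<^esub> g = f'")
    case True
    thus ?thesis using K.finsum_singleton[of f "{h \<in> carrier M. h \<otimes>\<^bsub>M\<^esub> g = f'}" "\<lambda>_. if b' = b then c else \<zero>\<^bsub>K\<^esub>"]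
      finite_monoid assms p by (auto simp: single_def)
  next
    case False
    hence "(\<Oplus>\<^bsub>K\<^esub>h\<in>{h \<in> carrier M. h \<otimes>\<^bsub>M\<^esub> g = f'}. if f = h then (if b' = b then c else \<zero>\<^bsub>K\<^esub>) else \<zero>\<^bsub>K\<^esub>) = \<zero>\<^bsub>K\<^esub>"
      by (intro K.add.finprod_one_eqI) auto
    thus ?thesis using False p by (auto simp: single_def)
  qed
  finally show "(sgl X (b, f) c \<cdot>\<^bsub>free X\<^esub> g) p = sgl X (b, f \<otimes>\<^bsub>M\<^esub> g) c p" .
qed

lemma free_ract_zero: "g \<in> carrier M \<Longrightarrow> \<zero>\<^bsub>free X\<^esub> \<cdot>\<^bsub>free X\<^esub> g = \<zero>\<^bsub>free X\<^esub>"
proof -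
  assume g: "g \<in> carrier M"
  interpret F: module K "free X" by (rule free_module)
  let ?z = "\<zero>\<^bsub>free X\<^esub> \<cdot>\<^bsub>free X\<^esub> g"
  have z: "?z \<in> carrier (free X)" using free_ract_closed free_zero_closed g by blast
  have "?z \<oplus>\<^bsub>free X\<^esub> ?z = ?z"
    using free_ract_add[OF free_zero_closed[of X] free_zero_closed[of X] g] by (simp add: free_zero_closed)
  thus ?thesis using z by (simp add: F.add.r_cancel_one)
qed

lemma sgl_smult: "a \<in> carrier K \<Longrightarrow> a \<odot>\<^bsub>free X\<^esub> sgl X p c = sgl X p (a \<otimes>\<^bsub>K\<^esub> c)"
  by (auto simp: free_sel(4) single_def restrict_def fun_eq_iff)

lemma free_right_module: "rmod (free X)"
proof -
  interpret F: module K "free X" by (rule free_module)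
  show ?thesis
  proof (intro right_module.intro right_module_axioms.intro free_module M.monoid_axioms)
    fix a x f assume *: "a \<in> carrier K" "x \<in> carrier (free X)" "f \<in> carrier M"
    show "a \<odot>\<^bsub>free X\<^esub> x \<cdot>\<^bsub>free X\<^esub> f = a \<odot>\<^bsub>free X\<^esub> (x \<cdot>\<^bsub>free X\<^esub> f)"
      using *(2)
    proof (induction rule: free_induct)
      case (single p c)
      then obtain b h where p: "p = (b, h)" "b \<in> X" "h \<in> carrier M" by blast
      thus ?case using * single by (simp add: sgl_smult free_ract_sgl)
    qed (use * in \<open>simp_all add: free_ract_zero free_ract_add F.smult_r_distr free_ract_closed\<close>)
  next
    fix x assume *: "x \<in> carrier (free X)"
    show "x \<cdot>\<^bsub>free X\<^esub> \<one>\<^bsub>M\<^esub> = x"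
      using *
    proof (induction rule: free_induct)
      case (single p c)
      then obtain b h where p: "p = (b, h)" "b \<in> X" "h \<in> carrier M" by blast
      thus ?case using * single by (simp add: free_ract_sgl)
    qed (use * in \<open>simp_all add: free_ract_zero free_ract_add\<close>)
  next
    fix x f g assume *: "x \<in> carrier (free X)" "f \<in> carrier M" "g \<in> carrier M"
    show "x \<cdot>\<^bsub>free X\<^esub> (f \<otimes>\<^bsub>M\<^esub> g) = x \<cdot>\<^bsub>free X\<^esub> f \<cdot>\<^bsub>free X\<^esub> g"
      using *(1)
    proof (induction rule: free_induct)
      case (single p c)
      then obtain b h where p: "p = (b, h)" "b \<in> X" "h \<in> carrier M" by blast
      thus ?case using * single by (simp add: free_ract_sgl M.m_assoc)
    qed (use * in \<open>simp_all add: free_ract_zero free_ract_add free_ract_closed\<close>)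
  qed (simp_all add: free_ract_closed free_ract_add)
qed

abbreviation "gen X b \<equiv> sgl X (b, \<one>\<^bsub>M\<^esub>) \<one>\<^bsub>K\<^esub>"

lemma sgl_gen: "b \<in> X \<Longrightarrow> f \<in> carrier M \<Longrightarrow> c \<in> carrier K \<Longrightarrow> sgl X (b, f) c = c \<odot>\<^bsub>free X\<^esub> (gen X b \<cdot>\<^bsub>free X\<^esub> f)"
  by (simp add: free_ract_sgl sgl_smult)

lemma free_hom_eq:
  assumes "rmod V" "h \<in> Hom (free X) V" "h' \<in> Hom (free X) V"
    "\<And>b. b \<in> X \<Longrightarrow> h (gen X b) = h' (gen X b)" "x \<in> carrier (free X)"
  shows "h x = h' x"
  using assms(5)
proof (induction rule: free_induct)
  case zero
  thus ?case using rmodule_hom_zero[OF _ free_right_module assms(1)] assms(2,3) by metis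
next
  case (single p c)
  then obtain b f where p: "p = (b, f)" "b \<in> X" "f \<in> carrier M" by blast
  have g: "gen X b \<in> carrier (free X)" "gen X b \<cdot>\<^bsub>free X\<^esub> f \<in> carrier (free X)"
    using p by (simp_all add: sgl_closed free_ract_closed)
  show ?case unfolding p(1) sgl_gen[OF p(2,3) single(2)]
    using g p single assms(4) by (simp add: rmodule_homD[OF assms(2)] rmodule_homD[OF assms(3)])
next
  case (add x y)
  thus ?case by (simp add: rmodule_homD[OF assms(2)] rmodule_homD[OF assms(3)])
qed

lemma free_lift:
  assumes V: "rmod V" and t: "\<And>b. b \<in> X \<Longrightarrow> t b \<in> carrier V"
  shows "\<exists>H\<in>Hom (free X) V. \<forall>b\<in>X. H (gen X b) = t b"
proof -
  interpret V: right_module K M V by fact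
  let ?s = "\<lambda>x. {p \<in> X \<times> carrier M. x p \<noteq> \<zero>\<^bsub>K\<^esub>}"
  let ?T = "\<lambda>p. t (fst p) \<cdot>\<^bsub>V\<^esub> snd p"
  define H where "H x = (\<Oplus>\<^bsub>V\<^esub>p\<in>?s x. x p \<odot>\<^bsub>V\<^esub> ?T p)" for x
  have T: "?T p \<in> carrier V" if "p \<in> X \<times> carrier M" for p
    using that t V.ract_closed by auto
  \<comment> \<open>The sum over the support may be extended to any larger finite set, so that two
    supports can be merged when additivity is checked.\<close>
  have ext: "H x = (\<Oplus>\<^bsub>V\<^esub>p\<in>S. x p \<odot>\<^bsub>V\<^esub> ?T p)"
    if "x \<in> carrier (free X)" "finite S" "?s x \<subseteq> S" "S \<subseteq> X \<times> carrier M" for x S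
    unfolding H_def using that T free_val[OF that(1)]
    by (intro V.M.add.finprod_mono_neutral_cong_left) auto
  have fin: "finite (?s x)" if "x \<in> carrier (free X)" for x using that by (simp add: free_sel)
  have cl: "H x \<in> carrier V" if "x \<in> carrier (free X)" for x
    unfolding H_def using T free_val[OF that] by (intro V.M.finsum_closed) auto
  have Hadd: "H (x \<oplus>\<^bsub>free X\<^esub> y) = H x \<oplus>\<^bsub>V\<^esub> H y" if xy: "x \<in> carrier (free X)" "y \<in> carrier (free X)" for x y
  proof -
    let ?S = "?s x \<union> ?s y"
    have S: "finite ?S" "?S \<subseteq> X \<times> carrier M" using fin xy by auto
    have "?s (x \<oplus>\<^bsub>free X\<^esub> y) \<subseteq> ?S" by (auto simp: free_sel(3))
    hence "H (x \<oplus>\<^bsub>free X\<^esub> y) = (\<Oplus>\<^bsub>V\<^esub>p\<in>?S. (x \<oplus>\<^bsub>free X\<^esub> y) p \<odot>\<^bsub>V\<^esub> ?T p)"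
      using ext[OF free_add_closed[OF xy] S(1)] S(2) by blast
    also have "\<dots> = (\<Oplus>\<^bsub>V\<^esub>p\<in>?S. x p \<odot>\<^bsub>V\<^esub> ?T p \<oplus>\<^bsub>V\<^esub> y p \<odot>\<^bsub>V\<^esub> ?T p)"
      using T free_val[OF xy(1)] free_val[OF xy(2)]
      by (intro V.M.finsum_cong') (auto simp: free_sel(3) V.smult_l_distr)
    also have "\<dots> = (\<Oplus>\<^bsub>V\<^esub>p\<in>?S. x p \<odot>\<^bsub>V\<^esub> ?T p) \<oplus>\<^bsub>V\<^esub> (\<Oplus>\<^bsub>V\<^esub>p\<in>?S. y p \<odot>\<^bsub>V\<^esub> ?T p)"
      using T free_val[OF xy(1)] free_val[OF xy(2)] by (intro V.M.finsum_addf) auto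
    also have "\<dots> = H x \<oplus>\<^bsub>V\<^esub> H y" using ext[OF xy(1) S(1) _ S(2)] ext[OF xy(2) S(1) _ S(2)] by simp
    finally show ?thesis .
  qed
  have Hzero: "H \<zero>\<^bsub>free X\<^esub> = \<zero>\<^bsub>V\<^esub>"
  proof -
    have "?s \<zero>\<^bsub>free X\<^esub> = {}" by (auto simp: free_sel(2))
    thus ?thesis by (simp only: H_def V.M.finsum_empty)
  qed
  have sg: "H (sgl X p c) = c \<odot>\<^bsub>V\<^esub> ?T p" if p: "p \<in> X \<times> carrier M" "c \<in> carrier K" for p c
  proof -
    have "H (sgl X p c) = (\<Oplus>\<^bsub>V\<^esub>q\<in>{p}. sgl X p c q \<odot>\<^bsub>V\<^esub> ?T q)"
      by (rule ext[OF sgl_closed[OF p]]) (use p in \<open>auto simp: single_def\<close>)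
    also have "\<dots> = sgl X p c p \<odot>\<^bsub>V\<^esub> ?T p" using p T[OF p(1)] by (simp add: single_def)
    finally show ?thesis using p by (simp add: single_def)
  qed
  have sm: "H (a \<odot>\<^bsub>free X\<^esub> x) = a \<odot>\<^bsub>V\<^esub> H x" if "a \<in> carrier K" "x \<in> carrier (free X)" for a x
    using that(2)
  proof (induction rule: free_induct)
    interpret F: module K "free X" by (rule free_module)
    case zero show ?case using that Hzero by simp
  next
    case (single p c) thus ?case using that T by (simp add: sgl_smult sg V.smult_assoc1)
  next
    interpret F: module K "free X" by (rule free_module)
    case (add x y) thus ?case using that cl by (simp add: F.smult_r_distr free_smult_closed V.smult_r_distr Hadd)
  qed
  have ra: "H (x \<cdot>\<^bsub>free X\<^esub> g) = H x \<cdot>\<^bsub>V\<^esub> g" if "g \<in> carrier M" "x \<in> carrier (free X)" for g x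
    using that(2)
  proof (induction rule: free_induct)
    case zero show ?case using that Hzero by (simp add: free_ract_zero V.zero_ract)
  next
    case (single p c)
    then obtain b f where p: "p = (b, f)" "b \<in> X" "f \<in> carrier M" by blast
    thus ?case using single that T t by (simp add: free_ract_sgl sg V.ract_smult V.ract_mult V.ract_closed)
  next
    case (add x y) thus ?case using that cl by (simp add: free_ract_add Hadd free_ract_closed V.ract_add)
  qed
  have "H \<in> Hom (free X) V"
    by (rule rmodule_homI) (use cl Hadd sm ra in auto)
  moreover have "H (gen X b) = t b" if "b \<in> X" for b using sg[of "(b, \<one>\<^bsub>M\<^esub>)" "\<one>\<^bsub>K\<^esub>"] that t V.ract_one by simp
  ultimately show ?thesis by blast
qed

text \<open>In contrast to \<open>projective_rmodule\<close>, the index set may have any type.\<close>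

definition summand :: "'x set \<Rightarrow> ('k, 'v, 'm) rmodule \<Rightarrow> bool" where
  "summand X V \<longleftrightarrow> (\<exists>N N'. internal_direct_sum K M (free X) N N' \<and>
     rmodule_iso K M (free X\<lparr>carrier := N\<rparr>) V)"

lemma projective_iff_summand:
  "projective_rmodule K M V \<longleftrightarrow> rmod V \<and> (\<exists>X :: 'v set. summand X (V :: ('k, 'v, 'm) rmodule))"
  by (simp add: projective_rmodule_def summand_def)

section \<open>Lifting property and uniqueness of projective covers\<close>

lemma direct_sum_projection:
  assumes V: "rmod V" and ids: "internal_direct_sum K M V N N'"
  shows "\<exists>\<pi>\<in>Hom V V. (\<forall>x\<in>carrier V. \<pi> x \<in> N \<and> x \<ominus>\<^bsub>V\<^esub> \<pi> x \<in> N') \<and>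
    (\<forall>x\<in>N. \<pi> x = x) \<and> (\<forall>x\<in>N'. \<pi> x = \<zero>\<^bsub>V\<^esub>)"
proof -
  interpret V: right_module K M V by fact
  have NN: "submod V N" "submod V N'" "N \<inter> N' = {\<zero>\<^bsub>V\<^esub>}" "N <+>\<^bsub>V\<^esub> N' = carrier V"
    using ids by (auto simp: internal_direct_sum_def)
  note n = right_submoduleD[OF NN(1) V] and n' = right_submoduleD[OF NN(2) V]
  define \<pi> where "\<pi> x = (SOME y. y \<in> N \<and> x \<ominus>\<^bsub>V\<^esub> y \<in> N')" for x
  have ex: "\<exists>y. y \<in> N \<and> x \<ominus>\<^bsub>V\<^esub> y \<in> N'" if "x \<in> carrier V" for x
  proof -
    have "x \<in> N <+>\<^bsub>V\<^esub> N'" using that NN(4) by simp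
    then obtain a b where ab: "a \<in> N" "b \<in> N'" "x = a \<oplus>\<^bsub>V\<^esub> b" by (blast elim: set_addE)
    have c: "a \<in> carrier V" "b \<in> carrier V" using ab n(1) n'(1) by auto
    have "x \<ominus>\<^bsub>V\<^esub> a = b" using c ab(3) by (simp add: V.plus_minus_cancel)
    thus ?thesis using ab by blast
  qed
  have \<pi>: "\<pi> x \<in> N" "x \<ominus>\<^bsub>V\<^esub> \<pi> x \<in> N'" if "x \<in> carrier V" for x
    using someI_ex[OF ex[OF that]] unfolding \<pi>_def by blast+
  have uniq: "\<pi> x = y" if x: "x \<in> carrier V" and y: "y \<in> N" "x \<ominus>\<^bsub>V\<^esub> y \<in> N'" for x y
  proof -
    have c: "\<pi> x \<in> carrier V" "y \<in> carrier V" using \<pi>(1)[OF x] y n(1) by auto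
    have "(x \<ominus>\<^bsub>V\<^esub> y) \<ominus>\<^bsub>V\<^esub> (x \<ominus>\<^bsub>V\<^esub> \<pi> x) = \<pi> x \<ominus>\<^bsub>V\<^esub> y"
    proof -
      have "(x \<ominus>\<^bsub>V\<^esub> y) \<ominus>\<^bsub>V\<^esub> (x \<ominus>\<^bsub>V\<^esub> \<pi> x) = (x \<oplus>\<^bsub>V\<^esub> \<ominus>\<^bsub>V\<^esub> x) \<oplus>\<^bsub>V\<^esub> (\<pi> x \<oplus>\<^bsub>V\<^esub> \<ominus>\<^bsub>V\<^esub> y)"
        using x c by (simp add: a_minus_def V.minus_add V.a_ac)
      thus ?thesis using x c by (simp add: a_minus_def V.M.r_neg)
    qed
    hence "\<pi> x \<ominus>\<^bsub>V\<^esub> y \<in> N'" using n'(7)[OF y(2) \<pi>(2)[OF x]] by simp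
    moreover have "\<pi> x \<ominus>\<^bsub>V\<^esub> y \<in> N" using n(7)[OF \<pi>(1)[OF x] y(1)] .
    ultimately have "\<pi> x \<ominus>\<^bsub>V\<^esub> y = \<zero>\<^bsub>V\<^esub>" using NN(3) by blast
    thus ?thesis using c by (simp add: V.minus_eq_zero_iff)
  qed
  have "\<pi> \<in> Hom V V"
  proof (rule rmodule_homI)
    show "\<pi> x \<in> carrier V" if "x \<in> carrier V" for x using \<pi>(1)[OF that] n(1) by blast
  next
    fix x y assume xy: "x \<in> carrier V" "y \<in> carrier V"
    have c: "\<pi> x \<in> carrier V" "\<pi> y \<in> carrier V" using \<pi>(1) xy n(1) by auto
    have "(x \<oplus>\<^bsub>V\<^esub> y) \<ominus>\<^bsub>V\<^esub> (\<pi> x \<oplus>\<^bsub>V\<^esub> \<pi> y) = (x \<ominus>\<^bsub>V\<^esub> \<pi> x) \<oplus>\<^bsub>V\<^esub> (y \<ominus>\<^bsub>V\<^esub> \<pi> y)"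
      using xy c by (simp add: a_minus_def V.minus_add V.a_ac)
    thus "\<pi> (x \<oplus>\<^bsub>V\<^esub> y) = \<pi> x \<oplus>\<^bsub>V\<^esub> \<pi> y"
      using \<pi>(1)[OF xy(1)] \<pi>(1)[OF xy(2)] \<pi>(2)[OF xy(1)] \<pi>(2)[OF xy(2)] n(3) n'(3) xy by (intro uniq) auto
  next
    fix a x assume ax: "a \<in> carrier K" "x \<in> carrier V"
    have c: "\<pi> x \<in> carrier V" using \<pi>(1) ax n(1) by auto
    have "(a \<odot>\<^bsub>V\<^esub> x) \<ominus>\<^bsub>V\<^esub> (a \<odot>\<^bsub>V\<^esub> \<pi> x) = a \<odot>\<^bsub>V\<^esub> (x \<ominus>\<^bsub>V\<^esub> \<pi> x)"
      using ax c by (simp add: a_minus_def V.smult_r_distr V.smult_r_minus)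
    thus "\<pi> (a \<odot>\<^bsub>V\<^esub> x) = a \<odot>\<^bsub>V\<^esub> \<pi> x"
      using \<pi>(1)[OF ax(2)] \<pi>(2)[OF ax(2)] n(4) n'(4) ax by (intro uniq) auto
  next
    fix x f assume xf: "x \<in> carrier V" "f \<in> carrier M"
    have c: "\<pi> x \<in> carrier V" using \<pi>(1) xf n(1) by auto
    have "(x \<cdot>\<^bsub>V\<^esub> f) \<ominus>\<^bsub>V\<^esub> (\<pi> x \<cdot>\<^bsub>V\<^esub> f) = (x \<ominus>\<^bsub>V\<^esub> \<pi> x) \<cdot>\<^bsub>V\<^esub> f"
      using xf c by (simp add: a_minus_def V.ract_add V.neg_as_smult V.ract_smult V.ract_closed)
    thus "\<pi> (x \<cdot>\<^bsub>V\<^esub> f) = \<pi> x \<cdot>\<^bsub>V\<^esub> f"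
      using \<pi>(1)[OF xf(1)] \<pi>(2)[OF xf(1)] n(5) n'(5) xf V.ract_closed by (intro uniq) auto
  qed
  moreover have "\<pi> x = x" if "x \<in> N" for x
  proof -
    have "x \<in> carrier V" using that n(1) by blast
    moreover from this have "x \<ominus>\<^bsub>V\<^esub> x \<in> N'" using n'(2) V.minus_eq_zero_iff[of x x] by simp
    ultimately show ?thesis using uniq that by blast
  qed
  moreover have "\<pi> x = \<zero>\<^bsub>V\<^esub>" if "x \<in> N'" for x
  proof -
    have x: "x \<in> carrier V" using that n'(1) by blast
    have "x \<ominus>\<^bsub>V\<^esub> \<zero>\<^bsub>V\<^esub> = x" using V.plus_minus_cancel[of "\<zero>\<^bsub>V\<^esub>" x] x by simp
    thus ?thesis using uniq[OF x n(2)] that by simp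
  qed
  ultimately show ?thesis using \<pi> by blast
qed

text \<open>The homomorphism h is extended to the free module by the projection onto the summand,
  lifted there on generators, and restricted back to Q.\<close>

lemma summand_lift:
  assumes "summand X Q" "rmod Q" "rmod P" "rmod V"
    "g \<in> Hom P V" "g ` carrier P = carrier V" "h \<in> Hom Q V"
  shows "\<exists>k\<in>Hom Q P. \<forall>x\<in>carrier Q. g (k x) = h x"
proof -
  obtain N N' where ids: "internal_direct_sum K M (free X) N N'" and "rmodule_iso K M (free X\<lparr>carrier := N\<rparr>) Q"
    using assms(1) by (auto simp: summand_def)
  have F: "rmod (free X)" by (rule free_right_module)
  have N: "submod (free X) N" using ids by (simp add: internal_direct_sum_def)
  have NF: "rmod (free X\<lparr>carrier := N\<rparr>)" by (rule right_module_sub[OF F N])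
  have NX: "N \<subseteq> carrier (free X)" by (rule right_submoduleD(1)[OF N F])
  have "rmodule_iso K M Q (free X\<lparr>carrier := N\<rparr>)"
    by (rule rmodule_iso_sym[OF NF assms(2)]) fact
  then obtain j where j: "j \<in> Hom Q (free X\<lparr>carrier := N\<rparr>)" "bij_betw j (carrier Q) N"
    by (auto simp: rmodule_iso_def)
  obtain i where i: "i \<in> Hom (free X\<lparr>carrier := N\<rparr>) Q" "\<And>x. x \<in> carrier Q \<Longrightarrow> i (j x) = x"
  proof -
    let ?i = "the_inv_into (carrier Q) j"
    have inj: "inj_on j (carrier Q)" and im: "j ` carrier Q = N" using j(2) by (auto simp: bij_betw_def)
    interpret Q: right_module K M Q by fact
    have ij: "?i (j x) = x" if "x \<in> carrier Q" for x using the_inv_into_f_f[OF inj that] .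
    have ex: "\<exists>x\<in>carrier Q. y = j x" if "y \<in> N" for y using that im by blast
    note jh = rmodule_homD[OF j(1), simplified]
    have "?i \<in> Hom (free X\<lparr>carrier := N\<rparr>) Q"
    proof (rule rmodule_homI)
      fix y z assume "y \<in> carrier (free X\<lparr>carrier := N\<rparr>)" "z \<in> carrier (free X\<lparr>carrier := N\<rparr>)"
      hence "y \<in> N" "z \<in> N" by simp_all
      then obtain a b where ab: "a \<in> carrier Q" "y = j a" "b \<in> carrier Q" "z = j b" using ex by meson
      hence "y \<oplus>\<^bsub>free X\<lparr>carrier := N\<rparr>\<^esub> z = j (a \<oplus>\<^bsub>Q\<^esub> b)" using jh(2) by simp
      thus "?i (y \<oplus>\<^bsub>free X\<lparr>carrier := N\<rparr>\<^esub> z) = ?i y \<oplus>\<^bsub>Q\<^esub> ?i z" using ab by (simp add: ij)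
    next
      fix c y assume "c \<in> carrier K" "y \<in> carrier (free X\<lparr>carrier := N\<rparr>)"
      then obtain a where ab: "c \<in> carrier K" "a \<in> carrier Q" "y = j a" using ex by force
      hence "c \<odot>\<^bsub>free X\<lparr>carrier := N\<rparr>\<^esub> y = j (c \<odot>\<^bsub>Q\<^esub> a)" using jh(3) by simp
      thus "?i (c \<odot>\<^bsub>free X\<lparr>carrier := N\<rparr>\<^esub> y) = c \<odot>\<^bsub>Q\<^esub> ?i y" using ab by (simp add: ij)
    next
      fix y f assume "f \<in> carrier M" "y \<in> carrier (free X\<lparr>carrier := N\<rparr>)"
      then obtain a where ab: "f \<in> carrier M" "a \<in> carrier Q" "y = j a" using ex by force
      hence "y \<cdot>\<^bsub>free X\<lparr>carrier := N\<rparr>\<^esub> f = j (a \<cdot>\<^bsub>Q\<^esub> f)" using jh(4) by simp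
      thus "?i (y \<cdot>\<^bsub>free X\<lparr>carrier := N\<rparr>\<^esub> f) = ?i y \<cdot>\<^bsub>Q\<^esub> f" using ab by (simp add: ij Q.ract_closed)
    next
      fix y assume "y \<in> carrier (free X\<lparr>carrier := N\<rparr>)"
      then obtain a where "a \<in> carrier Q" "y = j a" using ex by force
      thus "?i y \<in> carrier Q" by (simp add: ij)
    qed
    thus ?thesis using that ij by blast
  qed
  obtain \<pi> where \<pi>: "\<pi> \<in> Hom (free X) (free X)" "\<And>x. x \<in> carrier (free X) \<Longrightarrow> \<pi> x \<in> N"
    "\<And>x. x \<in> N \<Longrightarrow> \<pi> x = x"
    using direct_sum_projection[OF F ids] by blast
  have \<pi>N: "\<pi> \<in> Hom (free X) (free X\<lparr>carrier := N\<rparr>)"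
    by (rule rmodule_hom_into_sub[OF \<pi>(1)]) (use \<pi>(2) in auto)
  define h' where "h' x = h (i (\<pi> x))" for x
  have h': "h' \<in> Hom (free X) V"
    unfolding h'_def by (rule rmodule_hom_comp[OF rmodule_hom_comp[OF \<pi>N i(1)] assms(7)])
  have gc: "gen X b \<in> carrier (free X)" if "b \<in> X" for b using that by (simp add: sgl_closed)
  have ex: "\<exists>y. y \<in> carrier P \<and> g y = h' (gen X b)" if "b \<in> X" for b
    using rmodule_homD(1)[OF h' gc[OF that]] assms(6) by (metis imageE)
  define t where "t b = (SOME y. y \<in> carrier P \<and> g y = h' (gen X b))" for b
  have t: "t b \<in> carrier P" "g (t b) = h' (gen X b)" if "b \<in> X" for b
    using someI_ex[OF ex[OF that]] unfolding t_def by blast+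
  obtain H where H: "H \<in> Hom (free X) P" "\<And>b. b \<in> X \<Longrightarrow> H (gen X b) = t b"
    using free_lift[OF assms(3), of X t] t(1) by blast
  have gH: "g (H x) = h' x" if "x \<in> carrier (free X)" for x
    by (rule free_hom_eq[OF assms(4) rmodule_hom_comp[OF H(1) assms(5)] h' _ that]) (simp add: H(2) t(2))
  have jF: "j \<in> Hom Q (free X)" by (rule rmodule_hom_from_sub[OF j(1) NX])
  have "(\<lambda>x. H (j x)) \<in> Hom Q P" by (rule rmodule_hom_comp[OF jF H(1)])
  moreover have "g (H (j x)) = h x" if x: "x \<in> carrier Q" for x
  proof -
    have "j x \<in> N" using j(2) x by (auto simp: bij_betw_def)
    thus ?thesis using gH[OF rmodule_homD(1)[OF jF x]] \<pi>(3) i(2)[OF x] by (simp add: h'_def)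
  qed
  ultimately show ?thesis by (intro bexI[of _ "\<lambda>x. H (j x)"]) auto
qed

text \<open>Projectivity of P gives a section of g. Its image is a complement of the kernel of g,
  and indecomposability of Q makes that kernel trivial.\<close>

lemma surjection_onto_projective_iso:
  assumes "indecomposable_rmodule K M Q" "rmod P" "summand X P" "carrier P \<noteq> {\<zero>\<^bsub>P\<^esub>}"
    "g \<in> Hom Q P" "g ` carrier Q = carrier P"
  shows "rmodule_iso K M Q P"
proof -
  have Q: "rmod Q" using assms by (simp add: indecomposable_rmodule_def)
  interpret Q: right_module K M Q by fact
  interpret P: right_module K M P by fact
  obtain \<sigma> where \<sigma>: "\<sigma> \<in> Hom P Q" "\<And>x. x \<in> carrier P \<Longrightarrow> g (\<sigma> x) = x"
    using summand_lift[OF assms(3,2) Q assms(2,5,6) rmodule_hom_id] by blast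
  let ?N = "\<sigma> ` carrier P" and ?Z = "{x \<in> carrier Q. g x = \<zero>\<^bsub>P\<^esub>}"
  note gh = rmodule_homD[OF assms(5)] and sh = rmodule_homD[OF \<sigma>(1)]
  have N: "submod Q ?N" by (rule right_submodule_image[OF \<sigma>(1) assms(2) Q right_submodule_carrier[OF assms(2)]])
  have Z: "submod Q ?Z" by (rule right_submodule_kernel[OF assms(5) Q assms(2)])
  have "?N \<inter> ?Z = {\<zero>\<^bsub>Q\<^esub>}"
  proof -
    have "x = \<zero>\<^bsub>Q\<^esub>" if "x \<in> ?N \<inter> ?Z" for x
      using that \<sigma>(2) rmodule_hom_zero[OF \<sigma>(1) assms(2) Q] by auto
    thus ?thesis using right_submoduleD(2)[OF N Q] right_submoduleD(2)[OF Z Q] by blast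
  qed
  moreover have "?N <+>\<^bsub>Q\<^esub> ?Z = carrier Q"
  proof (intro equalityI subsetI)
    fix x assume "x \<in> ?N <+>\<^bsub>Q\<^esub> ?Z"
    thus "x \<in> carrier Q" unfolding set_add_defs using sh(1) by auto
  next
    fix x assume x: "x \<in> carrier Q"
    have c: "g x \<in> carrier P" "\<sigma> (g x) \<in> carrier Q" using gh(1) sh(1) x by auto
    have "g (x \<ominus>\<^bsub>Q\<^esub> \<sigma> (g x)) = \<zero>\<^bsub>P\<^esub>"
      using rmodule_hom_minus[OF assms(5) Q assms(2) x c(2)] \<sigma>(2) c by (simp add: P.minus_eq_zero_iff)
    hence "x \<ominus>\<^bsub>Q\<^esub> \<sigma> (g x) \<in> ?Z" using x c by simp
    thus "x \<in> ?N <+>\<^bsub>Q\<^esub> ?Z" using Q.minus_plus_cancel[OF c(2) x] c by (intro set_addI) auto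
  qed
  ultimately have "internal_direct_sum K M Q ?N ?Z" using N Z by (simp add: internal_direct_sum_def)
  hence "?N = {\<zero>\<^bsub>Q\<^esub>} \<or> ?Z = {\<zero>\<^bsub>Q\<^esub>}" using assms(1) by (simp add: indecomposable_rmodule_def)
  moreover have "?N \<noteq> {\<zero>\<^bsub>Q\<^esub>}"
  proof
    assume e: "?N = {\<zero>\<^bsub>Q\<^esub>}"
    have "x = \<zero>\<^bsub>P\<^esub>" if x: "x \<in> carrier P" for x
    proof -
      have "\<sigma> x = \<zero>\<^bsub>Q\<^esub>" using e x by blast
      thus ?thesis using \<sigma>(2)[OF x] rmodule_hom_zero[OF assms(5) Q assms(2)] by simp
    qed
    thus False using assms(4) P.M.zero_closed by (metis P.zero_closed equalityI insertI1 singletonD subsetI)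
  qed
  ultimately have Z0: "?Z = {\<zero>\<^bsub>Q\<^esub>}" by blast
  show ?thesis
  proof (rule iso_of_surjections[OF Q Q assms(2) rmodule_hom_id _ assms(5,6)])
    fix x assume "x \<in> carrier Q"
    thus "x = \<zero>\<^bsub>Q\<^esub> \<longleftrightarrow> g x = \<zero>\<^bsub>P\<^esub>" using Z0 rmodule_hom_zero[OF assms(5) Q assms(2)] by blast
  qed simp
qed

lemma projective_cover_unique:
  assumes "indecomposable_rmodule K M Q" "summand Y Q" "summand X P" "carrier P \<noteq> {\<zero>\<^bsub>P\<^esub>}"
    "projective_cover K M P p S" "q \<in> Hom Q S" "q ` carrier Q = carrier S"
  shows "rmodule_iso K M Q P"
proof -
  have Q: "rmod Q" using assms by (simp add: indecomposable_rmodule_def)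
  have P: "rmod P" and S: "rmod S" and p: "p \<in> Hom P S" "p ` carrier P = carrier S"
    and sup: "\<And>N. submod P N \<Longrightarrow> N <+>\<^bsub>P\<^esub> a_kernel P S p = carrier P \<Longrightarrow> N = carrier P"
    using assms(5) by (auto simp: projective_cover_def projective_rmodule_def)
  interpret P: right_module K M P by fact
  interpret S: right_module K M S by fact
  obtain k where k: "k \<in> Hom Q P" "\<And>x. x \<in> carrier Q \<Longrightarrow> p (k x) = q x"
    using summand_lift[OF assms(2) Q P S p assms(6)] by blast
  have N: "submod P (k ` carrier Q)"
    by (rule right_submodule_image[OF k(1) Q P right_submodule_carrier[OF Q]])
  have "k ` carrier Q <+>\<^bsub>P\<^esub> a_kernel P S p = carrier P"
  proof (intro equalityI subsetI)
    fix x assume "x \<in> k ` carrier Q <+>\<^bsub>P\<^esub> a_kernel P S p"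
    thus "x \<in> carrier P" using rmodule_homD(1)[OF k(1)] unfolding set_add_defs a_kernel_defs by auto
  next
    fix x assume x: "x \<in> carrier P"
    then obtain y where y: "y \<in> carrier Q" "p x = q y" using rmodule_homD(1)[OF p(1) x] assms(7) by (metis imageE)
    have c: "k y \<in> carrier P" using rmodule_homD(1)[OF k(1) y(1)] .
    have "p (x \<ominus>\<^bsub>P\<^esub> k y) = \<zero>\<^bsub>S\<^esub>"
      using rmodule_hom_minus[OF p(1) P S x c] k(2)[OF y(1)] y(2) rmodule_homD(1)[OF p(1) x] by (simp add: S.minus_eq_zero_iff)
    hence "x \<ominus>\<^bsub>P\<^esub> k y \<in> a_kernel P S p" using x c by (simp add: a_kernel_defs)
    thus "x \<in> k ` carrier Q <+>\<^bsub>P\<^esub> a_kernel P S p"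
      using P.minus_plus_cancel[OF c x] y by (intro set_addI) auto
  qed
  hence "k ` carrier Q = carrier P" by (rule sup[OF N])
  thus ?thesis by (rule surjection_onto_projective_iso[OF assms(1) P assms(3,4) k(1)])
qed

text \<open>If q did not vanish on the kernel of p, this proper submodule would fill P together with
  the kernel of q, against superfluity. So one kernel contains the other, and maximality makes them
  equal.\<close>

lemma projective_cover_top_unique:
  assumes "projective_cover K M P p S" "projective_cover K M P q T" "simple_rmodule K M S" "simple_rmodule K M T"
  shows "rmodule_iso K M S T"
proof -
  have P: "rmod P" and p: "p \<in> Hom P S" "p ` carrier P = carrier S"
    using assms(1) by (auto simp: projective_cover_def projective_rmodule_def)
  have S: "rmod S" and T: "rmod T" and q: "q \<in> Hom P T" "q ` carrier P = carrier T"
    using assms(1,2) by (auto simp: projective_cover_def)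
  have sup: "N = carrier P" if "submod P N" "N <+>\<^bsub>P\<^esub> a_kernel P T q = carrier P" for N
    using assms(2) that unfolding projective_cover_def by blast
  interpret P: right_module K M P by fact
  interpret T: right_module K M T by fact
  interpret S: right_module K M S by fact
  let ?Z = "{x \<in> carrier P. p x = \<zero>\<^bsub>S\<^esub>}"
  have Z: "submod P ?Z" by (rule right_submodule_kernel[OF p(1) P S])
  have ZP: "?Z \<noteq> carrier P"
  proof
    assume e: "?Z = carrier P"
    have "carrier S = {\<zero>\<^bsub>S\<^esub>}" by (rule hom_zero_image[OF _ p(2) S.M.zero_closed]) (use e in blast)
    thus False using assms(3) by (simp add: simple_rmodule_def)
  qed
  have sub: "q x = \<zero>\<^bsub>T\<^esub>" if "x \<in> ?Z" for x
  proof (rule ccontr)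
    assume x0: "q x \<noteq> \<zero>\<^bsub>T\<^esub>"
    have "submod T (q ` ?Z)" by (rule right_submodule_image[OF q(1) P T Z])
    hence qZ: "q ` ?Z = carrier T" using assms(4) that x0 unfolding simple_rmodule_def by blast
    have "?Z <+>\<^bsub>P\<^esub> a_kernel P T q = carrier P"
    proof (intro equalityI subsetI)
      fix x assume "x \<in> ?Z <+>\<^bsub>P\<^esub> a_kernel P T q"
      thus "x \<in> carrier P" unfolding set_add_defs a_kernel_defs by auto
    next
      fix x assume x: "x \<in> carrier P"
      have "q x \<in> q ` ?Z" unfolding qZ by (rule rmodule_homD(1)[OF q(1) x])
      then obtain y where y: "y \<in> ?Z" "q x = q y" by blast
      have c: "y \<in> carrier P" using y by simp
      have "q (x \<ominus>\<^bsub>P\<^esub> y) = \<zero>\<^bsub>T\<^esub>"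
        using rmodule_hom_minus[OF q(1) P T x c] y(2) rmodule_homD(1)[OF q(1) x] by (simp add: T.minus_eq_zero_iff)
      hence "x \<ominus>\<^bsub>P\<^esub> y \<in> a_kernel P T q" using x c by (simp add: a_kernel_defs)
      thus "x \<in> ?Z <+>\<^bsub>P\<^esub> a_kernel P T q" using P.minus_plus_cancel[OF c x] y(1) by (intro set_addI) auto
    qed
    thus False using sup[OF Z] ZP by blast
  qed
  have "p x = \<zero>\<^bsub>S\<^esub> \<longleftrightarrow> q x = \<zero>\<^bsub>T\<^esub>" if x: "x \<in> carrier P" for x
  proof
    assume "p x = \<zero>\<^bsub>S\<^esub>" thus "q x = \<zero>\<^bsub>T\<^esub>" using sub x by blast
  next
    assume qx: "q x = \<zero>\<^bsub>T\<^esub>"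
    let ?Y = "{x \<in> carrier P. q x = \<zero>\<^bsub>T\<^esub>}"
    show "p x = \<zero>\<^bsub>S\<^esub>"
    proof (rule ccontr)
      assume "p x \<noteq> \<zero>\<^bsub>S\<^esub>"
      hence "?Y = carrier P"
        using simple_kernel_maximal[OF assms(3) P p(1) right_submodule_kernel[OF q(1) P T], of x] sub x qx by blast
      hence "carrier T = {\<zero>\<^bsub>T\<^esub>}" by (intro hom_zero_image[OF _ q(2) T.M.zero_closed]) blast
      thus False using assms(4) by (simp add: simple_rmodule_def)
    qed
  qed
  thus ?thesis by (rule iso_of_surjections[OF P S T p q])
qed

section \<open>Counting dimensions in the free module on one generator\<close>

lemma finite_pairs: "finite ({b} \<times> carrier M)"
  using finite_monoid by simp

text \<open>The pivots of a subspace of \<open>free {b}\<close>: positions of the leading coefficients with respect to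
  a fixed enumeration of the basis. Their number plays the role of the dimension.\<close>

definition enum :: "'x \<times> 'm \<Rightarrow> nat" where
  "enum p = (SOME e. inj_on e (carrier M) \<and> e ` carrier M = {..<card (carrier M)}) (snd p)"

definition pivots :: "'x \<Rightarrow> ('x \<times> 'm \<Rightarrow> 'k) set \<Rightarrow> ('x \<times> 'm) set" where
  "pivots b N = {p \<in> {b} \<times> carrier M. \<exists>x\<in>N. x p \<noteq> \<zero>\<^bsub>K\<^esub> \<and>
     (\<forall>q\<in>{b} \<times> carrier M. enum q < enum p \<longrightarrow> x q = \<zero>\<^bsub>K\<^esub>)}"

lemma enum_bij: "inj_on enum ({b} \<times> carrier M)" "p \<in> {b} \<times> carrier M \<Longrightarrow> enum p < card (carrier M)"
proof -
  have "\<exists>e. bij_betw e (carrier M) {..<card (carrier M)}"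
    using ex_bij_betw_finite_nat[OF finite_monoid] by (simp add: atLeast0LessThan)
  hence "\<exists>e. inj_on e (carrier M) \<and> e ` carrier M = {..<card (carrier M)}"
    by (simp add: bij_betw_def)
  from someI_ex[OF this] have *: "inj_on (SOME e. inj_on e (carrier M) \<and> e ` carrier M = {..<card (carrier M)}) (carrier M)"
    "(SOME e. inj_on e (carrier M) \<and> e ` carrier M = {..<card (carrier M)}) ` carrier M = {..<card (carrier M)}"
    by blast+
  show "inj_on enum ({b} \<times> carrier M)" using inj_onD[OF *(1)] by (auto simp: enum_def intro!: inj_onI)
  show "p \<in> {b} \<times> carrier M \<Longrightarrow> enum p < card (carrier M)" using *(2) by (auto simp: enum_def)
qed

lemma pivots_subset: "pivots b N \<subseteq> {b} \<times> carrier M"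
  by (auto simp: pivots_def)

lemma finite_pivots: "finite (pivots b N)"
  using finite_subset[OF pivots_subset finite_pairs] .

lemma pivots_mono: "N \<subseteq> N' \<Longrightarrow> pivots b N \<subseteq> pivots b N'"
  by (auto simp: pivots_def)

text \<open>Elimination position by position: if x in N' vanishes before position k, subtracting a
  multiple of a vector of N with pivot at k makes it vanish at k as well. The induction runs over
  the number of positions left.\<close>

lemma pivots_eq:
  assumes N: "submod (free {b}) N" and N': "submod (free {b}) N'"
    and sub: "N \<subseteq> N'" "pivots b N' \<subseteq> pivots b N"
  shows "N = N'"
proof -
  interpret F: right_module K M "free {b}" by (rule free_right_module)
  note n = right_submoduleD[OF N F.right_module_axioms] and n' = right_submoduleD[OF N' F.right_module_axioms]
  have "x \<in> N" if "x \<in> N'" "\<And>q. q \<in> {b} \<times> carrier M \<Longrightarrow> enum q < k \<Longrightarrow> x q = \<zero>\<^bsub>K\<^esub>" for k x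
    using that
  proof (induction "card (carrier M) - k" arbitrary: k x)
    case 0
    have xc: "x \<in> carrier (free {b})" using 0 n'(1) by blast
    have "x = \<zero>\<^bsub>free {b}\<^esub>"
    proof (rule free_eqI[OF xc free_zero_closed])
      fix p assume p: "p \<in> {b} \<times> carrier M"
      thus "x p = \<zero>\<^bsub>free {b}\<^esub> p" using 0 enum_bij(2)[OF p] by (simp add: free_sel(2))
    qed
    thus ?case using n(2) by simp
  next
    case (Suc d)
    have IH: "y \<in> N" if "y \<in> N'" "\<And>q. q \<in> {b} \<times> carrier M \<Longrightarrow> enum q < Suc k \<Longrightarrow> y q = \<zero>\<^bsub>K\<^esub>" for y
      using Suc.hyps(1)[of "Suc k" y] Suc.hyps(2) that by simp
    show ?case
    proof (cases "\<exists>p\<in>{b} \<times> carrier M. enum p = k \<and> x p \<noteq> \<zero>\<^bsub>K\<^esub>")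
      case False
      show ?thesis
      proof (rule IH[OF Suc.prems(1)])
        fix q assume q: "q \<in> {b} \<times> carrier M" "enum q < Suc k"
        show "x q = \<zero>\<^bsub>K\<^esub>" using False q Suc.prems(2)[OF q(1)] by (cases "enum q = k") auto
      qed
    next
      case True
      then obtain p where p: "p \<in> {b} \<times> carrier M" "enum p = k" "x p \<noteq> \<zero>\<^bsub>K\<^esub>" by blast
      have "p \<in> pivots b N'" unfolding pivots_def using p Suc.prems by blast
      hence "p \<in> pivots b N" using sub by blast
      then obtain y where y: "y \<in> N" "y p \<noteq> \<zero>\<^bsub>K\<^esub>" "\<And>q. q \<in> {b} \<times> carrier M \<Longrightarrow> enum q < enum p \<Longrightarrow> y q = \<zero>\<^bsub>K\<^esub>"
        unfolding pivots_def by blast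
      have c: "x \<in> carrier (free {b})" "y \<in> carrier (free {b})" using Suc.prems(1) y(1) n(1) n'(1) by auto
      have v: "x p \<in> carrier K" "y p \<in> carrier K" using free_val[OF c(1) p(1)] free_val[OF c(2) p(1)] .
      have yu: "y p \<in> Units K" using v y(2) K.field_Units by simp
      define a where "a = \<ominus>\<^bsub>K\<^esub> (x p \<otimes>\<^bsub>K\<^esub> inv\<^bsub>K\<^esub> (y p))"
      have a: "a \<in> carrier K" using v yu by (simp add: a_def)
      have ay: "a \<otimes>\<^bsub>K\<^esub> y p = \<ominus>\<^bsub>K\<^esub> x p" using v yu by (simp add: a_def K.l_minus K.m_assoc)
      define z where "z = x \<oplus>\<^bsub>free {b}\<^esub> (a \<odot>\<^bsub>free {b}\<^esub> y)"
      have zN': "z \<in> N'" using n'(3,4) Suc.prems(1) y(1) sub(1) a by (auto simp: z_def)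
      have zN: "z \<in> N"
      proof (rule IH[OF zN'])
        fix q assume q: "q \<in> {b} \<times> carrier M" "enum q < Suc k"
        have zq: "z q = x q \<oplus>\<^bsub>K\<^esub> a \<otimes>\<^bsub>K\<^esub> y q" using q by (simp add: z_def free_sel(3,4))
        show "z q = \<zero>\<^bsub>K\<^esub>"
        proof (cases "enum q = k")
          case True
          hence "q = p" using inj_onD[OF enum_bij(1)] p q by metis
          thus ?thesis using zq ay v by (simp add: K.r_neg)
        next
          case False
          hence "x q = \<zero>\<^bsub>K\<^esub>" "y q = \<zero>\<^bsub>K\<^esub>" using q p Suc.prems(2)[OF q(1)] y(3)[OF q(1)] by auto
          thus ?thesis using zq a by simp
        qed
      qed
      have "x = z \<oplus>\<^bsub>free {b}\<^esub> ((\<ominus>\<^bsub>K\<^esub> a) \<odot>\<^bsub>free {b}\<^esub> y)"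
        unfolding z_def using c a by (simp add: F.smult_l_minus F.a_assoc F.M.r_neg)
      thus ?thesis using n(3)[OF zN n(4)[OF _ y(1)]] a by simp
    qed
  qed
  from this[of _ 0] show ?thesis using sub(1) by blast
qed

lemma pivots_card_less:
  assumes "submod (free {b}) N" "submod (free {b}) N'" "N \<subset> N'"
  shows "card (pivots b N) < card (pivots b N')"
proof -
  have "N \<subseteq> N'" "N \<noteq> N'" using assms(3) by auto
  hence "pivots b N \<subseteq> pivots b N'" "pivots b N \<noteq> pivots b N'"
    using pivots_mono[of N N' b] pivots_eq[OF assms(1,2)] by auto
  thus ?thesis by (intro psubset_card_mono finite_pivots) blast
qed

lemma maximal_submodule_exists:
  assumes I: "submod (free {b}) I" "I \<noteq> {\<zero>\<^bsub>free {b}\<^esub>}"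
  shows "\<exists>N. submod (free {b}) N \<and> N \<subset> I \<and>
    (\<forall>N'. submod (free {b}) N' \<longrightarrow> N \<subseteq> N' \<longrightarrow> N' \<subseteq> I \<longrightarrow> N' = N \<or> N' = I)"
proof -
  let ?P = "\<lambda>N. submod (free {b}) N \<and> N \<subset> I"
  have z: "?P {\<zero>\<^bsub>free {b}\<^esub>}"
    using right_submodule_zero[OF free_right_module] right_submoduleD(2)[OF I(1) free_right_module] I(2) by blast
  have "card (pivots b N) < Suc (card ({b} \<times> carrier M))" for N
    by (simp add: less_Suc_eq_le card_mono[OF finite_pairs pivots_subset])
  hence "\<exists>N. ?P N \<and> (\<forall>N'. ?P N' \<longrightarrow> card (pivots b N') \<le> card (pivots b N))"
    by (intro ex_has_greatest_nat[of ?P "{\<zero>\<^bsub>free {b}\<^esub>}" _ "Suc (card ({b} \<times> carrier M))"] z) blast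
  then obtain N where N: "?P N" "\<And>N'. ?P N' \<Longrightarrow> card (pivots b N') \<le> card (pivots b N)" by blast
  have "N' = N \<or> N' = I" if "submod (free {b}) N'" "N \<subseteq> N'" "N' \<subseteq> I" for N'
  proof (rule ccontr)
    assume "\<not> (N' = N \<or> N' = I)"
    hence "?P N'" "N \<subset> N'" using that by auto
    thus False using N(2)[of N'] pivots_card_less[of b N N'] N(1) by simp
  qed
  thus ?thesis using N(1) by blast
qed

text \<open>Fitting's lemma for an indecomposable submodule of \<open>free {b}\<close>.\<close>

lemma indecomposable_endomorphism:
  assumes D: "submod (free {b}) D" "indecomposable_rmodule K M (free {b}\<lparr>carrier := D\<rparr>)"
    and \<phi>: "\<phi> \<in> Hom (free {b}\<lparr>carrier := D\<rparr>) (free {b}\<lparr>carrier := D\<rparr>)"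
  shows "\<phi> ` D = D \<or> (\<exists>n. \<forall>x\<in>D. (\<phi> ^^ n) x = \<zero>\<^bsub>free {b}\<^esub>)"
proof -
  let ?F = "free {b}" and ?D = "free {b}\<lparr>carrier := D\<rparr>"
  have F: "rmod ?F" by (rule free_right_module)
  have Dm: "rmod ?D" by (rule right_module_sub[OF F D(1)])
  interpret Dm: right_module K M ?D by fact
  have pow: "(\<phi> ^^ n) \<in> Hom ?D ?D" for n
  proof (induction n)
    case 0 thus ?case using rmodule_hom_id[of K M ?D] by (simp add: id_def)
  next
    case (Suc n) thus ?case using rmodule_hom_comp[OF Suc \<phi>] by (simp add: comp_def)
  qed
  note ph = rmodule_homD[OF pow, simplified]
  let ?E = "\<lambda>n. (\<phi> ^^ n) ` D" and ?Z = "\<lambda>n. {x \<in> D. (\<phi> ^^ n) x = \<zero>\<^bsub>?F\<^esub>}"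
  have Esub: "submod ?F (?E n)" "submod ?D (?E n)" "?E n \<subseteq> D" for n
  proof -
    show "submod ?D (?E n)"
      using right_submodule_image[OF pow Dm Dm right_submodule_carrier[OF Dm], of n] by simp
    thus "submod ?F (?E n)" "?E n \<subseteq> D" using right_submodule_sub_iff[OF F D(1)] by auto
  qed
  have Zsub: "submod ?F (?Z n)" "submod ?D (?Z n)" for n
  proof -
    show "submod ?D (?Z n)" using right_submodule_kernel[OF pow Dm Dm, of n] by simp
    thus "submod ?F (?Z n)" using right_submodule_sub_iff[OF F D(1)] by auto
  qed
  have zero: "(\<phi> ^^ n) \<zero>\<^bsub>?F\<^esub> = \<zero>\<^bsub>?F\<^esub>" for n using rmodule_hom_zero[OF pow Dm Dm, of n] by simp
  have Edec: "?E (m + n) \<subseteq> ?E m" for m n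
    using ph(1)[of _ n] by (auto simp: funpow_add)
  have Zinc: "?Z m \<subseteq> ?Z (n + m)" for m n using zero by (auto simp: funpow_add)
  define f where "f n = card (pivots b (?E n))" for n
  define g where "g n = card ({b} \<times> carrier M) - card (pivots b (?Z n))" for n
  \<comment> \<open>A positive exponent from which image and kernel no longer change under doubling,
    both being monotone. The shift by \<open>Suc\<close> matters at the end, where the image of the
    n-th power has to lie in the image of \<phi> itself.\<close>
  have "\<exists>n. \<forall>m. f (Suc n) + g (Suc n) \<le> f (Suc m) + g (Suc m)"
    using ex_has_least_nat[of "\<lambda>_. True" 0 "\<lambda>n. f (Suc n) + g (Suc n)"] by blast
  then obtain n0 where n0: "\<And>m. f (Suc n0) + g (Suc n0) \<le> f (Suc m) + g (Suc m)" by blast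
  define n where "n = Suc n0"
  have fm: "f (n + n) \<le> f n" unfolding f_def by (intro card_mono finite_pivots pivots_mono Edec)
  have gm: "g (n + n) \<le> g n" unfolding g_def by (intro diff_le_mono2 card_mono finite_pivots pivots_mono Zinc)
  have eqs: "f (n + n) = f n" "g (n + n) = g n" using n0[of "n0 + n"] fm gm by (auto simp: n_def)
  have E: "?E (n + n) = ?E n"
    using pivots_card_less[OF Esub(1)[of "n + n"] Esub(1)[of n]] Edec[of n n] eqs(1) by (auto simp: f_def)
  have Z: "?Z (n + n) = ?Z n"
  proof (rule ccontr)
    assume "?Z (n + n) \<noteq> ?Z n"
    hence "card (pivots b (?Z n)) < card (pivots b (?Z (n + n)))"
      using pivots_card_less[OF Zsub(1)[of n] Zsub(1)[of "n + n"]] Zinc[of n n] by blast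
    moreover have "card (pivots b (?Z (n + n))) \<le> card ({b} \<times> carrier M)"
      by (rule card_mono[OF finite_pairs pivots_subset])
    ultimately show False using eqs(2) unfolding g_def by linarith
  qed
  have "internal_direct_sum K M ?D (?E n) (?Z n)"
    unfolding internal_direct_sum_def
  proof (intro conjI Esub Zsub)
    show "?E n \<inter> ?Z n = {\<zero>\<^bsub>?D\<^esub>}"
    proof -
      have "x = \<zero>\<^bsub>?F\<^esub>" if x: "x \<in> ?E n" "x \<in> ?Z n" for x
      proof -
        from x obtain y where y: "y \<in> D" "x = (\<phi> ^^ n) y" by blast
        hence "y \<in> ?Z (n + n)" using x(2) by (simp add: funpow_add)
        hence "y \<in> ?Z n" unfolding Z .
        thus ?thesis using y by simp
      qed
      thus ?thesis using right_submoduleD(2)[OF Esub(1) F, of n] right_submoduleD(2)[OF Zsub(1) F, of n] by auto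
    qed
    show sum: "?E n <+>\<^bsub>?D\<^esub> ?Z n = carrier ?D"
    proof (intro equalityI subsetI)
      fix x assume "x \<in> ?E n <+>\<^bsub>?D\<^esub> ?Z n"
      then obtain u v where "u \<in> ?E n" "v \<in> ?Z n" "x = u \<oplus>\<^bsub>?D\<^esub> v" by (blast elim: set_addE)
      thus "x \<in> carrier ?D" using Dm.M.a_closed[of u v] Esub(3)[of n] by auto
    next
      fix x assume x: "x \<in> carrier ?D"
      hence "(\<phi> ^^ n) x \<in> ?E (n + n)" unfolding E by simp
      then obtain y where y: "y \<in> D" "(\<phi> ^^ n) x = (\<phi> ^^ n) ((\<phi> ^^ n) y)" by (auto simp: funpow_add)
      define u where "u = (\<phi> ^^ n) y"
      have u: "u \<in> ?E n" "u \<in> carrier ?D" using y ph(1)[of y n] by (auto simp: u_def)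
      have "(\<phi> ^^ n) (x \<ominus>\<^bsub>?D\<^esub> u) = \<zero>\<^bsub>?D\<^esub>"
        using rmodule_hom_minus[OF pow Dm Dm x u(2), of n] y(2) ph(1)[of x n] x
          Dm.minus_eq_zero_iff[of "(\<phi> ^^ n) x" "(\<phi> ^^ n) x"] by (simp add: u_def)
      moreover have "x \<ominus>\<^bsub>?D\<^esub> u \<in> carrier ?D" using x u(2) by (rule Dm.M.minus_closed)
      ultimately have "x \<ominus>\<^bsub>?D\<^esub> u \<in> ?Z n" by simp
      thus "x \<in> ?E n <+>\<^bsub>?D\<^esub> ?Z n" using Dm.minus_plus_cancel[OF u(2) x] u(1) by (intro set_addI)
    qed
  qed
  note ids = this
  have sum: "?E n <+>\<^bsub>?D\<^esub> ?Z n = carrier ?D" using ids by (simp add: internal_direct_sum_def)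
  have "?E n = {\<zero>\<^bsub>?D\<^esub>} \<or> ?Z n = {\<zero>\<^bsub>?D\<^esub>}" using ids D(2) by (simp add: indecomposable_rmodule_def)
  thus ?thesis
  proof
    assume "?E n = {\<zero>\<^bsub>?D\<^esub>}"
    hence "(\<phi> ^^ n) x = \<zero>\<^bsub>?F\<^esub>" if "x \<in> D" for x using that by auto
    thus ?thesis by blast
  next
    assume Z0: "?Z n = {\<zero>\<^bsub>?D\<^esub>}"
    have "x \<in> ?E n" if "x \<in> D" for x
    proof -
      have "x \<in> ?E n <+>\<^bsub>?D\<^esub> ?Z n" using that sum by simp
      then obtain u where "u \<in> ?E n" "x = u \<oplus>\<^bsub>?D\<^esub> \<zero>\<^bsub>?D\<^esub>" unfolding Z0 by (blast elim: set_addE)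
      moreover from this have "u \<in> carrier ?D" using Esub(3)[of n] by auto
      ultimately show ?thesis using Dm.M.r_zero by metis
    qed
    moreover have "?E n \<subseteq> \<phi> ` D" using ph(1)[of _ n0] by (auto simp: n_def)
    ultimately show ?thesis using rmodule_homD(1)[OF \<phi>] by auto
  qed
qed

lemma internal_direct_sum_sym:
  assumes "rmod V" "internal_direct_sum K M V N N'"
  shows "internal_direct_sum K M V N' N"
proof -
  interpret V: right_module K M V by fact
  have n: "N \<subseteq> carrier V" "N' \<subseteq> carrier V"
    using assms right_submoduleD(1)[OF _ assms(1)] by (auto simp: internal_direct_sum_def)
  have "N' <+>\<^bsub>V\<^esub> N = N <+>\<^bsub>V\<^esub> N'"
  proof (intro equalityI subsetI)
    fix x assume "x \<in> N' <+>\<^bsub>V\<^esub> N"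
    then obtain a c where "a \<in> N'" "c \<in> N" "x = a \<oplus>\<^bsub>V\<^esub> c" by (blast elim: set_addE)
    moreover from this have "c \<oplus>\<^bsub>V\<^esub> a = x" using n V.M.a_comm[of a c] by (simp add: subset_iff)
    ultimately show "x \<in> N <+>\<^bsub>V\<^esub> N'" by (intro set_addI[of c _ a])
  next
    fix x assume "x \<in> N <+>\<^bsub>V\<^esub> N'"
    then obtain a c where "a \<in> N" "c \<in> N'" "x = a \<oplus>\<^bsub>V\<^esub> c" by (blast elim: set_addE)
    moreover from this have "c \<oplus>\<^bsub>V\<^esub> a = x" using n V.M.a_comm[of a c] by (simp add: subset_iff)
    ultimately show "x \<in> N' <+>\<^bsub>V\<^esub> N" by (intro set_addI[of c _ a])
  qed
  thus ?thesis using assms(2) by (simp add: internal_direct_sum_def Int_commute)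
qed

lemma internal_direct_sum_refine:
  assumes V: "rmod V" and 1: "internal_direct_sum K M V D D'"
    and 2: "internal_direct_sum K M (V\<lparr>carrier := D\<rparr>) E E'"
  shows "internal_direct_sum K M V E (E' <+>\<^bsub>V\<^esub> D')"
proof -
  interpret V: right_module K M V by fact
  have D: "submod V D" "submod V D'" "D \<inter> D' = {\<zero>\<^bsub>V\<^esub>}" "D <+>\<^bsub>V\<^esub> D' = carrier V"
    using 1 by (auto simp: internal_direct_sum_def)
  have E: "submod V E" "submod V E'" "E \<subseteq> D" "E' \<subseteq> D" "E \<inter> E' = {\<zero>\<^bsub>V\<^esub>}"
    using 2 right_submodule_sub_iff[OF V D(1)] by (auto simp: internal_direct_sum_def)
  have ED: "E <+>\<^bsub>V\<^esub> E' = D" using 2 by (simp add: internal_direct_sum_def set_add_defs)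
  note d = right_submoduleD[OF D(1) V] and d' = right_submoduleD[OF D(2) V]
    and e = right_submoduleD[OF E(1) V] and e' = right_submoduleD[OF E(2) V]
  have sub: "submod V (E' <+>\<^bsub>V\<^esub> D')"
  proof (rule right_submoduleI[OF V])
    show "E' <+>\<^bsub>V\<^esub> D' \<subseteq> carrier V" using e'(1) d'(1) by (auto elim!: set_addE)
    show "\<zero>\<^bsub>V\<^esub> \<in> E' <+>\<^bsub>V\<^esub> D'" by (rule set_addI[OF e'(2) d'(2)]) simp
  next
    fix x y assume "x \<in> E' <+>\<^bsub>V\<^esub> D'" "y \<in> E' <+>\<^bsub>V\<^esub> D'"
    then obtain a b a' b' where ab: "a \<in> E'" "b \<in> D'" "x = a \<oplus>\<^bsub>V\<^esub> b" "a' \<in> E'" "b' \<in> D'" "y = a' \<oplus>\<^bsub>V\<^esub> b'"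
      by (blast elim: set_addE)
    have c: "a \<in> carrier V" "b \<in> carrier V" "a' \<in> carrier V" "b' \<in> carrier V" using ab e'(1) d'(1) by auto
    show "x \<oplus>\<^bsub>V\<^esub> y \<in> E' <+>\<^bsub>V\<^esub> D'"
      by (rule set_addI[OF e'(3)[OF ab(1,4)] d'(3)[OF ab(2,5)]]) (use c ab in \<open>simp add: V.a_ac\<close>)
  next
    fix a x assume a: "a \<in> carrier K" "x \<in> E' <+>\<^bsub>V\<^esub> D'"
    then obtain u v where u: "u \<in> E'" "v \<in> D'" "x = u \<oplus>\<^bsub>V\<^esub> v" by (blast elim: set_addE)
    have c: "u \<in> carrier V" "v \<in> carrier V" using u e'(1) d'(1) by auto
    show "a \<odot>\<^bsub>V\<^esub> x \<in> E' <+>\<^bsub>V\<^esub> D'"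
      by (rule set_addI[OF e'(4)[OF a(1) u(1)] d'(4)[OF a(1) u(2)]]) (use c u a in \<open>simp add: V.smult_r_distr\<close>)
  next
    fix x f assume a: "f \<in> carrier M" "x \<in> E' <+>\<^bsub>V\<^esub> D'"
    then obtain u v where u: "u \<in> E'" "v \<in> D'" "x = u \<oplus>\<^bsub>V\<^esub> v" by (blast elim: set_addE)
    have c: "u \<in> carrier V" "v \<in> carrier V" using u e'(1) d'(1) by auto
    show "x \<cdot>\<^bsub>V\<^esub> f \<in> E' <+>\<^bsub>V\<^esub> D'"
      by (rule set_addI[OF e'(5)[OF u(1) a(1)] d'(5)[OF u(2) a(1)]]) (use c u a in \<open>simp add: V.ract_add\<close>)
  qed
  have "E \<inter> (E' <+>\<^bsub>V\<^esub> D') = {\<zero>\<^bsub>V\<^esub>}"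
  proof -
    have "x = \<zero>\<^bsub>V\<^esub>" if x: "x \<in> E" "x \<in> E' <+>\<^bsub>V\<^esub> D'" for x
    proof -
      from x(2) obtain u v where u: "u \<in> E'" "v \<in> D'" "x = u \<oplus>\<^bsub>V\<^esub> v" by (blast elim: set_addE)
      have c: "u \<in> carrier V" "v \<in> carrier V" using u e'(1) d'(1) by auto
      have "v = x \<ominus>\<^bsub>V\<^esub> u" using V.plus_minus_cancel[OF c] u by simp
      hence "v \<in> D" using d(7) x(1) u(1) E(3,4) by blast
      hence "v = \<zero>\<^bsub>V\<^esub>" using u(2) D(3) by blast
      hence "x \<in> E'" using u c by simp
      thus ?thesis using x(1) E(5) by blast
    qed
    thus ?thesis using e(2) right_submoduleD(2)[OF sub V] by blast
  qed
  moreover have "E <+>\<^bsub>V\<^esub> (E' <+>\<^bsub>V\<^esub> D') = carrier V"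
  proof (intro equalityI subsetI)
    fix x assume "x \<in> E <+>\<^bsub>V\<^esub> (E' <+>\<^bsub>V\<^esub> D')"
    then obtain u v where "u \<in> E" "v \<in> E' <+>\<^bsub>V\<^esub> D'" "x = u \<oplus>\<^bsub>V\<^esub> v" by (blast elim: set_addE)
    thus "x \<in> carrier V" using e(1) right_submoduleD(1)[OF sub V] by auto
  next
    fix x assume "x \<in> carrier V"
    hence "x \<in> D <+>\<^bsub>V\<^esub> D'" using D(4) by simp
    then obtain u v where u: "u \<in> D" "v \<in> D'" "x = u \<oplus>\<^bsub>V\<^esub> v" by (blast elim: set_addE)
    hence "u \<in> E <+>\<^bsub>V\<^esub> E'" using ED by simp
    then obtain p q where p: "p \<in> E" "q \<in> E'" "u = p \<oplus>\<^bsub>V\<^esub> q" by (blast elim: set_addE)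
    have c: "p \<in> carrier V" "q \<in> carrier V" "v \<in> carrier V" using p u e(1) e'(1) d'(1) by auto
    show "x \<in> E <+>\<^bsub>V\<^esub> (E' <+>\<^bsub>V\<^esub> D')"
      by (rule set_addI[OF p(1) set_addI[OF p(2) u(2) HOL.refl]]) (use c u p in \<open>simp add: V.a_assoc\<close>)
  qed
  ultimately show ?thesis using E(1) sub by (simp add: internal_direct_sum_def)
qed

text \<open>A projective cover of S realized by a submodule D of the free module on b. The index set
  has the type of b, while \<open>projective_rmodule\<close> would ask for indices of the element
  type of D.\<close>

definition free_cover :: "'x \<Rightarrow> ('k, 's, 'm) rmodule \<Rightarrow> ('x \<times> 'm \<Rightarrow> 'k) set \<Rightarrow> (('x \<times> 'm \<Rightarrow> 'k) \<Rightarrow> 's) \<Rightarrow> bool" where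
  "free_cover b S D p \<longleftrightarrow> submod (free {b}) D \<and> summand {b} (free {b}\<lparr>carrier := D\<rparr>) \<and>
    indecomposable_rmodule K M (free {b}\<lparr>carrier := D\<rparr>) \<and>
    p \<in> Hom (free {b}\<lparr>carrier := D\<rparr>) S \<and> p ` D = carrier S \<and>
    (\<forall>N. submod (free {b}\<lparr>carrier := D\<rparr>) N \<and>
      N <+>\<^bsub>free {b}\<lparr>carrier := D\<rparr>\<^esub> a_kernel (free {b}\<lparr>carrier := D\<rparr>) S p = D \<longrightarrow> N = D)"

text \<open>Take a direct summand D of \<open>free {b}\<close> with a nonzero map h to S and as few
  pivots as possible; minimality makes D indecomposable. If N fills D together with the kernel of h,
  a lift of h through N is an endomorphism preserving h, hence not nilpotent, hence onto by
  Fitting's lemma; but its image lies in N.\<close>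

lemma free_cover_exists:
  assumes S: "simple_rmodule K M S"
  shows "\<exists>D p. free_cover b S D p"
proof -
  let ?F = "free {b}" and ?R = "\<lambda>D. free {b}\<lparr>carrier := D\<rparr>"
  have F: "rmod ?F" by (rule free_right_module)
  interpret F: right_module K M ?F by (rule F)
  have Sm: "rmod S" using S simple_right_module by blast
  interpret S: right_module K M S by (rule Sm)
  let ?P = "\<lambda>D. (\<exists>D'. internal_direct_sum K M ?F D D') \<and> (\<exists>h\<in>Hom (?R D) S. \<exists>x\<in>D. h x \<noteq> \<zero>\<^bsub>S\<^esub>)"
  have "?P (carrier ?F)"
  proof (intro conjI)
    have "internal_direct_sum K M ?F (carrier ?F) {\<zero>\<^bsub>?F\<^esub>}"
      unfolding internal_direct_sum_def
    proof (intro conjI right_submodule_carrier right_submodule_zero F)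
      show "carrier ?F <+>\<^bsub>?F\<^esub> {\<zero>\<^bsub>?F\<^esub>} = carrier ?F"
        by (auto elim!: set_addE intro!: set_addI[of _ _ "\<zero>\<^bsub>?F\<^esub>"])
    qed auto
    thus "\<exists>D'. internal_direct_sum K M ?F (carrier ?F) D'" by blast
    obtain t where t: "t \<in> carrier S" "t \<noteq> \<zero>\<^bsub>S\<^esub>" using S S.M.zero_closed unfolding simple_rmodule_def by blast
    obtain H where H: "H \<in> Hom ?F S" "H (gen {b} b) = t" using free_lift[OF Sm, of "{b}" "\<lambda>_. t"] t by auto
    have "gen {b} b \<in> carrier ?F" by (simp add: sgl_closed)
    thus "\<exists>h\<in>Hom (?R (carrier ?F)) S. \<exists>x\<in>carrier ?F. h x \<noteq> \<zero>\<^bsub>S\<^esub>" using H t by auto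
  qed
  then obtain D where D: "?P D" "\<And>D'. ?P D' \<Longrightarrow> card (pivots b D) \<le> card (pivots b D')"
    using ex_has_least_nat[of ?P "carrier ?F" "\<lambda>D. card (pivots b D)"] by blast
  obtain D' h x where D': "internal_direct_sum K M ?F D D'" and h: "h \<in> Hom (?R D) S"
    and x: "x \<in> D" "h x \<noteq> \<zero>\<^bsub>S\<^esub>" using D(1) by blast
  have Ds: "submod ?F D" using D' by (simp add: internal_direct_sum_def)
  have R: "rmod (?R D)" by (rule right_module_sub[OF F Ds])
  interpret R: right_module K M "?R D" by (rule R)
  have hs: "h ` D = carrier S" using hom_to_simple_surj[OF S R h, of x] x by simp
  have summ: "summand {b} (?R D)" unfolding summand_def using D' rmodule_iso_refl by blast
  have no_split: "E' = {\<zero>\<^bsub>?F\<^esub>}"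
    if E: "internal_direct_sum K M (?R D) E E'" and e: "e \<in> E" "h e \<noteq> \<zero>\<^bsub>S\<^esub>" for E E' e
  proof -
    have ED: "submod ?F E" "E \<subseteq> D" "submod ?F E'" "E' \<subseteq> D" "E \<inter> E' = {\<zero>\<^bsub>?F\<^esub>}"
      using E right_submodule_sub_iff[OF F Ds] by (auto simp: internal_direct_sum_def)
    have "h \<in> Hom (?R E) S" using rmodule_hom_sub[OF h, of E] ED(2) by simp
    hence "?P E" using internal_direct_sum_refine[OF F D' E] e by blast
    hence "card (pivots b D) \<le> card (pivots b E)" by (rule D(2))
    hence "E = D" using ED(2) pivots_card_less[OF ED(1) Ds] by (meson not_le psubsetI)
    thus ?thesis using ED(4,5) right_submoduleD(2)[OF ED(3) F] by blast
  qed
  have ind: "indecomposable_rmodule K M (?R D)"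
    unfolding indecomposable_rmodule_def
  proof (intro conjI R allI impI)
    show "carrier (?R D) \<noteq> {\<zero>\<^bsub>?R D\<^esub>}" using x rmodule_hom_zero[OF h R Sm] by auto
    fix E E' assume E: "internal_direct_sum K M (?R D) E E'"
    have ED: "E \<subseteq> D" "E' \<subseteq> D" using E right_submodule_sub_iff[OF F Ds] by (auto simp: internal_direct_sum_def)
    have "x \<in> E <+>\<^bsub>?R D\<^esub> E'" using E x by (simp add: internal_direct_sum_def)
    then obtain u v where u: "u \<in> E" "v \<in> E'" "x = u \<oplus>\<^bsub>?R D\<^esub> v" by (blast elim: set_addE)
    have "h x = h u \<oplus>\<^bsub>S\<^esub> h v" unfolding u(3) using rmodule_homD(2)[OF h] u ED by auto
    hence "h u \<noteq> \<zero>\<^bsub>S\<^esub> \<or> h v \<noteq> \<zero>\<^bsub>S\<^esub>" using x by auto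
    thus "E = {\<zero>\<^bsub>?R D\<^esub>} \<or> E' = {\<zero>\<^bsub>?R D\<^esub>}"
      using no_split[OF E u(1)] no_split[OF internal_direct_sum_sym[OF R E] u(2)] by auto
  qed
  have "N = D" if N: "submod (?R D) N" "N <+>\<^bsub>?R D\<^esub> a_kernel (?R D) S h = D" for N
  proof -
    have ND: "submod ?F N" "N \<subseteq> D" using N right_submodule_sub_iff[OF F Ds] by auto
    have Nm: "rmod (?R N)" by (rule right_module_sub[OF F ND(1)])
    have hN: "h \<in> Hom (?R N) S" using rmodule_hom_sub[OF h, of N] ND(2) by simp
    have hNs: "h ` carrier (?R N) = carrier S"
    proof -
      have "h y \<in> h ` N" if y: "y \<in> D" for y
      proof -
        have "y \<in> N <+>\<^bsub>?R D\<^esub> a_kernel (?R D) S h" using y N(2) by simp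
        then obtain u v where u: "u \<in> N" "v \<in> a_kernel (?R D) S h" "y = u \<oplus>\<^bsub>?R D\<^esub> v" by (blast elim: set_addE)
        have v: "v \<in> D" "h v = \<zero>\<^bsub>S\<^esub>" using u(2) by (auto simp: a_kernel_defs)
        have "h y = h u \<oplus>\<^bsub>S\<^esub> h v" unfolding u(3) using rmodule_homD(2)[OF h, of u v] u(1) v ND(2) by auto
        moreover have "h u \<in> carrier S" using rmodule_homD(1)[OF h, of u] u(1) ND(2) by auto
        ultimately show ?thesis using v u by simp
      qed
      hence "h ` D \<subseteq> h ` N" by blast
      moreover have "h ` N \<subseteq> h ` D" using ND(2) by blast
      ultimately show ?thesis using hs by simp
    qed
    obtain k where k: "k \<in> Hom (?R D) (?R N)" "\<And>y. y \<in> D \<Longrightarrow> h (k y) = h y"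
      using summand_lift[OF summ R Nm Sm hN hNs h] by auto
    have kD: "k \<in> Hom (?R D) (?R D)"
      using rmodule_homD[OF k(1)] ND(2) by (intro rmodule_homI) auto
    have "k ` D = D \<or> (\<exists>n. \<forall>x\<in>D. (k ^^ n) x = \<zero>\<^bsub>?F\<^esub>)"
      by (rule indecomposable_endomorphism[OF Ds ind kD])
    moreover have "\<not> (\<exists>n. \<forall>x\<in>D. (k ^^ n) x = \<zero>\<^bsub>?F\<^esub>)"
    proof
      assume "\<exists>n. \<forall>x\<in>D. (k ^^ n) x = \<zero>\<^bsub>?F\<^esub>"
      then obtain n where n: "(k ^^ n) x = \<zero>\<^bsub>?F\<^esub>" using x by blast
      have "(k ^^ n) x \<in> D \<and> h ((k ^^ n) x) = h x" for n
        by (induction n) (use x k(2) rmodule_homD(1)[OF kD] in auto)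
      hence "h \<zero>\<^bsub>?F\<^esub> = h x" using n by metis
      thus False using x rmodule_hom_zero[OF h R Sm] by simp
    qed
    moreover have "k ` D \<subseteq> N" using rmodule_homD(1)[OF k(1)] by auto
    ultimately show ?thesis using ND(2) by blast
  qed
  hence "free_cover b S D h" unfolding free_cover_def using Ds summ ind h hs by blast
  thus ?thesis by blast
qed

text \<open>Covers arise among functions on pairs of an index and a monoid element, while they are
  wanted as functions on the monoid; the structure is carried along an injection between the
  types.\<close>

lemma transport_module:
  assumes V: "rmod V" and j: "inj_on j (carrier V)"
  shows "\<exists>P :: ('k, 'p, 'm) rmodule. rmod P \<and> carrier P = j ` carrier V \<and> j \<in> Hom V P"
proof -
  interpret V: right_module K M V by fact
  let ?i = "the_inv_into (carrier V) j"
  have ij: "?i (j x) = x" if "x \<in> carrier V" for x using the_inv_into_f_f[OF j that] .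
  define P :: "('k, 'p, 'm) rmodule" where
    "P = \<lparr>carrier = j ` carrier V, mult = undefined, one = undefined, zero = j \<zero>\<^bsub>V\<^esub>,
      add = (\<lambda>x y. j (?i x \<oplus>\<^bsub>V\<^esub> ?i y)), smult = (\<lambda>a x. j (a \<odot>\<^bsub>V\<^esub> ?i x)), ract = (\<lambda>x f. j (?i x \<cdot>\<^bsub>V\<^esub> f))\<rparr>"
  have "rmod P"
    by (rule right_module_image[OF V, of j]) (simp_all add: P_def ij)
  moreover have "j \<in> Hom V P"
    by (rule rmodule_homI) (simp_all add: P_def ij)
  ultimately show ?thesis by (intro exI[of _ P]) (simp add: P_def)
qed

theorem projective_cover_exists:
  assumes S: "simple_rmodule K M S"
  shows "\<exists>P :: ('k, 'm \<Rightarrow> 'k, 'm) rmodule. indecomposable_rmodule K M P \<and> projective_rmodule K M P \<and>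
    (\<exists>p. projective_cover K M P p S)"
proof -
  \<comment> \<open>The value is arbitrary, but its type is chosen: projectivity asks for index sets
    of the element type of P, which is that of functions on the monoid.\<close>
  define b :: "'m \<Rightarrow> 'k" where "b = undefined"
  let ?F = "free {b}" and ?R = "\<lambda>D. free {b}\<lparr>carrier := D\<rparr>"
  have F: "rmod ?F" by (rule free_right_module)
  have Sm: "rmod S" using S simple_right_module by blast
  obtain D p where Dp: "free_cover b S D p" using free_cover_exists[OF S, where b = b] by blast
  have D: "submod ?F D" "summand {b} (?R D)" "indecomposable_rmodule K M (?R D)"
    and p: "p \<in> Hom (?R D) S" "p ` D = carrier S"
    and sup: "\<And>N. submod (?R D) N \<Longrightarrow> N <+>\<^bsub>?R D\<^esub> a_kernel (?R D) S p = D \<Longrightarrow> N = D"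
    using Dp unfolding free_cover_def by blast+
  have R: "rmod (?R D)" by (rule right_module_sub[OF F D(1)])
  interpret R: right_module K M "?R D" by (rule R)
  have DF: "D \<subseteq> carrier ?F" by (rule right_submoduleD(1)[OF D(1) F])
  \<comment> \<open>With the single index b, a vector is the same as a function on the
    monoid.\<close>
  define j where "j x = (\<lambda>f\<in>carrier M. x (b, f))" for x :: "(('m \<Rightarrow> 'k) \<times> 'm) \<Rightarrow> 'k"
  have "inj_on j (carrier (?R D))"
  proof (rule inj_onI)
    fix x y assume xy: "x \<in> carrier (?R D)" "y \<in> carrier (?R D)" "j x = j y"
    have "x (b, f) = y (b, f)" if "f \<in> carrier M" for f
      using fun_cong[OF xy(3), of f] that by (simp add: j_def)
    thus "x = y" using xy DF by (intro free_eqI[of x "{b}" y]) auto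
  qed
  then obtain P :: "('k, 'm \<Rightarrow> 'k, 'm) rmodule" where P: "rmod P" "carrier P = j ` D"
    and j: "j \<in> Hom (?R D) P"
    and inj: "inj_on j D"
    using transport_module[OF R, of j] by auto
  interpret P: right_module K M P by (rule P(1))
  have "rmodule_iso K M (?R D) P" unfolding rmodule_iso_def using j P(2) inj by (auto simp: bij_betw_def)
  moreover from this have "rmodule_iso K M P (?R D)" by (rule rmodule_iso_sym[OF R P(1)])
  then obtain h where h: "h \<in> Hom P (?R D)" "bij_betw h (carrier P) D"
    by (auto simp: rmodule_iso_def)
  have hi: "inj_on h (carrier P)" "h ` carrier P = D" using h(2) by (auto simp: bij_betw_def)
  have hz: "h \<zero>\<^bsub>P\<^esub> = \<zero>\<^bsub>?R D\<^esub>" by (rule rmodule_hom_zero[OF h(1) P(1) R])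
  note hh = rmodule_homD[OF h(1)]
  have sum: "h ` (A <+>\<^bsub>P\<^esub> B) = h ` A <+>\<^bsub>?R D\<^esub> h ` B" if "A \<subseteq> carrier P" "B \<subseteq> carrier P" for A B
  proof (intro equalityI subsetI)
    fix x assume "x \<in> h ` (A <+>\<^bsub>P\<^esub> B)"
    then obtain u v where "u \<in> A" "v \<in> B" "x = h (u \<oplus>\<^bsub>P\<^esub> v)" by (blast elim: set_addE)
    moreover from this have "h u \<oplus>\<^bsub>?R D\<^esub> h v = x" using hh(2)[of u v] that by (simp add: subset_iff)
    ultimately show "x \<in> h ` A <+>\<^bsub>?R D\<^esub> h ` B" by (intro set_addI[of "h u" _ "h v"]) blast+
  next
    fix x assume "x \<in> h ` A <+>\<^bsub>?R D\<^esub> h ` B"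
    then obtain u v where uv: "u \<in> A" "v \<in> B" "x = h u \<oplus>\<^bsub>?R D\<^esub> h v" by (blast elim: set_addE)
    hence "x = h (u \<oplus>\<^bsub>P\<^esub> v)" using hh(2)[of u v] that by (simp add: subset_iff)
    thus "x \<in> h ` (A <+>\<^bsub>P\<^esub> B)" using set_addI[OF uv(1,2) HOL.refl, of P] by blast
  qed
  have ind: "indecomposable_rmodule K M P"
    unfolding indecomposable_rmodule_def
  proof (intro conjI P(1) allI impI)
    show "carrier P \<noteq> {\<zero>\<^bsub>P\<^esub>}"
    proof
      assume "carrier P = {\<zero>\<^bsub>P\<^esub>}"
      hence "D = {\<zero>\<^bsub>?R D\<^esub>}" using hi(2) hz by (metis image_empty image_insert)
      thus False using D(3) by (simp add: indecomposable_rmodule_def)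
    qed
    fix N N' assume ids: "internal_direct_sum K M P N N'"
    hence N: "submod P N" "submod P N'" "N \<inter> N' = {\<zero>\<^bsub>P\<^esub>}" "N <+>\<^bsub>P\<^esub> N' = carrier P"
      by (auto simp: internal_direct_sum_def)
    have NP: "N \<subseteq> carrier P" "N' \<subseteq> carrier P" using right_submoduleD(1)[OF _ P(1)] N by auto
    have "h ` N \<inter> h ` N' = {\<zero>\<^bsub>?R D\<^esub>}"
      using inj_on_image_Int[OF hi(1) NP] N(3) hz by simp
    moreover have "h ` N <+>\<^bsub>?R D\<^esub> h ` N' = carrier (?R D)" using sum[OF NP] N(4) hi(2) by simp
    ultimately have "internal_direct_sum K M (?R D) (h ` N) (h ` N')"
      unfolding internal_direct_sum_def using right_submodule_image[OF h(1) P(1) R] N by blast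
    hence "h ` N = {\<zero>\<^bsub>?R D\<^esub>} \<or> h ` N' = {\<zero>\<^bsub>?R D\<^esub>}" using D(3) by (simp add: indecomposable_rmodule_def)
    moreover have "A = {\<zero>\<^bsub>P\<^esub>}" if A: "A \<subseteq> carrier P" "h ` A = {\<zero>\<^bsub>?R D\<^esub>}" for A
    proof -
      have "h ` A = h ` {\<zero>\<^bsub>P\<^esub>}" using A hz by simp
      thus ?thesis using inj_on_image_eq_iff[OF hi(1) A(1), of "{\<zero>\<^bsub>P\<^esub>}"] by simp
    qed
    ultimately show "N = {\<zero>\<^bsub>P\<^esub>} \<or> N' = {\<zero>\<^bsub>P\<^esub>}" using NP by blast
  qed
  have proj: "projective_rmodule K M P"
  proof -
    have "summand {b} P" using D(2) calculation rmodule_iso_trans unfolding summand_def by blast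
    thus ?thesis using P(1) projective_iff_summand by blast
  qed
  have "projective_cover K M P (\<lambda>x. p (h x)) S"
    unfolding projective_cover_def
  proof (intro conjI proj Sm rmodule_hom_comp[OF h(1) p(1)] allI impI)
    show "(\<lambda>x. p (h x)) ` carrier P = carrier S" using hi(2) p(2) by (metis image_image)
    fix N assume N: "submod P N \<and> N <+>\<^bsub>P\<^esub> a_kernel P S (\<lambda>x. p (h x)) = carrier P"
    have NP: "N \<subseteq> carrier P" using right_submoduleD(1)[OF _ P(1)] N by blast
    have kP: "a_kernel P S (\<lambda>x. p (h x)) \<subseteq> carrier P" by (auto simp: a_kernel_defs)
    have "h ` a_kernel P S (\<lambda>x. p (h x)) = a_kernel (?R D) S p"
      using hi(2) by (auto simp: a_kernel_defs)
    hence "h ` N <+>\<^bsub>?R D\<^esub> a_kernel (?R D) S p = D" using sum[OF NP kP] N hi(2) by simp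
    hence "h ` N = D" using sup right_submodule_image[OF h(1) P(1) R] N by blast
    thus "N = carrier P" using inj_on_image_eq_iff[OF hi(1) NP, of "carrier P"] hi(2) by simp
  qed
  thus ?thesis using ind proj by blast
qed

text \<open>Some coordinate map of the ambient free module is nonzero on Q, so Q maps onto a nonzero
  submodule I of the free module on one generator, and I has a maximal submodule. The simple module
  so obtained has a type independent of that of Q.\<close>

theorem simple_quotient_exists:
  assumes Q: "rmod Q" "summand X Q" "carrier Q \<noteq> {\<zero>\<^bsub>Q\<^esub>}"
  shows "\<exists>(S :: ('k, (unit \<times> 'm \<Rightarrow> 'k) set, 'm) rmodule) q.
    simple_rmodule K M S \<and> q \<in> Hom Q S \<and> q ` carrier Q = carrier S"
proof -
  let ?F = "free {()}"
  have F: "rmod ?F" and FX: "rmod (free X)" by (rule free_right_module)+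
  interpret F: right_module K M ?F by (rule F)
  interpret Q: right_module K M Q by (rule Q(1))
  obtain N N' where ids: "internal_direct_sum K M (free X) N N'" and "rmodule_iso K M (free X\<lparr>carrier := N\<rparr>) Q"
    using Q(2) by (auto simp: summand_def)
  have N: "submod (free X) N" using ids by (simp add: internal_direct_sum_def)
  have NF: "rmod (free X\<lparr>carrier := N\<rparr>)" by (rule right_module_sub[OF FX N])
  have NX: "N \<subseteq> carrier (free X)" by (rule right_submoduleD(1)[OF N FX])
  have "rmodule_iso K M Q (free X\<lparr>carrier := N\<rparr>)"
    by (rule rmodule_iso_sym[OF NF Q(1)]) fact
  then obtain j where j: "j \<in> Hom Q (free X\<lparr>carrier := N\<rparr>)" "bij_betw j (carrier Q) N"
    by (auto simp: rmodule_iso_def)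
  have jF: "j \<in> Hom Q (free X)" by (rule rmodule_hom_from_sub[OF j(1) NX])
  obtain y where y: "y \<in> carrier Q" "y \<noteq> \<zero>\<^bsub>Q\<^esub>" using Q(3) Q.M.zero_closed by blast
  have jz: "j \<zero>\<^bsub>Q\<^esub> = \<zero>\<^bsub>free X\<^esub>" by (rule rmodule_hom_zero[OF jF Q(1) FX])
  have "j y \<noteq> \<zero>\<^bsub>free X\<^esub>" using j(2) y jz Q.M.zero_closed by (metis bij_betw_def inj_onD)
  moreover have jy: "j y \<in> carrier (free X)" by (rule rmodule_homD(1)[OF jF y(1)])
  ultimately have "\<exists>p\<in>X \<times> carrier M. j y p \<noteq> \<zero>\<^bsub>K\<^esub>"
    using free_eqI[OF jy free_zero_closed[of X]] by (auto simp: free_sel(2))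
  then obtain b f where bf: "b \<in> X" "f \<in> carrier M" "j y (b, f) \<noteq> \<zero>\<^bsub>K\<^esub>" by blast
  define c :: "('b \<times> 'm \<Rightarrow> 'k) \<Rightarrow> unit \<times> 'm \<Rightarrow> 'k" where "c x = (\<lambda>q\<in>{()} \<times> carrier M. x (b, snd q))" for x
  have cc: "c x \<in> carrier ?F" if x: "x \<in> carrier (free X)" for x
    using free_val[OF x] bf(1) finite_pairs[of "()"] by (auto simp: free_sel c_def)
  have c: "c \<in> Hom (free X) ?F"
  proof (rule rmodule_homI)
    fix x y assume "x \<in> carrier (free X)" "y \<in> carrier (free X)"
    show "c (x \<oplus>\<^bsub>free X\<^esub> y) = c x \<oplus>\<^bsub>?F\<^esub> c y" using bf(1) by (auto simp: c_def free_sel(3) fun_eq_iff restrict_def)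
  next
    fix a x
    show "c (a \<odot>\<^bsub>free X\<^esub> x) = a \<odot>\<^bsub>?F\<^esub> c x" using bf(1) by (auto simp: c_def free_sel(4) fun_eq_iff restrict_def)
  next
    fix x g assume x: "x \<in> carrier (free X)" "g \<in> carrier M"
    show "c (x \<cdot>\<^bsub>free X\<^esub> g) = c x \<cdot>\<^bsub>?F\<^esub> g"
    proof (rule free_eqI[OF cc[OF free_ract_closed[OF x]] free_ract_closed[OF cc[OF x(1)] x(2)]])
      fix p :: "unit \<times> 'm" assume "p \<in> {()} \<times> carrier M"
      then obtain f where p: "p = ((), f)" "f \<in> carrier M" by auto
      have "(c x \<cdot>\<^bsub>?F\<^esub> g) p = (\<Oplus>\<^bsub>K\<^esub>f'\<in>{f' \<in> carrier M. f' \<otimes>\<^bsub>M\<^esub> g = f}. c x ((), f'))"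
        unfolding p(1) by (rule free_ract_apply[OF cc[OF x(1)] x(2) _ p(2)]) simp
      also have "\<dots> = (\<Oplus>\<^bsub>K\<^esub>f'\<in>{f' \<in> carrier M. f' \<otimes>\<^bsub>M\<^esub> g = f}. x (b, f'))"
        using free_val[OF x(1)] bf(1) by (intro K.finsum_cong') (auto simp: c_def)
      also have "\<dots> = c (x \<cdot>\<^bsub>free X\<^esub> g) p"
        using free_ract_apply[OF x bf(1) p(2)] p by (simp add: c_def)
      finally show "c (x \<cdot>\<^bsub>free X\<^esub> g) p = (c x \<cdot>\<^bsub>?F\<^esub> g) p" by simp
    qed
  qed (rule cc)
  define g where "g x = c (j x)" for x
  have g: "g \<in> Hom Q ?F" unfolding g_def by (rule rmodule_hom_comp[OF jF c])
  define I where "I = g ` carrier Q"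
  have I: "submod ?F I"
    unfolding I_def by (rule right_submodule_image[OF g Q(1) F right_submodule_carrier[OF Q(1)]])
  have "g y ((), f) \<noteq> \<zero>\<^bsub>K\<^esub>" using bf by (simp add: g_def c_def)
  hence "g y \<noteq> \<zero>\<^bsub>?F\<^esub>" using bf by (auto simp: free_sel(2))
  hence "I \<noteq> {\<zero>\<^bsub>?F\<^esub>}" using y by (auto simp: I_def)
  then obtain L where L: "submod ?F L" "L \<subset> I"
    "\<And>N'. submod ?F N' \<Longrightarrow> L \<subseteq> N' \<Longrightarrow> N' \<subseteq> I \<Longrightarrow> N' = L \<or> N' = I"
    using maximal_submodule_exists[OF I] by blast
  let ?V = "?F\<lparr>carrier := I\<rparr>"
  have V: "rmod ?V" by (rule right_module_sub[OF F I])
  have LV: "submod ?V L" using right_submodule_sub_iff[OF F I] L by blast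
  have S: "simple_rmodule K M (rmodule_quot ?V L)"
    using right_submodule_sub_iff[OF F I] L by (intro simple_quot[OF V LV]) auto
  have gV: "g \<in> Hom Q ?V" by (rule rmodule_hom_into_sub[OF g]) (simp add: I_def)
  have "(\<lambda>x. L +>\<^bsub>?V\<^esub> g x) \<in> Hom Q (rmodule_quot ?V L)"
    by (rule rmodule_hom_comp[OF gV quot_hom[OF V LV]])
  moreover have "(\<lambda>x. L +>\<^bsub>?V\<^esub> g x) ` carrier Q = carrier (rmodule_quot ?V L)"
    using quot_surj[OF V LV] unfolding I_def[symmetric] by (simp add: I_def image_image)
  ultimately show ?thesis using S by blast
qed

end

section \<open>Translation modules\<close>

locale translation = finite_coxeter_group G I s m + K: field K
  for G :: "'a monoid" (structure) and I :: "'i set" and s :: "'i \<Rightarrow> 'a" and m :: "'i \<Rightarrow> 'i \<Rightarrow> nat" and K :: "'k ring" +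
  fixes M :: "('a \<Rightarrow> 'a) monoid"
  defines M_def: "M \<equiv> biHecke G I s"
begin

abbreviation "rmod \<equiv> right_module K M"
abbreviation "submod \<equiv> right_submodule K M"
abbreviation "Hom \<equiv> rmodule_hom K M"
abbreviation "zerov w \<equiv> zero_vec K (right_interval G I s w)"
abbreviation zeroK ("\<zero>\<^sub>K") where "\<zero>\<^sub>K \<equiv> \<zero>\<^bsub>K\<^esub>"
abbreviation oneK ("\<one>\<^sub>K") where "\<one>\<^sub>K \<equiv> \<one>\<^bsub>K\<^esub>"
abbreviation addK (infixl "\<oplus>\<^sub>K" 65) where "x \<oplus>\<^sub>K y \<equiv> x \<oplus>\<^bsub>K\<^esub> y"
abbreviation multK (infixl "\<otimes>\<^sub>K" 70) where "x \<otimes>\<^sub>K y \<equiv> x \<otimes>\<^bsub>K\<^esub> y"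

abbreviation "hw \<equiv> hecke_word_fun G I s"
abbreviation "T \<equiv> translation_module K G I s"

lemma M_sel: "carrier M = hw ` HW" "\<one>\<^bsub>M\<^esub> = (\<lambda>w\<in>W. w)" "f \<otimes>\<^bsub>M\<^esub> g = compose (W) g f"
  by (simp_all add: M_def biHecke_def)

lemma hw_apply: "hw gs = (\<lambda>w\<in>W. run gs w)"
  by (simp add: hecke_word_fun_def run_def)

lemma hw_mult: "gs \<in> HW \<Longrightarrow> hw gs \<otimes>\<^bsub>M\<^esub> hw hs = hw (gs @ hs)"
  by (auto simp: M_sel hw_apply compose_def restrict_def fun_eq_iff)

lemma hw_one: "\<one>\<^bsub>M\<^esub> = hw []"
  by (simp add: M_sel hw_apply)

lemma hw_eq_iff: "hw gs = hw hs \<longleftrightarrow> (\<forall>w\<in>W. run gs w = run hs w)"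
  by (auto simp: hw_apply restrict_def fun_eq_iff)

lemma hw_closed: "gs \<in> HW \<Longrightarrow> hw gs \<in> carrier M"
  by (simp add: M_sel)

lemma M_cases: "f \<in> carrier M \<Longrightarrow> \<exists>gs\<in>HW. f = hw gs"
  by (auto simp: M_sel)

lemma M_monoid: "monoid M"
proof (rule monoidI)
  fix x y assume "x \<in> carrier M" "y \<in> carrier M"
  then obtain gs hs where "gs \<in> HW" "x = hw gs" "hs \<in> HW" "y = hw hs" using M_cases by meson
  thus "x \<otimes>\<^bsub>M\<^esub> y \<in> carrier M" by (simp add: hw_mult hw_closed)
next
  show "\<one>\<^bsub>M\<^esub> \<in> carrier M" unfolding hw_one by (simp add: hw_closed)
next
  fix x y z assume "x \<in> carrier M" "y \<in> carrier M" "z \<in> carrier M"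
  then obtain gs hs ks where "gs \<in> HW" "x = hw gs" "hs \<in> HW" "y = hw hs" "ks \<in> HW" "z = hw ks"
    using M_cases by meson
  thus "x \<otimes>\<^bsub>M\<^esub> y \<otimes>\<^bsub>M\<^esub> z = x \<otimes>\<^bsub>M\<^esub> (y \<otimes>\<^bsub>M\<^esub> z)" by (simp add: hw_mult)
next
  fix x assume "x \<in> carrier M"
  then obtain gs where "gs \<in> HW" "x = hw gs" using M_cases by meson
  thus "\<one>\<^bsub>M\<^esub> \<otimes>\<^bsub>M\<^esub> x = x" "x \<otimes>\<^bsub>M\<^esub> \<one>\<^bsub>M\<^esub> = x" unfolding hw_one by (simp_all add: hw_mult)
qed

lemma M_finite: "finite (carrier M)"
proof -
  have "hw gs \<in> W \<rightarrow>\<^sub>E W" if "gs \<in> HW" for gs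
    unfolding hw_apply using run_closed[OF that] by (simp add: restrict_PiE_iff)
  hence "carrier M \<subseteq> W \<rightarrow>\<^sub>E W" unfolding M_sel by blast
  thus ?thesis using finite_PiE[of "W" "\<lambda>_. W"] finite_carrier finite_subset by blast
qed

sublocale fma: finite_monoid_algebra K M
  using M_monoid M_finite by (intro finite_monoid_algebra.intro finite_monoid_algebra_axioms.intro K.field_axioms)

section \<open>The action on a translation module by an explicit formula\<close>

abbreviation "Vec w \<equiv> B w \<rightarrow>\<^sub>E carrier K"

lemma T_sel:
  "carrier (T w) = Vec w" "\<zero>\<^bsub>T w\<^esub> = zerov w"
  "x \<oplus>\<^bsub>T w\<^esub> y = (\<lambda>v\<in>B w. x v \<oplus>\<^sub>K y v)" "a \<odot>\<^bsub>T w\<^esub> x = (\<lambda>v\<in>B w. a \<otimes>\<^sub>K x v)"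
  by (simp_all add: translation_module_def Let_def)

lemma zero_vec_apply: "u \<in> B w \<Longrightarrow> zerov w u = \<zero>\<^sub>K"
  by (simp add: zero_vec_def)

lemma zero_vec_closed [simp]: "zerov w \<in> Vec w"
  by (auto simp: zero_vec_def)

lemma Vec_val: "c \<in> Vec w \<Longrightarrow> u \<in> B w \<Longrightarrow> c u \<in> carrier K"
  by auto

lemma Vec_eqI: "c \<in> Vec w \<Longrightarrow> d \<in> Vec w \<Longrightarrow> (\<And>u. u \<in> B w \<Longrightarrow> c u = d u) \<Longrightarrow> c = d"
  by (rule extensionalityI[of c "B w" d]) (simp_all add: PiE_def)

lemma T_add_closed: "c \<in> Vec w \<Longrightarrow> d \<in> Vec w \<Longrightarrow> c \<oplus>\<^bsub>T w\<^esub> d \<in> Vec w"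
  unfolding T_sel restrict_PiE_iff using Vec_val by (intro ballI K.a_closed) auto

lemma T_smult_closed: "a \<in> carrier K \<Longrightarrow> c \<in> Vec w \<Longrightarrow> a \<odot>\<^bsub>T w\<^esub> c \<in> Vec w"
  unfolding T_sel restrict_PiE_iff using Vec_val by (intro ballI K.m_closed) auto

text \<open>The coefficient at a collects the u that gs translates to a. The formula depends only on
  the function induced by gs (\<open>act_cong\<close>), which is what makes the definite description
  in \<open>translation_module\<close> meaningful (\<open>T_ract\<close>).\<close>

definition act :: "'a \<Rightarrow> 'i hecke_gen list \<Rightarrow> ('a \<Rightarrow> 'k) \<Rightarrow> 'a \<Rightarrow> 'k" where
  "act w gs c = (\<lambda>a\<in>B w. \<Oplus>\<^bsub>K\<^esub>u\<in>{u \<in> B w. ok w gs u \<and> run gs u = a}. c u)"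

lemma act_closed: "c \<in> Vec w \<Longrightarrow> act w gs c \<in> Vec w"
  unfolding act_def restrict_PiE_iff using Vec_val by (intro ballI K.finsum_closed) auto

lemma act_apply: "a \<in> B w \<Longrightarrow> act w gs c a = (\<Oplus>\<^bsub>K\<^esub>u\<in>{u \<in> B w. ok w gs u \<and> run gs u = a}. c u)"
  by (simp add: act_def)

lemma act_cong:
  assumes "w \<in> W" "\<And>u. u \<in> W \<Longrightarrow> run gs u = run hs u"
  shows "act w gs c = act w hs c"
proof -
  have "{u \<in> B w. ok w gs u \<and> run gs u = a} = {u \<in> B w. ok w hs u \<and> run hs u = a}" for a
  proof -
    have "ok w gs u \<and> run gs u = a \<longleftrightarrow> ok w hs u \<and> run hs u = a" if "u \<in> B w" for u
      using assms(2)[of u] assms(2)[of "co w \<otimes> u"] interval_closed[OF that] assms(1) by (simp add: ok_def)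
    thus ?thesis by blast
  qed
  thus ?thesis by (simp add: act_def)
qed

lemma act_add:
  assumes "c \<in> Vec w" "d \<in> Vec w"
  shows "act w gs (c \<oplus>\<^bsub>T w\<^esub> d) = act w gs c \<oplus>\<^bsub>T w\<^esub> act w gs d"
proof (rule Vec_eqI)
  fix a assume a: "a \<in> B w"
  let ?S = "{u \<in> B w. ok w gs u \<and> run gs u = a}"
  have "act w gs (c \<oplus>\<^bsub>T w\<^esub> d) a = (\<Oplus>\<^bsub>K\<^esub>u\<in>?S. c u \<oplus>\<^sub>K d u)"
    unfolding act_apply[OF a] using Vec_val[OF assms(1)] Vec_val[OF assms(2)]
    by (intro K.finsum_cong') (auto simp: T_sel)
  also have "\<dots> = act w gs c a \<oplus>\<^sub>K act w gs d a"
    unfolding act_apply[OF a] using Vec_val[OF assms(1)] Vec_val[OF assms(2)]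
    by (intro K.finsum_addf) auto
  finally show "act w gs (c \<oplus>\<^bsub>T w\<^esub> d) a = (act w gs c \<oplus>\<^bsub>T w\<^esub> act w gs d) a" using a by (simp add: T_sel)
qed (intro act_closed T_add_closed assms)+

lemma act_smult:
  assumes "x \<in> carrier K" "c \<in> Vec w"
  shows "act w gs (x \<odot>\<^bsub>T w\<^esub> c) = x \<odot>\<^bsub>T w\<^esub> act w gs c"
proof (rule Vec_eqI)
  fix a assume a: "a \<in> B w"
  let ?S = "{u \<in> B w. ok w gs u \<and> run gs u = a}"
  have "act w gs (x \<odot>\<^bsub>T w\<^esub> c) a = (\<Oplus>\<^bsub>K\<^esub>u\<in>?S. x \<otimes>\<^sub>K c u)"
    unfolding act_apply[OF a] using Vec_val[OF assms(2)] assms(1)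
    by (intro K.finsum_cong') (auto simp: T_sel)
  also have "\<dots> = x \<otimes>\<^sub>K act w gs c a"
    unfolding act_apply[OF a] using Vec_val[OF assms(2)] assms(1)
    by (intro K.finsum_rdistr[symmetric]) auto
  finally show "act w gs (x \<odot>\<^bsub>T w\<^esub> c) a = (x \<odot>\<^bsub>T w\<^esub> act w gs c) a" using a by (simp add: T_sel)
qed (intro act_closed T_smult_closed assms)+

lemma act_Nil: "c \<in> Vec w \<Longrightarrow> act w [] c = c"
proof (rule Vec_eqI[of _ w])
  fix a assume a: "a \<in> B w" and c: "c \<in> Vec w"
  have "{u \<in> B w. ok w [] u \<and> run [] u = a} = {a}" using a by auto
  thus "act w [] c a = c a" using Vec_val[OF c a] unfolding act_apply[OF a] by simp
qed (use act_closed in blast)+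

text \<open>The u contributing at a are sorted by their intermediate value under gs. By
  \<open>ok_append\<close> and \<open>ok_interval\<close> these fibres are the ones summed over by
  the two successive actions.\<close>

lemma act_append:
  assumes "w \<in> W" "c \<in> Vec w" "gs \<in> HW" "hs \<in> HW"
  shows "act w (gs @ hs) c = act w hs (act w gs c)"
proof (rule Vec_eqI[of _ w])
  fix a assume a: "a \<in> B w"
  let ?S = "\<lambda>b. {u \<in> B w. ok w gs u \<and> run gs u = b}" and ?R = "{b \<in> B w. ok w hs b \<and> run hs b = a}"
  have "{u \<in> B w. ok w (gs @ hs) u \<and> run (gs @ hs) u = a} = (\<Union>b\<in>?R. ?S b)"
  proof -
    have "ok w (gs @ hs) u \<and> run (gs @ hs) u = a \<longleftrightarrow>
      ok w gs u \<and> run gs u \<in> B w \<and> ok w hs (run gs u) \<and> run hs (run gs u) = a" if u: "u \<in> B w" for u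
      using ok_append[OF assms(1) interval_closed[OF u] assms(3,4)] ok_interval[OF assms(1) u assms(3)] by auto
    thus ?thesis by blast
  qed
  hence "act w (gs @ hs) c a = (\<Oplus>\<^bsub>K\<^esub>u\<in>(\<Union>b\<in>?R. ?S b). c u)" unfolding act_apply[OF a] by simp
  also have "\<dots> = (\<Oplus>\<^bsub>K\<^esub>b\<in>?R. \<Oplus>\<^bsub>K\<^esub>u\<in>?S b. c u)"
    using Vec_val[OF assms(2)] by (intro K.add.finprod_UN_disjoint) (auto simp: pairwise_def disjnt_def)
  also have "\<dots> = act w hs (act w gs c) a"
    unfolding act_apply[OF a] using Vec_val[OF act_closed[OF assms(2)]] act_apply[of _ w gs c]
    by (intro K.finsum_cong') auto
  finally show "act w (gs @ hs) c a = act w hs (act w gs c) a" .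
qed (intro act_closed assms)+

lemma trans_gen_act:
  assumes w: "w \<in> W" and g: "g \<in> hecke_gens I" and c: "c \<in> Vec w"
  shows "trans_gen K G I s w g c = act w [g] c"
proof -
  have basis: "trans_gen_basis K G I s w g u =
    (if ok w [g] u then basis_vec K (B w) (run [g] u) else zerov w)" if u: "u \<in> B w" for u
    using g
  proof (cases rule: hecke_gens_cases)
    case (1 i)
    thus ?thesis using ok_gen(1)[OF w u 1(1)] by (simp add: Let_def)
  next
    case (2 i)
    thus ?thesis using ok_gen(2)[OF w u 2(1)] interval_descent(1)[OF w u, of i] by (auto simp: Let_def)
  qed
  show ?thesis
  proof
    fix a show "trans_gen K G I s w g c a = act w [g] c a"
    proof (cases "a \<in> B w")
      case True
      let ?S = "{u \<in> B w. ok w [g] u \<and> run [g] u = a}"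
      have "trans_gen K G I s w g c a = (\<Oplus>\<^bsub>K\<^esub>u\<in>B w. c u \<otimes>\<^sub>K trans_gen_basis K G I s w g u a)"
        using True by (simp add: trans_gen_def lin_ext_def)
      also have "\<dots> = (\<Oplus>\<^bsub>K\<^esub>u\<in>B w. if u \<in> ?S then c u else \<zero>\<^sub>K)"
        using Vec_val[OF c] True by (intro K.finsum_cong') (auto simp: basis basis_vec_def zero_vec_def)
      also have "\<dots> = (\<Oplus>\<^bsub>K\<^esub>u\<in>?S. c u)"
        using Vec_val[OF c] by (intro K.add.finprod_mono_neutral_cong_right) auto
      finally show ?thesis using act_apply[OF True] by simp
    qed (simp add: trans_gen_def lin_ext_def act_def)
  qed
qed

lemma foldl_trans_gen:
  assumes "w \<in> W" "c \<in> Vec w" "gs \<in> HW"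
  shows "foldl (\<lambda>z g. trans_gen K G I s w g z) c gs = act w gs c"
  using assms(3)
proof (induction gs rule: rev_induct)
  case (snoc g gs)
  thus ?case using trans_gen_act[OF assms(1), of g "act w gs c"] act_closed[OF assms(2)]
      act_append[OF assms(1,2), of gs "[g]"] by simp
qed (use assms act_Nil in simp)

lemma T_ract:
  assumes "w \<in> W" "c \<in> Vec w" "gs \<in> HW"
  shows "c \<cdot>\<^bsub>T w\<^esub> hw gs = act w gs c"
proof -
  have "c \<cdot>\<^bsub>T w\<^esub> hw gs = (THE y. \<exists>hs\<in>HW. hw hs = hw gs \<and> y = foldl (\<lambda>z g. trans_gen K G I s w g z) c hs)"
    by (simp add: translation_module_def Let_def)
  also have "\<dots> = act w gs c"
  proof (rule the_equality)
    show "\<exists>hs\<in>HW. hw hs = hw gs \<and> act w gs c = foldl (\<lambda>z g. trans_gen K G I s w g z) c hs"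
      using foldl_trans_gen[OF assms] assms(3) by metis
    fix y assume "\<exists>hs\<in>HW. hw hs = hw gs \<and> y = foldl (\<lambda>z g. trans_gen K G I s w g z) c hs"
    then obtain hs where hs: "hs \<in> HW" "hw hs = hw gs" "y = act w hs c" using foldl_trans_gen[OF assms(1,2)] by auto
    thus "y = act w gs c" using act_cong[OF assms(1), of hs gs] by (simp add: hw_eq_iff)
  qed
  finally show ?thesis .
qed

lemma T_module:
  assumes w: "w \<in> W"
  shows "rmod (T w)"
proof -
  have md: "module K (T w)"
  proof (rule K.function_module[of _ "B w"])
    show "x \<oplus>\<^bsub>T w\<^esub> y \<in> carrier (T w)" if "x \<in> carrier (T w)" "y \<in> carrier (T w)" for x y
      using that T_add_closed unfolding T_sel(1) by blast
    show "a \<odot>\<^bsub>T w\<^esub> x \<in> carrier (T w)" if "a \<in> carrier K" "x \<in> carrier (T w)" for a x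
      using that T_smult_closed unfolding T_sel(1) by blast
  qed (simp_all add: T_sel zero_vec_def)
  show ?thesis
  proof (intro right_module.intro right_module_axioms.intro md M_monoid)
    fix x f assume "x \<in> carrier (T w)" "f \<in> carrier M"
    then obtain gs where "x \<in> Vec w" "gs \<in> HW" "f = hw gs" using M_cases[of f] by (auto simp: T_sel(1))
    thus "x \<cdot>\<^bsub>T w\<^esub> f \<in> carrier (T w)" using T_ract[OF w] act_closed by (simp add: T_sel(1))
  next
    fix x y f assume "x \<in> carrier (T w)" "y \<in> carrier (T w)" "f \<in> carrier M"
    then obtain gs where "x \<in> Vec w" "y \<in> Vec w" "gs \<in> HW" "f = hw gs" using M_cases[of f] by (auto simp: T_sel(1))
    thus "(x \<oplus>\<^bsub>T w\<^esub> y) \<cdot>\<^bsub>T w\<^esub> f = x \<cdot>\<^bsub>T w\<^esub> f \<oplus>\<^bsub>T w\<^esub> y \<cdot>\<^bsub>T w\<^esub> f"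
      using T_ract[OF w] T_add_closed act_add by simp
  next
    fix a x f assume "a \<in> carrier K" "x \<in> carrier (T w)" "f \<in> carrier M"
    moreover from this obtain gs where "x \<in> Vec w" "gs \<in> HW" "f = hw gs" using M_cases[of f] by (auto simp: T_sel(1))
    ultimately show "a \<odot>\<^bsub>T w\<^esub> x \<cdot>\<^bsub>T w\<^esub> f = a \<odot>\<^bsub>T w\<^esub> (x \<cdot>\<^bsub>T w\<^esub> f)"
      using T_ract[OF w] T_smult_closed act_smult by simp
  next
    fix x assume "x \<in> carrier (T w)"
    thus "x \<cdot>\<^bsub>T w\<^esub> \<one>\<^bsub>M\<^esub> = x" unfolding hw_one using T_ract[OF w, of x "[]"] act_Nil by (simp add: T_sel(1))
  next
    fix x f g assume "x \<in> carrier (T w)" "f \<in> carrier M" "g \<in> carrier M"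
    then obtain gs hs where "x \<in> Vec w" "gs \<in> HW" "f = hw gs" "hs \<in> HW" "g = hw hs" using M_cases[of f] M_cases[of g] by (auto simp: T_sel(1))
    thus "x \<cdot>\<^bsub>T w\<^esub> (f \<otimes>\<^bsub>M\<^esub> g) = x \<cdot>\<^bsub>T w\<^esub> f \<cdot>\<^bsub>T w\<^esub> g"
      using T_ract[OF w] act_closed act_append[OF w] by (simp add: hw_mult)
  qed
qed

lemma act_Ascend:
  assumes "w \<in> W" "c \<in> Vec w" "i \<in> I" "a \<in> B w"
  shows "act w [Ascend i] c a = (if i \<in> D a then c a \<oplus>\<^sub>K c (a \<otimes> s i) else \<zero>\<^sub>K)"
proof -
  have ac: "a \<in> W" using interval_closed assms by blast
  let ?S = "{u \<in> B w. ok w [Ascend i] u \<and> run [Ascend i] u = a}"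
  have eq: "u \<otimes> s i = a \<longleftrightarrow> u = a \<otimes> s i" if "u \<in> W" for u
    using that ac assms(3) by (auto simp: m_assoc)
  have mem: "u \<in> ?S \<longleftrightarrow> i \<in> D u \<and> u = a \<or> i \<notin> D u \<and> u = a \<otimes> s i" if u: "u \<in> B w" for u
  proof -
    note e = eq[OF interval_closed[OF u]]
    have "u = a \<otimes> s i \<longrightarrow> u \<otimes> s i \<in> B w" using e assms(4) by metis
    thus ?thesis using ok_gen(1)[OF assms(1) u assms(3)] u e by (cases "i \<in> D u") (simp_all, blast)
  qed
  show ?thesis
  proof (cases "i \<in> D a")
    case True
    have b: "a \<otimes> s i \<in> B w" using interval_descent[OF assms(1,4) True] by simp
    have "a \<otimes> s i \<noteq> a" using len_mult_s(1)[OF assms(3) ac True] by auto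
    moreover have "?S = {a, a \<otimes> s i}"
      using mem True b assms(4) descent_mult_s[OF assms(3) ac] by blast
    ultimately show ?thesis unfolding act_apply[OF assms(4)]
      using True Vec_val[OF assms(2)] assms(4) b by simp
  next
    case False
    have "u \<notin> ?S" for u
      using mem[of u] False descent_mult_s[OF assms(3) ac] by (cases "u \<in> B w") (simp_all, metis)
    hence e: "?S = {}" by blast
    show ?thesis unfolding act_apply[OF assms(4)] e using False by simp
  qed
qed

lemma act_Descend:
  assumes "w \<in> W" "c \<in> Vec w" "i \<in> I" "a \<in> B w"
  shows "act w [Descend i] c a =
    (if i \<notin> D a \<and> a \<otimes> s i \<in> B w then c a \<oplus>\<^sub>K c (a \<otimes> s i) else \<zero>\<^sub>K)"
proof -
  have ac: "a \<in> W" using interval_closed assms by blast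
  let ?S = "{u \<in> B w. ok w [Descend i] u \<and> run [Descend i] u = a}"
  have eq: "u \<otimes> s i = a \<longleftrightarrow> u = a \<otimes> s i" if "u \<in> W" for u
    using that ac assms(3) by (auto simp: m_assoc)
  have mem: "u \<in> ?S \<longleftrightarrow> i \<in> D u \<and> u = a \<otimes> s i \<or> i \<notin> D u \<and> u \<otimes> s i \<in> B w \<and> u = a" if "u \<in> B w" for u
    using ok_gen(2)[OF assms(1) that assms(3)] interval_closed[OF that] eq assms(4) that by auto
  show ?thesis
  proof (cases "i \<notin> D a \<and> a \<otimes> s i \<in> B w")
    case True
    have "a \<otimes> s i \<noteq> a" using len_mult_s(2)[OF assms(3) ac] True by auto
    moreover have "?S = {a, a \<otimes> s i}"
      using mem True assms(4) descent_mult_s[OF assms(3) ac] by blast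
    ultimately show ?thesis unfolding act_apply[OF assms(4)]
      using True Vec_val[OF assms(2)] assms(4) by simp
  next
    case False
    have "u \<notin> ?S" for u
      using mem[of u] False descent_mult_s[OF assms(3) ac] by (cases "u \<in> B w") (simp_all, metis)
    hence e: "?S = {}" by blast
    show ?thesis unfolding act_apply[OF assms(4)] e using False by auto
  qed
qed

section \<open>Basis vectors, submodules and homomorphisms of translation modules\<close>

definition bas :: "'a \<Rightarrow> 'a \<Rightarrow> 'a \<Rightarrow> 'k" where "bas w u = basis_vec K (B w) u"

lemma bas_closed [simp]: "bas w u \<in> Vec w"
  by (auto simp: bas_def basis_vec_def)

lemma bas_apply: "a \<in> B w \<Longrightarrow> bas w u a = (if a = u then \<one>\<^sub>K else \<zero>\<^sub>K)"
  by (simp add: bas_def basis_vec_def)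

lemma act_bas:
  assumes "u \<in> B w"
  shows "act w gs (bas w u) = (if ok w gs u then bas w (run gs u) else zerov w)"
proof (rule Vec_eqI[of _ w])
  fix a assume a: "a \<in> B w"
  let ?S = "{x \<in> B w. ok w gs x \<and> run gs x = a}"
  show "act w gs (bas w u) a = (if ok w gs u then bas w (run gs u) else zerov w) a"
  proof (cases "u \<in> ?S")
    case True
    have "act w gs (bas w u) a = (\<Oplus>\<^bsub>K\<^esub>x\<in>?S. if u = x then \<one>\<^sub>K else \<zero>\<^sub>K)"
      unfolding act_apply[OF a] by (intro K.finsum_cong') (auto simp: bas_apply)
    also have "\<dots> = \<one>\<^sub>K" using K.finsum_singleton[OF True, of "\<lambda>_. \<one>\<^sub>K"] by simp
    finally show ?thesis using True by (auto simp: bas_apply[OF a])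
  next
    case False
    have "act w gs (bas w u) a = \<zero>\<^sub>K"
      unfolding act_apply[OF a] using False by (intro K.add.finprod_one_eqI) (auto simp: bas_apply)
    thus ?thesis using False assms a by (auto simp: bas_apply zero_vec_apply)
  qed
qed (use act_closed[OF bas_closed] in \<open>simp_all split: if_split\<close>)

lemma Vec_induct [consumes 1, case_names zero basis add]:
  assumes "c \<in> Vec w" "P (zerov w)"
    "\<And>u a. u \<in> B w \<Longrightarrow> a \<in> carrier K \<Longrightarrow> P (a \<odot>\<^bsub>T w\<^esub> bas w u)"
    "\<And>x y. x \<in> Vec w \<Longrightarrow> y \<in> Vec w \<Longrightarrow> P x \<Longrightarrow> P y \<Longrightarrow> P (x \<oplus>\<^bsub>T w\<^esub> y)"
  shows "P c"
proof -
  let ?r = "\<lambda>S. \<lambda>q\<in>B w. if q \<in> S then c q else \<zero>\<^sub>K"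
  have r: "?r S \<in> Vec w \<and> P (?r S)" if "finite S" "S \<subseteq> B w" for S
    using that
  proof (induction S rule: finite_induct)
    case empty
    have "?r {} = zerov w" by (simp add: zero_vec_def)
    thus ?case using assms(2) zero_vec_closed by simp
  next
    case (insert p S)
    hence p: "p \<in> B w" "c p \<in> carrier K" using Vec_val[OF assms(1)] by auto
    have e: "?r (insert p S) = ?r S \<oplus>\<^bsub>T w\<^esub> (c p \<odot>\<^bsub>T w\<^esub> bas w p)"
      using insert.hyps p Vec_val[OF assms(1)] by (auto simp: T_sel bas_apply fun_eq_iff restrict_def)
    have "?r S \<in> Vec w" "P (?r S)" using insert.IH insert.prems by blast+
    thus ?case unfolding e
      using assms(4)[OF _ T_smult_closed[OF p(2) bas_closed] _ assms(3)[OF p]]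
        T_add_closed[OF _ T_smult_closed[OF p(2) bas_closed]] by blast
  qed
  have "P (?r (B w))" by (rule conjunct2[OF r[OF finite_interval subset_refl]])
  moreover have "?r (B w) = c" using assms(1) by (auto simp: fun_eq_iff restrict_def PiE_def extensional_def)
  ultimately show ?thesis by simp
qed

lemma T_submoduleI:
  assumes "w \<in> W" "N \<subseteq> Vec w" "zerov w \<in> N"
    "\<And>x y. x \<in> N \<Longrightarrow> y \<in> N \<Longrightarrow> x \<oplus>\<^bsub>T w\<^esub> y \<in> N"
    "\<And>a x. a \<in> carrier K \<Longrightarrow> x \<in> N \<Longrightarrow> a \<odot>\<^bsub>T w\<^esub> x \<in> N"
    "\<And>x gs. x \<in> N \<Longrightarrow> gs \<in> HW \<Longrightarrow> act w gs x \<in> N"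
  shows "submod (T w) N"
proof (rule right_submoduleI[OF T_module[OF assms(1)]])
  fix x f assume "x \<in> N" "f \<in> carrier M"
  moreover from this obtain gs where "gs \<in> HW" "f = hw gs" using M_cases by blast
  ultimately show "x \<cdot>\<^bsub>T w\<^esub> f \<in> N" using T_ract[OF assms(1)] assms(2,6) by (simp add: subset_iff)
qed (use assms in \<open>simp_all add: T_sel(1,2)\<close>)

lemma T_submoduleD:
  assumes "w \<in> W" "submod (T w) N"
  shows "N \<subseteq> Vec w" "zerov w \<in> N"
    "\<And>x y. x \<in> N \<Longrightarrow> y \<in> N \<Longrightarrow> x \<oplus>\<^bsub>T w\<^esub> y \<in> N"
    "\<And>a x. a \<in> carrier K \<Longrightarrow> x \<in> N \<Longrightarrow> a \<odot>\<^bsub>T w\<^esub> x \<in> N"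
    "\<And>x gs. x \<in> N \<Longrightarrow> gs \<in> HW \<Longrightarrow> act w gs x \<in> N"
proof -
  note d = right_submoduleD[OF assms(2) T_module[OF assms(1)]]
  show 1: "N \<subseteq> Vec w" using d(1) by (simp add: T_sel)
  show "zerov w \<in> N" using d(2) by (simp add: T_sel)
  show "\<And>x y. x \<in> N \<Longrightarrow> y \<in> N \<Longrightarrow> x \<oplus>\<^bsub>T w\<^esub> y \<in> N" by (rule d(3))
  show "\<And>a x. a \<in> carrier K \<Longrightarrow> x \<in> N \<Longrightarrow> a \<odot>\<^bsub>T w\<^esub> x \<in> N" by (rule d(4))
  fix x gs assume "x \<in> N" "gs \<in> HW"
  thus "act w gs x \<in> N" using d(5)[of x "hw gs"] T_ract[OF assms(1), of x gs] 1 hw_closed by auto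
qed

lemma T_neg: "w \<in> W \<Longrightarrow> c \<in> Vec w \<Longrightarrow> u \<in> B w \<Longrightarrow> (\<ominus>\<^bsub>T w\<^esub> c) u = \<ominus>\<^bsub>K\<^esub> (c u)"
proof -
  assume *: "w \<in> W" "c \<in> Vec w" "u \<in> B w"
  interpret T: right_module K M "T w" by (rule T_module) fact
  have "\<ominus>\<^bsub>T w\<^esub> c = (\<ominus>\<^bsub>K\<^esub> \<one>\<^sub>K) \<odot>\<^bsub>T w\<^esub> c" using * by (intro T.neg_as_smult) (simp add: T_sel)
  thus ?thesis using * Vec_val[OF *(2,3)] by (simp add: T_sel K.l_minus)
qed

lemma T_minus: "w \<in> W \<Longrightarrow> c \<in> Vec w \<Longrightarrow> d \<in> Vec w \<Longrightarrow> u \<in> B w \<Longrightarrow> (c \<ominus>\<^bsub>T w\<^esub> d) u = c u \<ominus>\<^bsub>K\<^esub> d u"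
  by (simp add: a_minus_def T_sel(3) T_neg)

lemma act_zero: "w \<in> W \<Longrightarrow> gs \<in> HW \<Longrightarrow> act w gs (zerov w) = zerov w"
  using right_module.zero_ract[OF T_module, of w "hw gs"] T_ract[of w "zerov w" gs] hw_closed
  by (simp add: T_sel(2))

lemma act_minus:
  assumes "w \<in> W" "c \<in> Vec w" "d \<in> Vec w"
  shows "act w gs (c \<ominus>\<^bsub>T w\<^esub> d) = act w gs c \<ominus>\<^bsub>T w\<^esub> act w gs d"
proof -
  interpret T: right_module K M "T w" by (rule T_module) fact
  have c: "c \<in> carrier (T w)" "d \<in> carrier (T w)" "act w gs d \<in> carrier (T w)" using assms act_closed by (simp_all add: T_sel(1))
  have n: "\<ominus>\<^bsub>T w\<^esub> d = (\<ominus>\<^bsub>K\<^esub> \<one>\<^sub>K) \<odot>\<^bsub>T w\<^esub> d" "\<ominus>\<^bsub>T w\<^esub> (act w gs d) = (\<ominus>\<^bsub>K\<^esub> \<one>\<^sub>K) \<odot>\<^bsub>T w\<^esub> act w gs d"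
    by (intro T.neg_as_smult c)+
  show ?thesis unfolding a_minus_def n
    using act_add[OF assms(2) T_smult_closed[OF _ assms(3)], of "\<ominus>\<^bsub>K\<^esub> \<one>\<^sub>K" gs] act_smult[OF _ assms(3), of "\<ominus>\<^bsub>K\<^esub> \<one>\<^sub>K" gs] by simp
qed

lemma one_interval: "w \<in> W \<Longrightarrow> \<one> \<in> B w"
  by (simp add: interval_iff)

lemma self_interval: "w \<in> W \<Longrightarrow> w \<in> B w"
  by (simp add: interval_iff)

lemma ok_up:
  assumes "w \<in> W" "u \<in> W" "reduced z zs" "len (u \<otimes> z) = len u + len z" "u \<otimes> z \<in> B w" "u \<in> B w"
  shows "ok w (up zs) u" "run (up zs) u = u \<otimes> z"
proof -
  note r = red_word[OF assms(3)]
  show 1: "run (up zs) u = u \<otimes> z" by (rule run_up[OF assms(3,2,4)])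
  have "len (co w \<otimes> (u \<otimes> z)) = len (co w) + len (u \<otimes> z)" using interval_iff_co assms r by blast
  moreover have "len (co w \<otimes> u) = len (co w) + len u" using interval_iff_co assms by blast
  ultimately have "len (co w \<otimes> u \<otimes> z) = len (co w \<otimes> u) + len z" using assms r by (simp add: m_assoc)
  thus "ok w (up zs) u" unfolding ok_def 1 using run_up[OF assms(3), of "co w \<otimes> u"] assms r by (simp add: m_assoc)
qed

lemma ok_down:
  assumes "w \<in> W" "u \<in> W" "reduced z zs" "len (u \<otimes> z) = len u + len z" "u \<otimes> z \<in> B w" "u \<in> B w"
  shows "ok w (down zs) (u \<otimes> z)" "run (down zs) (u \<otimes> z) = u"
proof -
  note r = red_word[OF assms(3)]
  show 1: "run (down zs) (u \<otimes> z) = u" by (rule run_down[OF assms(3,2,4)])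
  have "len (co w \<otimes> (u \<otimes> z)) = len (co w) + len (u \<otimes> z)" using interval_iff_co assms r by blast
  moreover have "len (co w \<otimes> u) = len (co w) + len u" using interval_iff_co assms by blast
  ultimately have "len (co w \<otimes> u \<otimes> z) = len (co w \<otimes> u) + len z" using assms r by (simp add: m_assoc)
  thus "ok w (down zs) (u \<otimes> z)" unfolding ok_def 1 using run_down[OF assms(3), of "co w \<otimes> u"] assms r by (simp add: m_assoc)
qed

lemma act_up_one:
  assumes "w \<in> W" "u \<in> B w" "reduced u us"
  shows "act w (up us) (bas w \<one>) = bas w u"
  using ok_up[OF assms(1) one_closed assms(3)] assms interval_closed[OF assms(2)] one_interval act_bas[of \<one> w "up us"] by simp

lemma act_down_top:
  assumes "w \<in> W" "reduced w ws"
  shows "act w (down ws) (bas w w) = bas w \<one>"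
  using ok_down[OF assms(1) one_closed assms(2)] assms one_interval self_interval act_bas[of w w "down ws"] by simp

text \<open>Inside the interval w descends to 1, and 1 ascends to every u, so the top basis vector
  generates the whole module.\<close>

lemma T_submodule_top:
  assumes "w \<in> W" "submod (T w) N" "bas w w \<in> N"
  shows "N = Vec w"
proof -
  note n = T_submoduleD[OF assms(1,2)]
  obtain ws where ws: "reduced w ws" using reduced_word_exists assms by blast
  hence one: "bas w \<one> \<in> N" using act_down_top[OF assms(1) ws] n(5)[OF assms(3), of "down ws"] red_word[OF ws] by simp
  have bas: "bas w u \<in> N" if u: "u \<in> B w" for u
  proof -
    obtain us where us: "reduced u us" using reduced_word_exists interval_closed[OF u] by blast
    thus ?thesis using act_up_one[OF assms(1) u us] n(5)[OF one, of "up us"] red_word[OF us] by simp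
  qed
  have "c \<in> N" if "c \<in> Vec w" for c
    using that by (induction rule: Vec_induct) (use n bas in auto)
  thus ?thesis using n(1) by blast
qed

lemma T_hom:
  assumes w: "w \<in> W" and V: "rmod V" and t: "\<And>u. u \<in> B w \<Longrightarrow> t u \<in> carrier V"
    and eq: "\<And>u gs. u \<in> B w \<Longrightarrow> gs \<in> HW \<Longrightarrow> t u \<cdot>\<^bsub>V\<^esub> hw gs = (if ok w gs u then t (run gs u) else \<zero>\<^bsub>V\<^esub>)"
  shows "\<exists>H\<in>Hom (T w) V. \<forall>u\<in>B w. H (bas w u) = t u"
proof -
  interpret V: right_module K M V by fact
  interpret T: right_module K M "T w" by (rule T_module) fact
  define H where "H c = (\<Oplus>\<^bsub>V\<^esub>u\<in>B w. c u \<odot>\<^bsub>V\<^esub> t u)" for c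
  have cl: "H c \<in> carrier V" if "c \<in> Vec w" for c
    unfolding H_def using Vec_val[OF that] t by (intro V.M.finsum_closed) auto
  have hadd: "H (c \<oplus>\<^bsub>T w\<^esub> d) = H c \<oplus>\<^bsub>V\<^esub> H d" if v: "c \<in> Vec w" "d \<in> Vec w" for c d
  proof -
    have "H (c \<oplus>\<^bsub>T w\<^esub> d) = (\<Oplus>\<^bsub>V\<^esub>u\<in>B w. c u \<odot>\<^bsub>V\<^esub> t u \<oplus>\<^bsub>V\<^esub> d u \<odot>\<^bsub>V\<^esub> t u)"
      unfolding H_def using Vec_val[OF v(1)] Vec_val[OF v(2)] t
      by (intro V.M.finsum_cong') (auto simp: T_sel V.smult_l_distr)
    also have "\<dots> = H c \<oplus>\<^bsub>V\<^esub> H d"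
      unfolding H_def using Vec_val[OF v(1)] Vec_val[OF v(2)] t by (intro V.M.finsum_addf) auto
    finally show ?thesis .
  qed
  have sm: "H (a \<odot>\<^bsub>T w\<^esub> c) = a \<odot>\<^bsub>V\<^esub> H c" if v: "a \<in> carrier K" "c \<in> Vec w" for a c
  proof -
    have "H (a \<odot>\<^bsub>T w\<^esub> c) = (\<Oplus>\<^bsub>V\<^esub>u\<in>B w. a \<odot>\<^bsub>V\<^esub> (c u \<odot>\<^bsub>V\<^esub> t u))"
      unfolding H_def using Vec_val[OF v(2)] v(1) t
      by (intro V.M.finsum_cong') (auto simp: T_sel V.smult_assoc1)
    also have "\<dots> = a \<odot>\<^bsub>V\<^esub> H c"
      unfolding H_def using Vec_val[OF v(2)] v(1) t by (intro V.finsum_smult_ldistr[symmetric]) auto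
    finally show ?thesis .
  qed
  have bas: "H (bas w u) = t u" if u: "u \<in> B w" for u
  proof -
    have "H (bas w u) = (\<Oplus>\<^bsub>V\<^esub>x\<in>B w. if u = x then t x else \<zero>\<^bsub>V\<^esub>)"
      unfolding H_def using t by (intro V.M.finsum_cong') (auto simp: bas_apply)
    also have "\<dots> = t u" using t u by (intro V.M.finsum_singleton) auto
    finally show ?thesis .
  qed
  have hzero: "H (zerov w) = \<zero>\<^bsub>V\<^esub>"
    using sm[of "\<zero>\<^sub>K" "zerov w"] cl T.smult_l_null[of "zerov w"] by (simp add: T_sel)
  have ra: "H (act w gs c) = H c \<cdot>\<^bsub>V\<^esub> hw gs" if gs: "gs \<in> HW" and c: "c \<in> Vec w" for gs c
    using c
  proof (induction rule: Vec_induct)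
    case zero
    thus ?case using act_zero[OF w gs] hzero V.zero_ract hw_closed[OF gs] by simp
  next
    case (basis u a)
    have "H (act w gs (bas w u)) = t u \<cdot>\<^bsub>V\<^esub> hw gs"
      unfolding act_bas[OF basis(1)] eq[OF basis(1) gs] using bas[OF ok_interval[OF w basis(1) gs]] hzero by simp
    thus ?case using basis act_smult sm act_closed bas t V.ract_smult hw_closed[OF gs] by simp
  next
    case (add x y)
    thus ?case using act_add act_closed hadd cl V.ract_add hw_closed[OF gs] by simp
  qed
  have "H \<in> Hom (T w) V"
  proof (rule rmodule_homI)
    fix x f assume "x \<in> carrier (T w)" "f \<in> carrier M"
    then obtain gs where "x \<in> Vec w" "gs \<in> HW" "f = hw gs" using M_cases[of f] by (auto simp: T_sel(1))
    thus "H (x \<cdot>\<^bsub>T w\<^esub> f) = H x \<cdot>\<^bsub>V\<^esub> f" using ra T_ract[OF w] by simp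
  qed (use cl hadd sm in \<open>simp_all add: T_sel(1)\<close>)
  thus ?thesis using bas by blast
qed

section \<open>Antisymmetric vectors\<close>

abbreviation "P \<equiv> P_space K G I s"
abbreviation "PRef \<equiv> parabolic_reflections G s"

definition sg :: "nat \<Rightarrow> 'k \<Rightarrow> 'k" where
  "sg n x = (if even n then x else \<ominus>\<^bsub>K\<^esub> x)"

lemma sg_simps [simp]: "x \<in> carrier K \<Longrightarrow> sg n x \<in> carrier K" "sg 0 x = x" "sg n \<zero>\<^sub>K = \<zero>\<^sub>K"
  by (simp_all add: sg_def)

lemma sg_add: "x \<in> carrier K \<Longrightarrow> y \<in> carrier K \<Longrightarrow> sg n (x \<oplus>\<^sub>K y) = sg n x \<oplus>\<^sub>K sg n y"
  by (simp add: sg_def K.minus_add)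

lemma sg_smult: "a \<in> carrier K \<Longrightarrow> x \<in> carrier K \<Longrightarrow> sg n (a \<otimes>\<^sub>K x) = a \<otimes>\<^sub>K sg n x"
  by (simp add: sg_def K.r_minus)

lemma sg_flip: "x \<in> carrier K \<Longrightarrow> even n = odd n' \<Longrightarrow> sg n x = \<ominus>\<^bsub>K\<^esub> sg n' x"
  by (auto simp: sg_def)

lemma left_op_apply:
  assumes t: "t \<in> W" "t \<otimes> t = \<one>" and x: "x \<in> Vec w" and u: "u \<in> B w"
  shows "left_op K G I s w t x u = (if t \<otimes> u \<in> B w then x (t \<otimes> u) else \<ominus>\<^bsub>K\<^esub> (x u))"
proof -
  let ?c = "if t \<otimes> u \<in> B w then t \<otimes> u else u"
  let ?n = "\<lambda>y. if t \<otimes> u \<in> B w then y else \<ominus>\<^bsub>K\<^esub> y"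
  have c: "?c \<in> B w" using u by simp
  have invol: "t \<otimes> (t \<otimes> v) = v" if "v \<in> W" for v
    using t that m_assoc[of t t v] by simp
  have uc: "u \<in> W" using interval_closed u by blast
  have "left_op K G I s w t x u = (\<Oplus>\<^bsub>K\<^esub>v\<in>B w. x v \<otimes>\<^sub>K
      (if t \<otimes> v \<in> B w then basis_vec K (B w) (t \<otimes> v) else neg_vec K (B w) (basis_vec K (B w) v)) u)"
    using u by (simp add: left_op_def lin_ext_def Let_def)
  also have "\<dots> = (\<Oplus>\<^bsub>K\<^esub>v\<in>B w. if ?c = v then ?n (x v) else \<zero>\<^sub>K)"
  proof (rule K.finsum_cong')
    fix v assume v: "v \<in> B w"
    have vc: "v \<in> W" "x v \<in> carrier K" using interval_closed v Vec_val[OF x] by blast+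
    have e: "u = t \<otimes> v \<longleftrightarrow> v = t \<otimes> u" using invol[OF vc(1)] invol[OF uc] by metis
    show "x v \<otimes>\<^sub>K (if t \<otimes> v \<in> B w then basis_vec K (B w) (t \<otimes> v) else neg_vec K (B w) (basis_vec K (B w) v)) u
      = (if ?c = v then ?n (x v) else \<zero>\<^sub>K)"
    proof (cases "t \<otimes> v \<in> B w")
      case True
      have "v = u \<Longrightarrow> t \<otimes> u \<in> B w" using True by simp
      thus ?thesis using True u v vc e by (auto simp: basis_vec_def)
    next
      case False
      have "v = t \<otimes> u \<Longrightarrow> t \<otimes> v \<in> B w" using e u by metis
      thus ?thesis using False u v vc by (auto simp: basis_vec_def neg_vec_def K.r_minus)
    qed
  qed (use Vec_val[OF x] in auto)
  also have "\<dots> = ?n (x ?c)" using Vec_val[OF x] c by (intro K.finsum_singleton) auto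
  finally show ?thesis by simp
qed

lemma parabolic_reflection:
  assumes "J \<subseteq> I" "t \<in> PRef J"
  shows "t \<in> Par J" "t \<in> W" "t \<in> reflections" "t \<otimes> t = \<one>" "odd (len t)"
proof -
  obtain x j where x: "x \<in> Par J" "j \<in> J" "t = x \<otimes> s j \<otimes> inv x"
    using assms(2) by (auto simp: parabolic_reflections_def)
  show "t \<in> Par J" unfolding x(3)
    by (intro parabolic_mult x(1) parabolic_simple x(2) parabolic_inv assms(1))
  thus "t \<in> W" using parabolic_closed assms(1) by blast
  show t: "t \<in> reflections"
    unfolding reflections_def using x parabolic_closed[OF assms(1)] assms(1) by blast
  show "t \<otimes> t = \<one>" "odd (len t)" using reflection_square odd_len_reflection t by blast+
qed

text \<open>Where t u leaves the interval, the operator of t already changes the sign, so only pairs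
  u and t u inside \<open>B w\<close> impose a condition.\<close>

lemma P_space_iff:
  assumes "J \<subseteq> I"
  shows "x \<in> P w J \<longleftrightarrow> x \<in> Vec w \<and>
    (\<forall>t\<in>PRef J. \<forall>u\<in>B w. t \<otimes> u \<in> B w \<longrightarrow> x (t \<otimes> u) = \<ominus>\<^bsub>K\<^esub> (x u))"
proof -
  have "left_op K G I s w t x = neg_vec K (B w) x \<longleftrightarrow>
      (\<forall>u\<in>B w. t \<otimes> u \<in> B w \<longrightarrow> x (t \<otimes> u) = \<ominus>\<^bsub>K\<^esub> (x u))" if x: "x \<in> Vec w" and t: "t \<in> PRef J" for t
  proof -
    have "left_op K G I s w t x = neg_vec K (B w) x \<longleftrightarrow>
        (\<forall>u\<in>B w. left_op K G I s w t x u = neg_vec K (B w) x u)"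
      by (auto simp: left_op_def lin_ext_def Let_def neg_vec_def fun_eq_iff restrict_def)
    thus ?thesis using left_op_apply[OF parabolic_reflection(2,4)[OF assms t] x] by (auto simp: neg_vec_def)
  qed
  thus ?thesis by (auto simp: P_space_def T_sel(1))
qed

lemma P_space_empty: "P w {} = Vec w"
  using P_space_iff[of "{}"] by (auto simp: parabolic_reflections_def)

lemma P_space_mono:
  assumes "J \<subseteq> I" "J' \<subseteq> I" "s ` J \<subseteq> s ` J'"
  shows "P w J' \<subseteq> P w J"
proof -
  have "PRef J \<subseteq> PRef J'"
  proof
    fix t assume "t \<in> PRef J"
    then obtain x j where x: "x \<in> Par J" "j \<in> J" "t = x \<otimes> s j \<otimes> inv x"
      by (auto simp: parabolic_reflections_def)
    moreover obtain j' where "j' \<in> J'" "s j = s j'" using x(2) assms(3) by blast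
    ultimately show "t \<in> PRef J'" using parabolic_mono[OF assms(3) x(1)] unfolding parabolic_reflections_def by auto
  qed
  hence "x \<in> P w J" if "x \<in> P w J'" for x
    using that P_space_iff[OF assms(1), of x w] P_space_iff[OF assms(2), of x w] by blast
  thus ?thesis by blast
qed

section \<open>Antisymmetrization over a block\<close>

lemma block_data:
  assumes "w \<in> W" "RB w J"
  shows "J \<subseteq> I" "mrep J w \<in> W" "block_rep J (mrep J w)" "top_part J w \<in> Par J" "w = top_part J w \<otimes> mrep J w"
  using RB_subset[OF assms(2)] RB_block_rep[OF assms(2,1)] min_rep_mem(1)[OF _ assms(1)] top_part(1,3)[OF _ assms(1)] by blast+

lemma coset_decomp:
  assumes "J \<subseteq> I" "y \<in> Par J" "a \<in> W" "left_minimal J a"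
  shows "mrep J (y \<otimes> a) = a" "top_part J (y \<otimes> a) = y"
  using min_rep_unique[OF assms] top_part_unique[OF assms] by blast+

lemma block_interval:
  assumes "w \<in> W" "RB w J" "u \<in> W"
  shows "u \<in> B w \<longleftrightarrow> rle (top_part J u) (top_part J w) \<and> mrep J u \<in> B (mrep J w)"
proof -
  note d = block_data[OF assms(1,2)]
  note t = top_part[OF d(1) assms(3)] and m = min_rep_mem(1)[OF d(1) assms(3)]
  show ?thesis
    using block_rep_rle_iff[OF d(3,4) t(1) m left_minimal_min_rep[OF d(1) assms(3)], folded t(3) d(5)]
      assms d(2) m by (simp add: interval_iff)
qed

lemma block_interval_rep:
  assumes "w \<in> W" "RB w J" "a \<in> B (mrep J w)"
  shows "a \<in> B w" "left_minimal J a" "mrep J a = a" "top_part J a = \<one>"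
proof -
  note d = block_data[OF assms(1,2)]
  have a: "a \<in> W" "rle a (mrep J w)" using assms(3) d(2) by (simp_all add: interval_iff)
  show "a \<in> B w" and m: "left_minimal J a"
    using block_rep_interval[OF d(3,4) a(1), folded d(5)] a assms(1) by (simp_all add: interval_iff)
  show "mrep J a = a" "top_part J a = \<one>" using coset_decomp[OF d(1) parabolic_one a(1) m] a(1) by simp_all
qed

text \<open>Antisymmetrization over W_J, truncated to the interval \<open>B w\<close>: a vector on
  the minimal representatives is spread over their cosets with the sign character of W_J.\<close>

definition phi :: "'i set \<Rightarrow> 'a \<Rightarrow> ('a \<Rightarrow> 'k) \<Rightarrow> 'a \<Rightarrow> 'k" where
  "phi J w c = (\<lambda>u\<in>B w. sg (len (top_part J u)) (c (mrep J u)))"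

lemma phi_apply: "u \<in> B w \<Longrightarrow> phi J w c u = sg (len (top_part J u)) (c (mrep J u))"
  by (simp add: phi_def)

context
  fixes w J
  assumes w: "w \<in> W" and RB: "RB w J"
begin

lemma min_rep_interval: "u \<in> B w \<Longrightarrow> mrep J u \<in> B (mrep J w)"
  using block_interval[OF w RB] interval_closed by blast

lemma phi_closed: "c \<in> Vec (mrep J w) \<Longrightarrow> phi J w c \<in> Vec w"
  unfolding phi_def restrict_PiE_iff using min_rep_interval Vec_val by (intro ballI sg_simps(1)) blast

lemma phi_rep: "a \<in> B (mrep J w) \<Longrightarrow> phi J w c a = c a"
  using block_interval_rep[OF w RB] by (simp add: phi_apply)

text \<open>Write u = y a with a minimal and let r = a s_i a^-1. If r lies in W_J, then u and u s_i
  belong to the same coset with opposite signs and cancel on the right, while on the left a s_i is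
  outside the smaller interval and the coefficient at a is zero. Otherwise a s_i is minimal again,
  and descents, interval membership and signs for u and u s_i are those for a and a s_i, up to the
  common sign of y.\<close>

lemma phi_gen:
  assumes c: "c \<in> Vec (mrep J w)" and g: "g \<in> hecke_gens I"
  shows "phi J w (act (mrep J w) [g] c) = act w [g] (phi J w c)"
proof (rule Vec_eqI[of _ w])
  note d = block_data[OF w RB]
  fix u assume u: "u \<in> B w"
  define a y where "a = mrep J u" and "y = top_part J u"
  have uc: "u \<in> W" using interval_closed u by blast
  note t = top_part[OF d(1) uc, folded a_def y_def]
  have ab: "a \<in> B (mrep J w)" using min_rep_interval[OF u] by (simp add: a_def)
  have a: "a \<in> W" "left_minimal J a" using ab block_interval_rep(2)[OF w RB] interval_closed by blast+
  have yr: "rle y (top_part J w)" using block_interval[OF w RB uc] u by (simp add: y_def)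
  obtain i where i: "i \<in> I" "g = Ascend i \<or> g = Descend i" using g by (auto elim: hecke_gens_cases)
  have sic: "s i \<in> W" using i by simp
  define r where "r = a \<otimes> s i \<otimes> inv a"
  have rr: "r \<in> reflections" unfolding r_def reflections_def using a i by blast
  have rc: "r \<in> W" using rr reflections_closed by blast
  have ra: "a \<otimes> s i = r \<otimes> a" using a sic by (simp add: r_def m_assoc)
  have us: "u \<otimes> s i = y \<otimes> (a \<otimes> s i)" using t(2) a(1) sic by (subst t(3)) (simp add: m_assoc)
  have cv: "b \<in> B (mrep J w) \<Longrightarrow> c b \<in> carrier K" for b using Vec_val[OF c] .
  have pu: "phi J w c u = sg (len y) (c a)" using u by (simp add: phi_apply a_def y_def)
  have lhs: "phi J w (act (mrep J w) [g] c) u = sg (len y) (act (mrep J w) [g] c a)"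
    using u by (simp add: phi_apply a_def y_def)
  show "phi J w (act (mrep J w) [g] c) u = act w [g] (phi J w c) u"
  proof (cases "r \<in> Par J")
    case True
    have "len (r \<otimes> a) = len r + len a"
      using inversions_mult_minimal(1)[OF d(1) True a(1)] left_minimal_iff[OF d(1) a(1)] a(2) by blast
    moreover have "len r > 0" using odd_len_reflection[OF rr] by (cases "len r") auto
    ultimately have na: "i \<notin> D a" using len_mult_s(1)[OF i(1) a(1)] ra by auto
    have "a \<otimes> s i \<notin> B (mrep J w)"
    proof
      assume "a \<otimes> s i \<in> B (mrep J w)"
      hence "mrep J (a \<otimes> s i) = a \<otimes> s i" using block_interval_rep(3)[OF w RB] by blast
      hence "a \<otimes> s i = a" using coset_decomp(1)[OF d(1) True a] ra by simp
      thus False using len_mult_s(2)[OF i(1) a(1) na] by simp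
    qed
    hence "act (mrep J w) [g] c a = \<zero>\<^sub>K"
      using i(2) na act_Ascend[OF d(2) c i(1) ab] act_Descend[OF d(2) c i(1) ab] by auto
    moreover have "phi J w c u \<oplus>\<^sub>K phi J w c (u \<otimes> s i) = \<zero>\<^sub>K" if b: "u \<otimes> s i \<in> B w"
    proof -
      have yrp: "y \<otimes> r \<in> Par J" by (intro parabolic_mult t(1) True)
      have "u \<otimes> s i = y \<otimes> r \<otimes> a" unfolding us ra using t(2) rc a by (simp add: m_assoc)
      hence "mrep J (u \<otimes> s i) = a" "top_part J (u \<otimes> s i) = y \<otimes> r" using coset_decomp[OF d(1) yrp a] by simp_all
      hence "phi J w c (u \<otimes> s i) = sg (len (y \<otimes> r)) (c a)" using b by (simp add: phi_apply)
      also have "\<dots> = \<ominus>\<^bsub>K\<^esub> sg (len y) (c a)"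
        using even_len_mult[OF t(2) rc] odd_len_reflection[OF rr] cv[OF ab] by (intro sg_flip) auto
      finally show ?thesis unfolding pu using cv[OF ab] by (simp add: K.r_neg)
    qed
    ultimately show ?thesis unfolding lhs
      using i(2) act_Ascend[OF w phi_closed[OF c] i(1) u] act_Descend[OF w phi_closed[OF c] i(1) u]
        interval_descent(1)[OF w u] by auto
  next
    case False
    have m: "left_minimal J (a \<otimes> s i)"
      unfolding left_minimal_def
    proof
      fix j assume j: "j \<in> J"
      have "s j \<noteq> r" using False parabolic_simple[OF j] by metis
      moreover have "inversions (s i) = {s i}" using inversions_mult[of "s i" \<one>] i by auto
      hence "inversions (a \<otimes> s i) = sym_diff (inversions a) {r}" using inversions_mult[OF a(1) sic] by (simp add: r_def)
      ultimately show "s j \<notin> inversions (a \<otimes> s i)" using a(2) j by (simp add: left_minimal_def)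
    qed
    have asc: "a \<otimes> s i \<in> W" using a sic by simp
    note e = coset_decomp[OF d(1) t(1) asc m, folded us]
    have "len (u \<otimes> s i) = len y + len (a \<otimes> s i)"
      using top_part(4)[OF d(1), of "u \<otimes> s i"] uc sic e by simp
    hence D: "i \<in> D u \<longleftrightarrow> i \<in> D a" using t(4) by (simp add: descent_iff_len)
    have Bi: "u \<otimes> s i \<in> B w \<longleftrightarrow> a \<otimes> s i \<in> B (mrep J w)"
      using block_interval[OF w RB, of "u \<otimes> s i"] uc sic e yr by simp
    have pus: "phi J w c (u \<otimes> s i) = sg (len y) (c (a \<otimes> s i))" if "u \<otimes> s i \<in> B w"
      using that e by (simp add: phi_apply)
    have s2: "sg (len y) (c a \<oplus>\<^sub>K c (a \<otimes> s i)) = phi J w c u \<oplus>\<^sub>K phi J w c (u \<otimes> s i)" if "u \<otimes> s i \<in> B w"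
      using that pu pus[OF that] cv[OF ab] cv[of "a \<otimes> s i"] Bi by (simp add: sg_add)
    show ?thesis unfolding lhs
      using i(2) act_Ascend[OF w phi_closed[OF c] i(1) u] act_Descend[OF w phi_closed[OF c] i(1) u]
        act_Ascend[OF d(2) c i(1) ab] act_Descend[OF d(2) c i(1) ab] D Bi s2
        interval_descent(1)[OF w u] by auto
  qed
qed (intro phi_closed act_closed c)+

lemma phi_act:
  assumes c: "c \<in> Vec (mrep J w)" and gs: "gs \<in> HW"
  shows "phi J w (act (mrep J w) gs c) = act w gs (phi J w c)"
  using gs
proof (induction gs rule: rev_induct)
  case Nil
  thus ?case using act_Nil phi_closed c by simp
next
  case (snoc g gs)
  note d = block_data[OF w RB]
  have g: "gs \<in> HW" "g \<in> hecke_gens I" "[g] \<in> HW" using snoc.prems by auto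
  show ?case
    using act_append[OF d(2) c g(1,3)] act_append[OF w phi_closed[OF c] g(1,3)] phi_gen[OF act_closed[OF c] g(2)] snoc.IH g(1)
    by simp
qed

lemma phi_hom: "phi J w \<in> Hom (T (mrep J w)) (T w)"
proof (rule rmodule_homI)
  note d = block_data[OF w RB]
  fix c assume "c \<in> carrier (T (mrep J w))"
  hence c: "c \<in> Vec (mrep J w)" by (simp add: T_sel(1))
  show "phi J w c \<in> carrier (T w)" unfolding T_sel(1) by (rule phi_closed[OF c])
  { fix c' assume "c' \<in> carrier (T (mrep J w))"
    hence c': "c' \<in> Vec (mrep J w)" by (simp add: T_sel(1))
    show "phi J w (c \<oplus>\<^bsub>T (mrep J w)\<^esub> c') = phi J w c \<oplus>\<^bsub>T w\<^esub> phi J w c'"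
      using Vec_val[OF c min_rep_interval] Vec_val[OF c' min_rep_interval] min_rep_interval
      by (auto simp: T_sel(3) phi_def fun_eq_iff restrict_def sg_add) }
  { fix x assume "x \<in> carrier K"
    thus "phi J w (x \<odot>\<^bsub>T (mrep J w)\<^esub> c) = x \<odot>\<^bsub>T w\<^esub> phi J w c"
      using Vec_val[OF c min_rep_interval] min_rep_interval
      by (auto simp: T_sel(4) phi_def fun_eq_iff restrict_def sg_smult) }
  fix f assume "f \<in> carrier M"
  then obtain gs where "gs \<in> HW" "f = hw gs" using M_cases by blast
  thus "phi J w (c \<cdot>\<^bsub>T (mrep J w)\<^esub> f) = phi J w c \<cdot>\<^bsub>T w\<^esub> f"
    using T_ract[OF d(2) c] T_ract[OF w phi_closed[OF c]] phi_act[OF c] by simp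
qed

lemma phi_P_space: "c \<in> Vec (mrep J w) \<Longrightarrow> phi J w c \<in> P w J"
proof -
  assume c: "c \<in> Vec (mrep J w)"
  note d = block_data[OF w RB]
  have "phi J w c (t \<otimes> u) = \<ominus>\<^bsub>K\<^esub> phi J w c u" if t: "t \<in> PRef J" and u: "u \<in> B w" "t \<otimes> u \<in> B w" for t u
  proof -
    note r = parabolic_reflection[OF d(1) t]
    have uc: "u \<in> W" using interval_closed u by blast
    note p = top_part[OF d(1) uc] and m = min_rep_mem(1)[OF d(1) uc]
    have "t \<otimes> u = t \<otimes> top_part J u \<otimes> mrep J u" using r(2) p(2) m m_assoc[OF r(2) p(2) m] p(3) by simp
    hence e: "mrep J (t \<otimes> u) = mrep J u" "top_part J (t \<otimes> u) = t \<otimes> top_part J u"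
      using coset_decomp[OF d(1) parabolic_mult[OF r(1) p(1)] m left_minimal_min_rep[OF d(1) uc]] by simp_all
    show ?thesis unfolding phi_apply[OF u(1)] phi_apply[OF u(2)] e
      using even_len_mult[OF r(2) p(2)] r(5) Vec_val[OF c min_rep_interval[OF u(1)]] by (intro sg_flip) auto
  qed
  thus ?thesis using P_space_iff[OF d(1)] phi_closed[OF c] by blast
qed

text \<open>An antisymmetric vector is determined by its values on minimal representatives: the
  factor y in W_J is shortened by right descents, which stays inside the interval, and the sign
  changes at each step.\<close>

lemma P_space_phi:
  assumes x: "x \<in> P w J"
  shows "x = phi J w (restrict x (B (mrep J w)))" "restrict x (B (mrep J w)) \<in> Vec (mrep J w)"
proof -
  note d = block_data[OF w RB]
  have xv: "x \<in> Vec w" and xr: "\<And>t u. t \<in> PRef J \<Longrightarrow> u \<in> B w \<Longrightarrow> t \<otimes> u \<in> B w \<Longrightarrow> x (t \<otimes> u) = \<ominus>\<^bsub>K\<^esub> (x u)"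
    using x P_space_iff[OF d(1)] by blast+
  show r: "restrict x (B (mrep J w)) \<in> Vec (mrep J w)"
    unfolding restrict_PiE_iff using Vec_val[OF xv] block_interval_rep(1)[OF w RB] by blast
  have *: "x (y \<otimes> a) = sg (len y) (x a)" if "y \<in> Par J" "a \<in> B (mrep J w)" "y \<otimes> a \<in> B w" for y a
    using that
  proof (induction "len y" arbitrary: y)
    case 0
    have "y \<in> W" using 0 parabolic_closed[OF d(1)] by blast
    hence "y = \<one>" using 0 len_zero_iff by simp
    thus ?case using interval_closed[OF 0(3)] by simp
  next
    case (Suc n)
    have y: "y \<in> W" using Suc parabolic_closed[OF d(1)] by blast
    have ac: "a \<in> W" using interval_closed[OF Suc.prems(2)] .
    note ar = block_interval_rep[OF w RB Suc.prems(2)]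
    have "y \<noteq> \<one>" using Suc(2) by auto
    then obtain j where j: "j \<in> J" "j \<in> D y" using parabolic_right_descent[OF d(1) Suc.prems(1)] by blast
    have sj: "s j \<in> W" "j \<in> I" using j d(1) by auto
    define y' where "y' = y \<otimes> s j"
    have y': "y' \<in> Par J" unfolding y'_def by (intro parabolic_mult Suc.prems(1) parabolic_simple j)
    have yc: "y' \<in> W" using y' parabolic_closed[OF d(1)] by blast
    have l: "Suc (len y') = len y" using len_mult_s(1)[OF sj(2) y j(2)] by (simp add: y'_def)
    have yy: "y = y' \<otimes> s j" using y sj by (simp add: y'_def m_assoc)
    hence "rle y' y" using rle_mult[OF yc sj(1)] l sj by simp
    moreover note e = coset_decomp[OF d(1) y' ac ar(2)] and e2 = coset_decomp[OF d(1) Suc.prems(1) ac ar(2)]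
    ultimately have b: "y' \<otimes> a \<in> B w"
      using block_interval[OF w RB, of "y' \<otimes> a"] block_interval[OF w RB, of "y \<otimes> a"] Suc.prems(3) yc y ac rle_trans
      by (metis m_closed)
    \<comment> \<open>The passage from y' a to y a is left multiplication by this reflection of W_J,
      in general not a simple one; here antisymmetry under all reflections enters.\<close>
    define t where "t = y' \<otimes> s j \<otimes> inv y'"
    have t: "t \<in> PRef J" unfolding parabolic_reflections_def t_def using y' j by blast
    have "t \<otimes> (y' \<otimes> a) = y \<otimes> a" using yc sj ac by (simp add: t_def yy m_assoc)
    hence "x (y \<otimes> a) = \<ominus>\<^bsub>K\<^esub> (x (y' \<otimes> a))" using xr[OF t b] Suc.prems(3) by simp
    also have "x (y' \<otimes> a) = sg (len y') (x a)" using Suc.hyps(1)[of y'] l Suc(2) y' Suc.prems(2) b by simp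
    finally show ?case using sg_flip[of "x a" "len y" "len y'"] l[symmetric] Vec_val[OF xv ar(1)] by simp
  qed
  show "x = phi J w (restrict x (B (mrep J w)))"
  proof (rule Vec_eqI[OF xv phi_closed[OF r]])
    fix u assume u: "u \<in> B w"
    note p = top_part[OF d(1) interval_closed[OF u]]
    show "x u = phi J w (restrict x (B (mrep J w))) u"
      using *[OF p(1) min_rep_interval[OF u]] p(3) u min_rep_interval[OF u] by (simp add: phi_apply)
  qed
qed

lemma phi_image: "phi J w ` Vec (mrep J w) = P w J"
  using phi_P_space P_space_phi by blast

lemma phi_inj: "c \<in> Vec (mrep J w) \<Longrightarrow> c' \<in> Vec (mrep J w) \<Longrightarrow> phi J w c = phi J w c' \<Longrightarrow> c = c'"
  using phi_rep Vec_eqI[of c "mrep J w" c'] by metis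

lemma P_space_submodule: "submod (T w) (P w J)"
  using right_submodule_image[OF phi_hom T_module T_module[OF w] right_submodule_carrier[OF T_module]] block_data(2)[OF w RB]
    phi_image by (simp add: T_sel(1))

text \<open>The image of the basis vector of a is supported on the coset of a, whose other elements
  are longer. This is the triangularity on which the later eliminations rest.\<close>

lemma phi_bas:
  assumes a: "a \<in> B (mrep J w)"
  shows "phi J w (bas (mrep J w) a) \<in> P w J" "phi J w (bas (mrep J w) a) a = \<one>\<^sub>K"
    "u \<in> B w \<Longrightarrow> phi J w (bas (mrep J w) a) u \<noteq> \<zero>\<^sub>K \<Longrightarrow> u = a \<or> len a < len u"
proof -
  note d = block_data[OF w RB]
  show "phi J w (bas (mrep J w) a) \<in> P w J" "phi J w (bas (mrep J w) a) a = \<one>\<^sub>K"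
    using phi_P_space phi_rep[OF a] a by (simp_all add: bas_apply)
  assume u: "u \<in> B w" "phi J w (bas (mrep J w) a) u \<noteq> \<zero>\<^sub>K"
  have uc: "u \<in> W" using interval_closed u by blast
  note p = top_part[OF d(1) uc]
  have "mrep J u = a" using u min_rep_interval[OF u(1)] by (auto simp: phi_apply bas_apply split: if_splits)
  thus "u = a \<or> len a < len u" using p len_zero_iff[OF p(2)] interval_closed[OF a] by (cases "len (top_part J u)") auto
qed

end

section \<open>The sum of the antisymmetric subspaces and its complement\<close>

abbreviation "PSum \<equiv> P_space_sum K G I s"

lemma
  assumes w: "w \<in> W"
  shows PSum_submodule: "submod (T w) (PSum w J)"
    and PSum_member: "\<And>J'. RB w J' \<Longrightarrow> J \<subset> J' \<Longrightarrow> P w J' \<subseteq> PSum w J"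
    and PSum_least: "\<And>N. zerov w \<in> N \<Longrightarrow> (\<And>x y. x \<in> N \<Longrightarrow> y \<in> N \<Longrightarrow> x \<oplus>\<^bsub>T w\<^esub> y \<in> N) \<Longrightarrow>
      (\<And>J'. RB w J' \<Longrightarrow> J \<subset> J' \<Longrightarrow> P w J' \<subseteq> N) \<Longrightarrow> PSum w J \<subseteq> N"
proof -
  let ?F = "{J'. RB w J' \<and> J \<subset> J'}"
  have F: "finite ?F" using RB_subset finite_index by (auto intro!: finite_subset[of ?F "Pow I"])
  have A: "submod (T w) (P w J')" if "J' \<in> ?F" for J'
    using P_space_submodule[OF w] that by blast
  have e: "PSum w J = {\<Oplus>\<^bsub>T w\<^esub>J'\<in>?F. x J' | x. x \<in> (\<Pi> J'\<in>?F. P w J')}"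
    by (simp add: P_space_sum_def Let_def)
  note l = submodule_sum[OF T_module[OF w] F A] submodule_sum_member[OF T_module[OF w] F A]
    submodule_sum_least[OF T_module[OF w] F A]
  show "submod (T w) (PSum w J)" unfolding e by (rule l(1))
  show "\<And>J'. RB w J' \<Longrightarrow> J \<subset> J' \<Longrightarrow> P w J' \<subseteq> PSum w J" unfolding e by (rule l(2)) auto
  show "PSum w J \<subseteq> N" if "zerov w \<in> N" "\<And>x y. x \<in> N \<Longrightarrow> y \<in> N \<Longrightarrow> x \<oplus>\<^bsub>T w\<^esub> y \<in> N"
    "\<And>J'. RB w J' \<Longrightarrow> J \<subset> J' \<Longrightarrow> P w J' \<subseteq> N" for N
    unfolding e using that by (intro l(3)) (auto simp: T_sel(2))
qed

definition interior :: "'a \<Rightarrow> 'a set" where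
  "interior w = {u \<in> B w. \<forall>J. RB w J \<longrightarrow> J \<noteq> {} \<longrightarrow> \<not> left_minimal J u}"

lemma interior_upper: "a \<in> interior w \<Longrightarrow> b \<in> B w \<Longrightarrow> rle a b \<Longrightarrow> b \<in> interior w"
  by (auto simp: interior_def left_minimal_def rle_def)

text \<open>Gaussian elimination along the length.\<close>

lemma eliminate:
  assumes A: "A \<subseteq> Vec w" "zerov w \<in> A"
    "\<And>r x y. r \<in> carrier K \<Longrightarrow> x \<in> A \<Longrightarrow> y \<in> A \<Longrightarrow> x \<oplus>\<^bsub>T w\<^esub> r \<odot>\<^bsub>T w\<^esub> y \<in> A"
    and S: "S \<subseteq> B w" and b: "\<And>u. u \<in> S \<Longrightarrow> b u \<in> A" "\<And>u. u \<in> S \<Longrightarrow> b u u = \<one>\<^sub>K"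
    "\<And>u v. u \<in> S \<Longrightarrow> v \<in> B w \<Longrightarrow> b u v \<noteq> \<zero>\<^sub>K \<Longrightarrow> v = u \<or> len u < len v"
    and c: "c \<in> Vec w"
  shows "\<exists>y\<in>A. \<forall>u\<in>S. y u = c u"
proof -
  have "finite S" using S finite_interval finite_subset by blast
  thus ?thesis using S b
  proof (induction S rule: finite_ranking_induct[where f = len])
    case empty
    show ?case using A(2) by blast
  next
    case (insert x S)
    then obtain y where y: "y \<in> A" "\<forall>u\<in>S. y u = c u" by auto
    show ?case
    proof (cases "x \<in> S")
      case True
      thus ?thesis using y by (auto simp: insert_absorb)
    next
      case False
      have x: "x \<in> B w" "b x \<in> A" "b x x = \<one>\<^sub>K" using insert.prems by auto
      have yv: "y \<in> Vec w" "b x \<in> Vec w" using y x A(1) by blast+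
      let ?r = "c x \<ominus>\<^bsub>K\<^esub> y x"
      have r: "?r \<in> carrier K" using Vec_val[OF c x(1)] Vec_val[OF yv(1) x(1)] by simp
      let ?y = "y \<oplus>\<^bsub>T w\<^esub> ?r \<odot>\<^bsub>T w\<^esub> b x"
      have "?y \<in> A" by (intro A(3) y x r)
      moreover have "?y x = c x"
        using x Vec_val[OF c x(1)] Vec_val[OF yv(1) x(1)] by (simp add: T_sel K.minus_plus_cancel)
      moreover have "?y u = c u" if u: "u \<in> S" for u
      proof -
        have ub: "u \<in> B w" using u insert.prems by blast
        have "b x u = \<zero>\<^sub>K" using insert.prems(4)[of x u] insert.hyps(2)[OF u] ub u False by auto
        thus ?thesis using ub y u r Vec_val[OF c ub] by (simp add: T_sel)
      qed
      ultimately show ?thesis by blast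
    qed
  qed
qed

context
  fixes w
  assumes w: "w \<in> W"
begin

lemma exterior_block:
  assumes "u \<in> B w - interior w"
  shows "\<exists>L. RB w L \<and> L \<noteq> {} \<and> left_minimal L u \<and> (\<forall>J'. RB w J' \<longrightarrow> left_minimal J' u \<longrightarrow> s ` J' \<subseteq> s ` L)"
proof -
  obtain J where J: "RB w J" "J \<noteq> {}" "left_minimal J u" using assms by (auto simp: interior_def)
  obtain L where L: "RB w L" "left_minimal L u" "\<And>J'. RB w J' \<Longrightarrow> left_minimal J' u \<Longrightarrow> s ` J' \<subseteq> s ` L"
    using maximal_RB[OF J(1,3) w] by blast
  thus ?thesis using J(2) L(3)[OF J(1,3)] by blast
qed

text \<open>A largest block for which u is minimal, up to the naming of reflections. This choice
  puts \<open>ext_vec u\<close> into \<open>P w J\<close> for every reduced block J for which u is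
  minimal.\<close>

definition ext_block :: "'a \<Rightarrow> 'i set" where
  "ext_block u = (SOME L. RB w L \<and> L \<noteq> {} \<and> left_minimal L u \<and>
     (\<forall>J'. RB w J' \<longrightarrow> left_minimal J' u \<longrightarrow> s ` J' \<subseteq> s ` L))"

lemma ext_block:
  assumes "u \<in> B w - interior w"
  shows "RB w (ext_block u)" "ext_block u \<noteq> {}" "left_minimal (ext_block u) u"
    "\<And>J'. RB w J' \<Longrightarrow> left_minimal J' u \<Longrightarrow> s ` J' \<subseteq> s ` ext_block u"
  using someI_ex[OF exterior_block[OF assms]] unfolding ext_block_def by blast+

lemma left_minimal_rep: "RB w J \<Longrightarrow> u \<in> B w \<Longrightarrow> left_minimal J u \<Longrightarrow> u \<in> B (mrep J w)"
proof -
  assume J: "RB w J" and u: "u \<in> B w" "left_minimal J u"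
  note d = block_data[OF w J]
  have uc: "u \<in> W" using interval_closed u by blast
  have "rle u (mrep J w)"
    using block_rep_interval[OF d(3,4) uc, folded d(5)] u w by (simp add: interval_iff)
  thus ?thesis using interval_iff[OF d(2)] uc by blast
qed

text \<open>One vector of \<open>PSum w {}\<close> for each u outside the interior, equal to 1 at u
  and otherwise supported on longer elements. Together these vectors form a basis of
  \<open>PSum w {}\<close>.\<close>

definition ext_vec :: "'a \<Rightarrow> 'a \<Rightarrow> 'k" where
  "ext_vec u = phi (ext_block u) w (bas (mrep (ext_block u) w) u)"

lemma ext_vec:
  assumes u: "u \<in> B w - interior w"
  shows "ext_vec u \<in> P w (ext_block u)" "ext_vec u \<in> PSum w {}" "ext_vec u \<in> Vec w" "ext_vec u u = \<one>\<^sub>K"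
    "v \<in> B w \<Longrightarrow> ext_vec u v \<noteq> \<zero>\<^sub>K \<Longrightarrow> v = u \<or> len u < len v"
proof -
  note e = ext_block[OF u]
  have a: "u \<in> B (mrep (ext_block u) w)" using left_minimal_rep[OF e(1) _ e(3)] u by blast
  note p = phi_bas[OF w e(1) a, folded ext_vec_def]
  show "ext_vec u \<in> P w (ext_block u)" "ext_vec u u = \<one>\<^sub>K"
    "v \<in> B w \<Longrightarrow> ext_vec u v \<noteq> \<zero>\<^sub>K \<Longrightarrow> v = u \<or> len u < len v" by (rule p; assumption)+
  show "ext_vec u \<in> PSum w {}" using PSum_member[OF w e(1), of "{}"] e(2) p(1) by blast
  thus "ext_vec u \<in> Vec w" using T_submoduleD(1)[OF w PSum_submodule[OF w]] by blast
qed

lemma reduce_interior: "c \<in> Vec w \<Longrightarrow> \<exists>y\<in>PSum w {}. \<forall>u\<in>B w - interior w. y u = c u"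
  using T_submoduleD(1-4)[OF w PSum_submodule[OF w, of "{}"]]
  by (intro eliminate[OF _ _ _ Diff_subset ext_vec(2) ext_vec(4) ext_vec(5)]) simp_all

definition ext_comb :: "('a \<Rightarrow> 'k) \<Rightarrow> 'a \<Rightarrow> 'k" where
  "ext_comb a = (\<lambda>v\<in>B w. \<Oplus>\<^bsub>K\<^esub>u\<in>B w - interior w. a u \<otimes>\<^sub>K ext_vec u v)"

lemma ext_vec_val: "u \<in> B w - interior w \<Longrightarrow> v \<in> B w \<Longrightarrow> ext_vec u v \<in> carrier K"
  using Vec_val ext_vec(3) by blast

lemma ext_comb_closed:
  assumes "a \<in> (B w - interior w) \<rightarrow> carrier K"
  shows "ext_comb a \<in> Vec w"
  unfolding ext_comb_def restrict_PiE_iff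
  using assms ext_vec_val by (intro ballI K.finsum_closed) (auto simp: Pi_iff)

text \<open>\<open>P_space\<close> only grows when the block shrinks, so the maximal blocks suffice to span the sum.\<close>

lemma PSum_ext_comb:
  assumes "c \<in> PSum w {}"
  shows "\<exists>a\<in>(B w - interior w) \<rightarrow> carrier K. c = ext_comb a"
proof -
  let ?N = "B w - interior w"
  let ?A = "ext_comb ` (?N \<rightarrow> carrier K)"
  have z: "zerov w \<in> ?A"
  proof (rule image_eqI)
    show "zerov w = ext_comb (\<lambda>_. \<zero>\<^sub>K)"
      using ext_vec_val by (auto simp: ext_comb_def zero_vec_def fun_eq_iff restrict_def intro!: K.add.finprod_one_eqI[symmetric])
  qed simp
  have lin: "x \<oplus>\<^bsub>T w\<^esub> r \<odot>\<^bsub>T w\<^esub> y \<in> ?A" if xy: "r \<in> carrier K" "x \<in> ?A" "y \<in> ?A" for r x y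
  proof -
    obtain a b where ab: "a \<in> ?N \<rightarrow> carrier K" "b \<in> ?N \<rightarrow> carrier K" "x = ext_comb a" "y = ext_comb b" using xy by blast
    note k = funcset_mem[OF ab(1)] funcset_mem[OF ab(2)] xy(1)
    have "ext_comb a \<oplus>\<^bsub>T w\<^esub> r \<odot>\<^bsub>T w\<^esub> ext_comb b = ext_comb (\<lambda>u. a u \<oplus>\<^sub>K r \<otimes>\<^sub>K b u)"
    proof
      fix v
      have "(\<Oplus>\<^bsub>K\<^esub>u\<in>?N. (a u \<oplus>\<^sub>K r \<otimes>\<^sub>K b u) \<otimes>\<^sub>K ext_vec u v) =
          (\<Oplus>\<^bsub>K\<^esub>u\<in>?N. a u \<otimes>\<^sub>K ext_vec u v) \<oplus>\<^sub>K r \<otimes>\<^sub>K (\<Oplus>\<^bsub>K\<^esub>u\<in>?N. b u \<otimes>\<^sub>K ext_vec u v)" if v: "v \<in> B w"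
      proof -
        note kv = k ext_vec_val[OF _ v]
        have "(\<Oplus>\<^bsub>K\<^esub>u\<in>?N. (a u \<oplus>\<^sub>K r \<otimes>\<^sub>K b u) \<otimes>\<^sub>K ext_vec u v) =
            (\<Oplus>\<^bsub>K\<^esub>u\<in>?N. a u \<otimes>\<^sub>K ext_vec u v \<oplus>\<^sub>K r \<otimes>\<^sub>K (b u \<otimes>\<^sub>K ext_vec u v))"
          using kv by (intro K.finsum_cong') (auto simp: K.l_distr K.m_assoc)
        also have "\<dots> = (\<Oplus>\<^bsub>K\<^esub>u\<in>?N. a u \<otimes>\<^sub>K ext_vec u v) \<oplus>\<^sub>K (\<Oplus>\<^bsub>K\<^esub>u\<in>?N. r \<otimes>\<^sub>K (b u \<otimes>\<^sub>K ext_vec u v))"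
          using kv by (intro K.finsum_addf) auto
        also have "(\<Oplus>\<^bsub>K\<^esub>u\<in>?N. r \<otimes>\<^sub>K (b u \<otimes>\<^sub>K ext_vec u v)) = r \<otimes>\<^sub>K (\<Oplus>\<^bsub>K\<^esub>u\<in>?N. b u \<otimes>\<^sub>K ext_vec u v)"
          using kv by (intro K.finsum_rdistr[symmetric]) auto
        finally show ?thesis .
      qed
      thus "(ext_comb a \<oplus>\<^bsub>T w\<^esub> r \<odot>\<^bsub>T w\<^esub> ext_comb b) v = ext_comb (\<lambda>u. a u \<oplus>\<^sub>K r \<otimes>\<^sub>K b u) v"
        by (simp add: T_sel ext_comb_def)
    qed
    moreover have "(\<lambda>u. a u \<oplus>\<^sub>K r \<otimes>\<^sub>K b u) \<in> ?N \<rightarrow> carrier K" using k by auto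
    ultimately show ?thesis unfolding ab(3,4) by (intro image_eqI)
  qed
  have add: "x \<oplus>\<^bsub>T w\<^esub> y \<in> ?A" if xy: "x \<in> ?A" "y \<in> ?A" for x y
  proof -
    interpret TT: right_module K M "T w" by (rule T_module[OF w])
    have "y \<in> carrier (T w)" using xy(2) ext_comb_closed by (auto simp: T_sel(1))
    thus ?thesis using lin[OF K.one_closed xy] by simp
  qed
  have basis: "ext_vec u \<in> ?A" if u: "u \<in> ?N" for u
  proof (rule image_eqI)
    show "ext_vec u = ext_comb (\<lambda>u'. if u = u' then \<one>\<^sub>K else \<zero>\<^sub>K)"
    proof (rule Vec_eqI[OF ext_vec(3)[OF u] ext_comb_closed])
      fix v assume v: "v \<in> B w"
      have "(\<Oplus>\<^bsub>K\<^esub>u'\<in>?N. (if u = u' then \<one>\<^sub>K else \<zero>\<^sub>K) \<otimes>\<^sub>K ext_vec u' v) =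
          (\<Oplus>\<^bsub>K\<^esub>u'\<in>?N. if u = u' then ext_vec u' v else \<zero>\<^sub>K)"
        using ext_vec_val[OF _ v] by (intro K.finsum_cong') auto
      also have "\<dots> = ext_vec u v" using ext_vec_val[OF _ v] u by (intro K.finsum_singleton) auto
      finally show "ext_vec u v = ext_comb (\<lambda>u'. if u = u' then \<one>\<^sub>K else \<zero>\<^sub>K) v" using v by (simp add: ext_comb_def)
    qed simp
  qed simp
  have "PSum w {} \<subseteq> ?A"
  proof (rule PSum_least[OF w z add])
    fix J assume J: "RB w J" "{} \<subset> J"
    note d = block_data[OF w J(1)] and n = T_submoduleD[OF w P_space_submodule[OF w J(1)]]
    show "P w J \<subseteq> ?A"
    proof
      fix x assume x: "x \<in> P w J"
      have N: "u \<in> ?N" if "u \<in> B (mrep J w)" for u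
        using block_interval_rep[OF w J(1) that] J by (auto simp: interior_def)
      have inP: "ext_vec u \<in> P w J" if u: "u \<in> B (mrep J w)" for u
      proof -
        note e = ext_block[OF N[OF u]]
        have "s ` J \<subseteq> s ` ext_block u" by (rule e(4)[OF J(1) block_interval_rep(2)[OF w J(1) u]])
        thus ?thesis using P_space_mono[OF d(1) RB_subset[OF e(1)]] ext_vec(1)[OF N[OF u]] by blast
      qed
      \<comment> \<open>The elimination is carried out inside \<open>P w J\<close>, so that
        agreement with x on the minimal representatives already forces equality.\<close>
      have "\<exists>y\<in>?A \<inter> P w J. \<forall>u\<in>B (mrep J w). y u = x u"
      proof (rule eliminate[where b = ext_vec])
        show "B (mrep J w) \<subseteq> B w" using block_interval_rep(1)[OF w J(1)] by blast
        show "?A \<inter> P w J \<subseteq> Vec w" "x \<in> Vec w" using n(1) x by blast+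
        show "zerov w \<in> ?A \<inter> P w J" by (intro IntI z n(2))
        show "y \<oplus>\<^bsub>T w\<^esub> r \<odot>\<^bsub>T w\<^esub> y' \<in> ?A \<inter> P w J" if "r \<in> carrier K" "y \<in> ?A \<inter> P w J" "y' \<in> ?A \<inter> P w J" for r y y'
          using that by (intro IntI lin n(3,4)) simp_all
        show "ext_vec u \<in> ?A \<inter> P w J" if "u \<in> B (mrep J w)" for u
          by (intro IntI basis inP N that)
      qed (use ext_vec(4,5) N in simp_all)
      then obtain y where y: "y \<in> ?A" "y \<in> P w J" "\<forall>u\<in>B (mrep J w). y u = x u" by blast
      have "restrict y (B (mrep J w)) = restrict x (B (mrep J w))" using y(3) by (simp add: restrict_def fun_eq_iff)
      hence "y = x" using P_space_phi(1)[OF w J(1) x] P_space_phi(1)[OF w J(1) y(2)] by simp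
      thus "x \<in> ?A" using y(1) by simp
    qed
  qed
  thus ?thesis using assms by blast
qed

text \<open>Expand c in the vectors \<open>ext_vec u\<close>. By triangularity the coefficients for
  exterior u shorter than x vanish one after the other, and the remaining vectors are zero at x,
  which is not longer than their leading element.\<close>

lemma PSum_low:
  assumes c: "c \<in> PSum w {}" and x: "x \<in> interior w"
    and low: "\<And>u. u \<in> B w - interior w \<Longrightarrow> len u < len x \<Longrightarrow> c u = \<zero>\<^sub>K"
  shows "c x = \<zero>\<^sub>K"
proof -
  let ?N = "B w - interior w"
  obtain a where a: "a \<in> ?N \<rightarrow> carrier K" "c = ext_comb a" using PSum_ext_comb[OF c] by blast
  have "u \<in> ?N \<Longrightarrow> len u < len x \<Longrightarrow> a u = \<zero>\<^sub>K" for u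
  proof (induction "len u" arbitrary: u rule: less_induct)
    case less
    have au: "a u \<in> carrier K" using a less.prems by blast
    have ub: "u \<in> B w" using less.prems by blast
    have "c u = (\<Oplus>\<^bsub>K\<^esub>u'\<in>?N. a u' \<otimes>\<^sub>K ext_vec u' u)" using a(2) ub by (simp add: ext_comb_def)
    also have "\<dots> = (\<Oplus>\<^bsub>K\<^esub>u'\<in>?N. if u = u' then a u' else \<zero>\<^sub>K)"
    proof (rule K.finsum_cong')
      fix u' assume u': "u' \<in> ?N"
      have v: "a u' \<in> carrier K" "ext_vec u' u \<in> carrier K" using a(1) u' ext_vec_val[OF u' ub] by blast+
      show "a u' \<otimes>\<^sub>K ext_vec u' u = (if u = u' then a u' else \<zero>\<^sub>K)"
      proof (cases "u = u'")
        case False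
        hence "ext_vec u' u = \<zero>\<^sub>K \<or> a u' = \<zero>\<^sub>K"
          using ext_vec(5)[OF u' ub] less.hyps[OF _ u'] less.prems(2) by (metis less_trans)
        thus ?thesis using v False by auto
      qed (use v ext_vec(4)[OF u'] in simp)
    qed (use a(1) in auto)
    also have "\<dots> = a u" using a(1) less.prems by (intro K.finsum_singleton) auto
    finally show ?case using low[OF less.prems] by simp
  qed note z = this
  have xb: "x \<in> B w" using x by (simp add: interior_def)
  have "(\<Oplus>\<^bsub>K\<^esub>u\<in>?N. a u \<otimes>\<^sub>K ext_vec u x) = \<zero>\<^sub>K"
  proof (rule K.add.finprod_one_eqI)
    fix u assume u: "u \<in> ?N"
    have "ext_vec u x = \<zero>\<^sub>K \<or> a u = \<zero>\<^sub>K" using ext_vec(5)[OF u xb] z[OF u] u x by blast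
    moreover have "a u \<in> carrier K" "ext_vec u x \<in> carrier K" using a(1) u ext_vec_val[OF u xb] by blast+
    ultimately show "a u \<otimes>\<^sub>K ext_vec u x = \<zero>\<^sub>K" by auto
  qed
  thus ?thesis using a(2) xb by (simp add: ext_comb_def)
qed

lemma PSum_interior_zero:
  assumes "c \<in> PSum w {}" "\<And>u. u \<in> B w - interior w \<Longrightarrow> c u = \<zero>\<^sub>K"
  shows "c = zerov w"
proof (rule Vec_eqI)
  show "c \<in> Vec w" using T_submoduleD(1)[OF w PSum_submodule[OF w]] assms(1) by blast
  fix u assume "u \<in> B w"
  thus "c u = zerov w u" using assms(2) PSum_low[OF assms(1) _ assms(2)] by (cases "u \<in> interior w") (auto simp: zero_vec_apply)
qed simp

end

text \<open>Left multiplication by \<open>w\<inverse>\<close> reverses \<open>[1, w]\<^sub>R\<close> onto \<open>[1, w\<inverse>]\<^sub>R\<close>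
  and exchanges the two families of generators.\<close>

definition dual :: "'a \<Rightarrow> ('a \<Rightarrow> 'k) \<Rightarrow> 'a \<Rightarrow> 'k" where
  "dual w c = (\<lambda>u\<in>B (inv w). c (w \<otimes> u))"

fun flip :: "'i hecke_gen \<Rightarrow> 'i hecke_gen" where
  "flip (Ascend i) = Descend i" | "flip (Descend i) = Ascend i"

lemma flip_gens: "g \<in> hecke_gens I \<Longrightarrow> flip g \<in> hecke_gens I"
  by (erule hecke_gens_cases) (auto simp: hecke_gens_def)

lemma map_flip_words [simp]: "map flip (up xs) = down (rev xs)" "map flip (down xs) = up (rev xs)"
  by (simp_all add: up_def down_def)

lemma interval_complement:
  assumes "w \<in> W" "u \<in> W"
  shows "w \<otimes> u \<in> B w \<longleftrightarrow> u \<in> B (inv w)" "u \<in> B (inv w) \<Longrightarrow> len (w \<otimes> u) + len u = len w"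
proof -
  have "inv (w \<otimes> u) \<otimes> w = inv u" using assms by (simp add: inv_mult_group m_assoc)
  moreover have "len (w \<otimes> u) = len (inv u \<otimes> inv w)" using len_inv[of "w \<otimes> u"] assms by (simp add: inv_mult_group)
  ultimately show "w \<otimes> u \<in> B w \<longleftrightarrow> u \<in> B (inv w)" "u \<in> B (inv w) \<Longrightarrow> len (w \<otimes> u) + len u = len w"
    using assms rle_iff_len[of "w \<otimes> u" w] rle_iff_len[of u "inv w"] by (auto simp: interval_iff)
qed

context
  fixes w
  assumes w: "w \<in> W"
begin

lemma dual_closed: "c \<in> Vec w \<Longrightarrow> dual w c \<in> Vec (inv w)"
  unfolding dual_def restrict_PiE_iff using interval_complement(1)[OF w interval_closed] Vec_val by blast

lemma dual_dual: "c \<in> Vec w \<Longrightarrow> dual (inv w) (dual w c) = c"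
proof -
  assume c: "c \<in> Vec w"
  have "inv w \<otimes> u \<in> B (inv w)" "w \<otimes> (inv w \<otimes> u) = u" if u: "u \<in> B w" for u
    using interval_complement(1)[of "inv w" u] u interval_closed[OF u] w m_assoc[of w "inv w" u] by simp_all
  thus ?thesis using c w by (auto simp: dual_def fun_eq_iff restrict_def PiE_def extensional_def)
qed

lemma dual_gen:
  assumes c: "c \<in> Vec w" and g: "g \<in> hecke_gens I"
  shows "dual w (act w [g] c) = act (inv w) [flip g] (dual w c)"
proof (rule Vec_eqI)
  show "dual w (act w [g] c) \<in> Vec (inv w)" "act (inv w) [flip g] (dual w c) \<in> Vec (inv w)"
    using dual_closed act_closed c by blast+
  fix u assume u: "u \<in> B (inv w)"
  obtain i where i: "i \<in> I" "g = Ascend i \<or> g = Descend i" using g by (auto elim: hecke_gens_cases)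
  have uc: "u \<in> W" "s i \<in> W" using interval_closed[OF u] i by auto
  note e = interval_complement[OF w uc(1)] and e2 = interval_complement[OF w, of "u \<otimes> s i"]
  have a: "w \<otimes> u \<in> B w" using e(1) u by blast
  have m: "w \<otimes> u \<otimes> s i = w \<otimes> (u \<otimes> s i)" using w uc by (simp add: m_assoc)
  have wi: "inv w \<in> W" using w by simp
  note d = len_mult_s[OF i(1) uc(1)] len_mult_s[OF i(1), of "w \<otimes> u"]
  have *: "i \<in> D (w \<otimes> u) \<longleftrightarrow> i \<notin> D u \<and> u \<otimes> s i \<in> B (inv w)"
    "i \<in> D u \<longleftrightarrow> i \<notin> D (w \<otimes> u) \<and> w \<otimes> u \<otimes> s i \<in> B w"
    using interval_descent(1)[OF w a, of i] interval_descent(1)[OF wi u, of i] d[unfolded m] e(2)[OF u] e2 w uc unfolding m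
    by (cases "i \<in> D u"; cases "i \<in> D (w \<otimes> u)"; auto)+
  have v: "dual w c u = c (w \<otimes> u)" "u \<otimes> s i \<in> B (inv w) \<Longrightarrow> dual w c (u \<otimes> s i) = c (w \<otimes> u \<otimes> s i)"
    using u m by (simp_all add: dual_def)
  have "dual w (act w [g] c) u = act w [g] c (w \<otimes> u)" using u by (simp add: dual_def)
  moreover have "act w [Ascend i] c (w \<otimes> u) = act (inv w) [Descend i] (dual w c) u"
    unfolding act_Ascend[OF w c i(1) a] act_Descend[OF wi dual_closed[OF c] i(1) u] *(1) using v by auto
  moreover have "act w [Descend i] c (w \<otimes> u) = act (inv w) [Ascend i] (dual w c) u"
    unfolding act_Descend[OF w c i(1) a] act_Ascend[OF wi dual_closed[OF c] i(1) u] *(2)[symmetric]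
    using v interval_descent(1)[OF wi u, of i] by auto
  ultimately show "dual w (act w [g] c) u = act (inv w) [flip g] (dual w c) u"
    using i(2) by auto
qed

lemma dual_act:
  assumes c: "c \<in> Vec w" and gs: "gs \<in> HW"
  shows "dual w (act w gs c) = act (inv w) (map flip gs) (dual w c)"
  using gs
proof (induction gs rule: rev_induct)
  case Nil
  thus ?case using act_Nil dual_closed c by simp
next
  case (snoc g gs)
  have g: "gs \<in> HW" "g \<in> hecke_gens I" "[g] \<in> HW" using snoc.prems by auto
  have h: "map flip gs \<in> HW" "[flip g] \<in> HW" using g flip_gens by auto
  have wi: "inv w \<in> W" using w by simp
  show ?case
    using act_append[OF w c g(1,3)] act_append[OF wi dual_closed[OF c] h] dual_gen[OF act_closed[OF c] g(2)] snoc.IH g(1)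
    by simp
qed

text \<open>A block J of w goes to the block of \<open>inv w\<close> found in
  \<open>RB_inverse\<close>. Conjugation by w matches the reflections of the two blocks, so
  antisymmetry survives the relabelling.\<close>

lemma dual_PSum: "c \<in> PSum w {} \<Longrightarrow> dual w c \<in> PSum (inv w) {}"
proof -
  have wi: "inv w \<in> W" using w by simp
  note n = T_submoduleD[OF wi PSum_submodule[OF wi, of "{}"]]
  let ?N = "{c \<in> Vec w. dual w c \<in> PSum (inv w) {}}"
  have b: "w \<otimes> u \<in> B w" if "u \<in> B (inv w)" for u using interval_complement(1)[OF w interval_closed] that by blast
  have "PSum w {} \<subseteq> ?N"
  proof (rule PSum_least[OF w])
    have "dual w (zerov w) = zerov (inv w)"
      using b by (auto simp: dual_def zero_vec_def fun_eq_iff restrict_def)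
    thus "zerov w \<in> ?N" using n(2) by simp
    fix x y assume "x \<in> ?N" "y \<in> ?N"
    moreover have "dual w (x \<oplus>\<^bsub>T w\<^esub> y) = dual w x \<oplus>\<^bsub>T (inv w)\<^esub> dual w y"
      using b by (auto simp: T_sel(3) dual_def fun_eq_iff restrict_def)
    ultimately show "x \<oplus>\<^bsub>T w\<^esub> y \<in> ?N" using T_add_closed n(3) by simp
  next
    fix J assume J: "RB w J" "{} \<subset> J"
    obtain L where L: "RB (inv w) L" "L \<noteq> {}" "\<And>t. t \<in> PRef L \<Longrightarrow> w \<otimes> t \<otimes> inv w \<in> PRef J"
      using RB_inverse[OF J(1) w] J(2) by blast
    note JI = RB_subset[OF J(1)] and LI = RB_subset[OF L(1)]
    have "dual w x \<in> P (inv w) L" if x: "x \<in> P w J" for x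
    proof -
      have xv: "x \<in> Vec w" and xr: "\<And>t u. t \<in> PRef J \<Longrightarrow> u \<in> B w \<Longrightarrow> t \<otimes> u \<in> B w \<Longrightarrow> x (t \<otimes> u) = \<ominus>\<^bsub>K\<^esub> (x u)"
        using x P_space_iff[OF JI] by blast+
      have "dual w x (t \<otimes> u) = \<ominus>\<^bsub>K\<^esub> (dual w x u)" if t: "t \<in> PRef L" and u: "u \<in> B (inv w)" "t \<otimes> u \<in> B (inv w)" for t u
      proof -
        have c: "t \<in> W" "u \<in> W" using parabolic_reflection(2)[OF LI t] interval_closed[OF u(1)] by blast+
        have "w \<otimes> t \<otimes> inv w \<otimes> (w \<otimes> u) = w \<otimes> (t \<otimes> u)" using w c by (simp add: m_assoc inv_solve_left)
        thus ?thesis using xr[OF L(3)[OF t] b[OF u(1)]] b[OF u(2)] u by (simp add: dual_def)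
      qed
      thus ?thesis using P_space_iff[OF LI] dual_closed[OF xv] by blast
    qed
    moreover have "P (inv w) L \<subseteq> PSum (inv w) {}" using PSum_member[OF wi L(1)] L(2) by blast
    moreover have "P w J \<subseteq> Vec w" using P_space_iff[OF JI] by blast
    ultimately show "P w J \<subseteq> ?N" by blast
  qed
  thus "c \<in> PSum w {} \<Longrightarrow> dual w c \<in> PSum (inv w) {}" by blast
qed

end

lemma PSum_dual: "w \<in> W \<Longrightarrow> c \<in> Vec w \<Longrightarrow> dual w c \<in> PSum (inv w) {} \<Longrightarrow> c \<in> PSum w {}"
  using dual_PSum[of "inv w" "dual w c"] dual_dual[of w c] by simp

section \<open>The radical of a translation module\<close>

context
  fixes w
  assumes w: "w \<in> W"
begin

text \<open>Modulo \<open>PSum w {}\<close> the vector \<open>n \<cdot> up vs\<close> is represented by a unique \<open>y0\<close> supported in the interior.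
  By maximality of \<open>v\<close>, \<open>y0\<close> is killed by the ascents at non-descents of \<open>v\<close>, so that its support is
  an interval \<open>[a0, w]\<^sub>R\<close> in a coset of a parabolic subgroup; the idempotents attached to \<open>a0\<close> and
  to \<open>v\<close> then force \<open>a0 = v\<close>.\<close>

lemma maximal_up:
  assumes N: "N \<subseteq> Vec w" "\<And>x gs. x \<in> N \<Longrightarrow> gs \<in> HW \<Longrightarrow> act w gs x \<in> N"
    and n: "n \<in> N" "reduced v vs" "act w (up vs) n \<notin> PSum w {}"
    and max: "\<And>v' vs' n'. n' \<in> N \<Longrightarrow> reduced v' vs' \<Longrightarrow> act w (up vs') n' \<notin> PSum w {} \<Longrightarrow> len v' \<le> len v"
  shows "v \<in> interior w \<and> (\<exists>k\<in>Par (I - D v). w = v \<otimes> k)"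
proof -
  interpret TT: right_module K M "T w" by (rule T_module[OF w])
  let ?S = "PSum w {}" and ?X = "B w - interior w" and ?K = "I - D v"
  note S = T_submoduleD[OF w PSum_submodule[OF w, of "{}"]]
  note Sm = right_submoduleD(7)[OF PSum_submodule[OF w, of "{}"] T_module[OF w]]
  note rv = red_word[OF n(2)]
  define y where "y = act w (up vs) n"
  have nv: "n \<in> Vec w" using N n by blast
  have up: "up vs \<in> HW" using rv by simp
  have yN: "y \<in> N" "y \<in> Vec w" "y \<notin> ?S" using N n up unfolding y_def by blast+
  obtain \<sigma> where \<sigma>: "\<sigma> \<in> ?S" "\<And>u. u \<in> ?X \<Longrightarrow> \<sigma> u = y u" using reduce_interior[OF w yN(2)] by blast
  have \<sigma>v: "\<sigma> \<in> Vec w" using \<sigma> S(1) by blast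
  define y0 where "y0 = y \<ominus>\<^bsub>T w\<^esub> \<sigma>"
  have Tc: "x \<in> carrier (T w) \<longleftrightarrow> x \<in> Vec w" for x by (simp add: T_sel(1))
  have y0v: "y0 \<in> Vec w" using TT.M.minus_closed[of y \<sigma>] yN \<sigma>v by (simp add: y0_def Tc)
  have y0X: "y0 u = \<zero>\<^sub>K" if u: "u \<in> ?X" for u
  proof -
    have ub: "u \<in> B w" using u by blast
    show ?thesis using T_minus[OF w yN(2) \<sigma>v ub] \<sigma>(2)[OF u] Vec_val[OF yN(2) ub] K.minus_eq_zero_iff by (simp add: y0_def)
  qed
  have y0_act: "act w gs y0 = act w gs y \<ominus>\<^bsub>T w\<^esub> act w gs \<sigma>" for gs
    unfolding y0_def by (rule act_minus[OF w yN(2) \<sigma>v])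
  have actS: "act w gs y0 \<in> ?S \<longleftrightarrow> act w gs y \<in> ?S" if "gs \<in> HW" for gs
  proof -
    have c: "act w gs y \<in> carrier (T w)" "act w gs \<sigma> \<in> carrier (T w)" using act_closed yN \<sigma>v by (simp_all add: Tc)
    have s: "act w gs \<sigma> \<in> ?S" using S(5) \<sigma> that by blast
    have "act w gs y = act w gs \<sigma> \<oplus>\<^bsub>T w\<^esub> act w gs y0"
      unfolding y0_act using TT.M.minus_plus_cancel[OF c(2,1)] by simp
    thus ?thesis using S(3)[OF s] Sm[OF _ s] y0_act by metis
  qed
  have fixS: "act w gs y0 \<ominus>\<^bsub>T w\<^esub> y0 \<in> ?S" if g: "gs \<in> HW" "act w gs y = y" for gs
  proof -
    have c: "y \<in> carrier (T w)" "\<sigma> \<in> carrier (T w)" "act w gs \<sigma> \<in> carrier (T w)"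
      using act_closed yN \<sigma>v by (simp_all add: Tc)
    have "act w gs y0 \<ominus>\<^bsub>T w\<^esub> y0 = \<sigma> \<ominus>\<^bsub>T w\<^esub> act w gs \<sigma>"
      unfolding y0_act g(2) unfolding y0_def by (rule TT.M.minus_diff_swap[OF c(3,2,1)])
    thus ?thesis using Sm[OF \<sigma>(1) S(5)[OF \<sigma>(1) g(1)]] by simp
  qed
  have gens: "[Ascend i] \<in> HW" if "i \<in> I" for i using that by (simp add: hecke_gens_def)
  \<comment> \<open>For a descent i of an exterior u, the element u s_i lies below u and is exterior
    as well, so both coefficients of y0 that enter vanish.\<close>
  have ascX: "act w [Ascend i] y0 u = \<zero>\<^sub>K" if i: "i \<in> I" and u: "u \<in> ?X" for i u
  proof -
    have ub: "u \<in> B w" "u \<in> W" using u interval_closed by blast+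
    have "y0 (u \<otimes> s i) = \<zero>\<^sub>K" if d: "i \<in> D u"
    proof (rule y0X)
      have b: "u \<otimes> s i \<in> B w" by (rule interval_descent(1)[OF w ub(1) d])
      have c: "u \<otimes> s i \<in> W" "u \<otimes> s i \<otimes> s i = u" using ub i by (simp_all add: m_assoc)
      have "rle (u \<otimes> s i) u"
        using rle_mult[OF c(1) s_closed[OF i]] len_mult_s(1)[OF i ub(2) d] c(2) i by simp
      thus "u \<otimes> s i \<in> ?X" using interior_upper[of "u \<otimes> s i" w u] u b by blast
    qed
    thus ?thesis using act_Ascend[OF w y0v i ub(1)] y0X[OF u] by simp
  qed
  \<comment> \<open>Appending i gives a reduced word longer than vs, so maximality puts the image
    into \<open>PSum w {}\<close>; since it also vanishes outside the interior, it is zero.\<close>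
  have asc1: "act w [Ascend i] y0 = zerov w" if i: "i \<in> ?K" for i
  proof -
    have iI: "i \<in> I" "i \<notin> D v" using i by auto
    have r: "reduced (v \<otimes> s i) (vs @ [i])"
      using reduced_append_intro[OF n(2), of "s i" "[i]"] reduced_word_iff[of "s i" "[i]"] iI len_mult_s(2)[OF iI(1) rv(2) iI(2)] by simp
    have "act w (up (vs @ [i])) n = act w [Ascend i] y"
      using act_append[OF w nv up gens[OF iI(1)]] by (simp add: y_def)
    moreover have "len (v \<otimes> s i) = Suc (len v)" by (rule len_mult_s(2)[OF iI(1) rv(2) iI(2)])
    ultimately have "act w [Ascend i] y \<in> ?S" using max[OF n(1) r] by fastforce
    hence "act w [Ascend i] y0 \<in> ?S" using actS[OF gens[OF iI(1)]] by blast
    thus ?thesis using PSum_interior_zero[OF w] ascX[OF iI(1)] by blast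
  qed
  \<comment> \<open>All values of \<open>up vs\<close> have the descents of v, so these ascents fix
    y, and hence y0 modulo \<open>PSum w {}\<close>. The difference vanishes outside the interior,
    so y0 is fixed exactly.\<close>
  have asc2: "act w [Ascend i] y0 u = y0 u" if i: "i \<in> D v" and u: "u \<in> B w" for i u
  proof -
    have iI: "i \<in> I" using i descent_index by blast
    have "act w [Ascend i] y = act w (up vs @ [Ascend i]) n"
      unfolding y_def by (rule act_append[OF w nv up gens[OF iI], symmetric])
    also have "\<dots> = y" unfolding y_def
      by (rule act_cong[OF w]) (use run_up_descent[OF n(2) _ i] in simp)
    finally have "act w [Ascend i] y0 \<ominus>\<^bsub>T w\<^esub> y0 \<in> ?S" by (rule fixS[OF gens[OF iI]])
    moreover have "(act w [Ascend i] y0 \<ominus>\<^bsub>T w\<^esub> y0) u' = \<zero>\<^sub>K" if u': "u' \<in> ?X" for u'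
      using T_minus[OF w act_closed[OF y0v] y0v, of u'] ascX[OF iI u'] y0X[OF u'] u' by (simp add: K.minus_eq)
    ultimately have z: "act w [Ascend i] y0 \<ominus>\<^bsub>T w\<^esub> y0 = zerov w" using PSum_interior_zero[OF w] by blast
    have "act w [Ascend i] y0 u \<ominus>\<^bsub>K\<^esub> y0 u = \<zero>\<^sub>K"
      using T_minus[OF w act_closed[OF y0v, of "[Ascend i]"] y0v u, unfolded z] zero_vec_apply[OF u] by simp
    thus ?thesis using K.minus_eq_zero_iff Vec_val[OF act_closed[OF y0v] u] Vec_val[OF y0v u] by blast
  qed
  define supp where "supp = {a \<in> B w. y0 a \<noteq> \<zero>\<^sub>K}"
  have sB: "a \<in> supp \<Longrightarrow> a \<in> B w \<and> a \<in> W" for a using interval_closed by (auto simp: supp_def)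
  have F1: "y0 a \<oplus>\<^sub>K y0 (a \<otimes> s i) = \<zero>\<^sub>K" if "i \<in> ?K" "a \<in> B w" "i \<in> D a" for i a
    using asc1[OF that(1)] act_Ascend[OF w y0v _ that(2), of i] that zero_vec_apply[OF that(2)] by simp
  have F2: "D v \<subseteq> D a" if "a \<in> supp" for a
  proof
    fix i assume i: "i \<in> D v"
    show "i \<in> D a" using asc2[OF i, of a] act_Ascend[OF w y0v descent_index[OF i], of a] that by (auto simp: supp_def split: if_splits)
  qed
  have F3: "a \<otimes> s i \<in> supp" if i: "i \<in> ?K" and a: "a \<in> supp" "a \<otimes> s i \<in> B w" for i a
  proof -
    have ac: "a \<in> W" "i \<in> I" "a \<in> B w" "y0 a \<noteq> \<zero>\<^sub>K" using sB a i by (auto simp: supp_def)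
    have e: "a \<otimes> s i \<otimes> s i = a" using ac by (simp add: m_assoc)
    have v: "y0 a \<in> carrier K" "y0 (a \<otimes> s i) \<in> carrier K" using Vec_val[OF y0v] ac a by blast+
    have "y0 a \<oplus>\<^sub>K y0 (a \<otimes> s i) = \<zero>\<^sub>K"
    proof (cases "i \<in> D a")
      case False
      hence "i \<in> D (a \<otimes> s i)" using descent_mult_s ac by blast
      thus ?thesis using F1[OF i a(2)] e v by (simp add: K.a_comm)
    qed (rule F1[OF i ac(3)])
    thus ?thesis using v ac(4) a(2) by (auto simp: supp_def)
  qed
  have "supp \<noteq> {}"
  proof
    assume e: "supp = {}"
    have "y0 = zerov w" using e by (intro Vec_eqI[OF y0v zero_vec_closed]) (auto simp: supp_def zero_vec_apply)
    hence "act w [] y0 \<in> ?S" using act_Nil[OF y0v] S(2) by simp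
    thus False using actS[of "[]"] act_Nil[OF yN(2)] yN(3) by simp
  qed
  moreover have "finite supp" by (simp add: supp_def)
  ultimately obtain a0 where a0: "a0 \<in> supp" "\<And>a. a \<in> supp \<Longrightarrow> len a0 \<le> len a"
    using ex_has_least_nat[of "\<lambda>a. a \<in> supp" _ len] by blast
  \<comment> \<open>Climbing from a to w stays in the support: each ascent taken is at a non-descent
    of the current element, hence at a non-descent of v by \<open>F2\<close>, and \<open>F3\<close>
    applies.\<close>
  have top: "\<exists>k\<in>Par ?K. w = a \<otimes> k" if "a \<in> supp" for a
    using that
  proof (induction "len w - len a" arbitrary: a rule: less_induct)
    case less
    note ab = sB[OF less.prems]
    show ?case
    proof (cases "a = w")
      case False
      then obtain i where i: "i \<in> I" "i \<notin> D a" "a \<otimes> s i \<in> B w" using interval_climb[OF w] ab by blast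
      have iK: "i \<in> ?K" using i F2[OF less.prems] by blast
      have "len (a \<otimes> s i) = Suc (len a)" using len_mult_s(2)[OF i(1)] i ab by blast
      moreover have "len (a \<otimes> s i) \<le> len w" using rle_len[OF _ w] i(3) interval_iff[OF w] by blast
      ultimately obtain k where k: "k \<in> Par ?K" "w = a \<otimes> s i \<otimes> k"
        using less.hyps[OF _ F3[OF iK less.prems i(3)]] by fastforce
      have "s i \<otimes> k \<in> Par ?K" by (intro parabolic_mult parabolic_simple iK k)
      moreover have "w = a \<otimes> (s i \<otimes> k)" using k ab i parabolic_closed[OF _ k(1)] by (auto simp: m_assoc)
      ultimately show ?thesis by blast
    qed (use ab in \<open>auto intro!: bexI[of _ \<one>]\<close>)
  qed
  note a0b = sB[OF a0(1)]
  have KD: "?K \<inter> D a0 = {}"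
  proof -
    have False if i: "i \<in> ?K" "i \<in> D a0" for i
    proof -
      have b: "a0 \<otimes> s i \<in> B w" by (rule interval_descent(1)[OF w _ i(2)]) (use a0b in blast)
      have "Suc (len (a0 \<otimes> s i)) = len a0" using len_mult_s(1)[of i a0] i a0b by blast
      thus False using a0(2)[OF F3[OF i(1) a0(1) b]] by simp
    qed
    thus ?thesis by blast
  qed
  have KI: "?K \<subseteq> I" by blast
  have uniq: "a = a0" if a: "a \<in> supp" "len a \<le> len a0" for a
  proof -
    obtain k k0 where k: "k \<in> Par ?K" "w = a \<otimes> k" "k0 \<in> Par ?K" "w = a0 \<otimes> k0" using top[OF a(1)] top[OF a0(1)] by blast
    note kc = parabolic_closed[OF KI k(1)] parabolic_closed[OF KI k(3)]
    have p: "k0 \<otimes> inv k \<in> Par ?K" by (intro parabolic_mult k parabolic_inv KI)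
    have "a = w \<otimes> inv k" using k(2) kc sB[OF a(1)] by (simp add: m_assoc)
    hence e: "a = a0 \<otimes> (k0 \<otimes> inv k)" using k(4) kc a0b by (simp add: m_assoc)
    hence "len (k0 \<otimes> inv k) = 0" using right_minimal_mult[OF KI p _ KD] a0b a(2) by simp
    hence "k0 \<otimes> inv k = \<one>" using len_zero_iff kc by simp
    thus ?thesis using e a0b by simp
  qed
  have a0i: "a0 \<in> interior w" using a0 y0X[of a0] by (auto simp: supp_def)
  have val: "y0 u \<in> carrier K" if "u \<in> B w" for u using Vec_val[OF y0v that] .
  \<comment> \<open>The idempotent never lowers the length and the support of y0 starts at length
    len a0, so nothing arrives at shorter elements.\<close>
  have long: "act w (down zs @ up zs) y0 u = \<zero>\<^sub>K"
    if z: "reduced z zs" and u: "u \<in> B w" "len u < len a0" for z zs u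
  proof -
    have "y0 u' = \<zero>\<^sub>K" if "u' \<in> B w" "run (down zs @ up zs) u' = u" for u'
    proof (rule ccontr)
      assume "y0 u' \<noteq> \<zero>\<^sub>K"
      hence "len a0 \<le> len u'" using that a0(2)[of u'] by (simp add: supp_def)
      thus False using len_run_down_up[OF z interval_closed[OF that(1)]] that(2) u(2) by simp
    qed
    thus ?thesis unfolding act_apply[OF u(1)] by (intro K.add.finprod_one_eqI) blast
  qed
  \<comment> \<open>The idempotent attached to a0 keeps the coefficient at a0, so it does not take y
    into \<open>PSum w {}\<close>. Hence \<open>up as\<close> takes some element of N outside
    \<open>PSum w {}\<close>, and the choice of v bounds len a0.\<close>
  have a0v: "len a0 \<le> len v"
  proof -
    obtain as where as: "reduced a0 as" using reduced_word_exists a0b by blast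
    note ra = red_word[OF as]
    let ?gs = "down as @ up as"
    have g: "?gs \<in> HW" "down as \<in> HW" "up as \<in> HW" using ra by simp_all
    have "act w ?gs y \<notin> ?S"
    proof
      assume "act w ?gs y \<in> ?S"
      hence "act w ?gs y0 \<in> ?S" using actS[OF g(1)] by blast
      hence z: "act w ?gs y0 a0 = \<zero>\<^sub>K" using PSum_low[OF w _ a0i] long[OF as] by blast
      have l: "len (\<one> \<otimes> a0) = len \<one> + len a0" "\<one> \<otimes> a0 \<in> B w" using a0b by simp_all
      have "ok w (down as) a0" "run (down as) a0 = \<one>" "ok w (up as) \<one>" "run (up as) \<one> = a0"
        using ok_down[OF w one_closed as l one_interval[OF w]] ok_up[OF w one_closed as l one_interval[OF w]] a0b by simp_all
      hence ok: "ok w ?gs a0" "run ?gs a0 = a0" using ok_append[OF w _ g(2,3)] a0b by simp_all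
      have z0: "y0 u = \<zero>\<^sub>K" if u: "u \<in> B w" "run ?gs u = a0" "u \<noteq> a0" for u
      proof (rule ccontr)
        assume "y0 u \<noteq> \<zero>\<^sub>K"
        hence "u \<in> supp" using u by (simp add: supp_def)
        thus False using uniq[of u] len_run_down_up[OF as interval_closed[OF u(1)]] u by simp
      qed
      let ?F = "{u \<in> B w. ok w ?gs u \<and> run ?gs u = a0}"
      have "act w ?gs y0 a0 = (\<Oplus>\<^bsub>K\<^esub>u\<in>?F. y0 u)" using act_apply a0b by blast
      also have "\<dots> = (\<Oplus>\<^bsub>K\<^esub>u\<in>?F. if a0 = u then y0 u else \<zero>\<^sub>K)"
      proof (rule K.finsum_cong')
        fix u assume "u \<in> ?F"
        hence "u \<in> B w" "run ?gs u = a0" by (simp_all only: mem_Collect_eq)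
        from z0[OF this] show "y0 u = (if a0 = u then y0 u else \<zero>\<^sub>K)" by (cases "a0 = u") auto
      qed (use val in auto)
      also have "\<dots> = y0 a0"
      proof (rule K.finsum_singleton)
        show "a0 \<in> ?F" using ok a0b by blast
        show "finite ?F" by simp
        show "y0 \<in> ?F \<rightarrow> carrier K" using val by blast
      qed
      finally show False using z a0(1) by (simp add: supp_def)
    qed
    hence "act w (up as) (act w (down as) y) \<notin> ?S" using act_append[OF w yN(2) g(2,3)] by simp
    thus ?thesis using max[OF N(2)[OF yN(1) g(2)] as] by blast
  qed
  \<comment> \<open>The idempotent attached to v fixes y. By \<open>PSum_low\<close> it then leaves
    the coefficient of y0 at a0 unchanged, so a0 is a value of \<open>up vs\<close>, and all of
    these lie above v.\<close>
  have "lle v a0"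
  proof -
    let ?gs = "down vs @ up vs"
    have g: "?gs \<in> HW" using rv by simp
    have "act w ?gs y = act w (up vs @ ?gs) n" unfolding y_def by (rule act_append[OF w nv up g, symmetric])
    also have "\<dots> = y" unfolding y_def by (rule act_cong[OF w]) (use run_up_down_up[OF n(2)] in simp)
    finally have d: "act w ?gs y0 \<ominus>\<^bsub>T w\<^esub> y0 \<in> ?S" by (rule fixS[OF g])
    have m: "(act w ?gs y0 \<ominus>\<^bsub>T w\<^esub> y0) u = act w ?gs y0 u \<ominus>\<^bsub>K\<^esub> y0 u" if "u \<in> B w" for u
      by (rule T_minus[OF w act_closed[OF y0v] y0v that])
    have "(act w ?gs y0 \<ominus>\<^bsub>T w\<^esub> y0) a0 = \<zero>\<^sub>K"
    proof (rule PSum_low[OF w d a0i])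
      fix u assume u: "u \<in> ?X" "len u < len a0"
      thus "(act w ?gs y0 \<ominus>\<^bsub>T w\<^esub> y0) u = \<zero>\<^sub>K" using m[of u] long[OF n(2), of u] y0X[OF u(1)] by (simp add: K.minus_eq)
    qed
    hence "act w ?gs y0 a0 = y0 a0"
      using m[of a0] a0b K.minus_eq_zero_iff Vec_val[OF act_closed[OF y0v]] val by metis
    hence ne: "act w ?gs y0 a0 \<noteq> \<zero>\<^sub>K" using a0(1) by (simp add: supp_def)
    have "\<exists>u\<in>B w. run ?gs u = a0"
    proof (rule ccontr)
      assume "\<not> ?thesis"
      hence e: "{u \<in> B w. ok w ?gs u \<and> run ?gs u = a0} = {}" by blast
      have "a0 \<in> B w" using a0b by blast
      from act_apply[OF this, of ?gs y0] show False unfolding e using ne by simp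
    qed
    then obtain u where u: "u \<in> B w" "run (up vs) (run (down vs) u) = a0" by auto
    have "run (down vs) u \<in> W" using interval_closed[OF u(1)] rv by simp
    from run_up_lle[OF n(2) this] show ?thesis using u by simp
  qed
  hence "v = a0" using lle_len_eq[OF rv(2) _ _ a0v] a0b by blast
  thus ?thesis using a0i top[OF a0(1)] by blast
qed

section \<open>The largest proper submodule\<close>

definition rad :: "('a \<Rightarrow> 'k) set" where
  "rad = {c \<in> Vec w. \<forall>gs\<in>HW. \<forall>ws. reduced w ws \<longrightarrow> act w (up ws) (act w gs c) = zerov w}"

lemma rad_submodule: "submod (T w) rad"
proof (rule T_submoduleI[OF w])
  show "zerov w \<in> rad" using act_zero[OF w] red_word(1) by (simp add: rad_def)
  show "x \<oplus>\<^bsub>T w\<^esub> y \<in> rad" if "x \<in> rad" "y \<in> rad" for x y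
  proof -
    have z: "zerov w \<oplus>\<^bsub>T w\<^esub> zerov w = zerov w" by (auto simp: T_sel(3) zero_vec_def fun_eq_iff restrict_def)
    thus ?thesis using that T_add_closed act_add act_closed by (simp add: rad_def)
  qed
  show "r \<odot>\<^bsub>T w\<^esub> x \<in> rad" if "r \<in> carrier K" "x \<in> rad" for r x
  proof -
    have z: "r \<odot>\<^bsub>T w\<^esub> zerov w = zerov w" using that by (auto simp: T_sel(4) zero_vec_def fun_eq_iff restrict_def)
    thus ?thesis using that T_smult_closed act_smult act_closed by (simp add: rad_def)
  qed
  show "act w gs x \<in> rad" if "x \<in> rad" "gs \<in> HW" for gs x
    using that act_closed act_append[OF w, of x gs] by (simp add: rad_def flip: act_append[OF w])
qed (auto simp: rad_def)

text \<open>All values of \<open>up ws\<close> lie above w in the left order and are at least as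
  long as w; within \<open>B w\<close> only w itself is.\<close>

lemma act_up_top:
  assumes "reduced w ws" "c \<in> Vec w" "a \<in> B w" "a \<noteq> w"
  shows "act w (up ws) c a = \<zero>\<^sub>K"
proof -
  have "a \<noteq> run (up ws) u" if "u \<in> B w" for u
  proof
    assume e: "a = run (up ws) u"
    have "lle w a" unfolding e by (rule run_up_lle[OF assms(1) interval_closed[OF that]])
    hence "len w \<le> len a" using lle_len w interval_closed[OF assms(3)] by blast
    thus False using rle_len_eq[of a w] assms(3,4) w interval_iff[OF w] by blast
  qed
  hence e: "{u \<in> B w. ok w (up ws) u \<and> run (up ws) u = a} = {}" by blast
  show ?thesis unfolding act_apply[OF assms(3)] e by simp
qed

text \<open>An element of N outside \<open>rad w\<close> has an image under the monoid that is a
  nonzero multiple of the top basis vector, and this vector generates everything.\<close>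

lemma rad_greatest:
  assumes N: "submod (T w) N" "N \<noteq> Vec w"
  shows "N \<subseteq> rad"
proof
  note n = T_submoduleD[OF w N(1)]
  fix c assume c: "c \<in> N"
  have "act w (up ws) (act w gs c) = zerov w" if gs: "gs \<in> HW" and ws: "reduced w ws" for gs ws
  proof (rule ccontr)
    let ?y = "act w (up ws) (act w gs c)"
    assume ne: "?y \<noteq> zerov w"
    have cv: "act w gs c \<in> Vec w" using act_closed c n(1) by blast
    have yN: "?y \<in> N" using n(5) c gs red_word(1)[OF ws] by simp
    have yv: "?y \<in> Vec w" using yN n(1) by blast
    have wB: "w \<in> B w" by (rule self_interval[OF w])
    have z: "?y a = \<zero>\<^sub>K" if "a \<in> B w" "a \<noteq> w" for a by (rule act_up_top[OF ws cv that])
    have yw: "?y w \<noteq> \<zero>\<^sub>K"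
    proof
      assume "?y w = \<zero>\<^sub>K"
      hence "?y u = zerov w u" if "u \<in> B w" for u using z[OF that] that by (cases "u = w") (simp_all add: zero_vec_apply)
      thus False using ne Vec_eqI[OF yv zero_vec_closed] by blast
    qed
    have u: "?y w \<in> Units K" using yw Vec_val[OF yv wB] K.field_Units by blast
    have "inv\<^bsub>K\<^esub> (?y w) \<odot>\<^bsub>T w\<^esub> ?y = bas w w"
    proof (rule Vec_eqI)
      show "inv\<^bsub>K\<^esub> (?y w) \<odot>\<^bsub>T w\<^esub> ?y \<in> Vec w" using T_smult_closed yv K.Units_inv_closed[OF u] by blast
      fix a assume a: "a \<in> B w"
      show "(inv\<^bsub>K\<^esub> (?y w) \<odot>\<^bsub>T w\<^esub> ?y) a = bas w w a"
        using a z[OF a] K.Units_l_inv[OF u] K.Units_inv_closed[OF u] by (cases "a = w") (simp_all add: T_sel(4) bas_apply)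
    qed simp
    hence "bas w w \<in> N" using n(4)[OF K.Units_inv_closed[OF u] yN] by simp
    thus False using T_submodule_top[OF w N(1)] N(2) by blast
  qed
  thus "c \<in> rad" using c n(1) by (auto simp: rad_def)
qed

lemma rad_proper: "bas w \<one> \<notin> rad"
proof
  assume r: "bas w \<one> \<in> rad"
  obtain ws where ws: "reduced w ws" using reduced_word_exists w by blast
  have "bas w w = act w (up ws) (act w [] (bas w \<one>))"
    using act_up_one[OF w self_interval[OF w] ws] act_Nil[OF bas_closed] by simp
  also have "\<dots> = zerov w" using r ws by (simp add: rad_def)
  finally show False using bas_apply[OF self_interval[OF w], of w] zero_vec_apply[OF self_interval[OF w]] by simp
qed

end

text \<open>Each \<open>P w J\<close> with J nonempty is proper: the top basis vector is nonzero at
  w but zero at \<open>mrep J w\<close>, a different element of the same coset, and antisymmetry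
  would relate the two values.\<close>

lemma PSum_le_rad:
  assumes w: "w \<in> W"
  shows "PSum w {} \<subseteq> rad w"
proof (rule PSum_least[OF w])
  note r = T_submoduleD[OF w rad_submodule[OF w]]
  show "zerov w \<in> rad w" by (rule r(2))
  show "x \<oplus>\<^bsub>T w\<^esub> y \<in> rad w" if "x \<in> rad w" "y \<in> rad w" for x y by (rule r(3)[OF that])
  fix J assume J: "RB w J" "{} \<subset> J"
  note d = block_data[OF w J(1)]
  have ne: "top_part J w \<noteq> \<one>" using J RB_iff[OF w, of J] by auto
  have vw: "mrep J w \<noteq> w" using ne w by (auto simp: top_part_def)
  have vb: "mrep J w \<in> B w" "mrep J w \<in> B (mrep J w)"
    using self_interval[OF d(2)] block_interval_rep(1)[OF w J(1)] by blast+
  have "bas w w \<notin> P w J"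
  proof
    assume "bas w w \<in> P w J"
    from P_space_phi(1)[OF w J(1) this]
    have "bas w w w = phi J w (restrict (bas w w) (B (mrep J w))) w" by simp
    also have "\<dots> = \<zero>\<^sub>K" using self_interval[OF w] vb vw by (simp add: phi_apply bas_apply)
    finally show False using bas_apply[OF self_interval[OF w], of w] by simp
  qed
  hence "P w J \<noteq> Vec w" using bas_closed by blast
  thus "P w J \<subseteq> rad w" by (rule rad_greatest[OF w P_space_submodule[OF w J(1)]])
qed

lemma rad_le_PSum:
  assumes w: "w \<in> W"
  shows "rad w \<subseteq> PSum w {}"
proof (rule ccontr)
  note r = T_submoduleD[OF w rad_submodule[OF w]]
  have wi: "inv w \<in> W" using w by simp
  note S' = T_submoduleD[OF wi PSum_submodule[OF wi, of "{}"]] and S = T_submoduleD[OF w PSum_submodule[OF w, of "{}"]]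
  \<comment> \<open>Says that \<open>up vs\<close> takes some element of the radical outside
    \<open>PSum w {}\<close>. If the inclusion fails, this holds for 1 with the empty word.\<close>
  define Q where "Q v \<longleftrightarrow> (\<exists>n vs. n \<in> rad w \<and> reduced v vs \<and> act w (up vs) n \<notin> PSum w {})" for v
  assume "\<not> rad w \<subseteq> PSum w {}"
  then obtain c where c: "c \<in> rad w" "c \<notin> PSum w {}" by blast
  have "act w (up []) c = c" using act_Nil c r(1) by auto
  hence "Q \<one>" unfolding Q_def using c reduced_word_iff[of \<one> "[]"] by (intro exI[of _ c] exI[of _ "[]"]) simp
  moreover have "len v < Suc (len longest)" if "Q v" for v
    using that len_longest_mult[of v] reduced_word_closed by (auto simp: Q_def)
  ultimately obtain v where v: "Q v" "\<And>v'. Q v' \<Longrightarrow> len v' \<le> len v"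
    using ex_has_greatest_nat[of Q \<one> len "Suc (len longest)"] by blast
  obtain n vs where n: "n \<in> rad w" "reduced v vs" "act w (up vs) n \<notin> PSum w {}" using v(1) by (auto simp: Q_def)
  note rv = red_word[OF n(2)]
  have "v \<in> interior w \<and> (\<exists>k\<in>Par (I - D v). w = v \<otimes> k)"
  proof (rule maximal_up[OF w r(1) r(5) n])
    fix v' vs' n' assume "n' \<in> rad w" "reduced v' vs'" "act w (up vs') n' \<notin> PSum w {}"
    thus "len v' \<le> len v" using v(2)[of v'] unfolding Q_def by blast
  qed
  then obtain k where k: "v \<in> interior w" "k \<in> Par (I - D v)" "w = v \<otimes> k" by blast
  \<comment> \<open>The same argument for the dual module, where the reversed word ascends to
    \<open>inv v\<close> and corresponds to \<open>down vs\<close>. If the result were in the sum,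
    applying \<open>up vs\<close> once more would put \<open>act w (up vs) n\<close> there, as the
    two words are generalized inverses.\<close>
  have "inv v \<in> interior (inv w) \<and> (\<exists>k\<in>Par (I - D (inv v)). inv w = inv v \<otimes> k)"
  proof (rule maximal_up[OF wi])
    let ?N = "dual w ` rad w"
    show "?N \<subseteq> Vec (inv w)" using dual_closed[OF w] r(1) by blast
    show "act (inv w) gs x \<in> ?N" if x: "x \<in> ?N" and gs: "gs \<in> HW" for x gs
    proof -
      obtain c where c: "c \<in> rad w" "x = dual w c" using x by blast
      have "flip (flip g) = g" for g by (cases g) auto
      hence "map flip (map flip gs) = gs" by (simp add: comp_def)
      moreover have f: "map flip gs \<in> HW" using gs flip_gens by auto
      moreover have cv: "c \<in> Vec w" using c r(1) by blast
      ultimately have "act (inv w) gs x = dual w (act w (map flip gs) c)"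
        using dual_act[OF w cv f] c(2) by simp
      thus ?thesis using r(5)[OF c(1) f] by blast
    qed
    have yr: "act w (up vs) n \<in> rad w" using r(5) n(1) rv by simp
    have yv: "act w (up vs) n \<in> Vec w" using yr r(1) by blast
    show "dual w (act w (up vs) n) \<in> ?N" using yr by blast
    show "reduced (inv v) (rev vs)" by (rule reduced_word_rev[OF n(2)])
    show "act (inv w) (up (rev vs)) (dual w (act w (up vs) n)) \<notin> PSum (inv w) {}"
    proof
      assume a: "act (inv w) (up (rev vs)) (dual w (act w (up vs) n)) \<in> PSum (inv w) {}"
      have "act (inv w) (up (rev vs)) (dual w (act w (up vs) n)) = dual w (act w (down vs) (act w (up vs) n))"
        using dual_act[OF w yv, of "down vs"] rv by simp
      hence "act w (down vs) (act w (up vs) n) \<in> PSum w {}" using PSum_dual[OF w act_closed[OF yv]] a by simp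
      hence "act w (up vs) (act w (down vs) (act w (up vs) n)) \<in> PSum w {}" using S(5) rv by simp
      moreover have "act w (up vs) (act w (down vs) (act w (up vs) n)) = act w (up vs @ down vs @ up vs) n"
        using act_append[OF w yv, of "down vs" "up vs"] act_append[OF w _ , of n "up vs" "down vs @ up vs"] n(1) r(1) rv by auto
      moreover have "\<dots> = act w (up vs) n" by (rule act_cong[OF w]) (rule run_up_down_up[OF n(2)])
      ultimately show False using n(3) by simp
    qed
    \<comment> \<open>Maximality carries over: an ascending word for the dual module is a descending
      word for w, and this one equals itself followed by the ascending word of the same element and
      then itself again. So that ascending word also leads outside the sum.\<close>
    fix v' vs' n' assume a: "n' \<in> ?N" "reduced v' vs'" "act (inv w) (up vs') n' \<notin> PSum (inv w) {}"
    obtain c where c: "c \<in> rad w" "n' = dual w c" using a(1) by blast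
    have cv: "c \<in> Vec w" using c r(1) by blast
    let ?zs = "rev vs'"
    note z = reduced_word_rev[OF a(2)]
    note rz = red_word[OF z]
    have wd: "down ?zs \<in> HW" "up ?zs \<in> HW" using rz(1) by (simp_all only: up_down_words)
    have "act (inv w) (up vs') n' = dual w (act w (down ?zs) c)"
      using dual_act[OF w cv wd(1)] c(2) by simp
    hence nd: "act w (down ?zs) c \<notin> PSum w {}" using dual_PSum[OF w] a(3) by fastforce
    have "act w (down ?zs) c = act w (down ?zs @ up ?zs @ down ?zs) c"
      by (rule act_cong[OF w]) (rule run_down_up_down[OF z, symmetric])
    also have "\<dots> = act w (down ?zs) (act w (up ?zs) (act w (down ?zs) c))"
      using act_append[OF w cv wd(1), of "up ?zs @ down ?zs"] act_append[OF w act_closed[OF cv] wd(2,1)] wd by simp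
    finally have "act w (up ?zs) (act w (down ?zs) c) \<notin> PSum w {}" using S(5) nd wd(1) by metis
    hence "Q (inv v')" using r(5)[OF c(1) wd(1)] z unfolding Q_def by blast
    thus "len v' \<le> len (inv v)" using v(2) reduced_word_closed[OF a(2)] rv by fastforce
  qed
  then obtain k' where k': "k' \<in> Par (I - D (inv v))" "inv w = inv v \<otimes> k'" by blast
  let ?H = "I - D (inv v)"
  have HI: "?H \<subseteq> I" "I - D v \<subseteq> I" by blast+
  note kc = parabolic_closed[OF HI(1) k'(1)]
  define h where "h = inv k'"
  have h: "h \<in> Par ?H" "h \<in> W" using parabolic_inv[OF HI(1) k'(1)] kc by (simp_all add: h_def)
  have "inv (inv w) = inv (inv v \<otimes> k')" by (rule arg_cong[OF k'(2)])
  hence wh: "w = h \<otimes> v" using kc rv w by (simp add: h_def inv_mult_group)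
  have lm: "left_minimal ?H v" using descent_iff_inversion(2)[of _ "inv v"] rv by (auto simp: left_minimal_def)
  show False
  proof (cases "h = \<one>")
    case True
    hence "reduced w vs" using n(2) wh rv by simp
    moreover have "act w [] n = n" using act_Nil n(1) r(1) by blast
    moreover have "act w (up vs) (act w [] n) = zerov w" if "reduced w vs"
      using n(1) that lists.Nil[of "hecke_gens I"] unfolding rad_def[OF w] mem_Collect_eq by blast
    ultimately have "act w (up vs) n = zerov w" by simp
    thus False using n(3) S(2) by simp
  next
    case False
    have e: "h \<otimes> v = v \<otimes> k" using wh k(3) by simp
    have "(I - D v) \<inter> D v = {}" by blast
    then obtain J where "J \<noteq> {}" "RB (h \<otimes> v) J" "left_minimal J v"
      using block_from_factorizations[OF HI rv(2) h(1) k(2) e lm _ False] by blast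
    thus False using k(1) by (simp add: interior_def flip: wh)
  qed
qed

section \<open>Tops and simple subquotients\<close>

lemma PSum_eq_rad: "w \<in> W \<Longrightarrow> PSum w {} = rad w"
  using PSum_le_rad rad_le_PSum by blast

text \<open>A block L of \<open>mrep J w\<close> extends to a block N of w containing J.
  Antisymmetrizing over L and then over J amounts to antisymmetrizing over N, since the factors in
  W_J and W_L multiply with additive lengths.\<close>

lemma phi_PSum:
  assumes w: "w \<in> W" and J: "RB w J" and c: "c \<in> rad (mrep J w)"
  shows "phi J w c \<in> PSum w J"
proof -
  note d = block_data[OF w J]
  let ?v = "mrep J w"
  note S = T_submoduleD[OF w PSum_submodule[OF w, of J]]
  note h = rmodule_homD[OF phi_hom[OF w J]] and hz = rmodule_hom_zero[OF phi_hom[OF w J] T_module[OF d(2)] T_module[OF w]]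
  have "PSum ?v {} \<subseteq> {c \<in> Vec ?v. phi J w c \<in> PSum w J}"
  proof (rule PSum_least[OF d(2)])
    show "zerov ?v \<in> {c \<in> Vec ?v. phi J w c \<in> PSum w J}" using hz S(2) by (simp add: T_sel(2))
    fix x y assume "x \<in> {c \<in> Vec ?v. phi J w c \<in> PSum w J}" "y \<in> {c \<in> Vec ?v. phi J w c \<in> PSum w J}"
    thus "x \<oplus>\<^bsub>T ?v\<^esub> y \<in> {c \<in> Vec ?v. phi J w c \<in> PSum w J}"
      using h(2)[of x y] T_add_closed S(3) by (simp add: T_sel(1))
  next
    fix L assume L: "RB ?v L" "{} \<subset> L"
    obtain N where N: "RB w N" "J \<subset> N" "s ` N = s ` (J \<union> L)" "mrep N w = mrep L ?v"
      using RB_extend[OF w J L(1)] L(2) by blast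
    note e = block_data[OF d(2) L(1)] and f = block_data[OF w N(1)]
    have "x \<in> Vec ?v \<and> phi J w x \<in> PSum w J" if x: "x \<in> P ?v L" for x
    proof -
      define b where "b = restrict x (B (mrep L ?v))"
      have xb: "x = phi L ?v b" "b \<in> Vec (mrep L ?v)" using P_space_phi[OF d(2) L(1) x] by (simp_all add: b_def)
      have "phi J w x = phi N w b"
      proof
        fix u show "phi J w x u = phi N w b u"
        proof (cases "u \<in> B w")
          case True
          have uc: "u \<in> W" using interval_closed True by blast
          define u0 where "u0 = mrep J u"
          define u1 where "u1 = mrep L u0"
          have u0: "u0 \<in> B ?v" using min_rep_interval[OF w J True] by (simp add: u0_def)
          have u1: "u1 \<in> B (mrep N w)" using min_rep_interval[OF d(2) L(1) u0] by (simp add: u1_def N(4))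
          have c: "u0 \<in> W" "u1 \<in> W" using interval_closed u0 u1 by blast+
          note p = top_part[OF d(1) uc, folded u0_def] and q = top_part[OF e(1) c(1), folded u1_def]
          have par: "top_part J u \<otimes> top_part L u0 \<in> Par N"
            using parabolic_mono[of J N] parabolic_mono[of L N] p(1) q(1) N(3) by (intro parabolic_mult) auto
          have eq: "u = top_part J u \<otimes> top_part L u0 \<otimes> u1" using p(2,3) q(2,3) c m_assoc[OF p(2) q(2) c(2)] by simp
          have m: "mrep N u = u1" "top_part N u = top_part J u \<otimes> top_part L u0"
            using coset_decomp[OF f(1) par c(2) block_interval_rep(2)[OF w N(1) u1], folded eq] by simp_all
          have "len (top_part N u) = len (top_part J u) + len (top_part L u0)"
            using top_part(4)[OF f(1) uc] m(1) p(4) q(4) by simp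
          moreover have "b u1 \<in> carrier K" using Vec_val[OF xb(2)] u1 N(4) by simp
          ultimately show ?thesis
            unfolding phi_apply[OF True] xb(1) using m(1) u0 by (auto simp: phi_apply u0_def[symmetric] u1_def[symmetric] sg_def)
        qed (simp add: phi_def)
      qed
      moreover have "phi N w b \<in> P w N" using phi_P_space[OF w N(1)] xb(2) N(4) by simp
      moreover have "P w N \<subseteq> PSum w J" by (rule PSum_member[OF w N(1,2)])
      moreover have "x \<in> Vec ?v" using x P_space_iff[OF e(1)] by blast
      ultimately show ?thesis by auto
    qed
    thus "P ?v L \<subseteq> {c \<in> Vec ?v. phi J w c \<in> PSum w J}" by blast
  qed
  thus ?thesis using c PSum_eq_rad[OF d(2)] by blast
qed

text \<open>For a reduced block N larger than J, the preimage of \<open>P w N\<close> in the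
  translation module of \<open>mrep J w\<close> is a proper submodule, as it misses the top basis
  vector. Hence it lies in the radical.\<close>

lemma PSum_phi:
  assumes w: "w \<in> W" and J: "RB w J" and x: "x \<in> PSum w J"
  shows "\<exists>c\<in>rad (mrep J w). x = phi J w c"
proof -
  note d = block_data[OF w J]
  let ?v = "mrep J w"
  note R = T_submoduleD[OF d(2) rad_submodule[OF d(2)]]
  note h = rmodule_homD[OF phi_hom[OF w J]] and hz = rmodule_hom_zero[OF phi_hom[OF w J] T_module[OF d(2)] T_module[OF w]]
  have "PSum w J \<subseteq> phi J w ` rad ?v"
  proof (rule PSum_least[OF w])
    show "zerov w \<in> phi J w ` rad ?v" using hz R(2) by (metis T_sel(2) image_eqI)
    fix x y assume "x \<in> phi J w ` rad ?v" "y \<in> phi J w ` rad ?v"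
    then obtain a b where ab: "a \<in> rad ?v" "b \<in> rad ?v" "x = phi J w a" "y = phi J w b" by blast
    have "phi J w (a \<oplus>\<^bsub>T ?v\<^esub> b) = x \<oplus>\<^bsub>T w\<^esub> y" using h(2)[of a b] ab R(1) by (auto simp: T_sel(1))
    thus "x \<oplus>\<^bsub>T w\<^esub> y \<in> phi J w ` rad ?v" using R(3)[OF ab(1,2)] by (metis image_eqI)
  next
    fix N assume N: "RB w N" "J \<subset> N"
    note f = block_data[OF w N(1)]
    let ?v' = "mrep N w" and ?A = "{c \<in> carrier (T ?v). phi J w c \<in> P w N}"
    have v: "?v \<in> B w" "?v \<in> B ?v" "?v' \<in> B w" "?v' \<in> B ?v'"
      using self_interval d(2) f(2) block_interval_rep(1)[OF w J] block_interval_rep(1)[OF w N(1)] by blast+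
    \<comment> \<open>Here reducedness of N enters: the smaller set J has a different minimal
      representative.\<close>
    have ne: "?v' \<noteq> ?v" using N by (simp add: reduced_left_block_def left_reduced_def)
    have lm: "left_minimal J ?v'" using block_interval_rep(2)[OF w N(1) v(4)] N(2) by (auto simp: left_minimal_def)
    have tc: "top_part J w \<in> W" "top_part N w \<in> W"
      using parabolic_closed[OF d(1,4)] parabolic_closed[OF f(1,4)] .
    have "top_part J w \<in> Par N" using parabolic_mono[OF _ d(4), of N] N(2) by blast
    hence p: "inv (top_part J w) \<otimes> top_part N w \<in> Par N" by (intro parabolic_mult parabolic_inv f)
    have "inv (top_part J w) \<otimes> w = ?v" using d(2,5) tc by (metis inv_closed l_inv l_one m_assoc)
    moreover have "inv (top_part J w) \<otimes> w = inv (top_part J w) \<otimes> top_part N w \<otimes> ?v'"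
      using f(2,5) tc by (metis inv_closed m_assoc)
    ultimately have "?v = inv (top_part J w) \<otimes> top_part N w \<otimes> ?v'" by simp
    hence mv: "mrep N ?v = ?v'"
      using coset_decomp(1)[OF f(1) p f(2) block_interval_rep(2)[OF w N(1) v(4)]] by simp
    have "bas ?v ?v \<notin> ?A"
    proof
      assume a: "bas ?v ?v \<in> ?A"
      \<comment> \<open>Antisymmetry over N would express the value of this vector at
        \<open>mrep J w\<close>, which is 1, by its value at \<open>mrep N w\<close>, which is
        0.\<close>
      let ?x = "phi J w (bas ?v ?v)"
      have "?x ?v' = \<zero>\<^sub>K"
        using coset_decomp[OF d(1) parabolic_one f(2) lm] f(2) v(3) ne
        by (simp add: phi_apply bas_def basis_vec_def) (simp add: block_interval[OF w J f(2)])
      moreover have "?x ?v = phi N w (restrict ?x (B ?v')) ?v" using P_space_phi(1)[OF w N(1), of ?x] a by simp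
      ultimately have "?x ?v = \<zero>\<^sub>K" using v(1,4) mv by (simp add: phi_apply[of ?v w N])
      thus False using phi_rep[OF w J v(2), of "bas ?v ?v"] v(2) by (simp add: bas_apply)
    qed
    moreover have A: "submod (T ?v) ?A"
      by (rule right_submodule_preimage[OF phi_hom[OF w J] T_module[OF d(2)] T_module[OF w] P_space_submodule[OF w N(1)]])
    ultimately have "?A \<subseteq> rad ?v" using rad_greatest[OF d(2) A] bas_closed by blast
    moreover have "P w N \<subseteq> P w J" using P_space_mono[OF d(1) f(1)] N(2) by blast
    ultimately show "P w N \<subseteq> phi J w ` rad ?v"
      using phi_image[OF w J] by (force simp: T_sel(1))
  qed
  thus ?thesis using x by blast
qed

abbreviation "S \<equiv> S_module K G I s"

lemma S_module_empty: "w \<in> W \<Longrightarrow> S w {} = rmodule_quot (T w) (rad w)"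
proof -
  assume w: "w \<in> W"
  have "T w\<lparr>carrier := P w {}\<rparr> = T w" unfolding P_space_empty T_sel(1)[symmetric] by simp
  thus ?thesis using PSum_eq_rad[OF w] by (simp add: S_module_def)
qed

lemma S_simple: "w \<in> W \<Longrightarrow> simple_rmodule K M (S w {})"
proof -
  assume w: "w \<in> W"
  have "rad w \<noteq> carrier (T w)" using rad_proper[OF w] bas_closed by (auto simp: T_sel(1))
  thus ?thesis unfolding S_module_empty[OF w]
    using rad_greatest[OF w] by (intro simple_quot T_module w rad_submodule) (auto simp: T_sel(1))
qed

text \<open>Every proper submodule lies in \<open>rad w\<close>, so this is the only maximal
  submodule, and the intersection defining the radical reduces to it.\<close>

lemma S_top: "w \<in> W \<Longrightarrow> rmodule_top K M (T w) = S w {}"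
proof -
  assume w: "w \<in> W"
  have ne: "rad w \<noteq> carrier (T w)" using rad_proper[OF w] bas_closed by (auto simp: T_sel(1))
  have "{N. submod (T w) N \<and> N \<noteq> carrier (T w) \<and>
       (\<forall>N'. submod (T w) N' \<and> N \<subseteq> N' \<longrightarrow> N' = N \<or> N' = carrier (T w))} = {rad w}"
    using rad_greatest[OF w] rad_submodule[OF w] ne unfolding T_sel(1)[symmetric] by blast
  moreover have "rad w \<subseteq> carrier (T w)" using T_submoduleD(1)[OF w rad_submodule[OF w]] by (simp add: T_sel(1))
  ultimately have "rmodule_radical K M (T w) = rad w" unfolding rmodule_radical_def by auto
  thus ?thesis by (simp add: rmodule_top_def S_module_empty[OF w])
qed

lemma S_block_iso:
  assumes w: "w \<in> W" and J: "RB w J"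
  shows "rmod (S w J)" "rmodule_iso K M (S (mrep J w) {}) (S w J)"
proof -
  note d = block_data[OF w J]
  let ?v = "mrep J w"
  let ?V = "T w\<lparr>carrier := P w J\<rparr>"
  have V: "rmod ?V" by (rule right_module_sub[OF T_module[OF w] P_space_submodule[OF w J]])
  have "PSum w J \<subseteq> P w J"
    using PSum_phi[OF w J] phi_P_space[OF w J] T_submoduleD(1)[OF d(2) rad_submodule[OF d(2)]] by blast
  hence N: "submod ?V (PSum w J)"
    using right_submodule_sub_iff[OF T_module[OF w] P_space_submodule[OF w J]] PSum_submodule[OF w] by blast
  show Q: "rmod (S w J)" unfolding S_module_def by (rule quot_module[OF V N])
  note TV = T_module[OF d(2)] and RV = rad_submodule[OF d(2)]
  have ph: "phi J w \<in> Hom (T ?v) ?V"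
    by (rule rmodule_hom_into_sub[OF phi_hom[OF w J]]) (use phi_image[OF w J] in \<open>simp add: T_sel(1)\<close>)
  show "rmodule_iso K M (S ?v {}) (S w J)"
    unfolding S_module_empty[OF d(2)]
  proof (rule iso_of_surjections[OF TV quot_module[OF TV RV] Q quot_hom[OF TV RV] quot_surj[OF TV RV]])
    show "(\<lambda>c. PSum w J +>\<^bsub>?V\<^esub> phi J w c) \<in> Hom (T ?v) (S w J)"
      unfolding S_module_def by (rule rmodule_hom_comp[OF ph quot_hom[OF V N]])
    have "carrier ?V = phi J w ` carrier (T ?v)" using phi_image[OF w J] by (simp add: T_sel(1))
    thus "(\<lambda>c. PSum w J +>\<^bsub>?V\<^esub> phi J w c) ` carrier (T ?v) = carrier (S w J)"
      unfolding S_module_def quot_surj[OF V N, symmetric] by (simp only: image_image)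
    fix c assume "c \<in> carrier (T ?v)"
    hence c: "c \<in> Vec ?v" "c \<in> carrier (T ?v)" by (simp_all add: T_sel(1))
    have "phi J w c \<in> PSum w J \<longleftrightarrow> c \<in> rad ?v"
    proof
      assume "phi J w c \<in> PSum w J"
      then obtain c' where "c' \<in> rad ?v" "phi J w c = phi J w c'" using PSum_phi[OF w J] by blast
      moreover have "c' \<in> Vec ?v" using calculation T_submoduleD(1)[OF d(2) RV] by blast
      ultimately show "c \<in> rad ?v" using phi_inj[OF w J c(1)] by blast
    qed (rule phi_PSum[OF w J])
    thus "rad ?v +>\<^bsub>T ?v\<^esub> c = \<zero>\<^bsub>rmodule_quot (T ?v) (rad ?v)\<^esub> \<longleftrightarrow> PSum w J +>\<^bsub>?V\<^esub> phi J w c = \<zero>\<^bsub>S w J\<^esub>"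
      using quot_zero_iff[OF TV RV c(2)] quot_zero_iff[OF V N, of "phi J w c"] phi_P_space[OF w J c(1)]
      by (simp add: S_module_def)
  qed
qed

section \<open>Classification of the simple modules\<close>

text \<open>Split \<open>co w\<close> as q p and pass from u to p u and on to q p u. After gs the
  two ratios still multiply to \<open>co w\<close>, while neither is longer than p or q
  respectively; as the lengths of q and p add up to that of \<open>co w\<close>, the first ratio
  must still be p.\<close>

lemma translate:
  assumes w: "w \<in> W" and u: "u \<in> B w" and p: "p \<in> W" "len (p \<otimes> w) = len p + len w"
  shows "len (p \<otimes> u) = len p + len u"
    and "gs \<in> HW \<Longrightarrow> ok w gs u \<Longrightarrow> run gs (p \<otimes> u) = p \<otimes> run gs u"
proof -
  have uc: "u \<in> W" using interval_closed u by blast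
  have "len w = len u + len (inv u \<otimes> w)" using u interval_iff[OF w] rle_iff_len[OF uc w] by blast
  moreover have "len (p \<otimes> u \<otimes> (inv u \<otimes> w)) \<le> len (p \<otimes> u) + len (inv u \<otimes> w)"
    using len_mult_le uc w p by simp
  moreover have "p \<otimes> u \<otimes> (inv u \<otimes> w) = p \<otimes> w" using uc w p by (simp add: m_assoc)
  ultimately show "len (p \<otimes> u) = len p + len u" using p len_mult_le[OF p(1) uc] by simp
  assume gs: "gs \<in> HW" "ok w gs u"
  define q where "q = co w \<otimes> inv p"
  have q: "q \<in> W" using w p by (simp add: q_def)
  have "q = longest \<otimes> inv (p \<otimes> w)" using w p by (simp add: q_def co_def inv_mult_group m_assoc)
  hence "len q + len (p \<otimes> w) = len longest" using len_longest_mult[of "inv (p \<otimes> w)"] w p by simp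
  hence lq: "len (co w) = len q + len p" using len_co[OF w] p by simp
  have cw: "co w = q \<otimes> p" using w p by (simp add: q_def m_assoc)
  let ?b = "run gs (p \<otimes> u)" and ?u = "run gs u"
  define r where "r = run gs (q \<otimes> (p \<otimes> u)) \<otimes> inv ?b"
  define r' where "r' = ?b \<otimes> inv ?u"
  have c: "?b \<in> W" "?u \<in> W" "r \<in> W" "r' \<in> W" using gs p q uc by (simp_all add: r_def r'_def)
  have r: "r = q \<or> len r < len q" "r' = p \<or> len r' < len p"
    using run_ratio[OF gs(1) q, of "p \<otimes> u"] run_ratio[OF gs(1) p(1) uc] p uc by (simp_all add: r_def r'_def)
  have "run gs (q \<otimes> (p \<otimes> u)) = co w \<otimes> ?u" using gs(2) p q uc by (simp add: ok_def cw m_assoc)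
  hence "r \<otimes> r' = co w \<otimes> ?u \<otimes> inv ?b \<otimes> (?b \<otimes> inv ?u)" by (simp add: r_def r'_def)
  also have "\<dots> = co w" using c w by (simp add: m_assoc)
  finally have "len (co w) \<le> len r + len r'" using len_mult_le[OF c(3,4)] by simp
  hence "r' = p" using r lq by auto
  moreover have "r' \<otimes> ?u = ?b" using c by (simp add: r'_def m_assoc)
  ultimately show "?b = p \<otimes> ?u" by simp
qed

text \<open>As \<open>longest\<close> is itself a value of \<open>up ws\<close> and the greatest
  element of the left order, monotonicity puts its image above it.\<close>

lemma run_up_longest:
  assumes "reduced w ws"
  shows "run (up ws) longest = longest"
proof -
  have c: "run (up ws) longest \<in> W" using red_word[OF assms] by simp
  have e: "run (up ws) (run (down ws) longest) = longest"
    using run_up_lle_id[OF assms longest_closed] lle_longest red_word[OF assms] by simp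
  have "run (down ws) longest \<in> W" using red_word[OF assms] by simp
  hence "lle (run (up ws) (run (down ws) longest)) (run (up ws) longest)"
    using run_lle[OF _ _ longest_closed lle_longest] red_word[OF assms] by simp
  hence "lle longest (run (up ws) longest)" unfolding e .
  thus ?thesis using lle_len_eq[OF longest_closed c] lle_len[OF c longest_closed lle_longest[OF c]] by simp
qed

lemma simple_classification:
  assumes V: "simple_rmodule K M V"
  shows "\<exists>w\<in>W. rmodule_iso K M V (S w {})"
proof -
  have VM: "rmod V" by (rule simple_right_module[OF V])
  interpret V: right_module K M V by (rule VM)
  define rw where "rw z = (SOME zs. reduced z zs)" for z
  have rw: "reduced z (rw z)" if "z \<in> W" for z
    unfolding rw_def using reduced_word_exists[OF that] by (rule someI_ex)
  note rww = red_word(1)[OF rw]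
  define Q where "Q z \<longleftrightarrow> z \<in> W \<and> (\<exists>n\<in>carrier V. n \<cdot>\<^bsub>V\<^esub> hw (up (rw z)) \<noteq> \<zero>\<^bsub>V\<^esub>)" for z
  have "rw \<one> = []" using red_word(4)[OF rw[OF one_closed]] by simp
  moreover obtain n where "n \<in> carrier V" "n \<noteq> \<zero>\<^bsub>V\<^esub>"
    using V V.M.zero_closed by (auto simp: simple_rmodule_def)
  ultimately have "Q \<one>" using V.ract_one[of n] by (auto simp: Q_def hw_one intro!: bexI[of _ n])
  moreover have "len z < Suc (len longest)" if "Q z" for z
    using that len_longest_mult[of z] by (simp add: Q_def)
  ultimately obtain w where w': "Q w" "\<And>z. Q z \<Longrightarrow> len z \<le> len w"
    using ex_has_greatest_nat[of Q \<one> len "Suc (len longest)"] by blast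
  then obtain n where n: "w \<in> W" "n \<in> carrier V" "n \<cdot>\<^bsub>V\<^esub> hw (up (rw w)) \<noteq> \<zero>\<^bsub>V\<^esub>" by (auto simp: Q_def)
  note w = n(1)
  let ?ws = "rw w"
  let ?E = "up ?ws @ down ?ws"
  \<comment> \<open>The idempotent attached to w comes first: all its values p satisfy len (p w) =
    len p + len w, so that \<open>up (rw u)\<close> acts on them as right multiplication by u for
    every u in \<open>B w\<close>.\<close>
  define t where "t u = n \<cdot>\<^bsub>V\<^esub> hw (?E @ up (rw u))" for u
  note rww' = rww[OF w]
  have E: "?E \<in> HW" using rww' by simp
  have act: "x \<cdot>\<^bsub>V\<^esub> hw gs \<cdot>\<^bsub>V\<^esub> hw hs = x \<cdot>\<^bsub>V\<^esub> hw (gs @ hs)"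
    if "x \<in> carrier V" "gs \<in> HW" "hs \<in> HW" for x gs hs
    using V.ract_mult[OF that(1) hw_closed hw_closed] that hw_mult by simp
  have hw_eq: "hw gs = hw hs" if "\<And>y. y \<in> W \<Longrightarrow> run gs y = run hs y" for gs hs
    using that hw_eq_iff by blast
  have tV: "t u \<in> carrier V" if "u \<in> B w" for u
    unfolding t_def using rww[OF interval_closed[OF that]] E by (intro V.ract_closed n hw_closed) simp
  have "\<exists>H\<in>Hom (T w) V. \<forall>u\<in>B w. H (bas w u) = t u"
  proof (rule T_hom[OF w VM tV])
    fix u gs assume u: "u \<in> B w" and gs: "gs \<in> HW"
    have uc: "u \<in> W" using interval_closed u by blast
    note ru = rw[OF uc] and rul = rww[OF uc]
    let ?u = "run gs u"
    have vc: "?u \<in> W" using gs uc by simp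
    let ?g = "?E @ up (rw u) @ gs"
    have g: "?E @ up (rw u) \<in> HW" "?g \<in> HW" using E rul gs by simp_all
    have tg: "t u \<cdot>\<^bsub>V\<^esub> hw gs = n \<cdot>\<^bsub>V\<^esub> hw ?g" unfolding t_def using act[OF n(2) g(1) gs] by simp
    have len1: "len (\<one> \<otimes> w) = len \<one> + len w" using w by simp
    show "t u \<cdot>\<^bsub>V\<^esub> hw gs = (if ok w gs u then t ?u else \<zero>\<^bsub>V\<^esub>)"
    proof (cases "ok w gs u")
      case True
      have vB: "?u \<in> B w" by (rule ok_interval[OF w u gs True])
      have "hw ?g = hw (?E @ up (rw ?u))"
      proof (rule hw_eq)
        fix y assume y: "y \<in> W"
        define p where "p = run ?E y"
        have p: "p \<in> W" "len (p \<otimes> w) = len p + len w"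
          using run_down_image[OF rw[OF w], of "run (up ?ws) y"] y rww' by (simp_all add: p_def)
        have "run (up (rw u)) p = p \<otimes> u" "run (up (rw ?u)) p = p \<otimes> ?u"
          using run_up[OF ru p(1)] run_up[OF rw[OF vc] p(1)] translate(1)[OF w u p] translate(1)[OF w vB p] by blast+
        thus "run ?g y = run (?E @ up (rw ?u)) y" using translate(2)[OF w u p gs True] by (simp add: p_def)
      qed
      thus ?thesis using True tg by (simp add: t_def)
    next
      case False
      have g1: "run ?g \<one> = ?u"
        using run_up_one[OF rw[OF w]] run_down[OF rw[OF w] one_closed len1] run_up_one[OF ru] w by simp
      have "len (co w \<otimes> u) = len (co w) + len u" using interval_iff_co[OF w uc] u by blast
      hence g2: "run ?g longest = run gs (co w \<otimes> u)"
        using run_up_longest[OF rw[OF w]] run_down_longest[OF rw[OF w]] run_up[OF ru co_closed[OF w]] by (simp add: co_def)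
      \<comment> \<open>The word sends 1 to u' = \<open>run gs u\<close> and \<open>longest\<close>
        to x u'. As x is shorter than \<open>co w\<close>, the element z is longer than w. By
        \<open>run_factor\<close> the word factors through \<open>up (rw z)\<close>, which
        annihilates V by the choice of w.\<close>
      define x where "x = run ?g longest \<otimes> inv ?u"
      define z where "z = inv x \<otimes> longest"
      have xc: "x \<in> W" "z \<in> W" using g(2) vc by (simp_all add: x_def z_def)
      have "len x < len (co w)" using not_ok_len[OF w uc gs False] g2 by (simp add: x_def)
      moreover have "len z + len x = len longest" using len_mult_longest[of "inv x"] xc by (simp add: z_def)
      ultimately have "len w < len z" using len_co[OF w] by simp
      hence "\<not> Q z" using w'(2)[of z] by auto
      hence kill: "v \<cdot>\<^bsub>V\<^esub> hw (up (rw z)) = \<zero>\<^bsub>V\<^esub>" if "v \<in> carrier V" for v using that xc by (auto simp: Q_def)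
      let ?a = "?g @ down (rw ?u)" and ?b = "down (rw z) @ up (rw ?u)"
      have wd: "?a \<in> HW" "up (rw z) \<in> HW" "?b \<in> HW" "?a @ up (rw z) \<in> HW" using g rww[OF vc] rww[OF xc(2)] by simp_all
      have "hw ?g = hw ((?a @ up (rw z)) @ ?b)"
        by (rule hw_eq) (use run_factor[OF g(2) g1[symmetric] x_def z_def rw[OF vc] rw[OF xc(2)]] in simp)
      hence "n \<cdot>\<^bsub>V\<^esub> hw ?g = n \<cdot>\<^bsub>V\<^esub> hw ?a \<cdot>\<^bsub>V\<^esub> hw (up (rw z)) \<cdot>\<^bsub>V\<^esub> hw ?b"
        using act[OF n(2) wd(1,2)] act[OF n(2) wd(4,3)] by simp
      also have "\<dots> = \<zero>\<^bsub>V\<^esub>"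
        using kill[OF V.ract_closed[OF n(2) hw_closed[OF wd(1)]]] V.zero_ract hw_closed[OF wd(3)] by simp
      finally show ?thesis using tg False by simp
    qed
  qed
  then obtain H where H: "H \<in> Hom (T w) V" "\<And>u. u \<in> B w \<Longrightarrow> H (bas w u) = t u" by blast
  have "hw (?E @ up ?ws) = hw (up ?ws)" by (rule hw_eq) (use run_up_down_up[OF rw[OF w]] in simp)
  hence ne: "H (bas w w) \<noteq> \<zero>\<^bsub>V\<^esub>" using H(2)[OF self_interval[OF w]] n(3) by (simp add: t_def)
  note TM = T_module[OF w] and R = rad_submodule[OF w]
  have bT: "bas w w \<in> carrier (T w)" by (simp add: T_sel(1))
  let ?N = "{x \<in> carrier (T w). H x = \<zero>\<^bsub>V\<^esub>}"
  have N: "submod (T w) ?N" by (rule right_submodule_kernel[OF H(1) TM VM])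
  have "?N \<noteq> Vec w" using bT ne unfolding T_sel(1)[symmetric] by blast
  hence NR: "?N \<subseteq> rad w" by (rule rad_greatest[OF w N])
  have "H y = \<zero>\<^bsub>V\<^esub>" if y: "y \<in> rad w" for y
  proof (rule ccontr)
    assume "H y \<noteq> \<zero>\<^bsub>V\<^esub>"
    hence "rad w = carrier (T w)" using simple_kernel_maximal[OF V TM H(1) R NR y] by blast
    thus False using rad_proper[OF w] bas_closed by (auto simp: T_sel(1))
  qed
  hence RN: "rad w = ?N" using NR T_submoduleD(1)[OF w R] by (auto simp: T_sel(1))
  have "rmodule_iso K M (S w {}) V" unfolding S_module_empty[OF w]
    by (rule rmodule_quot_iso[OF TM VM H(1) hom_to_simple_surj[OF V TM H(1), of "bas w w"] RN]) (rule bT, rule ne)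
  thus ?thesis using rmodule_iso_sym[OF simple_right_module[OF S_simple[OF w]] VM] w by blast
qed

text \<open>\<open>up ws\<close> does not annihilate the simple module of w, hence not that of u
  either. A nonzero coefficient can only occur at a value of \<open>up ws\<close>, and such values
  lie above w in the left order.\<close>

lemma S_iso_lle:
  assumes w: "w \<in> W" and u: "u \<in> W" and iso: "rmodule_iso K M (S w {}) (S u {})"
  shows "\<exists>a\<in>B u. lle w a"
proof -
  obtain h where h: "h \<in> Hom (S w {}) (S u {})" "bij_betw h (carrier (S w {})) (carrier (S u {}))"
    using iso by (auto simp: rmodule_iso_def)
  note Sw = simple_right_module[OF S_simple[OF w]] and Su = simple_right_module[OF S_simple[OF u]]
  interpret Sw: right_module K M "S w {}" by (rule Sw)
  note hd = rmodule_homD[OF h(1)] and hz = rmodule_hom_zero[OF h(1) Sw Su]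
  define q where "q z c = rad z +>\<^bsub>T z\<^esub> c" for z c
  have q: "q z \<in> Hom (T z) (S z {})" "q z ` carrier (T z) = carrier (S z {})"
    "c \<in> Vec z \<Longrightarrow> q z c = \<zero>\<^bsub>S z {}\<^esub> \<longleftrightarrow> c \<in> rad z" if z: "z \<in> W" for z c
    using quot_hom[OF T_module[OF z] rad_submodule[OF z]] quot_surj[OF T_module[OF z] rad_submodule[OF z]]
      quot_zero_iff[OF T_module[OF z] rad_submodule[OF z], of c]
    unfolding S_module_empty[OF z] q_def by (simp_all add: T_sel(1))
  obtain ws where ws: "reduced w ws" using reduced_word_exists w by blast
  have upw: "up ws \<in> HW" "hw (up ws) \<in> carrier M" using red_word(1)[OF ws] hw_closed by simp_all
  have b1: "bas w \<one> \<in> carrier (T w)" by (simp add: T_sel(1))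
  let ?Y = "q w (bas w \<one>)"
  have Y: "?Y \<in> carrier (S w {})" using rmodule_homD(1)[OF q(1)[OF w] b1] .
  have "?Y \<cdot>\<^bsub>S w {}\<^esub> hw (up ws) = q w (bas w w)"
    using rmodule_homD(4)[OF q(1)[OF w] b1 upw(2)] T_ract[OF w bas_closed upw(1)]
      act_up_one[OF w self_interval[OF w] ws] by simp
  moreover have "bas w w \<notin> rad w"
    using T_submodule_top[OF w rad_submodule[OF w]] rad_proper[OF w] bas_closed by blast
  ultimately have ne: "?Y \<cdot>\<^bsub>S w {}\<^esub> hw (up ws) \<noteq> \<zero>\<^bsub>S w {}\<^esub>" using q(3)[OF w bas_closed] by simp
  obtain c where c: "c \<in> carrier (T u)" "h ?Y = q u c" using hd(1)[OF Y] q(2)[OF u] by blast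
  have cv: "c \<in> Vec u" using c by (simp add: T_sel(1))
  have "h (?Y \<cdot>\<^bsub>S w {}\<^esub> hw (up ws)) = q u (act u (up ws) c)"
    using hd(4)[OF Y upw(2)] c(2) rmodule_homD(4)[OF q(1)[OF u] c(1) upw(2)] T_ract[OF u cv upw(1)] by simp
  moreover have "h (?Y \<cdot>\<^bsub>S w {}\<^esub> hw (up ws)) \<noteq> \<zero>\<^bsub>S u {}\<^esub>"
    using ne hz inj_onD[OF bij_betw_imp_inj_on[OF h(2)] _ Sw.ract_closed[OF Y upw(2)] Sw.M.zero_closed] by auto
  ultimately have "act u (up ws) c \<notin> rad u" using q(3)[OF u act_closed[OF cv]] by simp
  hence "act u (up ws) c \<noteq> zerov u" using T_submoduleD(2)[OF u rad_submodule[OF u]] by auto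
  then obtain a where a: "a \<in> B u" "act u (up ws) c a \<noteq> \<zero>\<^sub>K"
    using Vec_eqI[OF act_closed[OF cv] zero_vec_closed] by (auto simp: zero_vec_apply)
  have "{x \<in> B u. ok u (up ws) x \<and> run (up ws) x = a} \<noteq> {}"
  proof
    assume e: "{x \<in> B u. ok u (up ws) x \<and> run (up ws) x = a} = {}"
    show False using a(2) act_apply[OF a(1), of "up ws" c] unfolding e by simp
  qed
  then obtain x where "x \<in> B u" "run (up ws) x = a" by blast
  thus ?thesis using run_up_lle[OF ws interval_closed, of x u] a(1) by blast
qed

text \<open>Comparing in both directions gives a in \<open>B u\<close> above w and b in
  \<open>B w\<close> above u. The chain of lengths from w through a, u and b returns to w, so all
  lengths agree and w = a = u.\<close>

lemma S_iso_eq: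
  assumes w: "w \<in> W" and u: "u \<in> W" and iso: "rmodule_iso K M (S w {}) (S u {})"
  shows "w = u"
proof -
  have "rmodule_iso K M (S u {}) (S w {})"
    using rmodule_iso_sym iso simple_right_module S_simple w u by blast
  then obtain a b where ab: "a \<in> B u" "lle w a" "b \<in> B w" "lle u b"
    using S_iso_lle[OF w u iso] S_iso_lle[OF u w] by blast
  note c = interval_closed[OF ab(1)] interval_closed[OF ab(3)]
  have r: "rle a u" "rle b w" using ab interval_iff u w by blast+
  have "len w \<le> len a" "len a \<le> len u" "len u \<le> len b" "len b \<le> len w"
    using lle_len[OF w c(1) ab(2)] rle_len[OF c(1) u r(1)] lle_len[OF u c(2) ab(4)] rle_len[OF c(2) w r(2)] .
  thus ?thesis using lle_len_eq[OF w c(1) ab(2)] rle_len_eq[OF c(1) u r(1)] by simp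
qed

end

theorem theorem6p1:
  fixes K :: "'k ring" and G :: "'a monoid"
    and I :: "'i set" and s :: "'i \<Rightarrow> 'a" and m :: "'i \<Rightarrow> 'i \<Rightarrow> nat"
  assumes "finite_coxeter_group G I s m" and "field K"
  defines "M \<equiv> biHecke G I s"
  shows "\<exists>(S :: 'a \<Rightarrow> ('k, ('a \<Rightarrow> 'k) set, 'a \<Rightarrow> 'a) rmodule)
          (P :: 'a \<Rightarrow> ('k, ('a \<Rightarrow> 'a) \<Rightarrow> 'k, 'a \<Rightarrow> 'a) rmodule).
    (\<forall>w\<in>carrier G. simple_rmodule K M (S w)) \<and>
    (\<forall>u\<in>carrier G. \<forall>w\<in>carrier G. u \<noteq> w \<longrightarrow> \<not> rmodule_iso K M (S u) (S w)) \<and>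
    (\<forall>V :: ('k, 'v, 'a \<Rightarrow> 'a) rmodule.
       simple_rmodule K M V \<longrightarrow> (\<exists>w\<in>carrier G. rmodule_iso K M V (S w))) \<and>
    (\<forall>w\<in>carrier G. indecomposable_rmodule K M (P w) \<and> projective_rmodule K M (P w) \<and>
       (\<exists>p. projective_cover K M (P w) p (S w))) \<and>
    (\<forall>u\<in>carrier G. \<forall>w\<in>carrier G. u \<noteq> w \<longrightarrow> \<not> rmodule_iso K M (P u) (P w)) \<and>
    (\<forall>Q :: ('k, 'q, 'a \<Rightarrow> 'a) rmodule.
       indecomposable_rmodule K M Q \<and> projective_rmodule K M Q \<longrightarrow>
       (\<exists>w\<in>carrier G. rmodule_iso K M Q (P w))) \<and>
    (\<forall>w\<in>carrier G.
       rmodule_iso K M (S_module K G I s w {}) (rmodule_top K M (translation_module K G I s w)) \<and>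
       rmodule_iso K M (S w) (S_module K G I s w {})) \<and>
    (\<forall>w\<in>carrier G. \<forall>J. reduced_left_block G I s w J \<longrightarrow>
       simple_rmodule K M (S_module K G I s w J) \<and>
       rmodule_iso K M (S_module K G I s w J) (S (min_rep G I s J w)))"
proof -
  interpret tr: translation G I s m K M
    unfolding translation_def M_def using assms(1,2) by simp_all
  \<comment> \<open>The tops of the translation modules are themselves taken as the family of simple
    modules, so the isomorphism of each member with its top is the identity.\<close>
  let ?S = "\<lambda>w. S_module K G I s w {}"
  note Sm = simple_right_module[OF tr.S_simple]
  have "\<exists>P :: ('k, ('a \<Rightarrow> 'a) \<Rightarrow> 'k, 'a \<Rightarrow> 'a) rmodule. indecomposable_rmodule K M P \<and> projective_rmodule K M P \<and>
      (\<exists>p. projective_cover K M P p (?S w))" if "w \<in> carrier G" for w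
    by (rule tr.fma.projective_cover_exists[OF tr.S_simple[OF that]])
  then obtain P :: "'a \<Rightarrow> ('k, ('a \<Rightarrow> 'a) \<Rightarrow> 'k, 'a \<Rightarrow> 'a) rmodule"
    where P: "\<And>w. w \<in> carrier G \<Longrightarrow> indecomposable_rmodule K M (P w) \<and> projective_rmodule K M (P w) \<and>
      (\<exists>p. projective_cover K M (P w) p (?S w))" by metis
  have noniso: "u = w" if uw: "u \<in> carrier G" "w \<in> carrier G" "rmodule_iso K M (P u) (P w)" for u w
  proof -
    obtain h where h: "h \<in> rmodule_hom K M (P u) (P w)" "bij_betw h (carrier (P u)) (carrier (P w))"
      using uw(3) by (auto simp: rmodule_iso_def)
    obtain p q where pq: "projective_cover K M (P u) p (?S u)" "projective_cover K M (P w) q (?S w)" using P uw by meson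
    have "projective_cover K M (P u) (\<lambda>x. q (h x)) (?S w)"
      using projective_cover_iso[OF _ pq(2) h] P[OF uw(1)] by blast
    hence "rmodule_iso K M (?S u) (?S w)"
      using tr.fma.projective_cover_top_unique[OF pq(1) _ tr.S_simple[OF uw(1)] tr.S_simple[OF uw(2)]] by blast
    thus ?thesis by (rule tr.S_iso_eq[OF uw(1,2)])
  qed
  have classify: "\<exists>w\<in>carrier G. rmodule_iso K M Q (P w)"
    if Q: "indecomposable_rmodule K M Q" "projective_rmodule K M Q" for Q :: "('k, 'q, 'a \<Rightarrow> 'a) rmodule"
  proof -
    obtain X :: "'q set" where X: "right_module K M Q" "tr.fma.summand X Q" using Q(2) tr.fma.projective_iff_summand by blast
    have "carrier Q \<noteq> {\<zero>\<^bsub>Q\<^esub>}" using Q(1) by (simp add: indecomposable_rmodule_def)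
    \<comment> \<open>This simple quotient has a type of its own; the classification of simple
      modules is applied at that type and identifies it with a member of the family.\<close>
    then obtain S0 :: "('k, (unit \<times> ('a \<Rightarrow> 'a) \<Rightarrow> 'k) set, 'a \<Rightarrow> 'a) rmodule" and q
      where S0: "simple_rmodule K M S0" "q \<in> rmodule_hom K M Q S0" "q ` carrier Q = carrier S0"
      using tr.fma.simple_quotient_exists[OF X] by blast
    obtain w where w: "w \<in> carrier G" "rmodule_iso K M S0 (?S w)" using tr.simple_classification[OF S0(1)] by blast
    obtain h where h: "h \<in> rmodule_hom K M S0 (?S w)" "bij_betw h (carrier S0) (carrier (?S w))"
      using w(2) by (auto simp: rmodule_iso_def)
    obtain p where p: "projective_cover K M (P w) p (?S w)" using P[OF w(1)] by blast
    obtain Y :: "(('a \<Rightarrow> 'a) \<Rightarrow> 'k) set" where Y: "tr.fma.summand Y (P w)" using P[OF w(1)] by (auto simp: tr.fma.projective_iff_summand)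
    have ne: "carrier (P w) \<noteq> {\<zero>\<^bsub>P w\<^esub>}" using P[OF w(1)] by (simp add: indecomposable_rmodule_def)
    have "(\<lambda>x. h (q x)) ` carrier Q = carrier (?S w)"
      using S0(3) bij_betw_imp_surj_on[OF h(2)] by (metis image_image)
    hence "rmodule_iso K M Q (P w)"
      using tr.fma.projective_cover_unique[OF Q(1) X(2) Y ne p rmodule_hom_comp[OF S0(2) h(1)]] by blast
    thus ?thesis using w(1) by blast
  qed
  have block: "simple_rmodule K M (S_module K G I s w J) \<and> rmodule_iso K M (S_module K G I s w J) (?S (min_rep G I s J w))"
    if w: "w \<in> carrier G" and J: "reduced_left_block G I s w J" for w J
  proof -
    note d = tr.block_data(2)[OF w J] and i = tr.S_block_iso[OF w J]
    show ?thesis using simple_iso[OF tr.S_simple[OF d] i] rmodule_iso_sym[OF Sm[OF d] i] by blast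
  qed
  show ?thesis
  proof (rule exI[of _ ?S], rule exI[of _ P], intro conjI)
    show "\<forall>w\<in>carrier G. simple_rmodule K M (?S w)" using tr.S_simple by blast
    show "\<forall>u\<in>carrier G. \<forall>w\<in>carrier G. u \<noteq> w \<longrightarrow> \<not> rmodule_iso K M (?S u) (?S w)" using tr.S_iso_eq by blast
    show "\<forall>V :: ('k, 'v, 'a \<Rightarrow> 'a) rmodule. simple_rmodule K M V \<longrightarrow> (\<exists>w\<in>carrier G. rmodule_iso K M V (?S w))"
      using tr.simple_classification by blast
    show "\<forall>w\<in>carrier G. indecomposable_rmodule K M (P w) \<and> projective_rmodule K M (P w) \<and>
       (\<exists>p. projective_cover K M (P w) p (?S w))" using P by blast
    show "\<forall>u\<in>carrier G. \<forall>w\<in>carrier G. u \<noteq> w \<longrightarrow> \<not> rmodule_iso K M (P u) (P w)" using noniso by blast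
    show "\<forall>Q :: ('k, 'q, 'a \<Rightarrow> 'a) rmodule. indecomposable_rmodule K M Q \<and> projective_rmodule K M Q \<longrightarrow>
       (\<exists>w\<in>carrier G. rmodule_iso K M Q (P w))" using classify by blast
    show "\<forall>w\<in>carrier G. rmodule_iso K M (?S w) (rmodule_top K M (translation_module K G I s w)) \<and>
       rmodule_iso K M (?S w) (?S w)" by (simp add: tr.S_top rmodule_iso_refl)
    show "\<forall>w\<in>carrier G. \<forall>J. reduced_left_block G I s w J \<longrightarrow> simple_rmodule K M (S_module K G I s w J) \<and>
       rmodule_iso K M (S_module K G I s w J) (?S (min_rep G I s J w))" using block by blast
  qed
qed

end
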